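(* Let $k$ be a number field of degree $d \geq 3$ over $\mathbb{Q}$ that is not a CM-field. Let $r = r(k)$ be the rank of the unit group $O_k^{\times}$, let $D_k = |\Delta_k|$ be the absolute discriminant of $k$, and let $\operatorname{Reg}(k)$ be the regulator of $k$. Let $\gamma_d = d^{-d}$ and assume that $1 < \gamma_d D_k$. Then \[ \frac{(2r)!}{(r!)^3}\left(\frac{\log \log d}{2 \log d}\right)^{3 \rho(k)} \left(\frac{\log (\gamma_{d} D_k)}{4 d}\right)^{r - \rho(k)} \le \operatorname{Reg}(k). \]
   Context: For a number field $K$, $r(K)$ denotes the rank of the unit group $O_K^{\times}$ of its ring of integers. For the number field $k$, $\rho(k) = \max\{ r(k') : k' \subseteq k,\ k' \neq k\}$, the maximum being over proper subfields $k'$ of $k$. A CM-field is a totally imaginary quadratic extension of a totally real number field. *)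

theory Defs
  imports Complex_Main "HOL-Library.FuncSet" "HOL-Computational_Algebra.Polynomial"
    "Jordan_Normal_Form.Determinant"
begin

text \<open>
  Fields are subsets of an arbitrary ambient field of characteristic 0, with prime field \<open>\<rat>\<close>.
  An abstract number field is the case of the full carrier \<open>UNIV\<close>.
\<close>

definition is_subfield :: "'a::field set \<Rightarrow> bool" where
  "is_subfield k \<longleftrightarrow> 0 \<in> k \<and> 1 \<in> k \<and>
     (\<forall>x\<in>k. \<forall>y\<in>k. x - y \<in> k \<and> x * y \<in> k) \<and> (\<forall>x\<in>k. inverse x \<in> k)"

text \<open>\<open>B\<close> is a finite basis of the module \<open>M\<close> over the coefficient ring \<open>R\<close>.\<close>

definition is_basis :: "'a::field set \<Rightarrow> 'a set \<Rightarrow> 'a set \<Rightarrow> bool" where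
  "is_basis R M B \<longleftrightarrow> finite B \<and> B \<subseteq> M \<and>
     (\<forall>x\<in>M. \<exists>!c. c \<in> B \<rightarrow>\<^sub>E R \<and> x = (\<Sum>b\<in>B. c b * b))"

definition ext_degree :: "'a::field set \<Rightarrow> 'a set \<Rightarrow> nat" where
  "ext_degree F k = (THE n. \<exists>B. is_basis F k B \<and> card B = n)"

definition number_field :: "'a::field_char_0 set \<Rightarrow> bool" where
  "number_field k \<longleftrightarrow> is_subfield k \<and> (\<exists>B. is_basis \<rat> k B)"

definition int_ring :: "'a::field_char_0 set \<Rightarrow> 'a set" where
  "int_ring k = {x \<in> k. algebraic_int x}"

definition unit_grp :: "'a::field_char_0 set \<Rightarrow> 'a set" where
  "unit_grp k = {x \<in> int_ring k. \<exists>y \<in> int_ring k. x * y = 1}"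

definition mult_indep :: "'a::field set \<Rightarrow> bool" where
  "mult_indep S \<longleftrightarrow>
     (\<forall>e::'a \<Rightarrow> int. (\<Prod>x\<in>S. x powi e x) = 1 \<longrightarrow> (\<forall>x\<in>S. e x = 0))"

text \<open>The maximum exists because the unit group is finitely generated.\<close>

definition unit_rank :: "'a::field_char_0 set \<Rightarrow> nat" where
  "unit_rank k = Max {card S | S. finite S \<and> S \<subseteq> unit_grp k \<and> mult_indep S}"

definition max_subfield_rank :: "'a::field_char_0 set \<Rightarrow> nat" where
  "max_subfield_rank k = Max {unit_rank k' | k'. is_subfield k' \<and> k' \<subset> k}"

text \<open>Functions are made extensional so that each embedding of \<open>k\<close> is represented exactly once.\<close>

definition embeddings :: "'a::field_char_0 set \<Rightarrow> ('a \<Rightarrow> complex) set" where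
  "embeddings k = {\<sigma> \<in> extensional k. \<sigma> 1 = 1 \<and>
     (\<forall>x\<in>k. \<forall>y\<in>k. \<sigma> (x + y) = \<sigma> x + \<sigma> y \<and> \<sigma> (x * y) = \<sigma> x * \<sigma> y)}"

definition totally_real :: "'a::field_char_0 set \<Rightarrow> bool" where
  "totally_real k \<longleftrightarrow> (\<forall>\<sigma>\<in>embeddings k. \<sigma> ` k \<subseteq> \<real>)"

definition totally_imaginary :: "'a::field_char_0 set \<Rightarrow> bool" where
  "totally_imaginary k \<longleftrightarrow> (\<forall>\<sigma>\<in>embeddings k. \<not> \<sigma> ` k \<subseteq> \<real>)"

definition CM_field :: "'a::field_char_0 set \<Rightarrow> bool" where
  "CM_field k \<longleftrightarrow> number_field k \<and> totally_imaginary k \<and>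
     (\<exists>F. number_field F \<and> totally_real F \<and> F \<subseteq> k \<and> ext_degree F k = 2)"

text \<open>
  The squared determinant does not depend on the chosen integral basis and the chosen
  enumeration of the embeddings; it is an integer, here embedded into the complex numbers.
\<close>

definition field_disc :: "'a::field_char_0 set \<Rightarrow> complex" where
  "field_disc k =
     (let bs = (SOME bs. distinct bs \<and> is_basis \<int> (int_ring k) (set bs));
          \<sigma>s = (SOME \<sigma>s. distinct \<sigma>s \<and> set \<sigma>s = embeddings k);
          n = length bs
      in (det (mat n n (\<lambda>(i, j). (\<sigma>s ! i) (bs ! j))))\<^sup>2)"

text \<open>
  An archimedean place is a class \<open>{\<sigma>, cnj \<circ> \<sigma>}\<close> of embeddings; its cardinality is the local
  degree: 1 for a real place and 2 for a complex one.
\<close>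

definition arch_places :: "'a::field_char_0 set \<Rightarrow> ('a \<Rightarrow> complex) set set" where
  "arch_places k = {{\<sigma>, \<lambda>x\<in>k. cnj (\<sigma> x)} | \<sigma>. \<sigma> \<in> embeddings k}"

definition place_abs :: "('a \<Rightarrow> complex) set \<Rightarrow> 'a \<Rightarrow> real" where
  "place_abs v x = cmod ((SOME \<sigma>. \<sigma> \<in> v) x)"

text \<open>\<open>us\<close> represents a basis of the unit group modulo torsion.\<close>

definition fundamental_units :: "'a::field_char_0 set \<Rightarrow> 'a list \<Rightarrow> bool" where
  "fundamental_units k us \<longleftrightarrow> set us \<subseteq> unit_grp k \<and>
     (\<forall>u\<in>unit_grp k. \<exists>!es::int list. length es = length us \<and>
        (\<exists>n>0. (u / (\<Prod>i<length us. (us ! i) powi (es ! i))) ^ n = 1))"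

text \<open>
  The list of all archimedean places has one more entry than the list of fundamental units,
  so the last place is omitted. The value does not depend on the choices made.
\<close>

definition regulator :: "'a::field_char_0 set \<Rightarrow> real" where
  "regulator k =
     (let us = (SOME us. fundamental_units k us);
          vs = (SOME vs. distinct vs \<and> set vs = arch_places k);
          r = length us
      in \<bar>det (mat r r (\<lambda>(i, j). real (card (vs ! i)) * ln (place_abs (vs ! i) (us ! j))))\<bar>)"

end

theory Submission
 imports Defs "HOL-Analysis.Analysis" "Jordan_Normal_Form.Char_Poly" "Jordan_Normal_Form.Schur_Decomposition"
  "HOL-Computational_Algebra.Computational_Algebra" "HOL-Computational_Algebra.Field_as_Ring"
begin

hide_const (open) Determinants.det Finite_Cartesian_Product.mat Finite_Cartesian_Product.vec
 Finite_Cartesian_Product.row Finite_Cartesian_Product.transpose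
hide_const (open) Coset.order Polynomial.order
no_notation Finite_Cartesian_Product.vec_nth (infixl "$" 90)

text \<open>
 The regulator is the covolume of the lattice of logarithmic vectors of units, on which the height of a
 unit is a norm whose unit ball has volume \<open>(2r)! / (r!)\<^sup>3\<close>. The norm is bounded below on the
 nonzero lattice vectors by Dobrowolski's method: Frobenius congruences at many primes make the resultants
 of a conjugacy orbit with its images under \<open>x \<mapsto> x\<^sup>p\<close> large, whereas an energy inequality bounds them
 from above in terms of the height. Units of height below \<open>ln (\<gamma> D) / (2d)\<close> satisfy a second constraint:
 if they generated \<open>k\<close>, then monomials in them of total degree less than \<open>d\<close> would span \<open>k\<close>, and Hadamard's
 inequality would contradict the size of the discriminant. Hence they lie in a proper subfield and their
 logarithmic vectors span a space of dimension at most \<open>\<rho>(k)\<close>. A version of Minkowski's theorem for a norm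
 with one lower bound on a coordinate sublattice and a larger one off it yields the estimate.
\<close>

section \<open>Determinants of matrices given as functions\<close>

text \<open>The constants fit as follows. Dobrowolski's method gives \<open>hmin\<close> = (ln (ln
  d) / ln d)^3 / 4 as a lower bound for heights, and Minkowski's theorem halves lengths:
  \<open>hmin\<close> / 2 is the cube of ln (ln d) / (2 ln d), and half of ln (\<gamma> D) / (2 d)
  is the base of the other power. The factor 1/4 must hold for every d >= 3, not only
  asymptotically; this is why the energy inequality carries explicit error terms and is evaluated
  with tabulated primes for ln d <= 183/2 and with Chebyshev's estimate beyond. Distinctness of the
  points x^p is a second obstacle: if x -> x^p is not injective on an orbit, the orbit is replaced
  by the products over the fibres, a smaller orbit of no larger Mahler measure. The lattice theorem
  produces the number p of independent short units, and p <= \<rho>; passing from p to \<rho> only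
  moves factors from the larger base to the smaller one. All facts on embeddings come from one
  source: a rational-linear functional on k is a combination of embeddings, since the
  multiplications by elements of k commute and act diagonalizably on such functionals.\<close>

definition fdet :: "nat \<Rightarrow> (nat \<Rightarrow> nat \<Rightarrow> 'a::comm_ring_1) \<Rightarrow> 'a" where
 "fdet n A = Determinant.det (Matrix.mat n n (\<lambda>(i, j). A i j))"

lemma fdet_cong:
 assumes "\<And>i j. i < n \<Longrightarrow> j < n \<Longrightarrow> A i j = B i j"
 shows "fdet n A = fdet n B"
 unfolding fdet_def by (rule arg_cong[where f = Determinant.det], rule eq_matI) (use assms in auto)

lemma fdet_mult:
 "fdet n (\<lambda>i j. \<Sum>l<n. A i l * B l j) = fdet n A * fdet n B"
proof -
 have "Matrix.mat n n (\<lambda>(i, j). \<Sum>l<n. A i l * B l j)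
   = Matrix.mat n n (\<lambda>(i, j). A i j) * Matrix.mat n n (\<lambda>(i, j). B i j)"
  by (rule eq_matI) (auto simp: scalar_prod_def atLeast0LessThan)
 then show ?thesis
  unfolding fdet_def by (simp add: det_mult[where n = n])
qed

lemma fdet_transpose: "fdet n (\<lambda>i j. A j i) = fdet n A"
proof -
 have "Matrix.mat n n (\<lambda>(i, j). A j i) = transpose_mat (Matrix.mat n n (\<lambda>(i, j). A i j))"
  by (rule eq_matI) auto
 then show ?thesis
  unfolding fdet_def by (simp add: Determinant.det_transpose[where n = n])
qed

lemma fdet_id: "fdet n (\<lambda>i j. if i = j then 1 else 0) = (1::'a::comm_ring_1)"
proof -
 have "Matrix.mat n n (\<lambda>(i, j). if i = j then 1 else 0) = (1\<^sub>m n :: 'a mat)"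
  by (rule eq_matI) auto
 then show ?thesis unfolding fdet_def by (simp only: Determinant.det_one)
qed

lemma fdet_eq_0_iff:
 fixes A :: "nat \<Rightarrow> nat \<Rightarrow> 'a::field"
 shows "fdet n A = 0 \<longleftrightarrow> (\<exists>x. (\<exists>j<n. x j \<noteq> 0) \<and> (\<forall>i<n. (\<Sum>j<n. A i j * x j) = 0))"
proof -
 let ?M = "Matrix.mat n n (\<lambda>(i, j). A i j)"
 have "fdet n A = 0 \<longleftrightarrow> (\<exists>v. v \<in> carrier_vec n \<and> v \<noteq> 0\<^sub>v n \<and> ?M *\<^sub>v v = 0\<^sub>v n)"
  unfolding fdet_def by (rule det_0_iff_vec_prod_zero_field) auto
 also have "... \<longleftrightarrow> (\<exists>x. (\<exists>j<n. x j \<noteq> 0) \<and> (\<forall>i<n. (\<Sum>j<n. A i j * x j) = 0))"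
 proof
  assume "\<exists>v. v \<in> carrier_vec n \<and> v \<noteq> 0\<^sub>v n \<and> ?M *\<^sub>v v = 0\<^sub>v n"
  then obtain v where v: "v \<in> carrier_vec n" "v \<noteq> 0\<^sub>v n" "?M *\<^sub>v v = 0\<^sub>v n" by blast
  have "\<exists>j<n. vec_index v j \<noteq> 0"
  proof (rule ccontr)
   assume "\<not> ?thesis"
   then have "v = 0\<^sub>v n" using v(1) by (intro eq_vecI) auto
   then show False using v(2) by blast
  qed
  moreover have "(\<Sum>j<n. A i j * vec_index v j) = 0" if "i < n" for i
  proof -
   have "vec_index (?M *\<^sub>v v) i = 0" using v(3) that by simp
   then show ?thesis using that v(1) by (simp add: scalar_prod_def atLeast0LessThan)
  qed
  ultimately show "\<exists>x. (\<exists>j<n. x j \<noteq> 0) \<and> (\<forall>i<n. (\<Sum>j<n. A i j * x j) = 0)" by blast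
 next
  assume "\<exists>x. (\<exists>j<n. x j \<noteq> 0) \<and> (\<forall>i<n. (\<Sum>j<n. A i j * x j) = 0)"
  then obtain x j where x: "j < n" "x j \<noteq> 0" "\<forall>i<n. (\<Sum>j<n. A i j * x j) = 0" by blast
  have "Matrix.vec n x \<noteq> 0\<^sub>v n"
  proof
   assume "Matrix.vec n x = 0\<^sub>v n"
   then have "vec_index (Matrix.vec n x) j = vec_index (0\<^sub>v n) j" by simp
   then show False using x(1,2) by simp
  qed
  moreover have "?M *\<^sub>v Matrix.vec n x = 0\<^sub>v n"
   using x(3) by (intro eq_vecI) (auto simp: scalar_prod_def atLeast0LessThan)
  ultimately show "\<exists>v. v \<in> carrier_vec n \<and> v \<noteq> 0\<^sub>v n \<and> ?M *\<^sub>v v = 0\<^sub>v n"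
   by (intro exI[of _ "Matrix.vec n x"]) auto
 qed
 finally show ?thesis .
qed

text \<open>Zero rows pad the system to a square one. The transpose of the padded matrix kills the
  unit vector at position \<open>m\<close>, so the determinant vanishes and the padded system has a
  nontrivial solution.\<close>

lemma linear_dependence:
 fixes A :: "nat \<Rightarrow> nat \<Rightarrow> 'a::field"
 assumes "m < n"
 shows "\<exists>x. (\<exists>j<n. x j \<noteq> 0) \<and> (\<forall>i<m. (\<Sum>j<n. A i j * x j) = 0)"
proof -
 define B where "B i j = (if i < m then A i j else 0)" for i j
 have "fdet n (\<lambda>i j. B j i) = 0"
  unfolding fdet_eq_0_iff using assms
  by (intro exI[of _ "\<lambda>j. if j = m then 1 else 0"]) (auto simp: B_def)
 then have "fdet n B = 0" by (subst (asm) fdet_transpose)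
 then obtain x where x: "(\<exists>j<n. x j \<noteq> 0) \<and> (\<forall>i<n. (\<Sum>j<n. B i j * x j) = 0)"
  unfolding fdet_eq_0_iff by (rule exE)
 have "(\<Sum>j<n. A i j * x j) = 0" if "i < m" for i
  using conjunct2[OF x, rule_format, of i] that assms by (simp add: B_def)
 then show ?thesis using x by (intro exI[of _ x]) auto
qed

lemma fdet_inverse:
 fixes A :: "nat \<Rightarrow> nat \<Rightarrow> 'a::field"
 assumes nz: "fdet n A \<noteq> 0"
 obtains B where "\<And>i j. i < n \<Longrightarrow> j < n \<Longrightarrow> (\<Sum>l<n. A i l * B l j) = (if i = j then 1 else 0)"
  "\<And>i j. i < n \<Longrightarrow> j < n \<Longrightarrow> (\<Sum>l<n. B i l * A l j) = (if i = j then 1 else 0)"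
proof -
 let ?M = "Matrix.mat n n (\<lambda>(i, j). A i j)"
 let ?B = "\<lambda>i j. adj_mat ?M $$ (i, j) / fdet n A"
 have M: "?M \<in> carrier_mat n n" by simp
 have adj: "adj_mat ?M \<in> carrier_mat n n" by (rule adj_mat(1)[OF M])
 have "(\<Sum>l<n. A i l * ?B l j) = (if i = j then 1 else 0)" if "i < n" "j < n" for i j
 proof -
  have "(?M * adj_mat ?M) $$ (i, j) = (fdet n A \<cdot>\<^sub>m 1\<^sub>m n) $$ (i, j)"
   unfolding fdet_def using adj_mat(2)[OF M] by simp
  then show ?thesis using that adj nz by (simp add: scalar_prod_def atLeast0LessThan flip: sum_divide_distrib)
 qed
 moreover have "(\<Sum>l<n. ?B i l * A l j) = (if i = j then 1 else 0)" if "i < n" "j < n" for i j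
 proof -
  have "(adj_mat ?M * ?M) $$ (i, j) = (fdet n A \<cdot>\<^sub>m 1\<^sub>m n) $$ (i, j)"
   unfolding fdet_def using adj_mat(3)[OF M] by simp
  then show ?thesis using that adj nz by (simp add: scalar_prod_def atLeast0LessThan times_divide_eq_left flip: sum_divide_distrib)
 qed
 ultimately show ?thesis by (rule that)
qed

text \<open>Cramer's rule; it measures the effect of exchanging one member of a basis, both in the
  minimality argument for integral bases and in the exchange of lattice vectors.\<close>

lemma fdet_replace_column:
 fixes A :: "nat \<Rightarrow> nat \<Rightarrow> 'a::comm_ring_1"
 assumes "k < n"
 shows "fdet n (\<lambda>i j. if j = k then \<Sum>l<n. A i l * x l else A i j) = x k * fdet n A"
proof -
 let ?M = "Matrix.mat n n (\<lambda>(i, j). A i j)"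
 have "replace_col ?M (?M *\<^sub>v Matrix.vec n x) k
   = Matrix.mat n n (\<lambda>(i, j). if j = k then \<Sum>l<n. A i l * x l else A i j)"
  by (rule eq_matI) (auto simp: replace_col_def scalar_prod_def atLeast0LessThan)
 then show ?thesis
  using cramer_lemma_mat[of ?M n "Matrix.vec n x" k] assms by (simp add: fdet_def)
qed

lemma fdet_of_hom:
 assumes "comm_ring_hom h"
 shows "fdet n (\<lambda>i j. h (A i j)) = h (fdet n A)"
proof -
 interpret comm_ring_hom h by fact
 have "Matrix.mat n n (\<lambda>(i, j). h (A i j)) = mat_hom (Matrix.mat n n (\<lambda>(i, j). A i j))"
  by (rule eq_matI) auto
 then show ?thesis unfolding fdet_def by (simp add: hom_det)
qed

lemma fdet_scale_rows: "fdet n (\<lambda>i j. c i * A i j) = (\<Prod>i<n. c i) * fdet n A"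
proof -
 have "fdet n (\<lambda>i j. c i * A i j) = fdet n (\<lambda>i j. \<Sum>l<n. (if i = l then c i else 0) * A l j)"
  by (rule fdet_cong) (simp add: if_distrib[of "\<lambda>x. x * _"] cong: if_cong)
 also have "... = fdet n (\<lambda>i j. if i = j then c i else 0) * fdet n A"
  by (rule fdet_mult)
 also have "fdet n (\<lambda>i j. if i = j then c i else 0) = (\<Prod>i<n. c i)"
 proof -
  have "upper_triangular (Matrix.mat n n (\<lambda>(i, j). if i = j then c i else 0))"
   by (auto simp: upper_triangular_def)
  then have "fdet n (\<lambda>i j. if i = j then c i else 0) = prod_list (map c [0..<n])"
   unfolding fdet_def by (subst det_upper_triangular[where n = n])
    (auto simp: diag_mat_def intro!: arg_cong[where f = prod_list] map_cong)
  then show ?thesis using prod.distinct_set_conv_list[of "[0..<n]" c] by (simp add: atLeast0LessThan)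
 qed
 finally show ?thesis .
qed

section \<open>Algebraic integers\<close>

text \<open>The vector \<open>w\<close> is an eigenvector of the integer matrix for the eigenvalue
  \<open>x\<close>, so \<open>x\<close> is a root of a monic integral characteristic
  polynomial.\<close>

lemma algebraic_int_of_integer_matrix:
 fixes w :: "nat \<Rightarrow> 'a::field_char_0"
 assumes "i0 < n" "w i0 \<noteq> 0"
  and eq: "\<And>i. i < n \<Longrightarrow> x * w i = (\<Sum>j<n. of_int (A i j) * w j)"
 shows "algebraic_int x"
proof -
 let ?A = "Matrix.mat n n (\<lambda>(i, j). A i j)"
 let ?B = "of_int_hom.mat_hom ?A :: 'a mat"
 have A: "?A \<in> carrier_mat n n" and B: "?B \<in> carrier_mat n n" by auto
 have "?B *\<^sub>v Matrix.vec n w = x \<cdot>\<^sub>v Matrix.vec n w"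
  using eq by (intro eq_vecI) (auto simp: scalar_prod_def atLeast0LessThan)
 moreover have "Matrix.vec n w \<noteq> 0\<^sub>v n"
 proof
  assume "Matrix.vec n w = 0\<^sub>v n"
  then have "vec_index (Matrix.vec n w) i0 = vec_index (0\<^sub>v n) i0" by simp
  then show False using assms(1,2) by simp
 qed
 ultimately have "eigenvalue ?B x"
  unfolding eigenvalue_def eigenvector_def using B by (intro exI[of _ "Matrix.vec n w"]) auto
 then have "poly (char_poly ?B) x = 0" using eigenvalue_root_char_poly[OF B] by simp
 then have "poly (of_int_poly (char_poly ?A)) x = 0"
  by (simp add: of_int_hom.char_poly_hom[OF A])
 moreover have "lead_coeff (char_poly ?A) = 1"
  using degree_monic_char_poly[OF A] by simp
 ultimately show ?thesis unfolding algebraic_int_altdef_ipoly by blast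
qed

section \<open>Spans over the integers and the rationals; ring operations on algebraic
  integers\<close>

definition zspan :: "'a::field_char_0 set \<Rightarrow> 'a set" where
 "zspan W = {y. \<exists>c. y = (\<Sum>w\<in>W. of_int (c w) * w)}"

definition qspan :: "'a::field_char_0 set \<Rightarrow> 'a set" where
 "qspan W = {y. \<exists>c. y = (\<Sum>w\<in>W. of_rat (c w) * w)}"

lemma zspan_0: "0 \<in> zspan W"
 unfolding zspan_def by (auto intro!: exI[of _ "\<lambda>_. 0"])

lemma zspan_add: "x \<in> zspan W \<Longrightarrow> y \<in> zspan W \<Longrightarrow> x + y \<in> zspan W"
 unfolding zspan_def
proof clarify
 fix c c' :: "'a \<Rightarrow> int"
 show "\<exists>e. (\<Sum>w\<in>W. of_int (c w) * w) + (\<Sum>w\<in>W. of_int (c' w) * w) = (\<Sum>w\<in>W. of_int (e w) * w)"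
  by (rule exI[of _ "\<lambda>w. c w + c' w"]) (simp add: sum.distrib ring_distribs)
qed

lemma zspan_scale: "x \<in> zspan W \<Longrightarrow> of_int a * x \<in> zspan W"
 unfolding zspan_def
proof clarify
 fix c :: "'a \<Rightarrow> int"
 show "\<exists>e. of_int a * (\<Sum>w\<in>W. of_int (c w) * w) = (\<Sum>w\<in>W. of_int (e w) * w)"
  by (rule exI[of _ "\<lambda>w. a * c w"]) (simp add: sum_distrib_left mult_ac)
qed

lemma zspan_base: "finite W \<Longrightarrow> w \<in> W \<Longrightarrow> w \<in> zspan W"
 unfolding zspan_def
 by (rule CollectI, rule exI[of _ "\<lambda>v. if v = w then 1 else 0"])
  (simp add: if_distrib[of of_int] if_distrib[of "\<lambda>x. x * _"] cong: if_cong)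

lemma zspan_sum: "(\<And>i. i \<in> I \<Longrightarrow> f i \<in> zspan W) \<Longrightarrow> sum f I \<in> zspan W"
 by (induction I rule: infinite_finite_induct) (auto intro: zspan_0 zspan_add)

lemma qspan_0: "0 \<in> qspan W"
 unfolding qspan_def by (auto intro!: exI[of _ "\<lambda>_. 0"])

lemma qspan_add: "x \<in> qspan W \<Longrightarrow> y \<in> qspan W \<Longrightarrow> x + y \<in> qspan W"
 unfolding qspan_def
proof clarify
 fix c c' :: "'a \<Rightarrow> rat"
 show "\<exists>e. (\<Sum>w\<in>W. of_rat (c w) * w) + (\<Sum>w\<in>W. of_rat (c' w) * w) = (\<Sum>w\<in>W. of_rat (e w) * w)"
  by (rule exI[of _ "\<lambda>w. c w + c' w"]) (simp add: sum.distrib ring_distribs of_rat_add)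
qed

lemma qspan_scale: "x \<in> qspan W \<Longrightarrow> of_rat a * x \<in> qspan W"
 unfolding qspan_def
proof clarify
 fix c :: "'a \<Rightarrow> rat"
 show "\<exists>e. of_rat a * (\<Sum>w\<in>W. of_rat (c w) * w) = (\<Sum>w\<in>W. of_rat (e w) * w)"
  by (rule exI[of _ "\<lambda>w. a * c w"]) (simp add: sum_distrib_left mult_ac of_rat_mult)
qed

lemma qspan_diff: "x \<in> qspan W \<Longrightarrow> y \<in> qspan W \<Longrightarrow> x - y \<in> qspan W"
 using qspan_add[of x W "of_rat (-1) * y"] qspan_scale[of y W "-1"] by (simp add: of_rat_minus)

lemma qspan_base: "finite W \<Longrightarrow> w \<in> W \<Longrightarrow> w \<in> qspan W"
 unfolding qspan_def
 by (rule CollectI, rule exI[of _ "\<lambda>v. if v = w then 1 else 0"])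
  (simp add: if_distrib[of of_rat] if_distrib[of "\<lambda>x. x * _"] cong: if_cong)

lemma qspan_sum: "(\<And>i. i \<in> I \<Longrightarrow> f i \<in> qspan W) \<Longrightarrow> sum f I \<in> qspan W"
 by (induction I rule: infinite_finite_induct) (auto intro: qspan_0 qspan_add)

lemma qspan_subset: "finite W \<Longrightarrow> U \<subseteq> qspan W \<Longrightarrow> qspan U \<subseteq> qspan W"
 unfolding qspan_def[of U] by (auto intro!: qspan_sum qspan_scale)

text \<open>The standard integrality criterion: multiplication by \<open>x\<close> preserves a
  nonzero finitely generated module, and expanding the products in the generators gives the integer
  matrix.\<close>

lemma algebraic_int_of_zspan:
 assumes "finite W" "w0 \<in> W" "w0 \<noteq> 0" and mult: "\<And>w. w \<in> W \<Longrightarrow> x * w \<in> zspan W"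
 shows "algebraic_int x"
proof -
 obtain w where w: "bij_betw w {..<card W} W"
  using ex_bij_betw_nat_finite[OF assms(1)] by (auto simp: atLeast0LessThan)
 have "\<forall>v\<in>W. \<exists>c. x * v = (\<Sum>u\<in>W. of_int (c u) * u)"
  using mult unfolding zspan_def by blast
 then obtain c where c: "\<And>v. v \<in> W \<Longrightarrow> x * v = (\<Sum>u\<in>W. of_int (c v u) * u)"
  by metis
 obtain i0 where i0: "i0 < card W" "w i0 = w0"
  using assms(2) w unfolding bij_betw_def by (metis imageE lessThan_iff)
 have "x * w i = (\<Sum>j<card W. of_int (c (w i) (w j)) * w j)" if "i < card W" for i
 proof -
  have "w i \<in> W" using w that unfolding bij_betw_def by auto
  then have "x * w i = (\<Sum>u\<in>W. of_int (c (w i) u) * u)" by (rule c)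
  also have "... = (\<Sum>j<card W. of_int (c (w i) (w j)) * w j)"
   by (rule sum.reindex_bij_betw[OF w, symmetric])
  finally show ?thesis .
 qed
 then show ?thesis
  using algebraic_int_of_integer_matrix[of i0 "card W" w x "\<lambda>i j. c (w i) (w j)"] i0 assms(3) by auto
qed

lemma algebraic_int_power_relation:
 assumes "algebraic_int (x::'a::field_char_0)"
 obtains n a where "n > 0" "x ^ n = (\<Sum>j<n. of_int (a j) * x ^ j)"
proof -
 from assms obtain p where p: "poly (of_int_poly p) x = 0" "lead_coeff p = 1"
  unfolding algebraic_int_altdef_ipoly by blast
 have deg: "degree p > 0"
 proof (rule ccontr)
  assume "\<not> degree p > 0"
  then have "p = [:1:]" using p(2) by (metis degree_eq_zeroE gr0I lead_coeff_pCons(2) degree_pCons_0 coeff_pCons_0)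
  then show False using p(1) by simp
 qed
 have "0 = (\<Sum>i\<le>degree p. of_int (coeff p i) * x ^ i)"
  using p(1) by (simp add: poly_altdef)
 also have "... = (\<Sum>i<degree p. of_int (coeff p i) * x ^ i) + x ^ degree p"
  using p(2) by (simp flip: lessThan_Suc_atMost)
 finally have "x ^ degree p = (\<Sum>j<degree p. of_int (- coeff p j) * x ^ j)"
  by (simp add: sum_negf add_eq_0_iff2 algebra_simps)
 then show ?thesis by (rule that[OF deg])
qed

text \<open>The module spanned by the x^i y^j with i < n and j < m is stable under multiplication by
  x and by y, because the monic relations rewrite x^n and y^m. It is therefore stable under x + y
  and x y.\<close>

lemma algebraic_int_add_mult:
 assumes "algebraic_int (x::'a::field_char_0)" "algebraic_int y"
 shows "algebraic_int (x + y)" "algebraic_int (x * y)"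
proof -
 obtain n a where n: "n > 0" "x ^ n = (\<Sum>j<n. of_int (a j) * x ^ j)"
  by (rule algebraic_int_power_relation[OF assms(1)])
 obtain m b where m: "m > 0" "y ^ m = (\<Sum>j<m. of_int (b j) * y ^ j)"
  by (rule algebraic_int_power_relation[OF assms(2)])
 define W where "W = (\<lambda>(i, j). x ^ i * y ^ j) ` ({..<n} \<times> {..<m})"
 have fin: "finite W" unfolding W_def by simp
 have base: "x ^ i * y ^ j \<in> zspan W" if "i < n" "j < m" for i j
  by (rule zspan_base[OF fin]) (use that in \<open>auto simp: W_def\<close>)
 have one: "1 \<in> W" unfolding W_def using n(1) m(1) by (auto intro!: image_eqI[of _ _ "(0,0)"])
 have xW: "x * w \<in> zspan W" if w: "w \<in> W" for w
 proof -
  obtain i j where ij: "w = x ^ i * y ^ j" "i < n" "j < m" using w unfolding W_def by auto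
  show ?thesis
  proof (cases "Suc i < n")
   case True
   then show ?thesis using base[OF True ij(3)] ij(1) by (simp add: mult_ac)
  next
   case False
   then have "Suc i = n" using ij by simp
   then have "x * w = x ^ n * y ^ j" using ij(1) by (auto simp: mult_ac)
   also have "... = (\<Sum>l<n. of_int (a l) * (x ^ l * y ^ j))"
    unfolding n(2) by (subst sum_distrib_right) (simp add: mult_ac)
   also have "... \<in> zspan W" by (intro zspan_sum zspan_scale base) (use ij in auto)
   finally show ?thesis .
  qed
 qed
 have yW: "y * w \<in> zspan W" if w: "w \<in> W" for w
 proof -
  obtain i j where ij: "w = x ^ i * y ^ j" "i < n" "j < m" using w unfolding W_def by auto
  show ?thesis
  proof (cases "Suc j < m")
   case True
   then show ?thesis using base[OF ij(2) True] ij(1) by (simp add: mult_ac)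
  next
   case False
   then have "Suc j = m" using ij by simp
   then have "y * w = x ^ i * y ^ m" using ij(1) by (auto simp: mult_ac)
   also have "... = (\<Sum>l<m. of_int (b l) * (x ^ i * y ^ l))"
    unfolding m(2) by (simp add: sum_distrib_left mult_ac)
   also have "... \<in> zspan W" by (intro zspan_sum zspan_scale base) (use ij in auto)
   finally show ?thesis .
  qed
 qed
 have xZ: "x * z \<in> zspan W" if z: "z \<in> zspan W" for z
 proof -
  obtain c where "z = (\<Sum>w\<in>W. of_int (c w) * w)" using z unfolding zspan_def by blast
  then have "x * z = (\<Sum>w\<in>W. of_int (c w) * (x * w))" by (simp add: sum_distrib_left mult_ac)
  also have "... \<in> zspan W" by (intro zspan_sum zspan_scale xW)
  finally show ?thesis .
 qed
 show "algebraic_int (x + y)"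
  by (rule algebraic_int_of_zspan[OF fin one]) (auto simp: ring_distribs intro: zspan_add xW yW)
 show "algebraic_int (x * y)"
  by (rule algebraic_int_of_zspan[OF fin one]) (auto simp: mult.assoc intro: xZ yW)
qed

lemma algebraic_int_diff:
 "algebraic_int (x::'a::field_char_0) \<Longrightarrow> algebraic_int y \<Longrightarrow> algebraic_int (x - y)"
 using algebraic_int_add_mult(1)[of x "- y"] by auto

lemma algebraic_int_sum:
 "(\<And>i. i \<in> I \<Longrightarrow> algebraic_int (f i :: 'a::field_char_0)) \<Longrightarrow> algebraic_int (sum f I)"
 by (induction I rule: infinite_finite_induct) (auto intro: algebraic_int_add_mult)

lemma algebraic_int_prod:
 "(\<And>i. i \<in> I \<Longrightarrow> algebraic_int (f i :: 'a::field_char_0)) \<Longrightarrow> algebraic_int (prod f I)"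
 by (induction I rule: infinite_finite_induct) (auto intro: algebraic_int_add_mult)

lemma algebraic_int_power:
 "algebraic_int (x::'a::field_char_0) \<Longrightarrow> algebraic_int (x ^ n)"
 by (induction n) (auto intro: algebraic_int_add_mult)

lemma algebraic_int_of_int: "algebraic_int (of_int a :: 'a::field_char_0)"
 by (rule int_imp_algebraic_int) auto

section \<open>Rational linear algebra inside a field\<close>

definition qindep :: "'a::field_char_0 set \<Rightarrow> bool" where
 "qindep B \<longleftrightarrow> (\<forall>c. (\<Sum>b\<in>B. of_rat (c b) * b) = 0 \<longrightarrow> (\<forall>b\<in>B. c b = 0))"

lemma qindepD: "qindep B \<Longrightarrow> (\<Sum>b\<in>B. of_rat (c b) * b) = 0 \<Longrightarrow> b \<in> B \<Longrightarrow> c b = 0"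
 unfolding qindep_def by blast

lemma qindep_unique:
 assumes "qindep B" "(\<Sum>b\<in>B. of_rat (c b) * b) = (\<Sum>b\<in>B. of_rat (c' b) * b)" "b \<in> B"
 shows "c b = c' b"
 using qindepD[OF assms(1), of "\<lambda>b. c b - c' b" b] assms(2,3)
 by (simp add: of_rat_diff ring_distribs sum_subtractf)

lemma qindep_card_le:
 assumes "finite W" "finite B" "qindep B" "B \<subseteq> qspan W"
 shows "card B \<le> card W"
proof (rule ccontr)
 assume "\<not> ?thesis"
 then have less: "card W < card B" by simp
 obtain w where w: "bij_betw w {..<card W} W"
  using ex_bij_betw_nat_finite[OF assms(1)] by (auto simp: atLeast0LessThan)
 obtain b where b: "bij_betw b {..<card B} B"
  using ex_bij_betw_nat_finite[OF assms(2)] by (auto simp: atLeast0LessThan)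
 have "\<forall>v\<in>B. \<exists>c. v = (\<Sum>u\<in>W. of_rat (c u) * u)"
  using assms(4) unfolding qspan_def by blast
 then obtain c where c: "\<And>v. v \<in> B \<Longrightarrow> v = (\<Sum>u\<in>W. of_rat (c v u) * u)"
  by metis
 obtain x where x0: "(\<exists>j<card B. x j \<noteq> 0) \<and> (\<forall>i<card W. (\<Sum>j<card B. c (b j) (w i) * x j) = 0)"
  using linear_dependence[OF less, of "\<lambda>i j. c (b j) (w i)"] by (rule exE)
 then obtain j where x: "j < card B" "x j \<noteq> 0" by auto
 have x3: "\<And>i. i < card W \<Longrightarrow> (\<Sum>j<card B. c (b j) (w i) * x j) = 0" using x0 by blast
 have bi: "inv_into {..<card B} b (b j) = j" if "j < card B" for j
  using b that unfolding bij_betw_def by (simp add: inv_into_f_f)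
 define y where "y v = x (inv_into {..<card B} b v)" for v
 have yb: "y (b j) = x j" if "j < card B" for j using bi[OF that] by (simp add: y_def)
 have bB: "b j \<in> B" if "j < card B" for j using b that unfolding bij_betw_def by auto
 have "(\<Sum>v\<in>B. of_rat (y v) * v) = (\<Sum>j<card B. of_rat (x j) * b j)"
  unfolding sum.reindex_bij_betw[OF b, symmetric] by (simp add: yb)
 also have "... = (\<Sum>j<card B. of_rat (x j) * (\<Sum>u\<in>W. of_rat (c (b j) u) * u))"
  using c[OF bB] by simp
 also have "... = (\<Sum>u\<in>W. of_rat (\<Sum>j<card B. c (b j) u * x j) * u)"
  by (simp add: sum_distrib_left sum_distrib_right of_rat_sum of_rat_mult mult_ac) (rule sum.swap)
 also have "... = 0"
 proof (rule sum.neutral, rule ballI)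
  fix u assume "u \<in> W"
  then obtain i where "i < card W" "u = w i" using w unfolding bij_betw_def by auto
  then show "of_rat (\<Sum>j<card B. c (b j) u * x j) * u = 0" using x3 by simp
 qed
 finally have "y (b j) = 0" using qindepD[OF assms(3)] bB[OF x(1)] by blast
 then show False using yb[OF x(1)] x(2) by simp
qed

lemma qindep_insert:
 assumes "finite B" "qindep B" "x \<notin> qspan B"
 shows "qindep (insert x B)"
 unfolding qindep_def
proof (intro allI impI)
 fix c assume c: "(\<Sum>b\<in>insert x B. of_rat (c b) * b) = 0"
 have xB: "x \<notin> B" using qspan_base[OF assms(1)] assms(3) by blast
 have s: "of_rat (c x) * x + (\<Sum>b\<in>B. of_rat (c b) * b) = 0" using c assms(1) xB by simp
 have "c x = 0"
 proof (rule ccontr)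
  assume nz: "c x \<noteq> 0"
  have "of_rat (c x) * x = - (\<Sum>b\<in>B. of_rat (c b) * b)" using s by (simp add: add_eq_0_iff2)
  then have "x = (\<Sum>b\<in>B. of_rat (- c b / c x) * b)"
   using nz by (simp add: of_rat_minus of_rat_divide sum_negf divide_simps flip: sum_divide_distrib)
    (simp add: mult_ac)
  then have "x \<in> qspan B" unfolding qspan_def by (intro CollectI exI[of _ "\<lambda>b. - c b / c x"])
  then show False using assms(3) by blast
 qed
 moreover have "\<forall>b\<in>B. c b = 0" using s calculation qindepD[OF assms(2)] by auto
 ultimately show "\<forall>b\<in>insert x B. c b = 0" by simp
qed

lemma qindep_extend:
 assumes "finite W" "B0 \<subseteq> W" "qindep B0"
 obtains B where "B0 \<subseteq> B" "B \<subseteq> W" "qindep B" "qspan B = qspan W"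
proof -
 have "\<exists>B. (B0 \<subseteq> B \<and> B \<subseteq> W \<and> qindep B) \<and> (\<forall>B'. B0 \<subseteq> B' \<and> B' \<subseteq> W \<and> qindep B' \<longrightarrow> card B' \<le> card B)"
  by (rule ex_has_greatest_nat[where b = "Suc (card W)" and k = B0])
   (use assms in \<open>auto simp: less_Suc_eq_le intro: card_mono\<close>)
 then obtain B where B0: "(B0 \<subseteq> B \<and> B \<subseteq> W \<and> qindep B) \<and>
   (\<forall>B'. B0 \<subseteq> B' \<and> B' \<subseteq> W \<and> qindep B' \<longrightarrow> card B' \<le> card B)" by (rule exE)
 then have B: "B0 \<subseteq> B" "B \<subseteq> W" "qindep B" by auto
 have max: "card B' \<le> card B" if "B0 \<subseteq> B'" "B' \<subseteq> W" "qindep B'" for B' using B0 that by blast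
 have fin: "finite B" using B(2) assms(1) by (rule finite_subset)
 have "W \<subseteq> qspan B"
 proof
  fix w assume w: "w \<in> W"
  show "w \<in> qspan B"
  proof (rule ccontr)
   assume nw: "w \<notin> qspan B"
   have "card (insert w B) \<le> card B"
    by (rule max) (use B w qindep_insert[OF fin B(3) nw] in auto)
   moreover have "w \<notin> B" using nw qspan_base[OF fin] by blast
   ultimately show False using fin by simp
  qed
 qed
 then have "qspan B = qspan W"
  using qspan_subset[OF fin, of W] qspan_subset[OF assms(1), of B] qspan_base[OF assms(1)] B(2) by blast
 then show ?thesis by (rule that[OF B])
qed

section \<open>Number fields and their embeddings\<close>

locale subfield =
 fixes k :: "'a::field_char_0 set"
 assumes subfield: "is_subfield k"
begin

lemma zero_in: "0 \<in> k" and one_in: "1 \<in> k" and diff_in: "x \<in> k \<Longrightarrow> y \<in> k \<Longrightarrow> x - y \<in> k"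
 and mult_in: "x \<in> k \<Longrightarrow> y \<in> k \<Longrightarrow> x * y \<in> k" and inverse_in: "x \<in> k \<Longrightarrow> inverse x \<in> k"
 using subfield unfolding is_subfield_def by blast+

lemma uminus_in: "x \<in> k \<Longrightarrow> - x \<in> k" using diff_in[OF zero_in, of x] by simp

lemma add_in: "x \<in> k \<Longrightarrow> y \<in> k \<Longrightarrow> x + y \<in> k" using diff_in[of x "- y"] uminus_in by simp

lemma divide_in: "x \<in> k \<Longrightarrow> y \<in> k \<Longrightarrow> x / y \<in> k"
 by (simp add: divide_inverse mult_in inverse_in)

lemma power_in: "x \<in> k \<Longrightarrow> x ^ n \<in> k" by (induction n) (auto intro: one_in mult_in)

lemma of_nat_in: "of_nat n \<in> k" by (induction n) (auto intro: zero_in one_in add_in)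

lemma of_int_in: "of_int n \<in> k" by (cases n) (auto intro: of_nat_in uminus_in diff_in one_in)

lemma of_rat_in: "of_rat q \<in> k"
 by (cases q) (auto simp: of_rat_rat intro: of_int_in divide_in)

lemma sum_in: "(\<And>i. i \<in> I \<Longrightarrow> f i \<in> k) \<Longrightarrow> sum f I \<in> k"
 by (induction I rule: infinite_finite_induct) (auto intro: zero_in add_in)

lemma prod_in: "(\<And>i. i \<in> I \<Longrightarrow> f i \<in> k) \<Longrightarrow> prod f I \<in> k"
 by (induction I rule: infinite_finite_induct) (auto intro: one_in mult_in)

lemma qspan_in: "W \<subseteq> k \<Longrightarrow> qspan W \<subseteq> k"
 unfolding qspan_def by (auto intro!: sum_in mult_in of_rat_in)

end

locale embedding = subfield +
 fixes \<sigma> :: "'a::field_char_0 \<Rightarrow> complex"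
 assumes emb: "\<sigma> \<in> embeddings k"
begin

lemma one[simp]: "\<sigma> 1 = 1" and add: "x \<in> k \<Longrightarrow> y \<in> k \<Longrightarrow> \<sigma> (x + y) = \<sigma> x + \<sigma> y"
 and mult: "x \<in> k \<Longrightarrow> y \<in> k \<Longrightarrow> \<sigma> (x * y) = \<sigma> x * \<sigma> y" and ext: "x \<notin> k \<Longrightarrow> \<sigma> x = undefined"
 using emb unfolding embeddings_def by (auto simp: extensional_def)

lemma zero[simp]: "\<sigma> 0 = 0" using add[OF zero_in zero_in] by simp

lemma uminus: "x \<in> k \<Longrightarrow> \<sigma> (- x) = - \<sigma> x"
 using add[of x "- x"] uminus_in by (simp add: add_eq_0_iff)

lemma diff: "x \<in> k \<Longrightarrow> y \<in> k \<Longrightarrow> \<sigma> (x - y) = \<sigma> x - \<sigma> y"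
 using add[of x "- y"] uminus[of y] uminus_in by simp

lemma power: "x \<in> k \<Longrightarrow> \<sigma> (x ^ n) = \<sigma> x ^ n" by (induction n) (auto simp: mult power_in)

lemma eq_0_iff: "x \<in> k \<Longrightarrow> \<sigma> x = 0 \<longleftrightarrow> x = 0"
 using mult[of x "inverse x"] inverse_in[of x] by (cases "x = 0") auto

lemma inverse: "x \<in> k \<Longrightarrow> \<sigma> (inverse x) = inverse (\<sigma> x)"
 using mult[of x "inverse x"] inverse_in[of x] eq_0_iff[of x]
 by (cases "x = 0") (auto simp: field_simps)

lemma divide: "x \<in> k \<Longrightarrow> y \<in> k \<Longrightarrow> \<sigma> (x / y) = \<sigma> x / \<sigma> y"
 by (simp add: divide_inverse mult inverse inverse_in)

lemma sum: "(\<And>i. i \<in> I \<Longrightarrow> f i \<in> k) \<Longrightarrow> \<sigma> (sum f I) = (\<Sum>i\<in>I. \<sigma> (f i))"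
 by (induction I rule: infinite_finite_induct) (auto simp: add sum_in)

lemma prod: "(\<And>i. i \<in> I \<Longrightarrow> f i \<in> k) \<Longrightarrow> \<sigma> (prod f I) = (\<Prod>i\<in>I. \<sigma> (f i))"
 by (induction I rule: infinite_finite_induct) (auto simp: mult prod_in)

lemma of_nat: "\<sigma> (of_nat n) = of_nat n"
 by (induction n) (auto simp: add one_in of_nat_in)

lemma of_int: "\<sigma> (of_int n) = of_int n"
 by (cases n rule: int_cases2) (auto simp: of_nat uminus of_nat_in)

lemma of_rat: "\<sigma> (of_rat q) = of_rat q"
 by (cases q) (auto simp: of_rat_rat divide of_int of_int_in)

lemma powi: "x \<in> k \<Longrightarrow> \<sigma> (x powi n) = \<sigma> x powi n"
 by (cases "n \<ge> 0") (auto simp: power_int_def power inverse power_in inverse_in)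

lemma inj: "x \<in> k \<Longrightarrow> y \<in> k \<Longrightarrow> \<sigma> x = \<sigma> y \<longleftrightarrow> x = y"
 using eq_0_iff[of "x - y"] diff[of x y] diff_in[of x y] by auto

lemma algebraic_int_iff:
 assumes "x \<in> k"
 shows "algebraic_int (\<sigma> x) \<longleftrightarrow> algebraic_int x"
proof -
 have *: "poly (of_int_poly p) (\<sigma> x) = \<sigma> (poly (of_int_poly p) x)" for p
  unfolding poly_altdef using assms
  by (subst sum) (auto simp: mult of_int power of_int_in power_in intro: mult_in)
 have in_k: "poly (of_int_poly p) x \<in> k" for p
  unfolding poly_altdef using assms by (auto intro!: sum_in mult_in of_int_in power_in)
 show ?thesis unfolding algebraic_int_altdef_ipoly * eq_0_iff[OF in_k] ..
qed

end

subsection \<open>Linear functionals are combinations of embeddings\<close>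

definition qlinear :: "'a::field_char_0 set \<Rightarrow> ('a \<Rightarrow> complex) \<Rightarrow> bool" where
 "qlinear k \<phi> \<longleftrightarrow> (\<forall>x\<in>k. \<forall>y\<in>k. \<phi> (x + y) = \<phi> x + \<phi> y) \<and>
  (\<forall>q. \<forall>x\<in>k. \<phi> (of_rat q * x) = of_rat q * \<phi> x)"

definition eigenfunctional :: "'a::field_char_0 set \<Rightarrow> 'a \<Rightarrow> complex \<Rightarrow> ('a \<Rightarrow> complex) \<Rightarrow> bool" where
 "eigenfunctional k a l \<phi> \<longleftrightarrow> (\<forall>x\<in>k. \<phi> (a * x) = l * \<phi> x)"

text \<open>With T the operator that turns \<phi> into the functional x -> \<phi> (a x), this says
  that the product of the operators T - l over the list kills \<phi> on \<open>k\<close>. The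
  recursion applies one factor at a time, as the diagonalization below consumes them.\<close>

fun annihilates :: "'a::field_char_0 set \<Rightarrow> 'a \<Rightarrow> complex list \<Rightarrow> ('a \<Rightarrow> complex) \<Rightarrow> bool" where
 "annihilates k a [] \<phi> \<longleftrightarrow> (\<forall>x\<in>k. \<phi> x = 0)"
| "annihilates k a (l # ls) \<phi> \<longleftrightarrow> annihilates k a ls (\<lambda>x. \<phi> (a * x) - l * \<phi> x)"

text \<open>An operator killed by a product of distinct linear factors is diagonalizable. The
  predicate \<open>P\<close> is any property stable under the operator and under linear
  combinations; it carries linearity and the eigenvector conditions for other multiplications
  through the decomposition.\<close>

lemma eigen_decomposition:
 assumes "distinct ls" "annihilates k a ls \<phi>" "P \<phi>"
  and P1: "\<And>\<phi>. P \<phi> \<Longrightarrow> P (\<lambda>x. \<phi> (a * x))"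
  and P2: "\<And>c \<phi> \<psi>. P \<phi> \<Longrightarrow> P \<psi> \<Longrightarrow> P (\<lambda>x. \<psi> x + c * \<phi> x)"
  and ak: "\<And>x. x \<in> k \<Longrightarrow> a * x \<in> k"
 shows "\<exists>f. (\<forall>l\<in>set ls. P (f l) \<and> eigenfunctional k a l (f l)) \<and> (\<forall>x\<in>k. \<phi> x = (\<Sum>l\<in>set ls. f l x))"
 using assms(1-3)
proof (induction ls arbitrary: \<phi>)
 case Nil
 then show ?case by simp
next
 case (Cons l ls)
 let ?\<psi> = "\<lambda>x. \<phi> (a * x) - l * \<phi> x"
 have "P ?\<psi>" using P2[OF Cons.prems(3) P1[OF Cons.prems(3)], of "- l"] by simp
 then obtain g where g: "\<And>m. m \<in> set ls \<Longrightarrow> P (g m)" "\<And>m. m \<in> set ls \<Longrightarrow> eigenfunctional k a m (g m)"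
  and \<psi>: "\<And>x. x \<in> k \<Longrightarrow> ?\<psi> x = (\<Sum>m\<in>set ls. g m x)"
  using Cons.IH[of ?\<psi>] Cons.prems(1,2) by auto
 have P0: "P (\<lambda>x. c * h x)" if "P h" for c h
  using P2[OF that that, of "c - 1"] by (simp add: algebra_simps)
 have Psum: "P (\<lambda>x. \<phi> x - (\<Sum>m\<in>M. g m x / (m - l)))" if "finite M" "M \<subseteq> set ls" for M
  using that
 proof (induction M rule: finite_induct)
  case empty
  then show ?case using Cons.prems(3) by simp
 next
  case (insert m M)
  then have "P (\<lambda>x. (\<phi> x - (\<Sum>m\<in>M. g m x / (m - l))) + (- 1 / (m - l)) * g m x)"
   by (intro P2 g) auto
  then show ?case using insert by (simp add: algebra_simps)
 qed
 \<comment> \<open>The component for \<open>l\<close> is what remains of \<phi> after the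
   eigenvectors of (T - l) \<phi>, divided by m - l, are removed; distinctness of the list makes
   these denominators nonzero.\<close>
 define f where "f m = (if m = l then (\<lambda>x. \<phi> x - (\<Sum>m\<in>set ls. g m x / (m - l)))
   else (\<lambda>x. (1 / (m - l)) * g m x))" for m
 have l: "l \<notin> set ls" using Cons.prems(1) by simp
 have "P (f m)" if "m \<in> set (l # ls)" for m
  using that Psum[of "set ls"] P0[OF g(1), of m "1 / (m - l)"] by (auto simp: f_def)
 moreover have "eigenfunctional k a m (f m)" if m: "m \<in> set (l # ls)" for m
 proof (cases "m = l")
  case False
  then have "m \<in> set ls" using m by simp
  then show ?thesis using g(2)[of m] False by (simp add: f_def eigenfunctional_def)
 next
  case True
  have "\<phi> (a * x) - (\<Sum>m\<in>set ls. g m (a * x) / (m - l)) = l * (\<phi> x - (\<Sum>m\<in>set ls. g m x / (m - l)))"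
   if x: "x \<in> k" for x
  proof -
   have "(\<Sum>m\<in>set ls. g m (a * x) / (m - l)) - l * (\<Sum>m\<in>set ls. g m x / (m - l)) = (\<Sum>m\<in>set ls. g m x)"
    unfolding sum_distrib_left sum_subtractf[symmetric]
   proof (rule sum.cong[OF refl])
    fix m assume m: "m \<in> set ls"
    then have "m - l \<noteq> 0" using l by auto
    moreover have "g m (a * x) = m * g m x" using g(2)[OF m] x by (simp add: eigenfunctional_def)
    moreover have "g m (a * x) / (m - l) - l * (g m x / (m - l)) = (m - l) * g m x / (m - l)"
     unfolding calculation(2) by (simp add: diff_divide_distrib left_diff_distrib)
    ultimately show "g m (a * x) / (m - l) - l * (g m x / (m - l)) = g m x" by simp
   qed
   then show ?thesis using \<psi>[OF x] by (simp add: algebra_simps)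
  qed
  then show ?thesis using True by (simp add: f_def eigenfunctional_def)
 qed
 moreover have "\<phi> x = (\<Sum>m\<in>set (l # ls). f m x)" if "x \<in> k" for x
 proof -
  have "(\<Sum>m\<in>set ls. f m x) = (\<Sum>m\<in>set ls. g m x / (m - l))"
   using l by (intro sum.cong) (auto simp: f_def)
  then show ?thesis using l by (simp add: f_def)
 qed
 ultimately show ?case by blast
qed

text \<open>The operator P(T) applied to \<phi>, where T multiplies the argument by
  \<open>a\<close>.\<close>

definition poly_act :: "'a::field_char_0 \<Rightarrow> complex poly \<Rightarrow> ('a \<Rightarrow> complex) \<Rightarrow> 'a \<Rightarrow> complex" where
 "poly_act a P \<phi> x = (\<Sum>i\<le>degree P. coeff P i * \<phi> (a ^ i * x))"

lemma poly_act_eq: "degree P \<le> N \<Longrightarrow> poly_act a P \<phi> x = (\<Sum>i\<le>N. coeff P i * \<phi> (a ^ i * x))"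
 unfolding poly_act_def by (rule sum.mono_neutral_left) (auto simp: coeff_eq_0)

lemma poly_act_linear_factor:
 "poly_act a ([:- l, 1:] * P) \<phi> x = poly_act a P (\<lambda>x. \<phi> (a * x) - l * \<phi> x) x"
proof -
 have "degree ([:- l, 1:] * P) \<le> Suc (degree P)"
  by (rule order_trans[OF degree_mult_le]) simp
 then have "poly_act a ([:- l, 1:] * P) \<phi> x = (\<Sum>i\<le>Suc (degree P). coeff ([:- l, 1:] * P) i * \<phi> (a ^ i * x))"
  by (rule poly_act_eq)
 also have "... = (\<Sum>i\<le>Suc (degree P). coeff (pCons 0 P) i * \<phi> (a ^ i * x))
   - l * (\<Sum>i\<le>Suc (degree P). coeff P i * \<phi> (a ^ i * x))"
  by (simp add: sum_distrib_left sum_subtractf algebra_simps del: sum.atMost_Suc)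
 also have "(\<Sum>i\<le>Suc (degree P). coeff P i * \<phi> (a ^ i * x)) = (\<Sum>i\<le>degree P. coeff P i * \<phi> (a ^ i * x))"
  by (simp add: coeff_eq_0)
 also have "(\<Sum>i\<le>Suc (degree P). coeff (pCons 0 P) i * \<phi> (a ^ i * x))
   = (\<Sum>i\<le>degree P. coeff P i * \<phi> (a ^ i * (a * x)))"
  by (subst sum.atMost_Suc_shift) (simp add: mult_ac)
 finally show ?thesis
  unfolding poly_act_def by (simp add: sum_distrib_left sum_subtractf algebra_simps)
qed

lemma annihilates_iff_poly_act:
 "annihilates k a ls \<phi> \<longleftrightarrow> (\<forall>x\<in>k. poly_act a (\<Prod>l\<leftarrow>ls. [:- l, 1:]) \<phi> x = 0)"
proof (induction ls arbitrary: \<phi>)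
 case Nil
 then show ?case by (simp add: poly_act_def)
next
 case (Cons l ls)
 then show ?case by (simp only: annihilates.simps list.map prod_list.Cons poly_act_linear_factor)
qed

interpretation of_rat_poly: map_poly_inj_idom_hom of_rat ..

lemma qlinear_sum:
 assumes "is_subfield k" "qlinear k \<phi>" "\<And>i. i \<in> I \<Longrightarrow> f i \<in> k"
 shows "\<phi> (sum f I) = (\<Sum>i\<in>I. \<phi> (f i))"
proof -
 interpret subfield k by standard fact
 have 0: "\<phi> 0 = 0" using assms(2) zero_in unfolding qlinear_def by force
 show ?thesis using assms(3)
 proof (induction I rule: infinite_finite_induct)
  case (insert x F)
  then have "sum f F \<in> k" "f x \<in> k" by (auto intro: sum_in)
  then show ?case using insert assms(2) unfolding qlinear_def by auto
 qed (auto simp: 0)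
qed

text \<open>All powers of \<open>a\<close> lie in a space spanned by N elements, so the first N + 1
  of them are linearly dependent.\<close>

lemma rational_annihilator:
 fixes a :: "'a::field_char_0"
 assumes "finite W" "\<And>i. a ^ i \<in> qspan W"
 obtains p :: "rat poly" where "p \<noteq> 0" "poly (map_poly of_rat p) a = 0"
proof -
 let ?N = "card W"
 obtain w where w: "bij_betw w {..<?N} W"
  using ex_bij_betw_nat_finite[OF assms(1)] by (auto simp: atLeast0LessThan)
 have "\<forall>i. \<exists>c. a ^ i = (\<Sum>u\<in>W. of_rat (c u) * u)"
  using assms(2) unfolding qspan_def by blast
 then obtain c where c: "\<And>i. a ^ i = (\<Sum>u\<in>W. of_rat (c i u) * u)" by metis
 obtain x where x: "(\<exists>j<Suc ?N. x j \<noteq> 0) \<and> (\<forall>i<?N. (\<Sum>j<Suc ?N. c j (w i) * x j) = 0)"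
  using linear_dependence[OF lessI[of ?N], of "\<lambda>i j. c j (w i)"] by (rule exE)
 define p where "p = (\<Sum>j<Suc ?N. monom (x j) j)"
 have coeff: "coeff p j = (if j < Suc ?N then x j else 0)" for j
  unfolding p_def by (simp add: coeff_sum if_distrib cong: if_cong del: sum.lessThan_Suc)
 have "p \<noteq> 0"
 proof
  assume "p = 0"
  then show False using x coeff by (metis coeff_0)
 qed
 moreover have "poly (map_poly of_rat p) a = 0"
 proof -
  have "map_poly of_rat p = (\<Sum>j<Suc ?N. monom (of_rat (x j) :: 'a) j)"
   unfolding p_def by (simp add: of_rat_hom.map_poly_hom_monom of_rat_poly.hom_sum del: sum.lessThan_Suc)
  then have "poly (map_poly of_rat p) a = (\<Sum>j<Suc ?N. of_rat (x j) * a ^ j)"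
   by (simp add: poly_sum poly_monom del: sum.lessThan_Suc)
  also have "... = (\<Sum>u\<in>W. of_rat (\<Sum>j<Suc ?N. c j u * x j) * u)"
   unfolding c by (simp add: sum_distrib_left sum_distrib_right of_rat_sum of_rat_mult mult_ac
     del: sum.lessThan_Suc) (rule sum.swap)
  also have "... = 0"
  proof (rule sum.neutral, rule ballI)
   fix u assume "u \<in> W"
   then obtain i where "i < ?N" "u = w i" using w unfolding bij_betw_def by auto
   then show "of_rat (\<Sum>j<Suc ?N. c j u * x j) * u = 0" using x by simp
  qed
  finally show ?thesis .
 qed
 ultimately show ?thesis by (rule that)
qed

text \<open>Take an annihilating polynomial p of least degree. By minimality gcd(p, p') does not
  vanish at \<open>a\<close>, so the cofactor kills \<open>a\<close> and must have full degree. Thus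
  p and p' are coprime over the rationals, and Bezout's identity excludes multiple complex
  roots.\<close>

lemma separable_annihilator:
 assumes "is_subfield k" "finite W" "k = qspan W" "a \<in> k"
 obtains p :: "rat poly" and c ls where "poly (map_poly of_rat p) a = 0" "c \<noteq> 0" "distinct ls"
  "map_poly of_rat p = smult c (\<Prod>l\<leftarrow>ls. [:- l, 1 :: complex:])"
proof -
 let ?Z = "\<lambda>p::rat poly. p \<noteq> 0 \<and> poly (map_poly of_rat p) a = 0"
 obtain p0 :: "rat poly" where "p0 \<noteq> 0" "poly (map_poly of_rat p0) a = 0"
  by (rule rational_annihilator[OF assms(2), of a])
   (use subfield.power_in[OF subfield.intro[OF assms(1)] assms(4)] assms(3) in auto)
 then have p0: "?Z p0" by simp
 obtain p where p: "?Z p" and least: "\<And>q. ?Z q \<Longrightarrow> degree p \<le> degree q"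
  using ex_has_least_nat[of ?Z, OF p0, of degree] by auto
 have deg: "degree p > 0"
 proof (rule ccontr)
  assume "\<not> degree p > 0"
  then obtain c where "p = [:c:]" by (metis degree_eq_zeroE gr0I)
  then show False using p by (simp add: hom_distribs)
 qed
 let ?g = "gcd p (pderiv p)"
 obtain h where h: "p = ?g * h" by (meson dvdE gcd_dvd1)
 have dp: "pderiv p \<noteq> 0" using deg by (simp add: pderiv_eq_0_iff)
 have g0: "?g \<noteq> 0" "h \<noteq> 0" using p h by auto
 have "degree ?g \<le> degree (pderiv p)" by (rule dvd_imp_degree_le) (use dp in auto)
 then have "degree ?g < degree p" using deg by (simp add: degree_pderiv)
 then have "poly (map_poly of_rat ?g) a \<noteq> 0" using least[of ?g] g0 by force
 moreover have "poly (map_poly of_rat p) a = poly (map_poly of_rat ?g) a * poly (map_poly of_rat h) a"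
  by (subst h) (simp add: of_rat_poly.hom_mult)
 ultimately have "poly (map_poly of_rat h) a = 0" using p by auto
 then have "degree p \<le> degree h" using least[of h] g0 by auto
 then have "degree ?g = 0" using degree_mult_eq[OF g0] h by simp
 then obtain e where e: "?g = [:e:]" by (metis degree_eq_zeroE)
 then have e0: "e \<noteq> 0" using g0 by auto
 obtain u v where uv: "u * p + v * pderiv p = [:e:]"
  using bezout_coefficients_fst_snd[of p "pderiv p"] e by metis
 let ?q = "map_poly of_rat p :: complex poly"
 have der: "map_poly of_rat (pderiv p) = pderiv ?q"
  by (rule of_rat_hom.map_poly_pderiv)
 have "rsquarefree ?q"
  unfolding rsquarefree_roots
 proof (intro allI notI, elim conjE)
  fix z assume z: "poly ?q z = 0" "poly (pderiv ?q) z = 0"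
  have "poly (map_poly of_rat (u * p + v * pderiv p)) z = of_rat e"
   unfolding uv by (simp add: hom_distribs)
  then have "of_rat e = (0::complex)"
   using z by (simp add: of_rat_poly.hom_add of_rat_poly.hom_mult der)
  then show False using e0 by simp
 qed
 then have dec: "smult (lead_coeff ?q) (\<Prod>z|poly ?q z = 0. [:-z, 1:]) = ?q"
  by (rule complex_poly_decompose_rsquarefree)
 have q0: "?q \<noteq> 0" using p by simp
 obtain ls where ls: "set ls = {z. poly ?q z = 0}" "distinct ls"
  using finite_distinct_list[OF poly_roots_finite[OF q0]] by blast
 have "?q = smult (lead_coeff ?q) (\<Prod>l\<leftarrow>ls. [:- l, 1:])"
  using dec ls prod.distinct_set_conv_list[OF ls(2), of "\<lambda>l. [:- l, 1:]"] by simp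
 moreover have "lead_coeff ?q \<noteq> 0" using q0 by simp
 ultimately show ?thesis using that p ls(2) by blast
qed

lemma qlinear_annihilated:
 assumes "is_subfield k" "qlinear k \<phi>" "a \<in> k" "poly (map_poly of_rat p) a = 0" "c \<noteq> 0"
  and p: "map_poly of_rat p = smult c (\<Prod>l\<leftarrow>ls. [:- l, 1 :: complex:])"
 shows "annihilates k a ls \<phi>"
proof -
 interpret subfield k by standard fact
 let ?q = "map_poly of_rat p :: complex poly" and ?P = "\<Prod>l\<leftarrow>ls. [:- l, 1 :: complex:]"
 have "poly_act a ?P \<phi> x = 0" if x: "x \<in> k" for x
 proof -
  have "poly_act a ?q \<phi> x = (\<Sum>i\<le>degree p. of_rat (coeff p i) * \<phi> (a ^ i * x))"
   by (simp add: poly_act_def)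
  also have "... = (\<Sum>i\<le>degree p. \<phi> (of_rat (coeff p i) * (a ^ i * x)))"
   using assms(2,3) x unfolding qlinear_def by (auto intro!: sum.cong simp: mult_in power_in)
  also have "... = \<phi> (\<Sum>i\<le>degree p. of_rat (coeff p i) * (a ^ i * x))"
   using assms x by (intro qlinear_sum[symmetric]) (auto intro!: mult_in power_in of_rat_in)
  also have "(\<Sum>i\<le>degree p. of_rat (coeff p i) * (a ^ i * x)) = poly (map_poly of_rat p) a * x"
   by (simp add: poly_altdef sum_distrib_right mult.assoc)
  also have "... = 0" using assms(4) by simp
  also have "\<phi> 0 = 0" using assms(2) zero_in unfolding qlinear_def by force
  finally have "poly_act a (smult c ?P) \<phi> x = 0" by (simp add: p)
  moreover have "poly_act a (smult c ?P) \<phi> x = c * poly_act a ?P \<phi> x"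
   using assms(5) by (simp add: poly_act_def sum_distrib_left mult.assoc)
  ultimately show ?thesis using assms(5) by simp
 qed
 then show ?thesis by (simp add: annihilates_iff_poly_act)
qed

text \<open>The finite set \<open>F\<close> is part of the definition because finiteness of the set
  of embeddings is a consequence of this section, not an input.\<close>

definition embcomb :: "'a::field_char_0 set \<Rightarrow> ('a \<Rightarrow> complex) \<Rightarrow> bool" where
 "embcomb k \<phi> \<longleftrightarrow> (\<exists>F c. finite F \<and> F \<subseteq> embeddings k \<and> (\<forall>x\<in>k. \<phi> x = (\<Sum>\<sigma>\<in>F. c \<sigma> * \<sigma> x)))"

lemma embcomb_sum:
 assumes "finite I" "\<And>i. i \<in> I \<Longrightarrow> embcomb k (f i)"
 shows "embcomb k (\<lambda>x. \<Sum>i\<in>I. f i x)"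
proof -
 have "\<forall>i\<in>I. \<exists>F c. finite F \<and> F \<subseteq> embeddings k \<and> (\<forall>x\<in>k. f i x = (\<Sum>\<sigma>\<in>F. c \<sigma> * \<sigma> x))"
  using assms(2) unfolding embcomb_def by blast
 from bchoice[OF this] obtain F where "\<forall>i\<in>I. \<exists>c. finite (F i) \<and> F i \<subseteq> embeddings k
   \<and> (\<forall>x\<in>k. f i x = (\<Sum>\<sigma>\<in>F i. c \<sigma> * \<sigma> x))" by (rule exE)
 from bchoice[OF this] obtain c where F0: "\<forall>i\<in>I. finite (F i) \<and> F i \<subseteq> embeddings k
   \<and> (\<forall>x\<in>k. f i x = (\<Sum>\<sigma>\<in>F i. c i \<sigma> * \<sigma> x))" by (rule exE)
 note F = F0[rule_format]
 let ?F = "\<Union>i\<in>I. F i"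
 let ?c = "\<lambda>\<sigma>. \<Sum>i\<in>I. if \<sigma> \<in> F i then c i \<sigma> else 0"
 have fin: "finite ?F" using assms(1) F by auto
 have "(\<Sum>i\<in>I. f i x) = (\<Sum>\<sigma>\<in>?F. ?c \<sigma> * \<sigma> x)" if x: "x \<in> k" for x
 proof -
  have "f i x = (\<Sum>\<sigma>\<in>?F. (if \<sigma> \<in> F i then c i \<sigma> else 0) * \<sigma> x)" if i: "i \<in> I" for i
  proof -
   have "f i x = (\<Sum>\<sigma>\<in>F i. (if \<sigma> \<in> F i then c i \<sigma> else 0) * \<sigma> x)" using F[OF i] x by simp
   also have "... = (\<Sum>\<sigma>\<in>?F. (if \<sigma> \<in> F i then c i \<sigma> else 0) * \<sigma> x)"
    by (rule sum.mono_neutral_left) (use fin i in auto)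
   finally show ?thesis .
  qed
  then have "(\<Sum>i\<in>I. f i x) = (\<Sum>i\<in>I. \<Sum>\<sigma>\<in>?F. (if \<sigma> \<in> F i then c i \<sigma> else 0) * \<sigma> x)" by simp
  also have "... = (\<Sum>\<sigma>\<in>?F. ?c \<sigma> * \<sigma> x)" unfolding sum_distrib_right by (rule sum.swap)
  finally show ?thesis .
 qed
 moreover have "?F \<subseteq> embeddings k" using F by blast
 ultimately show ?thesis unfolding embcomb_def using fin by (intro exI[of _ ?F] exI[of _ ?c]) auto
qed

lemma embcomb_cong: "embcomb k \<psi> \<Longrightarrow> (\<And>x. x \<in> k \<Longrightarrow> \<phi> x = \<psi> x) \<Longrightarrow> embcomb k \<phi>"
 unfolding embcomb_def by auto

text \<open>A simultaneous eigenfunctional for a spanning set satisfies \<phi>(1) \<phi>(x y) =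
  \<phi>(x) \<phi>(y). Hence it is zero or \<phi>(1) times an embedding.\<close>

lemma eigen_imp_embcomb:
 assumes "is_subfield k" "finite B" "k = qspan B" and lin: "qlinear k \<phi>"
  and eig: "\<And>b. b \<in> B \<Longrightarrow> \<exists>l. eigenfunctional k b l \<phi>"
 shows "embcomb k \<phi>"
proof -
 interpret subfield k by standard fact
 have Bk: "b \<in> k" if "b \<in> B" for b using qspan_base[OF assms(2) that] assms(3) by simp
 obtain l where l: "\<And>b. b \<in> B \<Longrightarrow> eigenfunctional k b (l b) \<phi>" using eig by metis
 have key: "\<phi> 1 * \<phi> (x * y) = \<phi> x * \<phi> y" if x: "x \<in> k" and y: "y \<in> k" for x y
 proof -
  obtain c where c: "x = (\<Sum>b\<in>B. of_rat (c b) * b)" using x unfolding assms(3) qspan_def by blast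
  have *: "\<phi> (x * z) = (\<Sum>b\<in>B. of_rat (c b) * l b) * \<phi> z" if z: "z \<in> k" for z
  proof -
   have "\<phi> (x * z) = \<phi> (\<Sum>b\<in>B. of_rat (c b) * (b * z))"
    unfolding c by (simp add: sum_distrib_right mult.assoc)
   also have "... = (\<Sum>b\<in>B. \<phi> (of_rat (c b) * (b * z)))"
    using z by (intro qlinear_sum[OF assms(1) lin]) (simp add: mult_in of_rat_in Bk)
   also have "... = (\<Sum>b\<in>B. of_rat (c b) * (l b * \<phi> z))"
    using lin z l Bk unfolding qlinear_def eigenfunctional_def by (intro sum.cong) (auto simp: mult_in)
   finally show ?thesis by (simp add: sum_distrib_right mult.assoc)
  qed
  show ?thesis using *[OF y] *[OF one_in] by simp
 qed
 show ?thesis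
 proof (cases "\<phi> 1 = 0")
  case True
  have "\<phi> x = 0" if "x \<in> k" for x using key[OF that that] key[of x x] True that by simp
  then show ?thesis unfolding embcomb_def by (intro exI[of _ "{}"]) auto
 next
  case False
  let ?\<sigma> = "\<lambda>x\<in>k. \<phi> x / \<phi> 1"
  have "?\<sigma> \<in> embeddings k"
  proof -
   have "\<phi> (x * y) / \<phi> 1 = \<phi> x / \<phi> 1 * (\<phi> y / \<phi> 1)" if "x \<in> k" "y \<in> k" for x y
    using key[OF that] False by (simp add: divide_simps mult.commute)
   moreover have "\<phi> (x + y) / \<phi> 1 = \<phi> x / \<phi> 1 + \<phi> y / \<phi> 1" if "x \<in> k" "y \<in> k" for x y
    using lin that by (simp add: qlinear_def add_divide_distrib)
   ultimately show ?thesis unfolding embeddings_def using False one_in by (simp add: add_in mult_in)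
  qed
  then show ?thesis unfolding embcomb_def
   using False by (intro exI[of _ "{?\<sigma>}"] exI[of _ "\<lambda>_. \<phi> 1"]) auto
 qed
qed

text \<open>The multiplications by the generators in \<open>B\<close> commute, so they are
  diagonalized one after another. The induction runs over the list of generators that have not been
  treated yet.\<close>

lemma qlinear_imp_embcomb:
 assumes "is_subfield k" "finite B" "k = qspan B" and lin: "qlinear k \<phi>"
 shows "embcomb k \<phi>"
proof -
 interpret subfield k by standard fact
 have Bk: "b \<in> k" if "b \<in> B" for b using qspan_base[OF assms(2) that] assms(3) by simp
 obtain as where as: "set as = B" using finite_list[OF assms(2)] by blast
 have "embcomb k \<phi>" if "qlinear k \<phi>" "set as \<subseteq> B" "\<And>b. b \<in> B - set as \<Longrightarrow> \<exists>l. eigenfunctional k b l \<phi>" for as \<phi>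
  using that
 proof (induction as arbitrary: \<phi>)
  case Nil
  then show ?case by (intro eigen_imp_embcomb[OF assms(1-3)]) auto
 next
  case (Cons a as)
  have a: "a \<in> k" using Cons.prems(2) Bk by simp
  obtain m where m: "\<And>b. b \<in> B - set (a # as) \<Longrightarrow> eigenfunctional k b (m b) \<phi>" using Cons.prems(3) by metis
  define P where "P \<psi> \<longleftrightarrow> qlinear k \<psi> \<and> (\<forall>b\<in>B - set (a # as). eigenfunctional k b (m b) \<psi>)" for \<psi>
  have P1: "P (\<lambda>x. \<psi> (a * x))" if "P \<psi>" for \<psi>
   using that a Bk mult_in unfolding P_def qlinear_def eigenfunctional_def
   by (auto simp: ring_distribs mult.left_commute[of a])
  have P2: "P (\<lambda>x. \<psi> x + c * \<psi>' x)" if "P \<psi>'" "P \<psi>" for c \<psi> \<psi>'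
   using that unfolding P_def qlinear_def eigenfunctional_def by (auto simp: algebra_simps)
  obtain p c ls where p: "poly (map_poly of_rat p) a = 0" "c \<noteq> 0" "distinct ls"
   "map_poly of_rat p = smult c (\<Prod>l\<leftarrow>ls. [:- l, 1 :: complex:])"
   by (rule separable_annihilator[OF assms(1-3) a])
  have ann: "annihilates k a ls \<phi>"
   by (rule qlinear_annihilated[OF assms(1) Cons.prems(1) a p(1,2,4)])
  have "P \<phi>" unfolding P_def using Cons.prems(1) m by auto
  then obtain f where f: "\<forall>l\<in>set ls. P (f l) \<and> eigenfunctional k a l (f l)"
   "\<forall>x\<in>k. \<phi> x = (\<Sum>l\<in>set ls. f l x)"
   using eigen_decomposition[OF p(3) ann, of P] P1 P2 mult_in[OF a] by blast
  have "embcomb k (f l)" if l: "l \<in> set ls" for l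
  proof (rule Cons.IH)
   show "qlinear k (f l)" "set as \<subseteq> B" using f(1) l Cons.prems(2) by (auto simp: P_def)
   show "\<exists>l'. eigenfunctional k b l' (f l)" if "b \<in> B - set as" for b
    using f(1) l that unfolding P_def by (cases "b = a") auto
  qed
  then have "embcomb k (\<lambda>x. \<Sum>l\<in>set ls. f l x)" by (intro embcomb_sum) auto
  then show ?case by (rule embcomb_cong) (use f(2) in auto)
 qed
 from this[OF lin, of as] as show ?thesis by auto
qed

text \<open>Dedekind's argument: evaluating a relation at y x and subtracting \<rho>(y) times the
  relation at x removes \<rho> from it, where y separates \<sigma> from \<rho>.\<close>

lemma dedekind_independence:
 assumes "is_subfield k" "finite F" "F \<subseteq> embeddings k" "\<And>x. x \<in> k \<Longrightarrow> (\<Sum>\<sigma>\<in>F. c \<sigma> * \<sigma> x) = 0" "\<tau> \<in> F"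
 shows "c \<tau> = 0"
 using assms(2-5)
proof (induction F arbitrary: c \<tau> rule: finite_induct)
 case (insert \<rho> F)
 interpret subfield k by standard fact
 have emb: "embedding k \<sigma>" if "\<sigma> \<in> insert \<rho> F" for \<sigma>
  using that insert.prems(1) assms(1) by (auto intro!: embedding.intro subfield.intro embedding_axioms.intro)
 have c0: "c \<sigma> = 0" if \<sigma>: "\<sigma> \<in> F" for \<sigma>
 proof -
  have "\<sigma> \<noteq> \<rho>" using insert.hyps \<sigma> by auto
  then obtain y where y: "\<sigma> y \<noteq> \<rho> y" by auto
  \<comment> \<open>Outside \<open>k\<close> both maps take the value \<open>undefined\<close>, so a
    point where they differ lies in \<open>k\<close>.\<close>
  have yk: "y \<in> k"
   using embedding.ext[OF emb, of \<sigma> y] embedding.ext[OF emb, of \<rho> y] y \<sigma> by force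
  have "(\<lambda>\<sigma>. c \<sigma> * (\<sigma> y - \<rho> y)) \<sigma> = 0"
  proof (rule insert.IH[of "\<lambda>\<sigma>. c \<sigma> * (\<sigma> y - \<rho> y)" \<sigma>])
   fix x assume x: "x \<in> k"
   have "0 = (\<Sum>\<sigma>\<in>insert \<rho> F. c \<sigma> * \<sigma> (y * x)) - \<rho> y * (\<Sum>\<sigma>\<in>insert \<rho> F. c \<sigma> * \<sigma> x)"
    using insert.prems(2) x yk by (simp add: mult_in)
   also have "... = (\<Sum>\<sigma>\<in>insert \<rho> F. c \<sigma> * (\<sigma> y - \<rho> y) * \<sigma> x)"
    unfolding sum_distrib_left sum_subtractf[symmetric]
    using embedding.mult[OF emb yk x] by (intro sum.cong) (auto simp: algebra_simps)
   also have "... = (\<Sum>\<sigma>\<in>F. c \<sigma> * (\<sigma> y - \<rho> y) * \<sigma> x)" using insert.hyps by simp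
   finally show "(\<Sum>\<sigma>\<in>F. c \<sigma> * (\<sigma> y - \<rho> y) * \<sigma> x) = 0" by simp
  qed (use insert.prems \<sigma> in auto)
  then show ?thesis using y by simp
 qed
 have "c \<rho> * \<rho> 1 = 0" using insert.prems(2)[OF one_in] insert.hyps c0 by simp
 then have "c \<rho> = 0" using embedding.one[OF emb, of \<rho>] by simp
 then show ?case using c0 insert.prems(3) by auto
qed auto

section \<open>Rational bases, and the embeddings as the dual side of a basis\<close>

lemma is_basis_Rats_imp:
 assumes "is_subfield k" "is_basis \<rat> k B"
 shows "finite B" "B \<subseteq> k" "qindep B" "qspan B = k"
proof -
 interpret subfield k by standard fact
 show fin: "finite B" and Bk: "B \<subseteq> k" using assms(2) unfolding is_basis_def by auto
 have uniq: "c = c'" if "c \<in> B \<rightarrow>\<^sub>E \<rat>" "c' \<in> B \<rightarrow>\<^sub>E \<rat>" "(\<Sum>b\<in>B. c b * b) = (\<Sum>b\<in>B. c' b * b)"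
  "(\<Sum>b\<in>B. c b * b) \<in> k" for c c'
  using assms(2) that unfolding is_basis_def by blast
 show "qindep B"
  unfolding qindep_def
 proof (intro allI impI ballI)
  fix c b assume c: "(\<Sum>b\<in>B. of_rat (c b) * b) = 0" "b \<in> B"
  have "(\<lambda>b\<in>B. of_rat (c b)) = (\<lambda>b\<in>B. 0::'a)"
  proof (rule uniq)
   have "(\<Sum>b\<in>B. (\<lambda>b\<in>B. of_rat (c b)) b * b) = (\<Sum>b\<in>B. of_rat (c b) * b)" by (rule sum.cong) auto
   then have *: "(\<Sum>b\<in>B. (\<lambda>b\<in>B. of_rat (c b)) b * b) = 0" using c(1) by simp
   show "(\<Sum>b\<in>B. (\<lambda>b\<in>B. of_rat (c b)) b * b) \<in> k" unfolding * by (rule zero_in)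
   show "(\<Sum>b\<in>B. (\<lambda>b\<in>B. of_rat (c b)) b * b) = (\<Sum>b\<in>B. (\<lambda>b\<in>B. 0) b * b)" unfolding * by simp
  qed auto
  then have "(\<lambda>b\<in>B. of_rat (c b)) b = (\<lambda>b\<in>B. 0::'a) b" by simp
  then show "c b = 0" using c(2) by simp
 qed
 show "qspan B = k"
 proof
  show "qspan B \<subseteq> k" by (rule qspan_in[OF Bk])
  show "k \<subseteq> qspan B"
  proof
   fix x assume "x \<in> k"
   then obtain c where c: "c \<in> B \<rightarrow>\<^sub>E \<rat>" "x = (\<Sum>b\<in>B. c b * b)" using assms(2) unfolding is_basis_def by blast
   then have "\<forall>b\<in>B. \<exists>q. c b = of_rat q" by (auto simp: Rats_def PiE_iff)
   from bchoice[OF this] obtain q where "\<forall>b\<in>B. c b = of_rat (q b)" by (rule exE)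
   then have "x = (\<Sum>b\<in>B. of_rat (q b) * b)" using c(2) by simp
   then show "x \<in> qspan B" unfolding qspan_def by blast
  qed
 qed
qed

lemma is_basis_RatsI:
 assumes "finite B" "qindep B" "qspan B = k"
 shows "is_basis \<rat> k B"
 unfolding is_basis_def
proof (intro conjI ballI ex_ex1I)
 show "finite B" by fact
 show "B \<subseteq> k" using qspan_base[OF assms(1)] assms(3) by blast
 fix x assume "x \<in> k"
 then obtain q where "x = (\<Sum>b\<in>B. of_rat (q b) * b)" using assms(3) unfolding qspan_def by blast
 then show "\<exists>c. c \<in> B \<rightarrow>\<^sub>E \<rat> \<and> x = (\<Sum>b\<in>B. c b * b)"
  by (intro exI[of _ "\<lambda>b\<in>B. of_rat (q b)"]) auto
next
 fix x c c' assume c: "c \<in> B \<rightarrow>\<^sub>E \<rat> \<and> x = (\<Sum>b\<in>B. c b * b)" "c' \<in> B \<rightarrow>\<^sub>E \<rat> \<and> x = (\<Sum>b\<in>B. c' b * b)"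
 have "\<forall>b\<in>B. \<exists>q. c b = of_rat q" using c by (auto simp: Rats_def PiE_iff)
 from bchoice[OF this] obtain q where q: "\<forall>b\<in>B. c b = of_rat (q b)" by (rule exE)
 have "\<forall>b\<in>B. \<exists>q. c' b = of_rat q" using c by (auto simp: Rats_def PiE_iff)
 from bchoice[OF this] obtain q' where q': "\<forall>b\<in>B. c' b = of_rat (q' b)" by (rule exE)
 have "q b = q' b" if "b \<in> B" for b
  by (rule qindep_unique[OF assms(2) _ that]) (use c q q' in auto)
 then show "c = c'" using c q q' by (intro PiE_ext[of _ B "\<lambda>_. \<rat>"]) auto
qed

text \<open>Only inverses are in question. An annihilating polynomial of \<open>a\<close> of least
  degree has a nonzero constant term c, and from c + a q(a) = 0 the inverse is -q(a) / c, which lies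
  in the ring.\<close>

lemma finite_qspan_ring_number_field:
 assumes "finite W" "R = qspan W" "1 \<in> R" and mult: "\<And>x y. x \<in> R \<Longrightarrow> y \<in> R \<Longrightarrow> x * y \<in> R"
 shows "number_field R"
proof -
 have pw: "x ^ i \<in> R" if "x \<in> R" for x i by (induction i) (auto intro: assms that)
 have inv: "inverse a \<in> R" if a: "a \<in> R" for a
 proof (cases "a = 0")
  case False
  let ?Z = "\<lambda>p::rat poly. p \<noteq> 0 \<and> poly (map_poly of_rat p) a = 0"
  obtain p0 :: "rat poly" where "p0 \<noteq> 0" "poly (map_poly of_rat p0) a = 0"
   by (rule rational_annihilator[OF assms(1), of a]) (use pw[OF a] assms(2) in auto)
  then have p0: "?Z p0" by simp
  obtain p where p: "?Z p" and least: "\<And>q. ?Z q \<Longrightarrow> degree p \<le> degree q"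
   using ex_has_least_nat[of ?Z, OF p0, of degree] by auto
  obtain c q where cq: "p = pCons c q" by (rule pCons_cases)
  have ev: "of_rat c + a * poly (map_poly of_rat q) a = 0" using p cq by (simp add: hom_distribs)
  have "c \<noteq> 0"
  proof
   assume "c = 0"
   then have "?Z q" using p cq ev False by auto
   then have "degree p \<le> degree q" by (rule least)
   then show False using cq p \<open>c = 0\<close> by (auto split: if_splits)
  qed
  have aq: "a * poly (map_poly of_rat q) a = - of_rat c" using ev by (simp add: add_eq_0_iff)
  have "a * (of_rat (- inverse c) * poly (map_poly of_rat q) a)
    = - inverse (of_rat c) * (a * poly (map_poly of_rat q) a)"
   by (simp add: of_rat_minus of_rat_inverse mult_ac)
  also have "... = 1" unfolding aq using \<open>c \<noteq> 0\<close> by simp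
  finally have "inverse a = of_rat (- inverse c) * poly (map_poly of_rat q) a"
   by (rule inverse_unique)
  also have "poly (map_poly of_rat q) a \<in> R"
   unfolding poly_altdef assms(2) using pw[OF a] assms(2) by (auto intro!: qspan_sum qspan_scale)
  then have "of_rat (- inverse c) * poly (map_poly of_rat q) a \<in> R"
   unfolding assms(2) by (rule qspan_scale)
  finally show ?thesis .
 qed (use that in simp)
 have "is_subfield R"
  unfolding is_subfield_def using assms(3) mult inv qspan_0 qspan_diff assms(2) by auto
 moreover obtain B where "B \<subseteq> W" "qindep B" "qspan B = qspan W"
  using qindep_extend[OF assms(1), of "{}"] by (auto simp: qindep_def)
 then have "is_basis \<rat> R B" using assms(1,2) by (intro is_basis_RatsI) (auto dest: finite_subset)
 ultimately show ?thesis unfolding number_field_def by blast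
qed

lemma number_fieldD: "number_field k \<Longrightarrow> is_subfield k"
 unfolding number_field_def by blast

lemma number_field_basis:
 assumes "number_field k"
 obtains B where "finite B" "qindep B" "qspan B = k"
 using assms is_basis_Rats_imp unfolding number_field_def by metis

text \<open>\<open>co\<close> gives the coordinates with respect to \<open>B\<close>, and
  \<open>W\<close> is the inverse of the square matrix of the values of the embeddings on
  \<open>B\<close>. Through \<open>W\<close>, traces, norms and discriminants are computed from
  rational coordinates.\<close>

definition dual_basis :: "'a::field_char_0 set \<Rightarrow> 'a set \<Rightarrow> ('a \<Rightarrow> 'a \<Rightarrow> rat) \<Rightarrow>
  ('a \<Rightarrow> ('a \<Rightarrow> complex) \<Rightarrow> complex) \<Rightarrow> bool" where
 "dual_basis k B co W \<longleftrightarrow> finite (embeddings k) \<and> card (embeddings k) = card B \<and>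
  (\<forall>x\<in>k. x = (\<Sum>b\<in>B. of_rat (co x b) * b)) \<and>
  (\<forall>x\<in>k. \<forall>b\<in>B. of_rat (co x b) = (\<Sum>\<sigma>\<in>embeddings k. W b \<sigma> * \<sigma> x)) \<and>
  (\<forall>\<sigma>\<in>embeddings k. \<forall>\<tau>\<in>embeddings k. (\<Sum>b\<in>B. \<tau> b * W b \<sigma>) = (if \<sigma> = \<tau> then 1 else 0))"

text \<open>The coordinate functionals are combinations of a finite set \<open>G\<close> of
  embeddings. Every embedding is a combination of coordinate functionals, hence of \<open>G\<close>,
  and independence forces it to belong to \<open>G\<close>.\<close>

lemma embeddings_dual_basis:
 assumes k: "is_subfield k" and B: "finite B" "qindep B" "qspan B = k"
 obtains co :: "'a::field_char_0 \<Rightarrow> 'a \<Rightarrow> rat" and W where "dual_basis k B co W"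
proof -
 interpret subfield k by standard fact
 let ?E = "embeddings k"
 have emb: "embedding k \<sigma>" if "\<sigma> \<in> ?E" for \<sigma>
  using that k by (auto intro!: embedding.intro subfield.intro embedding_axioms.intro)
 have Bk: "b \<in> k" if "b \<in> B" for b using qspan_base[OF B(1) that] B(3) by simp
 have "\<forall>x\<in>k. \<exists>c. x = (\<Sum>b\<in>B. of_rat (c b) * b)" using B(3) unfolding qspan_def by blast
 from bchoice[OF this] obtain co where co0: "\<forall>x\<in>k. x = (\<Sum>b\<in>B. of_rat (co x b) * b)" by (rule exE)
 note co = co0[rule_format]
 have co_eq: "co x b = c b" if "x \<in> k" "x = (\<Sum>b\<in>B. of_rat (c b) * b)" "b \<in> B" for x c b
  by (rule qindep_unique[OF B(2) _ that(3)]) (use co[OF that(1)] that(2) in simp)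
 have lin: "qlinear k (\<lambda>x. of_rat (co x b))" if b: "b \<in> B" for b
  unfolding qlinear_def
 proof (intro conjI ballI allI)
  fix x y assume xy: "x \<in> k" "y \<in> k"
  have "co (x + y) b = co x b + co y b"
  proof (rule co_eq[OF add_in[OF xy] _ b])
   have "x + y = (\<Sum>b\<in>B. of_rat (co x b) * b) + (\<Sum>b\<in>B. of_rat (co y b) * b)"
    using co xy by simp
   then show "x + y = (\<Sum>b\<in>B. of_rat (co x b + co y b) * b)"
    by (simp add: of_rat_add ring_distribs sum.distrib)
  qed
  then show "of_rat (co (x + y) b) = of_rat (co x b) + (of_rat (co y b) :: complex)"
   by (simp add: of_rat_add)
 next
  fix q x assume x: "x \<in> k"
  have "co (of_rat q * x) b = q * co x b"
  proof (rule co_eq[OF mult_in[OF of_rat_in x] _ b])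
   have "of_rat q * x = of_rat q * (\<Sum>b\<in>B. of_rat (co x b) * b)" using co x by simp
   then show "of_rat q * x = (\<Sum>b\<in>B. of_rat (q * co x b) * b)"
    by (simp add: of_rat_mult sum_distrib_left mult_ac)
  qed
  then show "of_rat (co (of_rat q * x) b) = of_rat q * (of_rat (co x b) :: complex)"
   by (simp add: of_rat_mult)
 qed
 have expand: "\<tau> x = (\<Sum>b\<in>B. of_rat (co x b) * \<tau> b)" if \<tau>: "\<tau> \<in> ?E" and x: "x \<in> k" for \<tau> x
 proof -
  interpret embedding k \<tau> by (rule emb[OF \<tau>])
  have "\<tau> x = \<tau> (\<Sum>b\<in>B. of_rat (co x b) * b)" using co[OF x] by simp
  also have "... = (\<Sum>b\<in>B. of_rat (co x b) * \<tau> b)"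
   by (subst sum) (auto simp: mult_in of_rat_in Bk mult of_rat)
  finally show ?thesis .
 qed
 have "\<forall>b\<in>B. \<exists>F c. finite F \<and> F \<subseteq> ?E \<and> (\<forall>x\<in>k. of_rat (co x b) = (\<Sum>\<sigma>\<in>F. c \<sigma> * \<sigma> x))"
  using qlinear_imp_embcomb[OF k B(1) B(3)[symmetric] lin] unfolding embcomb_def by blast
 from bchoice[OF this] obtain F where "\<forall>b\<in>B. \<exists>c. finite (F b) \<and> F b \<subseteq> ?E
   \<and> (\<forall>x\<in>k. of_rat (co x b) = (\<Sum>\<sigma>\<in>F b. c \<sigma> * \<sigma> x))" by (rule exE)
 from bchoice[OF this] obtain c where F0: "\<forall>b\<in>B. finite (F b) \<and> F b \<subseteq> ?E
   \<and> (\<forall>x\<in>k. of_rat (co x b) = (\<Sum>\<sigma>\<in>F b. c b \<sigma> * \<sigma> x))" by (rule exE)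
 define G where "G = (\<Union>b\<in>B. F b)"
 define W where "W b \<sigma> = (if \<sigma> \<in> F b then c b \<sigma> else 0)" for b \<sigma>
 have G: "finite G" "G \<subseteq> ?E" using F0 B(1) by (auto simp: G_def)
 have coW: "of_rat (co x b) = (\<Sum>\<sigma>\<in>G. W b \<sigma> * \<sigma> x)" if "x \<in> k" "b \<in> B" for x b
 proof -
  have "of_rat (co x b) = (\<Sum>\<sigma>\<in>F b. W b \<sigma> * \<sigma> x)" using F0 that by (auto simp: W_def)
  also have "... = (\<Sum>\<sigma>\<in>G. W b \<sigma> * \<sigma> x)"
   by (rule sum.mono_neutral_left) (use G that in \<open>auto simp: W_def G_def\<close>)
  finally show ?thesis .
 qed
 have \<tau>G: "\<tau> x = (\<Sum>\<sigma>\<in>G. (\<Sum>b\<in>B. \<tau> b * W b \<sigma>) * \<sigma> x)" if "\<tau> \<in> ?E" "x \<in> k" for \<tau> x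
 proof -
  have "\<tau> x = (\<Sum>b\<in>B. (\<Sum>\<sigma>\<in>G. W b \<sigma> * \<sigma> x) * \<tau> b)" using expand[OF that] coW[OF that(2)] by simp
  also have "... = (\<Sum>\<sigma>\<in>G. (\<Sum>b\<in>B. \<tau> b * W b \<sigma>) * \<sigma> x)"
   unfolding sum_distrib_right by (subst sum.swap) (simp add: mult_ac)
  finally show ?thesis .
 qed
 have EG: "?E = G"
 proof
  show "?E \<subseteq> G"
  proof
   fix \<tau> assume \<tau>: "\<tau> \<in> ?E"
   show "\<tau> \<in> G"
   proof (rule ccontr)
    assume n: "\<tau> \<notin> G"
    \<comment> \<open>An embedding outside \<open>G\<close> would enter the relation that expresses
      it through \<open>G\<close> with the coefficient -1.\<close>
    let ?c = "\<lambda>\<sigma>. if \<sigma> = \<tau> then - 1 else (\<Sum>b\<in>B. \<tau> b * W b \<sigma>)"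
    have "?c \<tau> = 0"
    proof (rule dedekind_independence[OF k, of "insert \<tau> G" ?c \<tau>])
     fix x assume x: "x \<in> k"
     have "(\<Sum>\<sigma>\<in>insert \<tau> G. ?c \<sigma> * \<sigma> x) = - \<tau> x + (\<Sum>\<sigma>\<in>G. ?c \<sigma> * \<sigma> x)" using n G(1) by simp
     also have "(\<Sum>\<sigma>\<in>G. ?c \<sigma> * \<sigma> x) = (\<Sum>\<sigma>\<in>G. (\<Sum>b\<in>B. \<tau> b * W b \<sigma>) * \<sigma> x)"
      by (rule sum.cong) (use n in auto)
     finally show "(\<Sum>\<sigma>\<in>insert \<tau> G. ?c \<sigma> * \<sigma> x) = 0" using \<tau>G[OF \<tau> x] by simp
    qed (use G \<tau> in auto)
    then show False by simp
   qed
  qed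
 qed (use G in auto)
 have VW: "(\<Sum>b\<in>B. \<tau> b * W b \<sigma>) = (if \<sigma> = \<tau> then 1 else 0)" if \<sigma>: "\<sigma> \<in> ?E" and \<tau>: "\<tau> \<in> ?E" for \<sigma> \<tau>
 proof -
  let ?c = "\<lambda>\<sigma>. (\<Sum>b\<in>B. \<tau> b * W b \<sigma>) - (if \<sigma> = \<tau> then 1 else 0)"
  have "?c \<sigma> = 0"
  proof (rule dedekind_independence[OF k, of ?E ?c \<sigma>])
   fix x assume x: "x \<in> k"
   have "(\<Sum>\<sigma>\<in>?E. ?c \<sigma> * \<sigma> x) = (\<Sum>\<sigma>\<in>?E. (\<Sum>b\<in>B. \<tau> b * W b \<sigma>) * \<sigma> x) - (\<Sum>\<sigma>\<in>?E. (if \<sigma> = \<tau> then 1 else 0) * \<sigma> x)"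
    by (simp only: left_diff_distrib sum_subtractf)
   also have "(\<Sum>\<sigma>\<in>?E. (if \<sigma> = \<tau> then 1 else 0) * \<sigma> x) = \<tau> x"
    using \<tau> G EG by (simp add: if_distrib[of "\<lambda>x. x * _"] cong: if_cong)
   finally show "(\<Sum>\<sigma>\<in>?E. ?c \<sigma> * \<sigma> x) = 0" using \<tau>G[OF \<tau> x] EG by simp
  qed (use G EG \<sigma> in auto)
  then show ?thesis by simp
 qed
 \<comment> \<open>The matrices of values and of coefficients are inverse on both sides. Comparing
   the traces of the two products gives the number of embeddings on one side and the size of the
   basis on the other.\<close>
 have "of_nat (card ?E) = (\<Sum>\<sigma>\<in>?E. \<Sum>b\<in>B. \<sigma> b * W b \<sigma>)" using VW by simp
 also have "... = (\<Sum>b\<in>B. \<Sum>\<sigma>\<in>?E. W b \<sigma> * \<sigma> b)" by (subst sum.swap) (simp add: mult.commute)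
 also have "... = (\<Sum>b\<in>B. 1)"
 proof (rule sum.cong[OF refl])
  fix b assume b: "b \<in> B"
  have "co b b = (if b = b then 1 else 0)"
   by (rule co_eq[OF Bk[OF b] _ b, where c = "\<lambda>b'. if b' = b then 1 else 0"])
    (use b B(1) in \<open>simp add: if_distrib[of of_rat] if_distrib[of "\<lambda>x. x * _"] cong: if_cong\<close>)
  then show "(\<Sum>\<sigma>\<in>?E. W b \<sigma> * \<sigma> b) = 1" using coW[OF Bk[OF b] b] EG by simp
 qed
 finally have "(of_nat (card ?E) :: complex) = of_nat (card B)" by simp
 then have card: "card ?E = card B" by (simp only: of_nat_eq_iff)
 show ?thesis
  by (rule that[of co W]) (use card VW coW EG G co0 in \<open>auto simp: dual_basis_def\<close>)
qed

subsection \<open>Degree, trace, norm\<close>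

locale number_fld =
 fixes k :: "'a::field_char_0 set"
 assumes nf: "number_field k"
begin

sublocale subfield k by standard (rule number_fieldD[OF nf])

abbreviation "E \<equiv> embeddings k"
definition "d = card E"

lemma emb: "\<sigma> \<in> E \<Longrightarrow> embedding k \<sigma>"
 using subfield by (auto intro!: embedding.intro subfield.intro embedding_axioms.intro)

lemma finite_E: "finite E" and basis_card: "finite B \<Longrightarrow> qindep B \<Longrightarrow> qspan B = k \<Longrightarrow> card B = d"
proof -
 obtain B where B: "finite B" "qindep B" "qspan B = k" by (rule number_field_basis[OF nf])
 show "finite E" using embeddings_dual_basis[OF subfield B] unfolding dual_basis_def by metis
 show "card B = d" if "finite B" "qindep B" "qspan B = k" for B
  using embeddings_dual_basis[OF subfield that] unfolding dual_basis_def d_def by metis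
qed

lemma ext_degree_eq: "ext_degree \<rat> k = d"
 unfolding ext_degree_def
proof (rule the_equality)
 obtain B where B: "finite B" "qindep B" "qspan B = k" by (rule number_field_basis[OF nf])
 then show "\<exists>B. is_basis \<rat> k B \<and> card B = d" using is_basis_RatsI[OF B] basis_card[OF B] by blast
 show "n = d" if "\<exists>B. is_basis \<rat> k B \<and> card B = n" for n
  using that is_basis_Rats_imp[OF subfield] basis_card by blast
qed

lemma E_nonempty: "E \<noteq> {}"
proof
 assume "E = {}"
 then have "d = 0" by (simp add: d_def)
 obtain B where B: "finite B" "qindep B" "qspan B = k" by (rule number_field_basis[OF nf])
 have "B = {}" using basis_card[OF B] \<open>d = 0\<close> B(1) by simp
 then show False using B(3) one_in by (auto simp: qspan_def)
qed

lemma qindep_card_le_d: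
 assumes "finite W" "W \<subseteq> k" "qindep W"
 shows "card W \<le> d"
proof -
 obtain B where B: "finite B" "qindep B" "qspan B = k" by (rule number_field_basis[OF nf])
 show ?thesis using qindep_card_le[OF B(1) assms(1,3)] assms(2) B basis_card[OF B] by simp
qed

text \<open>Inserting the sum of \<sigma>(b) \<open>W\<close> b \<sigma> over the basis, which is 1,
  turns the sum of conjugates into the trace of the rational matrix of multiplication by x.\<close>

lemma trace_in_Rats: "x \<in> k \<Longrightarrow> (\<Sum>\<sigma>\<in>E. \<sigma> x) \<in> \<rat>"
proof -
 assume x: "x \<in> k"
 obtain B where B: "finite B" "qindep B" "qspan B = k" by (rule number_field_basis[OF nf])
 have Bk: "b \<in> k" if "b \<in> B" for b using qspan_base[OF B(1) that] B(3) by simp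
 obtain co :: "'a \<Rightarrow> 'a \<Rightarrow> rat" and W where db: "dual_basis k B co W"
  by (rule embeddings_dual_basis[OF subfield B])
 note dual = db[unfolded dual_basis_def, THEN conjunct2, THEN conjunct2]
 note co = dual[THEN conjunct2, THEN conjunct1, rule_format] and VW = dual[THEN conjunct2, THEN conjunct2, rule_format]
 have "(\<Sum>\<sigma>\<in>E. \<sigma> x) = (\<Sum>\<sigma>\<in>E. \<sigma> x * (\<Sum>b\<in>B. \<sigma> b * W b \<sigma>))" using VW by simp
 also have "... = (\<Sum>b\<in>B. \<Sum>\<sigma>\<in>E. W b \<sigma> * \<sigma> (x * b))"
  unfolding sum_distrib_left
  by (subst sum.swap) (intro sum.cong refl, simp add: embedding.mult[OF emb] x Bk mult_ac)
 also have "... = (\<Sum>b\<in>B. of_rat (co (x * b) b))"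
  using co x Bk by (intro sum.cong) (auto simp: mult_in)
 finally show ?thesis by (auto intro!: Rats_sum)
qed

lemma algebraic_int_emb: "\<sigma> \<in> E \<Longrightarrow> x \<in> k \<Longrightarrow> algebraic_int x \<Longrightarrow> algebraic_int (\<sigma> x)"
 using embedding.algebraic_int_iff[OF emb] by blast

lemma trace_in_Ints:
 assumes "x \<in> k" "algebraic_int x"
 shows "(\<Sum>\<sigma>\<in>E. \<sigma> x) \<in> \<int>"
 by (rule rational_algebraic_int_is_int)
  (use assms in \<open>auto intro!: algebraic_int_sum algebraic_int_emb trace_in_Rats\<close>)

text \<open>The trace of x equals d times the constant. Applied to a Galois closure this says that
  the fixed field is rational.\<close>

lemma constant_imp_rational:
 assumes "x \<in> k" "\<And>\<sigma>. \<sigma> \<in> E \<Longrightarrow> \<sigma> x = c"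
 shows "c \<in> \<rat>"
proof -
 have "(\<Sum>\<sigma>\<in>E. \<sigma> x) = (\<Sum>\<sigma>\<in>E. c)" by (rule sum.cong) (use assms(2) in auto)
 then have "of_nat d * c \<in> \<rat>" using trace_in_Rats[OF assms(1)] by (simp add: d_def)
 then have "of_nat d * c / of_nat d \<in> \<rat>" by (intro Rats_divide) auto
 moreover have "d \<noteq> 0" using E_nonempty finite_E by (simp add: d_def)
 ultimately show ?thesis by simp
qed

definition is_enum :: "(nat \<Rightarrow> 'a \<Rightarrow> complex) \<Rightarrow> bool" where
 "is_enum s \<longleftrightarrow> bij_betw s {..<d} E"

lemma enum_exists: "\<exists>s. is_enum s"
 using ex_bij_betw_nat_finite[OF finite_E] by (auto simp: is_enum_def d_def atLeast0LessThan)

lemma enum_in: "is_enum s \<Longrightarrow> i < d \<Longrightarrow> s i \<in> E"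
 unfolding is_enum_def bij_betw_def by auto

lemma enum_sum: "is_enum s \<Longrightarrow> (\<Sum>i<d. f (s i)) = (\<Sum>\<sigma>\<in>E. f \<sigma>)"
 unfolding is_enum_def by (rule sum.reindex_bij_betw)

lemma enum_prod: "is_enum s \<Longrightarrow> (\<Prod>i<d. f (s i)) = (\<Prod>\<sigma>\<in>E. f \<sigma>)"
 unfolding is_enum_def by (rule prod.reindex_bij_betw)

lemma fdet_embeddings_nonzero:
 assumes s: "is_enum s" and b: "inj_on b {..<d}" "qindep (b ` {..<d})" "qspan (b ` {..<d}) = k"
 shows "fdet d (\<lambda>i j. s i (b j)) \<noteq> 0"
proof -
 let ?B = "b ` {..<d}"
 obtain co :: "'a \<Rightarrow> 'a \<Rightarrow> rat" and W where db: "dual_basis k ?B co W"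
  by (rule embeddings_dual_basis[OF subfield finite_imageI[OF finite_lessThan] b(2,3)])
 note dual = db[unfolded dual_basis_def, THEN conjunct2, THEN conjunct2]
 note VW = dual[THEN conjunct2, THEN conjunct2, rule_format]
 have "fdet d (\<lambda>i j. s i (b j)) * fdet d (\<lambda>j i. W (b j) (s i)) = fdet d (\<lambda>i j. \<Sum>l<d. s i (b l) * W (b l) (s j))"
  by (rule fdet_mult[symmetric])
 also have "... = fdet d (\<lambda>i j. if i = j then 1 else 0)"
 proof (rule fdet_cong)
  fix i j assume ij: "i < d" "j < d"
  have "(\<Sum>l<d. s i (b l) * W (b l) (s j)) = (\<Sum>b\<in>?B. s i b * W b (s j))"
   using b(1) by (simp add: sum.reindex)
  also have "... = (if s j = s i then 1 else 0)" using ij s by (intro VW enum_in) auto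
  also have "s j = s i \<longleftrightarrow> i = j" using s ij unfolding is_enum_def bij_betw_def inj_on_def by auto
  finally show "(\<Sum>l<d. s i (b l) * W (b l) (s j)) = (if i = j then 1 else 0)" .
 qed
 also have "... = 1" by (rule fdet_id)
 finally show ?thesis by auto
qed

lemma enum_basis:
 assumes "finite B" "qindep B" "qspan B = k"
 obtains b where "bij_betw b {..<d} B"
 using ex_bij_betw_nat_finite[OF assms(1)] basis_card[OF assms] by (auto simp: atLeast0LessThan)

text \<open>If V holds the values of the embeddings on a basis and M is the rational matrix of
  multiplication by x, then V M is V with its rows scaled by the conjugates of x. Cancelling det V
  identifies the product of the conjugates with det M.\<close>

lemma norm_in_Rats:
 assumes x: "x \<in> k"
 shows "(\<Prod>\<sigma>\<in>E. \<sigma> x) \<in> \<rat>"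
proof -
 obtain B where B: "finite B" "qindep B" "qspan B = k" by (rule number_field_basis[OF nf])
 have Bk: "b \<in> k" if "b \<in> B" for b using qspan_base[OF B(1) that] B(3) by simp
 obtain b where b: "bij_betw b {..<d} B" by (rule enum_basis[OF B])
 have bB: "b i \<in> B" if "i < d" for i using b that unfolding bij_betw_def by auto
 obtain s where s: "is_enum s" using enum_exists by blast
 obtain co :: "'a \<Rightarrow> 'a \<Rightarrow> rat" and W where db: "dual_basis k B co W"
  by (rule embeddings_dual_basis[OF subfield B])
 note dual = db[unfolded dual_basis_def, THEN conjunct2, THEN conjunct2]
 note co = dual[THEN conjunct1, rule_format]
 let ?V = "fdet d (\<lambda>i j. s i (b j))"
 have V: "?V \<noteq> 0" using b B by (intro fdet_embeddings_nonzero[OF s]) (auto simp: bij_betw_def)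
 have "?V * fdet d (\<lambda>l j. of_rat (co (x * b j) (b l))) = fdet d (\<lambda>i j. \<Sum>l<d. s i (b l) * of_rat (co (x * b j) (b l)))"
  by (rule fdet_mult[symmetric])
 also have "... = fdet d (\<lambda>i j. s i x * s i (b j))"
 proof (rule fdet_cong)
  fix i j assume ij: "i < d" "j < d"
  interpret embedding k "s i" by (rule emb[OF enum_in[OF s ij(1)]])
  have xb: "x * b j \<in> k" using x Bk bB ij by (simp add: mult_in)
  have "s i x * s i (b j) = s i (x * b j)" using x Bk bB ij by (simp add: mult)
  also have "... = s i (\<Sum>b'\<in>B. of_rat (co (x * b j) b') * b')" using co[OF xb] by simp
  also have "... = (\<Sum>b'\<in>B. s i b' * of_rat (co (x * b j) b'))"
   by (subst sum) (auto simp: mult of_rat mult_in of_rat_in Bk mult.commute)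
  also have "... = (\<Sum>l<d. s i (b l) * of_rat (co (x * b j) (b l)))"
   by (rule sum.reindex_bij_betw[OF b, symmetric])
  finally show "(\<Sum>l<d. s i (b l) * of_rat (co (x * b j) (b l))) = s i x * s i (b j)" by simp
 qed
 also have "... = (\<Prod>i<d. s i x) * ?V" by (rule fdet_scale_rows)
 finally have "(\<Prod>i<d. s i x) = fdet d (\<lambda>l j. of_rat (co (x * b j) (b l)))" using V by simp
 also have "... = of_rat (fdet d (\<lambda>l j. co (x * b j) (b l)))"
  by (rule fdet_of_hom) (rule of_rat_hom.comm_ring_hom_axioms)
 finally show ?thesis using enum_prod[OF s, of "\<lambda>\<sigma>. \<sigma> x"] by auto
qed

lemma norm_in_Ints:
 assumes "x \<in> k" "algebraic_int x"
 shows "(\<Prod>\<sigma>\<in>E. \<sigma> x) \<in> \<int>"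
 by (rule rational_algebraic_int_is_int)
  (use assms in \<open>auto intro!: algebraic_int_prod algebraic_int_emb norm_in_Rats\<close>)

end

section \<open>Lattices with bounded denominators\<close>

lemma group_int_combination:
 fixes \<Gamma> :: "(nat \<Rightarrow> real) set"
 assumes diff: "\<And>x y. x \<in> \<Gamma> \<Longrightarrow> y \<in> \<Gamma> \<Longrightarrow> (\<lambda>i. x i - y i) \<in> \<Gamma>" and x: "x \<in> \<Gamma>" and w: "w \<in> \<Gamma>"
 shows "(\<lambda>i. x i - of_int q * w i) \<in> \<Gamma>"
proof -
 have nat: "(\<lambda>i. x i - of_nat m * w i) \<in> \<Gamma>" if "w \<in> \<Gamma>" for m w
 proof (induction m)
  case (Suc m)
  then show ?case using diff[OF Suc that] by (simp add: algebra_simps)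
 qed (use x in simp)
 have "(\<lambda>i. - w i) \<in> \<Gamma>" using diff[OF diff[OF w w] w] by simp
 then show ?thesis using nat[OF w] nat[of "\<lambda>i. - w i"] by (cases q rule: int_cases2) auto
qed

text \<open>A Hermite-type basis. Since Q x is integral, the vectors vanishing beyond position i
  have a least positive i-th entry, attained by w i; division with remainder by these entries
  reduces any vector to zero. A vector supported below m uses only the first m basis vectors, and
  this is how a sublattice of short vectors becomes a coordinate sublattice.\<close>

lemma triangular_lattice_basis:
 fixes \<Gamma> :: "(nat \<Rightarrow> real) set"
 assumes Q: "Q > (0::nat)" and diff: "\<And>x y. x \<in> \<Gamma> \<Longrightarrow> y \<in> \<Gamma> \<Longrightarrow> (\<lambda>i. x i - y i) \<in> \<Gamma>"
  and int: "\<And>x i. x \<in> \<Gamma> \<Longrightarrow> i < n \<Longrightarrow> of_nat Q * x i \<in> \<int>"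
  and full: "\<And>i. i < n \<Longrightarrow> \<exists>x\<in>\<Gamma>. x i > 0 \<and> (\<forall>j. i < j \<and> j < n \<longrightarrow> x j = 0)"
 obtains w where "\<And>i. i < n \<Longrightarrow> w i \<in> \<Gamma>" "\<And>i. i < n \<Longrightarrow> w i i > 0"
  "\<And>i j. i < j \<Longrightarrow> j < n \<Longrightarrow> w i j = 0"
  "\<And>x m. x \<in> \<Gamma> \<Longrightarrow> m \<le> n \<Longrightarrow> (\<And>j. m \<le> j \<Longrightarrow> j < n \<Longrightarrow> x j = 0) \<Longrightarrow>
   \<exists>e::nat \<Rightarrow> int. (\<forall>i\<ge>m. e i = 0) \<and> (\<forall>l<n. x l = (\<Sum>i<n. e i * w i l))"
proof -
 let ?S = "\<lambda>i x. x \<in> \<Gamma> \<and> x i > 0 \<and> (\<forall>j. i < j \<and> j < n \<longrightarrow> x j = 0)"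
 have "\<forall>i\<in>{..<n}. \<exists>x. ?S i x \<and> (\<forall>y. ?S i y \<longrightarrow> nat \<lfloor>of_nat Q * x i\<rfloor> \<le> nat \<lfloor>of_nat Q * y i\<rfloor>)"
 proof
  fix i assume "i \<in> {..<n}"
  then obtain x where "?S i x" using full by blast
  then show "\<exists>x. ?S i x \<and> (\<forall>y. ?S i y \<longrightarrow> nat \<lfloor>of_nat Q * x i\<rfloor> \<le> nat \<lfloor>of_nat Q * y i\<rfloor>)"
   by (rule ex_has_least_nat[where P = "?S i" and m = "\<lambda>x. nat \<lfloor>of_nat Q * x i\<rfloor>"])
 qed
 from bchoice[OF this] obtain w where
  w0: "\<forall>i\<in>{..<n}. ?S i (w i) \<and> (\<forall>y. ?S i y \<longrightarrow> nat \<lfloor>of_nat Q * w i i\<rfloor> \<le> nat \<lfloor>of_nat Q * y i\<rfloor>)"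
  by (rule exE)
 have w: "w i \<in> \<Gamma>" "w i i > 0" "\<And>j. i < j \<Longrightarrow> j < n \<Longrightarrow> w i j = 0" if "i < n" for i
  using w0 that by auto
 have min: "w i i \<le> y i" if i: "i < n" and y: "?S i y" for i y
 proof -
  have "nat \<lfloor>of_nat Q * w i i\<rfloor> \<le> nat \<lfloor>of_nat Q * y i\<rfloor>" using w0 that by auto
  moreover have "of_nat Q * y i > 0" "of_nat Q * w i i > 0" using y w(2)[OF i] Q by auto
  ultimately have "\<lfloor>of_nat Q * w i i\<rfloor> \<le> \<lfloor>of_nat Q * y i\<rfloor>" by (simp add: nat_le_eq_zle)
  then have "of_nat Q * w i i \<le> of_nat Q * y i"
   using int[OF w(1)[OF i] i] int[of y i] y i by (auto elim!: Ints_cases)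
  then show ?thesis using Q by simp
 qed
 have rep: "\<exists>e::nat \<Rightarrow> int. (\<forall>i\<ge>m. e i = 0) \<and> (\<forall>l<n. x l = (\<Sum>i<n. e i * w i l))"
  if "x \<in> \<Gamma>" "m \<le> n" "\<And>j. m \<le> j \<Longrightarrow> j < n \<Longrightarrow> x j = 0" for x m
  using that
 proof (induction m arbitrary: x)
  case 0
  then show ?case by (intro exI[of _ "\<lambda>_. 0"]) auto
 next
  case (Suc m)
  have m: "m < n" using Suc.prems(2) by simp
  define q where "q = \<lfloor>x m / w m m\<rfloor>"
  define y where "y = (\<lambda>i. x i - of_int q * w m i)"
  have y: "y \<in> \<Gamma>" unfolding y_def by (rule group_int_combination[OF diff Suc.prems(1) w(1)[OF m]])
  have q: "of_int q \<le> x m / w m m" "x m / w m m < of_int q + 1" unfolding q_def by linarith+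
  have ym: "0 \<le> y m" "y m < w m m"
   using q w(2)[OF m] by (auto simp: y_def field_simps)
  have y0: "y j = 0" if "m < j" "j < n" for j
   using Suc.prems(3)[of j] w(3)[OF m, of j] that by (simp add: y_def)
  have "y m = 0"
  proof (rule ccontr)
   assume "y m \<noteq> 0"
   then have "?S m y" using ym y y0 by auto
   then show False using min[OF m] ym by force
  qed
  then have "\<And>j. m \<le> j \<Longrightarrow> j < n \<Longrightarrow> y j = 0" using y0 by (metis le_neq_implies_less)
  from Suc.IH[OF y _ this] m obtain e :: "nat \<Rightarrow> int" where
   e: "\<forall>i\<ge>m. e i = 0" "\<forall>l<n. y l = (\<Sum>i<n. e i * w i l)" by auto
  have "x l = (\<Sum>i<n. (e(m := q)) i * w i l)" if l: "l < n" for l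
  proof -
   have "(\<Sum>i<n. (e(m := q)) i * w i l) = (\<Sum>i<n. e i * w i l + (if i = m then of_int q * w m l else 0))"
    using e(1) by (intro sum.cong) auto
   also have "... = y l + of_int q * w m l" using e(2) l m by (simp add: sum.distrib)
   finally show ?thesis by (simp add: y_def)
  qed
  then show ?case using e(1) by (intro exI[of _ "e(m := q)"]) auto
 qed
 show ?thesis by (rule that[of w]) (use w rep in auto)
qed

text \<open>With c the leading coefficient and n the degree, c^(n-1) times the equation of x is a
  monic integral equation for c x.\<close>

lemma algebraic_imp_multiple_algebraic_int:
 assumes "algebraic (x::'a::field_char_0)"
 obtains n :: nat where "n > 0" "algebraic_int (of_nat n * x)"
proof -
 obtain p where p: "poly (of_int_poly p) x = 0" "p \<noteq> 0"
  using assms by (elim algebraicE') auto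
 define c where "c = lead_coeff p"
 define n where "n = degree p"
 define y where "y = of_int c * x"
 have c: "c \<noteq> 0" using p by (simp add: c_def)
 have n: "n > 0"
 proof (rule ccontr)
  assume "\<not> n > 0"
  then obtain a where "p = [:a:]" unfolding n_def by (metis degree_eq_zeroE gr0I)
  then show False using p by simp
 qed
 define W where "W = (\<lambda>i. y ^ i) ` {..<n}"
 have fin: "finite W" by (simp add: W_def)
 have base: "y ^ i \<in> zspan W" if "i < n" for i
  by (rule zspan_base[OF fin]) (use that in \<open>auto simp: W_def\<close>)
 have "algebraic_int y"
 proof (rule algebraic_int_of_zspan[OF fin, of "y ^ 0"])
  show "y ^ 0 \<in> W" using n by (auto simp: W_def intro!: image_eqI[of _ _ 0])
  fix w assume "w \<in> W"
  then obtain i where i: "i < n" "w = y ^ i" by (auto simp: W_def)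
  show "y * w \<in> zspan W"
  proof (cases "Suc i < n")
   case True
   then show ?thesis using base[of "Suc i"] i by simp
  next
   case False
   then have Suc_i: "Suc i = n" using i by simp
   have "0 = of_int c ^ (n - 1) * (\<Sum>i\<le>n. of_int (coeff p i) * x ^ i)"
    using p(1) by (simp add: poly_altdef n_def)
   also have "... = (\<Sum>i<n. of_int (c ^ (n - 1) * coeff p i) * x ^ i) + of_int c ^ (n - 1) * (of_int c * x ^ n)"
    by (simp add: sum_distrib_left c_def n_def mult_ac ring_distribs flip: lessThan_Suc_atMost)
   also have "of_int c ^ (n - 1) * (of_int c * x ^ n) = y ^ n"
    using n by (simp add: y_def power_mult_distrib flip: mult.assoc power_Suc2)
   also have "(\<Sum>i<n. of_int (c ^ (n - 1) * coeff p i) * x ^ i) = (\<Sum>i<n. of_int (c ^ (n - 1 - i) * coeff p i) * y ^ i)"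
   proof (rule sum.cong[OF refl])
    fix i assume "i \<in> {..<n}"
    then have "c ^ (n - 1) = c ^ (n - 1 - i) * c ^ i" by (simp flip: power_add)
    then show "of_int (c ^ (n - 1) * coeff p i) * x ^ i = of_int (c ^ (n - 1 - i) * coeff p i) * y ^ i"
     by (simp add: y_def power_mult_distrib mult_ac)
   qed
   finally have "y ^ n = (\<Sum>i<n. of_int (- (c ^ (n - 1 - i) * coeff p i)) * y ^ i)"
    by (simp add: sum_negf add_eq_0_iff2 algebra_simps)
   also have "... \<in> zspan W" by (intro zspan_sum zspan_scale base) auto
   finally show ?thesis using i Suc_i by (metis power_Suc)
  qed
 qed auto
 moreover have "of_nat (nat \<bar>c\<bar>) * x = y \<or> of_nat (nat \<bar>c\<bar>) * x = - y"
  unfolding y_def by (cases "c \<ge> 0") (auto simp: of_nat_nat)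
 ultimately have "algebraic_int (of_nat (nat \<bar>c\<bar>) * x)" by auto
 then show ?thesis using c by (intro that[of "nat \<bar>c\<bar>"]) auto
qed

lemma common_denominator:
 fixes c :: "'b \<Rightarrow> rat"
 assumes "finite B"
 obtains N :: nat and e :: "'b \<Rightarrow> int" where "N > 0" "\<And>b. b \<in> B \<Longrightarrow> of_nat N * c b = of_int (e b)"
proof -
 have "\<exists>(N::nat) e. N > 0 \<and> (\<forall>b\<in>B. of_nat N * c b = of_int (e b))"
  using assms
 proof (induction B rule: finite_induct)
  case (insert b B)
  then obtain N :: nat and e where N: "N > 0" "\<forall>b\<in>B. of_nat N * c b = of_int (e b)" by blast
  obtain p q where pq: "c b = of_int p / of_int q" "q > 0"
   by (cases "c b") (auto simp: Fract_of_int_quotient)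
  let ?N = "N * nat q" and ?e = "\<lambda>x. if x = b then int N * p else q * e x"
  have "of_nat ?N * c x = of_int (?e x)" if "x \<in> insert b B" for x
   using that N pq insert.hyps by (auto simp: field_simps)
  then show ?case using N pq by (intro exI[of _ ?N] exI[of _ ?e]) auto
 qed auto
 then show ?thesis using that by blast
qed

section \<open>Integral bases of a number field\<close>

context number_fld
begin

lemma multiple_algebraic_int:
 assumes x: "x \<in> k"
 obtains n :: nat where "n > 0" "algebraic_int (of_nat n * x)"
proof -
 obtain B where B: "finite B" "qindep B" "qspan B = k" by (rule number_field_basis[OF nf])
 obtain p :: "rat poly" where p: "p \<noteq> 0" "poly (map_poly of_rat p) x = 0"
  by (rule rational_annihilator[OF B(1), of x]) (use power_in[OF x] B(3) in auto)
 have "algebraic x"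
  unfolding algebraic_altdef using p by (intro exI[of _ "map_poly of_rat p"]) auto
 then show ?thesis using that by (rule algebraic_imp_multiple_algebraic_int)
qed

lemma int_ring_closed:
 assumes "x \<in> int_ring k" "y \<in> int_ring k"
 shows "x + y \<in> int_ring k" "x - y \<in> int_ring k" "x * y \<in> int_ring k"
 using assms by (auto simp: int_ring_def add_in diff_in mult_in algebraic_int_add_mult algebraic_int_diff)

lemma of_int_int_ring: "of_int a \<in> int_ring k"
 by (simp add: int_ring_def of_int_in algebraic_int_of_int)

lemma int_ring_sum: "(\<And>i. i \<in> I \<Longrightarrow> f i \<in> int_ring k) \<Longrightarrow> sum f I \<in> int_ring k"
 by (auto simp: int_ring_def intro!: sum_in algebraic_int_sum)

lemma integral_qbasis:
 obtains B where "finite B" "qindep B" "qspan B = k" "B \<subseteq> int_ring k"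
proof -
 obtain B where B: "finite B" "qindep B" "qspan B = k" by (rule number_field_basis[OF nf])
 have Bk: "b \<in> k" if "b \<in> B" for b using qspan_base[OF B(1) that] B(3) by simp
 have "\<forall>b\<in>B. \<exists>n::nat. n > 0 \<and> algebraic_int (of_nat n * b)"
  using multiple_algebraic_int[OF Bk] by metis
 from bchoice[OF this] obtain n :: "'a \<Rightarrow> nat" where
  n: "\<forall>b\<in>B. n b > 0 \<and> algebraic_int (of_nat (n b) * b)" by (rule exE)
 let ?W = "(\<lambda>b. of_nat (n b) * b) ` B"
 have W: "finite ?W" "?W \<subseteq> int_ring k" using B(1) n Bk by (auto simp: int_ring_def intro!: mult_in of_nat_in)
 have "B \<subseteq> qspan ?W"
 proof
  fix b assume b: "b \<in> B"
  have "of_rat (1 / of_nat (n b)) * (of_nat (n b) * b) \<in> qspan ?W"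
   using b W by (intro qspan_scale qspan_base) auto
  then show "b \<in> qspan ?W" using n b by (simp add: of_rat_divide)
 qed
 then have "k \<subseteq> qspan ?W" using qspan_subset[OF W(1)] B(3) by blast
 moreover have "qspan ?W \<subseteq> k" by (rule qspan_in) (use W in \<open>auto simp: int_ring_def\<close>)
 ultimately have Wk: "qspan ?W = k" by blast
 obtain B' where B': "B' \<subseteq> ?W" "qindep B'" "qspan B' = qspan ?W"
  by (rule qindep_extend[OF W(1), of "{}"]) (auto simp: qindep_def)
 show ?thesis by (rule that[of B']) (use B' W Wk finite_subset in auto)
qed

definition int_basis :: "(nat \<Rightarrow> 'a) \<Rightarrow> bool" where
 "int_basis \<omega> \<longleftrightarrow> (\<forall>i<d. \<omega> i \<in> int_ring k) \<and>
  (\<forall>x\<in>int_ring k. \<exists>e::nat \<Rightarrow> int. x = (\<Sum>i<d. of_int (e i) * \<omega> i)) \<and>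
  inj_on \<omega> {..<d} \<and> qindep (\<omega> ` {..<d}) \<and> qspan (\<omega> ` {..<d}) = k"

lemma fdet_nonzero_imp_basis:
 assumes s: "is_enum s" and b: "\<And>j. j < d \<Longrightarrow> b j \<in> k" and nz: "fdet d (\<lambda>i j. s i (b j)) \<noteq> 0"
 shows "inj_on b {..<d}" "qindep (b ` {..<d})" "qspan (b ` {..<d}) = k"
proof -
 let ?B = "b ` {..<d}"
 have ind: "c j = 0" if c: "(\<Sum>j<d. of_rat (c j) * b j) = 0" and j: "j < d" for c :: "nat \<Rightarrow> rat" and j
 proof (rule ccontr)
  assume cj: "c j \<noteq> 0"
  have "(\<Sum>j<d. s i (b j) * of_rat (c j)) = 0" if i: "i < d" for i
  proof -
   interpret embedding k "s i" by (rule emb[OF enum_in[OF s i]])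
   have "s i (\<Sum>j<d. of_rat (c j) * b j) = (\<Sum>j<d. of_rat (c j) * s i (b j))"
    using b by (subst sum) (auto simp: mult of_rat of_rat_in intro: mult_in)
   then show ?thesis using c by (simp add: mult.commute)
  qed
  then have "fdet d (\<lambda>i j. s i (b j)) = 0" unfolding fdet_eq_0_iff
   using cj j by (intro exI[of _ "\<lambda>j. of_rat (c j)"]) auto
  then show False using nz by simp
 qed
 show inj: "inj_on b {..<d}"
 proof
  fix i j assume ij: "i \<in> {..<d}" "j \<in> {..<d}" "b i = b j"
  have "(if i = i then 1 else 0) - (if i = j then 1 else 0) = (0::rat)"
   by (rule ind[of "\<lambda>l. (if l = i then 1 else 0) - (if l = j then 1 else 0)"])
    (use ij in \<open>simp_all add: of_rat_diff left_diff_distrib sum_subtractf if_distrib[of of_rat] if_distrib[of "\<lambda>x. x * _"] cong: if_cong\<close>)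
  then show "i = j" by (simp split: if_splits)
 qed
 show q: "qindep ?B" unfolding qindep_def
 proof (intro allI impI)
  fix c assume "(\<Sum>v\<in>?B. of_rat (c v) * v) = 0"
  then have "(\<Sum>j<d. of_rat (c (b j)) * b j) = 0" by (simp add: sum.reindex[OF inj])
  then show "\<forall>v\<in>?B. c v = 0" using ind[of "\<lambda>j. c (b j)"] by blast
 qed
 have B: "finite ?B" "?B \<subseteq> k" using b by auto
 have "x \<in> qspan ?B" if x: "x \<in> k" for x
 proof (rule ccontr)
  assume n: "x \<notin> qspan ?B"
  then have "x \<notin> ?B" using qspan_base[OF B(1)] by blast
  moreover have "card (insert x ?B) \<le> d"
   using B x by (intro qindep_card_le_d qindep_insert[OF B(1) q n]) auto
  ultimately show False using card_image[OF inj] B(1) by simp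
 qed
 then show "qspan ?B = k" using qspan_in[OF B(2)] by blast
qed

text \<open>The square is the determinant of the trace form, whose entries are traces of algebraic
  integers.\<close>

lemma disc_in_Ints:
 assumes s: "is_enum s" and b: "\<And>j. j < d \<Longrightarrow> b j \<in> int_ring k"
 obtains D :: int where "(fdet d (\<lambda>i j. s i (b j)))\<^sup>2 = of_int D"
proof -
 have "\<exists>t::int. i < d \<longrightarrow> j < d \<longrightarrow> (\<Sum>l<d. s l (b i) * s l (b j)) = of_int t" for i j
 proof (cases "i < d \<and> j < d")
  case True
  then have bk: "b i \<in> k" "b j \<in> k" "b i * b j \<in> int_ring k" using b int_ring_closed by (auto simp: int_ring_def)
  have "(\<Sum>l<d. s l (b i) * s l (b j)) = (\<Sum>\<sigma>\<in>E. \<sigma> (b i * b j))"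
   unfolding enum_sum[OF s, of "\<lambda>\<sigma>. \<sigma> (b i) * \<sigma> (b j)"] by (rule sum.cong) (auto simp: embedding.mult[OF emb] bk)
  also have "... \<in> \<int>" using bk(3) by (intro trace_in_Ints) (auto simp: int_ring_def)
  finally show ?thesis by (auto elim: Ints_cases)
 qed auto
 then obtain g :: "nat \<Rightarrow> nat \<Rightarrow> int" where
  g: "\<And>i j. i < d \<Longrightarrow> j < d \<Longrightarrow> (\<Sum>l<d. s l (b i) * s l (b j)) = of_int (g i j)" by metis
 have tr: "fdet d (\<lambda>i l. s l (b i)) = fdet d (\<lambda>i j. s i (b j))" by (rule fdet_transpose)
 have "(fdet d (\<lambda>i j. s i (b j)))\<^sup>2 = fdet d (\<lambda>i l. s l (b i)) * fdet d (\<lambda>l j. s l (b j))"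
  by (simp only: tr power2_eq_square)
 also have "... = fdet d (\<lambda>i j. \<Sum>l<d. s l (b i) * s l (b j))" by (rule fdet_mult[symmetric])
 also have "... = fdet d (\<lambda>i j. of_int (g i j))" by (rule fdet_cong) (rule g)
 also have "... = of_int (fdet d g)" by (rule fdet_of_hom) (rule of_int_hom.comm_ring_hom_axioms)
 finally show ?thesis by (rule that)
qed

text \<open>An integral basis of the field whose discriminant is minimal generates the ring of integers:
 a fractional coordinate would allow to decrease the discriminant.\<close>

lemma int_basis_exists: "\<exists>\<omega>. int_basis \<omega>"
proof -
 obtain s where s: "is_enum s" using enum_exists by blast
 let ?f = "\<lambda>b. fdet d (\<lambda>i j. s i (b j))"
 let ?P = "\<lambda>b. (\<forall>j<d. b j \<in> int_ring k) \<and> ?f b \<noteq> 0"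
 obtain B where B: "finite B" "qindep B" "qspan B = k" "B \<subseteq> int_ring k" by (rule integral_qbasis)
 obtain b0 where b0: "bij_betw b0 {..<d} B" by (rule enum_basis[OF B(1-3)])
 have "?f b0 \<noteq> 0" using b0 B by (intro fdet_embeddings_nonzero[OF s]) (auto simp: bij_betw_def)
 moreover have "\<forall>j<d. b0 j \<in> int_ring k" using b0 B(4) by (auto simp: bij_betw_def)
 ultimately have "?P b0" by blast
 from ex_has_least_nat[where P = ?P and m = "\<lambda>b. nat \<lfloor>(cmod (?f b))\<^sup>2\<rfloor>", OF this]
 obtain \<omega> where w: "?P \<omega>" and min: "\<forall>b. ?P b \<longrightarrow> nat \<lfloor>(cmod (?f \<omega>))\<^sup>2\<rfloor> \<le> nat \<lfloor>(cmod (?f b))\<^sup>2\<rfloor>" by blast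
 have wk: "\<omega> j \<in> k" if "j < d" for j using w that by (auto simp: int_ring_def)
 note basis = fdet_nonzero_imp_basis[OF s wk conjunct2[OF w]]
 have int: "\<exists>D::int. (cmod (?f b))\<^sup>2 = of_int D" if "?P b" for b
 proof -
  from disc_in_Ints[OF s, of b] that obtain D :: int where "(?f b)\<^sup>2 = of_int D" by blast
  then have "(cmod (?f b))\<^sup>2 = of_int \<bar>D\<bar>" by (metis norm_of_int norm_power of_int_abs)
  then show ?thesis by blast
 qed
 have "\<exists>e::nat \<Rightarrow> int. x = (\<Sum>i<d. of_int (e i) * \<omega> i)" if x: "x \<in> int_ring k" for x
 proof -
  have "x \<in> qspan (\<omega> ` {..<d})" using x basis(3) by (simp add: int_ring_def)
  then obtain c0 where "x = (\<Sum>v\<in>\<omega> ` {..<d}. of_rat (c0 v) * v)" by (auto simp: qspan_def)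
  then obtain c where c: "x = (\<Sum>i<d. of_rat (c i) * \<omega> i)" by (auto simp: sum.reindex[OF basis(1)])
  have "c j \<in> \<int>" if j: "j < d" for j
  proof (rule ccontr)
   assume "c j \<notin> \<int>"
   then have fr: "0 < frac (c j)" "frac (c j) < 1" by (auto simp: frac_lt_1)
   define b where "b = \<omega> (j := x - of_int \<lfloor>c j\<rfloor> * \<omega> j)"
   define c' where "c' = c(j := frac (c j))"
   have bi: "\<forall>i<d. b i \<in> int_ring k"
    using w x j by (auto simp: b_def intro!: int_ring_closed of_int_int_ring)
   have xc: "x - of_int \<lfloor>c j\<rfloor> * \<omega> j = (\<Sum>m<d. of_rat (c' m) * \<omega> m)"
   proof -
    have "(\<Sum>m<d. of_rat (c' m) * \<omega> m) = (\<Sum>m<d. of_rat (c m) * \<omega> m - (if m = j then of_int \<lfloor>c j\<rfloor> * \<omega> j else 0))"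
     by (rule sum.cong) (auto simp: c'_def frac_def of_rat_diff left_diff_distrib)
    then show ?thesis using c j by (simp add: sum_subtractf)
   qed
   have "?f b = fdet d (\<lambda>i l. if l = j then \<Sum>m<d. s i (\<omega> m) * of_rat (c' m) else s i (\<omega> l))"
   proof (rule fdet_cong)
    fix i l assume "i < d"
    then interpret embedding k "s i" by (intro emb enum_in[OF s])
    have "s i (\<Sum>m<d. of_rat (c' m) * \<omega> m) = (\<Sum>m<d. s i (\<omega> m) * of_rat (c' m))"
     using wk by (subst sum) (auto simp: mult of_rat of_rat_in mult.commute intro: mult_in)
    then show "s i (b l) = (if l = j then \<Sum>m<d. s i (\<omega> m) * of_rat (c' m) else s i (\<omega> l))"
     by (simp add: b_def xc)
   qed
   also have "... = of_rat (c' j) * ?f \<omega>" by (rule fdet_replace_column[OF j])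
   finally have fb: "?f b = of_rat (frac (c j)) * ?f \<omega>" by (simp add: c'_def)
   then have P: "?P b" using fr w bi by simp
   define z where "z = real_of_rat (frac (c j))"
   have z: "0 < z" "z < 1" using fr by (auto simp: z_def)
   have "(of_rat (frac (c j)) :: complex) = of_real z"
    unfolding z_def by (cases "frac (c j)") (simp add: of_rat_rat)
   then have "(cmod (?f b))\<^sup>2 = z\<^sup>2 * (cmod (?f \<omega>))\<^sup>2" unfolding fb using z by (simp add: norm_mult power_mult_distrib)
   moreover have "z\<^sup>2 < 1" using z by (simp add: power_less_one_iff)
   ultimately have "(cmod (?f b))\<^sup>2 < (cmod (?f \<omega>))\<^sup>2" using w by (simp add: mult_less_cancel_right1)
   moreover obtain D1 D2 :: int where "(cmod (?f b))\<^sup>2 = of_int D1" "(cmod (?f \<omega>))\<^sup>2 = of_int D2" using int P w by blast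
   moreover have "(cmod (?f b))\<^sup>2 \<ge> 0" by simp
   ultimately have "nat \<lfloor>(cmod (?f b))\<^sup>2\<rfloor> < nat \<lfloor>(cmod (?f \<omega>))\<^sup>2\<rfloor>" by simp
   then show False using min[rule_format, OF P] by (meson leD)
  qed
  then have "\<forall>j. \<exists>e::int. j < d \<longrightarrow> c j = of_int e" by (metis Ints_cases)
  then obtain e :: "nat \<Rightarrow> int" where "\<forall>j<d. c j = of_int (e j)" by metis
  then show ?thesis using c by (intro exI[of _ e]) simp
 qed
 then have "int_basis \<omega>" unfolding int_basis_def using w basis by blast
 then show ?thesis by blast
qed

end

section \<open>Hadamard's inequality for bounded entries\<close>

lemma complex_cmod_square: "(complex_of_real (cmod z))\<^sup>2 = z * cnj z"
 using complex_norm_square[of z] by simp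

text \<open>Let H be A times its conjugate transpose. Its eigenvalues are nonnegative, their product
  is the squared absolute value of det A, and their sum is the trace of H, at most n^2. The
  inequality of the means gives n^n; this bound is the source of \<gamma> = d^(-d).\<close>

lemma fdet_hadamard:
 fixes A :: "nat \<Rightarrow> nat \<Rightarrow> complex"
 assumes le1: "\<And>i j. i < n \<Longrightarrow> j < n \<Longrightarrow> cmod (A i j) \<le> 1"
 shows "(cmod (fdet n A))\<^sup>2 \<le> real n ^ n"
proof (cases "n = 0")
 case True
 then show ?thesis by (simp add: fdet_def)
next
 case False
 define h where "h i j = (\<Sum>l<n. A i l * cnj (A j l))" for i j
 define H where "H = Matrix.mat n n (\<lambda>(i, j). h i j)"
 have H: "H \<in> carrier_mat n n" by (simp add: H_def)
 have "fdet n h = fdet n A * fdet n (\<lambda>l j. cnj (A j l))"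
  unfolding h_def by (rule fdet_mult)
 also have "fdet n (\<lambda>l j. cnj (A j l)) = fdet n (\<lambda>j l. cnj (A j l))" by (rule fdet_transpose)
 also have "... = cnj (fdet n A)"
  by (rule fdet_of_hom) (unfold_locales, auto)
 finally have det: "Determinant.det H = of_real ((cmod (fdet n A))\<^sup>2)"
  by (simp add: fdet_def[of n h] H_def complex_cmod_square)
 obtain es where es: "char_poly H = (\<Prod>a\<leftarrow>es. [:- a, 1:])" "length es = n"
  using char_poly_factorized[OF H] by blast
 obtain B P Q where BPQ: "schur_decomposition H es = (B, P, Q)" by (metis prod_cases3)
 have wit: "similar_mat_wit H B P Q" and ut: "upper_triangular B" and diag: "diag_mat B = es"
  using schur_decomposition[OF H es(1) BPQ] by auto
 note PQ = similar_mat_witD2[OF H wit]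
 have B: "B \<in> carrier_mat n n" and P: "P \<in> carrier_mat n n" and Q: "Q \<in> carrier_mat n n"
  using PQ by auto
 have detB: "Determinant.det H = prod_list es"
  using det_similar[of H B] det_upper_triangular[OF ut B] wit diag unfolding similar_mat_def by auto
 have tr: "(\<Sum>i<n. h i i) = sum_list es"
 proof -
  have Hij: "h i i = (\<Sum>l<n. \<Sum>m<n. B $$ (l, m) * (Q $$ (m, i) * P $$ (i, l)))" if i: "i < n" for i
  proof -
   have "h i i = H $$ (i, i)" using i by (simp add: H_def)
   also have "... = (P * B * Q) $$ (i, i)" by (rule arg_cong[OF PQ(3)])
   also have "... = (\<Sum>l<n. P $$ (i, l) * (\<Sum>m<n. B $$ (l, m) * Q $$ (m, i)))"
    using i B P Q by (simp add: scalar_prod_def atLeast0LessThan)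
   also have "... = (\<Sum>l<n. \<Sum>m<n. B $$ (l, m) * (Q $$ (m, i) * P $$ (i, l)))"
    unfolding sum_distrib_left by (simp add: mult_ac)
   finally show ?thesis .
  qed
  have QP: "(\<Sum>i<n. Q $$ (m, i) * P $$ (i, l)) = (if m = l then 1 else 0)" if "l < n" "m < n" for l m
  proof -
   have "(Q * P) $$ (m, l) = (1\<^sub>m n) $$ (m, l)" using PQ(2) by simp
   then show ?thesis using that P Q by (simp add: scalar_prod_def atLeast0LessThan)
  qed
  have "(\<Sum>i<n. h i i) = (\<Sum>i<n. \<Sum>l<n. \<Sum>m<n. B $$ (l, m) * (Q $$ (m, i) * P $$ (i, l)))"
   using Hij by simp
  also have "... = (\<Sum>l<n. \<Sum>m<n. \<Sum>i<n. B $$ (l, m) * (Q $$ (m, i) * P $$ (i, l)))"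
   by (subst sum.swap) (intro sum.cong refl sum.swap)
  also have "... = (\<Sum>l<n. \<Sum>m<n. B $$ (l, m) * (if m = l then 1 else 0))"
   using QP by (simp flip: sum_distrib_left)
  also have "... = (\<Sum>l<n. B $$ (l, l))" by (simp add: if_distrib cong: if_cong)
  also have "... = sum_list es"
   unfolding diag[symmetric] diag_mat_def using B by (simp add: interv_sum_list_conv_sum_set_nat atLeast0LessThan)
  finally show ?thesis .
 qed
 \<comment> \<open>For an eigenvector x, the number e |x|^2 equals the squared length of the
   conjugate transpose of A applied to x.\<close>
 have nonneg: "\<exists>t\<ge>0. e = of_real t" if e: "e \<in> set es" for e
 proof -
  have "poly (char_poly H) e = 0" unfolding es(1) using e by (simp add: poly_prod_list o_def prod_list_zero_iff)
  then have "eigenvalue H e" using eigenvalue_root_char_poly[OF H] by simp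
  then obtain v where v: "v \<in> carrier_vec n" "v \<noteq> 0\<^sub>v n" "H *\<^sub>v v = e \<cdot>\<^sub>v v"
   unfolding eigenvalue_def eigenvector_def using H by auto
  define x where "x = vec_index v"
  have hx: "(\<Sum>j<n. h i j * x j) = e * x i" if "i < n" for i
  proof -
   have "vec_index (H *\<^sub>v v) i = vec_index (e \<cdot>\<^sub>v v) i" using v(3) by simp
   then show ?thesis using that v(1) by (simp add: H_def x_def scalar_prod_def atLeast0LessThan)
  qed
  obtain j where j: "j < n" "x j \<noteq> 0"
  proof (rule ccontr)
   assume "\<not> thesis"
   then have "v = 0\<^sub>v n" using v(1) that by (intro eq_vecI) (auto simp: x_def)
   then show False using v(2) by blast
  qed
  define u where "u l = (\<Sum>j<n. cnj (A j l) * x j)" for l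
  have "e * of_real (\<Sum>i<n. (cmod (x i))\<^sup>2) = (\<Sum>i<n. cnj (x i) * (e * x i))"
   by (simp add: sum_distrib_left complex_cmod_square mult_ac)
  also have "... = (\<Sum>i<n. cnj (x i) * (\<Sum>j<n. h i j * x j))" using hx by simp
  also have "... = (\<Sum>i<n. \<Sum>j<n. \<Sum>l<n. cnj (x i) * A i l * (cnj (A j l) * x j))"
   unfolding h_def by (simp add: sum_distrib_left sum_distrib_right mult_ac)
  also have "... = (\<Sum>i<n. \<Sum>l<n. \<Sum>j<n. cnj (x i) * A i l * (cnj (A j l) * x j))"
   by (intro sum.cong refl sum.swap)
  also have "... = (\<Sum>l<n. \<Sum>i<n. \<Sum>j<n. cnj (x i) * A i l * (cnj (A j l) * x j))" by (rule sum.swap)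
  also have "... = (\<Sum>l<n. cnj (u l) * u l)"
   unfolding u_def cnj_sum sum_product by (simp add: mult_ac)
  also have "... = of_real (\<Sum>l<n. (cmod (u l))\<^sup>2)" by (simp add: complex_cmod_square mult.commute)
  finally have eq: "e * of_real (\<Sum>i<n. (cmod (x i))\<^sup>2) = of_real (\<Sum>l<n. (cmod (u l))\<^sup>2)" .
  have pos: "(\<Sum>i<n. (cmod (x i))\<^sup>2) > 0" using j by (intro sum_pos2[of _ j]) auto
  have "e = of_real (\<Sum>l<n. (cmod (u l))\<^sup>2) / of_real (\<Sum>i<n. (cmod (x i))\<^sup>2)"
   using eq pos by (simp add: eq_divide_eq del: of_real_sum)
  then have "e = of_real ((\<Sum>l<n. (cmod (u l))\<^sup>2) / (\<Sum>i<n. (cmod (x i))\<^sup>2))" by simp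
  then show ?thesis using pos by (intro exI[of _ "(\<Sum>l<n. (cmod (u l))\<^sup>2) / (\<Sum>i<n. (cmod (x i))\<^sup>2)"]) (auto intro!: divide_nonneg_pos sum_nonneg)
 qed
 define t where "t i = Re (es ! i)" for i
 have t: "t i \<ge> 0" "es ! i = of_real (t i)" if "i < n" for i
  using nonneg[of "es ! i"] that es(2) by (auto simp: t_def)
 have "of_real ((cmod (fdet n A))\<^sup>2) = prod_list es" using det detB by simp
 also have "... = (\<Prod>i<n. es ! i)" using es(2) by (metis atLeast0LessThan prod.list_conv_set_nth)
 also have "... = of_real (\<Prod>i<n. t i)" using t by simp
 finally have prod: "(cmod (fdet n A))\<^sup>2 = (\<Prod>i<n. t i)" by (simp only: of_real_eq_iff)
 have "of_real (\<Sum>i<n. t i) = (\<Sum>i<n. es ! i)" using t by simp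
 also have "... = (\<Sum>i<n. h i i)" using tr es(2) by (metis atLeast0LessThan sum.list_conv_set_nth)
 also have "... = of_real (\<Sum>i<n. \<Sum>l<n. (cmod (A i l))\<^sup>2)" by (simp add: h_def complex_cmod_square)
 finally have "(\<Sum>i<n. t i) = (\<Sum>i<n. \<Sum>l<n. (cmod (A i l))\<^sup>2)" by (simp only: of_real_eq_iff)
 also have "... \<le> (\<Sum>i<n. \<Sum>l<n. 1)" using le1 by (intro sum_mono) (auto simp: power_le_one)
 finally have sum: "(\<Sum>i<n. t i) \<le> real n * real n" by simp
 \<comment> \<open>The inequality of the means in the form z <= exp (z - 1): the exponents add up to
   at most zero.\<close>
 have "(\<Prod>i<n. t i / n) \<le> (\<Prod>i<n. exp (t i / n - 1))"
  using t exp_ge_add_one_self[of "t i / n - 1" for i] by (intro prod_mono) auto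
 also have "... = exp ((\<Sum>i<n. t i) / n - n)"
  by (simp add: sum_subtractf sum_divide_distrib flip: exp_sum)
 also have "... \<le> 1" using sum False by (simp add: divide_le_eq)
 finally have "(\<Prod>i<n. t i) \<le> real n ^ n" using False by (simp add: prod_dividef divide_le_eq)
 then show ?thesis by (simp add: prod)
qed

section \<open>The field discriminant as a minimum over families of integers\<close>

context number_fld
begin

text \<open>A rational relation becomes an integral one after clearing denominators, so uniqueness
  of integral coordinates gives independence over the rationals; spanning holds because every
  element has an integral multiple.\<close>

lemma is_basis_Ints_imp:
 assumes "is_basis \<int> (int_ring k) B"
 shows "finite B" "B \<subseteq> int_ring k" "qindep B" "qspan B = k"
  "\<And>x. x \<in> int_ring k \<Longrightarrow> \<exists>e::'a \<Rightarrow> int. x = (\<Sum>b\<in>B. of_int (e b) * b)"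
proof -
 show fin: "finite B" and BO: "B \<subseteq> int_ring k" using assms unfolding is_basis_def by auto
 show ex: "\<exists>e::'a \<Rightarrow> int. x = (\<Sum>b\<in>B. of_int (e b) * b)" if x: "x \<in> int_ring k" for x
 proof -
  obtain c where c: "c \<in> B \<rightarrow>\<^sub>E \<int>" "x = (\<Sum>b\<in>B. c b * b)"
   using assms x unfolding is_basis_def by blast
  then have "\<forall>b\<in>B. \<exists>q. c b = of_int q" by (auto simp: Ints_def PiE_iff)
  from bchoice[OF this] obtain q where "\<forall>b\<in>B. c b = of_int (q b)" by (rule exE)
  then have "x = (\<Sum>b\<in>B. of_int (q b) * b)" using c(2) by simp
  then show ?thesis by blast
 qed
 have uniq: "c = c'" if "c \<in> B \<rightarrow>\<^sub>E \<int>" "c' \<in> B \<rightarrow>\<^sub>E \<int>" "(\<Sum>b\<in>B. c b * b) = (\<Sum>b\<in>B. c' b * b)"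
  "(\<Sum>b\<in>B. c b * b) \<in> int_ring k" for c c'
  using assms that unfolding is_basis_def by blast
 show "qindep B"
  unfolding qindep_def
 proof (intro allI impI ballI)
  fix c b assume c: "(\<Sum>b\<in>B. of_rat (c b) * b) = 0" "b \<in> B"
  obtain N :: nat and e where Ne: "N > 0" "\<And>b. b \<in> B \<Longrightarrow> of_nat N * c b = of_int (e b)"
   using common_denominator[OF fin, of c] by metis
  have ofe: "(of_int (e b) :: 'a) = of_nat N * of_rat (c b)" if "b \<in> B" for b
  proof -
   have "(of_rat (of_nat N * c b) :: 'a) = of_rat (of_int (e b))" using Ne(2)[OF that] by simp
   then show ?thesis by (simp add: of_rat_mult)
  qed
  have "(\<lambda>b\<in>B. of_int (e b)) = (\<lambda>b\<in>B. 0::'a)"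
  proof (rule uniq)
   have "(\<Sum>b\<in>B. (\<lambda>b\<in>B. of_int (e b)) b * b) = of_nat N * (\<Sum>b\<in>B. of_rat (c b) * b)"
    unfolding sum_distrib_left by (rule sum.cong) (auto simp: ofe mult_ac)
   then have *: "(\<Sum>b\<in>B. (\<lambda>b\<in>B. of_int (e b)) b * b) = 0" using c(1) by simp
   show "(\<Sum>b\<in>B. (\<lambda>b\<in>B. of_int (e b)) b * b) \<in> int_ring k"
    unfolding * using of_int_int_ring[of 0] by simp
   show "(\<Sum>b\<in>B. (\<lambda>b\<in>B. of_int (e b)) b * b) = (\<Sum>b\<in>B. (\<lambda>b\<in>B. 0) b * b)" unfolding * by simp
  qed auto
  then have "(\<lambda>b\<in>B. of_int (e b)) b = (\<lambda>b\<in>B. 0::'a) b" by simp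
  then have "e b = 0" using c(2) by simp
  then show "c b = 0" using Ne c(2) by force
 qed
 show "qspan B = k"
 proof
  show "qspan B \<subseteq> k" by (rule qspan_in) (use BO in \<open>auto simp: int_ring_def\<close>)
  show "k \<subseteq> qspan B"
  proof
   fix x assume x: "x \<in> k"
   obtain n :: nat where n: "n > 0" "algebraic_int (of_nat n * x)" by (rule multiple_algebraic_int[OF x])
   obtain e :: "'a \<Rightarrow> int" where e: "of_nat n * x = (\<Sum>b\<in>B. of_int (e b) * b)"
    using ex[of "of_nat n * x"] n x by (auto simp: int_ring_def mult_in of_nat_in)
   have "of_rat (1 / of_nat n) * (\<Sum>b\<in>B. of_rat (of_int (e b)) * b) \<in> qspan B"
    using fin by (intro qspan_scale qspan_sum qspan_base) auto
   also have "(\<Sum>b\<in>B. of_rat (of_int (e b)) * b) = of_nat n * x" using e by simp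
   also have "of_rat (1 / of_nat n) * (of_nat n * x) = x" using n by (simp add: of_rat_divide)
   finally show "x \<in> qspan B" .
  qed
 qed
qed

lemma int_basis_imp_is_basis:
 assumes "int_basis \<omega>"
 shows "is_basis \<int> (int_ring k) (\<omega> ` {..<d})"
 unfolding is_basis_def
proof (intro conjI ballI ex_ex1I)
 let ?B = "\<omega> ` {..<d}"
 show "finite ?B" "?B \<subseteq> int_ring k" using assms by (auto simp: int_basis_def)
 have inj: "inj_on \<omega> {..<d}" and ind: "qindep ?B" using assms by (auto simp: int_basis_def)
 {
  fix x assume "x \<in> int_ring k"
  then obtain e :: "nat \<Rightarrow> int" where e: "x = (\<Sum>i<d. of_int (e i) * \<omega> i)"
   using assms by (auto simp: int_basis_def)
  let ?c = "\<lambda>b\<in>?B. of_int (e (inv_into {..<d} \<omega> b))"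
  have "(\<Sum>b\<in>?B. ?c b * b) = (\<Sum>i<d. ?c (\<omega> i) * \<omega> i)" by (simp add: sum.reindex[OF inj])
  also have "... = x" unfolding e by (rule sum.cong) (auto simp: inv_into_f_f[OF inj])
  finally show "\<exists>c. c \<in> ?B \<rightarrow>\<^sub>E \<int> \<and> x = (\<Sum>b\<in>?B. c b * b)" by (intro exI[of _ ?c]) auto
 next
  fix x c c' assume c: "c \<in> ?B \<rightarrow>\<^sub>E \<int> \<and> x = (\<Sum>b\<in>?B. c b * b)" "c' \<in> ?B \<rightarrow>\<^sub>E \<int> \<and> x = (\<Sum>b\<in>?B. c' b * b)"
  have "\<forall>b\<in>?B. \<exists>q. c b = of_rat (of_int q)" using c by (auto simp: Ints_def PiE_iff)
  from bchoice[OF this] obtain q where q: "\<forall>b\<in>?B. c b = of_rat (of_int (q b))" by (rule exE)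
  have "\<forall>b\<in>?B. \<exists>q. c' b = of_rat (of_int q)" using c by (auto simp: Ints_def PiE_iff)
  from bchoice[OF this] obtain q' where q': "\<forall>b\<in>?B. c' b = of_rat (of_int (q' b))" by (rule exE)
  have "rat_of_int (q b) = rat_of_int (q' b)" if "b \<in> ?B" for b
   by (rule qindep_unique[OF ind _ that]) (use c q q' in auto)
  then show "c = c'" using c q q' by (intro PiE_ext[of _ ?B "\<lambda>_. \<int>"]) auto
 }
qed

text \<open>Any family of integers is an integral matrix times the chosen basis, so its determinant
  differs by an integer factor, which is nonzero here. The enumeration \<open>s\<close> is an output
  because it is the one picked by \<open>SOME\<close> inside \<open>field_disc\<close>.\<close>

lemma field_disc_minimal:
 obtains s where "is_enum s"
  "\<And>y. (\<And>j. j < d \<Longrightarrow> y j \<in> int_ring k) \<Longrightarrow> fdet d (\<lambda>i j. s i (y j)) \<noteq> 0 \<Longrightarrow>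
   cmod (field_disc k) \<le> (cmod (fdet d (\<lambda>i j. s i (y j))))\<^sup>2"
proof -
 define bs where "bs = (SOME bs. distinct bs \<and> is_basis \<int> (int_ring k) (set bs))"
 define ss where "ss = (SOME ss. distinct ss \<and> set ss = E)"
 obtain \<omega> where \<omega>: "int_basis \<omega>" using int_basis_exists by blast
 have bs: "distinct bs \<and> is_basis \<int> (int_ring k) (set bs)"
  unfolding bs_def
 proof (rule someI_ex, rule exI[of _ "map \<omega> [0..<d]"])
  show "distinct (map \<omega> [0..<d]) \<and> is_basis \<int> (int_ring k) (set (map \<omega> [0..<d]))"
   using \<omega> int_basis_imp_is_basis[OF \<omega>] by (auto simp: int_basis_def distinct_map atLeast0LessThan)
 qed
 have ss: "distinct ss \<and> set ss = E"
  unfolding ss_def by (rule someI_ex) (use finite_distinct_list[OF finite_E] in blast)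
 note B = is_basis_Ints_imp[OF conjunct2[OF bs]]
 have len: "length bs = d" using basis_card[OF B(1,3,4)] bs distinct_card by metis
 have lens: "length ss = d" using ss distinct_card[of ss] by (simp add: d_def)
 have s: "is_enum (\<lambda>i. ss ! i)"
  unfolding is_enum_def using bij_betw_nth[of ss "{..<d}" E] ss lens by auto
 have D: "field_disc k = (fdet d (\<lambda>i j. (ss ! i) (bs ! j)))\<^sup>2"
  unfolding field_disc_def Let_def fdet_def bs_def[symmetric] ss_def[symmetric] len by simp
 have "cmod (field_disc k) \<le> (cmod (fdet d (\<lambda>i j. (ss ! i) (y j))))\<^sup>2"
  if y: "\<And>j. j < d \<Longrightarrow> y j \<in> int_ring k" and nz: "fdet d (\<lambda>i j. (ss ! i) (y j)) \<noteq> 0" for y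
 proof -
  have "\<forall>j\<in>{..<d}. \<exists>e::'a \<Rightarrow> int. y j = (\<Sum>b\<in>set bs. of_int (e b) * b)" using B(5) y by auto
  from bchoice[OF this] obtain e :: "nat \<Rightarrow> 'a \<Rightarrow> int" where
   e: "\<forall>j\<in>{..<d}. y j = (\<Sum>b\<in>set bs. of_int (e j b) * b)" by (rule exE)
  have bk: "bs ! l \<in> k" if "l < d" for l
  proof -
   have "bs ! l \<in> set bs" using len that by simp
   then show ?thesis using B(2) by (auto simp: int_ring_def)
  qed
  have y': "y j = (\<Sum>l<d. of_int (e j (bs ! l)) * bs ! l)" if "j < d" for j
   using e that bs len sum.reindex_bij_betw[OF bij_betw_nth[of bs "{..<d}" "set bs"], of "\<lambda>b. of_int (e j b) * b"]
   by auto
  have "fdet d (\<lambda>i j. (ss ! i) (y j)) = fdet d (\<lambda>i j. \<Sum>l<d. (ss ! i) (bs ! l) * of_int (e j (bs ! l)))"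
  proof (rule fdet_cong)
   fix i j assume ij: "i < d" "j < d"
   interpret embedding k "ss ! i" by (rule emb[OF enum_in[OF s ij(1)]])
   show "(ss ! i) (y j) = (\<Sum>l<d. (ss ! i) (bs ! l) * of_int (e j (bs ! l)))"
    unfolding y'[OF ij(2)] by (subst sum) (auto simp: mult of_int bk mult_in of_int_in mult.commute)
  qed
  also have "... = fdet d (\<lambda>i j. (ss ! i) (bs ! j)) * fdet d (\<lambda>l j. of_int (e j (bs ! l)))" by (rule fdet_mult)
  also have "fdet d (\<lambda>l j. of_int (e j (bs ! l)) :: complex) = of_int (fdet d (\<lambda>l j. e j (bs ! l)))"
   by (rule fdet_of_hom) (rule of_int_hom.comm_ring_hom_axioms)
  finally have eq: "fdet d (\<lambda>i j. (ss ! i) (y j)) = fdet d (\<lambda>i j. (ss ! i) (bs ! j)) * of_int (fdet d (\<lambda>l j. e j (bs ! l)))" .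
  then have "fdet d (\<lambda>l j. e j (bs ! l)) \<noteq> 0" using nz by auto
  then have "cmod (of_int (fdet d (\<lambda>l j. e j (bs ! l)))) \<ge> 1" by (simp only: norm_of_int)
  then have "cmod (fdet d (\<lambda>i j. (ss ! i) (bs ! j))) \<le> cmod (fdet d (\<lambda>i j. (ss ! i) (y j)))"
   using mult_left_mono[OF _ norm_ge_zero[of "fdet d (\<lambda>i j. (ss ! i) (bs ! j))"], of 1] unfolding eq norm_mult by simp
  then show ?thesis unfolding D by (simp add: norm_power power_mono)
 qed
 then show ?thesis by (rule that[OF s])
qed

end

section \<open>The discriminant of a field generated by elements of small height\<close>

text \<open>The exponents run through a box, so that under each embedding one product, of the
  factors max 1 |y i| raised to \<open>e i\<close>, bounds all these monomials at once.\<close>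

definition box_monomials :: "'i set \<Rightarrow> ('i \<Rightarrow> 'a::field_char_0) \<Rightarrow> ('i \<Rightarrow> nat) \<Rightarrow> 'a set" where
 "box_monomials I y e = {\<Prod>i\<in>I. y i ^ a i | a. \<forall>i\<in>I. a i \<le> e i}"

lemma finite_box_monomials:
 assumes "finite I"
 shows "finite (box_monomials I y e)"
proof -
 have "box_monomials I y e \<subseteq> (\<lambda>a. \<Prod>i\<in>I. y i ^ a i) ` (PiE I (\<lambda>i. {..e i}))"
 proof
  fix x assume "x \<in> box_monomials I y e"
  then obtain a where a: "\<forall>i\<in>I. a i \<le> e i" "x = (\<Prod>i\<in>I. y i ^ a i)" unfolding box_monomials_def by auto
  then have "x = (\<Prod>i\<in>I. y i ^ restrict a I i)" by simp
  moreover have "restrict a I \<in> PiE I (\<lambda>i. {..e i})" using a by auto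
  ultimately show "x \<in> (\<lambda>a. \<Prod>i\<in>I. y i ^ a i) ` (PiE I (\<lambda>i. {..e i}))" by blast
 qed
 then show ?thesis by (rule finite_subset) (use assms in \<open>auto intro!: finite_PiE\<close>)
qed

context number_fld
begin

text \<open>For an algebraic integer this is d times the absolute logarithmic Weil height.\<close>

definition height :: "'a \<Rightarrow> real" where
 "height x = (\<Sum>\<sigma>\<in>E. max 0 (ln (cmod (\<sigma> x))))"

lemma exp_height:
 assumes "x \<in> k" "x \<noteq> 0"
 shows "exp (height x) = (\<Prod>\<sigma>\<in>E. max 1 (cmod (\<sigma> x)))"
 unfolding height_def exp_sum[OF finite_E]
proof (rule prod.cong[OF refl])
 fix \<sigma> assume "\<sigma> \<in> E"
 then have "\<sigma> x \<noteq> 0" using embedding.eq_0_iff[OF emb] assms by blast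
 then show "exp (max 0 (ln (cmod (\<sigma> x)))) = max 1 (cmod (\<sigma> x))"
  by (cases "cmod (\<sigma> x) \<le> 1") (auto simp: max_def)
qed

text \<open>Choose a box of largest exponent sum containing at least that sum plus one independent
  monomials; the sum is then below d. If y i times a monomial of the box left the span, enlarging
  \<open>e i\<close> by one would contradict maximality. So the span is closed under multiplication
  by all y i and is a subfield containing them.\<close>

lemma box_monomials_span:
 assumes "finite I" and y: "\<And>i. i \<in> I \<Longrightarrow> y i \<in> k"
  and gen: "\<And>F. is_subfield F \<Longrightarrow> F \<subseteq> k \<Longrightarrow> y ` I \<subseteq> F \<Longrightarrow> F = k"
 obtains e where "sum e I \<le> d - 1" "qspan (box_monomials I y e) = k"
proof -
 let ?M = "box_monomials I y"
 let ?P = "\<lambda>e. \<exists>U \<subseteq> ?M e. qindep U \<and> card U = sum e I + 1"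
 have fin: "finite (?M e)" for e by (rule finite_box_monomials[OF assms(1)])
 have Mk: "?M e \<subseteq> k" for e unfolding box_monomials_def by (auto intro!: prod_in power_in y)
 have one: "1 \<in> ?M e" for e unfolding box_monomials_def by (auto intro!: exI[of _ "\<lambda>_. 0"])
 have bound: "sum e I + 1 \<le> d" if "?P e" for e
  using that qindep_card_le_d Mk fin by (metis finite_subset order_trans)
 have "?P (\<lambda>_. 0)" using one by (intro exI[of _ "{1}"]) (auto simp: qindep_def)
 then have "\<exists>e. ?P e \<and> (\<forall>e'. ?P e' \<longrightarrow> sum e' I \<le> sum e I)"
  by (rule ex_has_greatest_nat[where P = ?P and f = "\<lambda>e. sum e I" and b = d])
   (use bound in \<open>auto simp: Suc_le_eq\<close>)
 then obtain e where e: "?P e \<and> (\<forall>e'. ?P e' \<longrightarrow> sum e' I \<le> sum e I)" by (rule exE)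
 then obtain U where U: "U \<subseteq> ?M e" "qindep U" "card U = sum e I + 1" by auto
 let ?R = "qspan (?M e)"
 have step: "y i * m \<in> ?R" if i: "i \<in> I" and m: "m \<in> ?M e" for i m
 proof (rule ccontr)
  assume n: "y i * m \<notin> ?R"
  let ?e = "e(i := e i + 1)"
  have sub: "?M e \<subseteq> ?M ?e"
  proof
   fix x assume "x \<in> ?M e"
   then obtain a where "\<forall>i\<in>I. a i \<le> e i" "x = (\<Prod>i\<in>I. y i ^ a i)" unfolding box_monomials_def by auto
   then show "x \<in> ?M ?e" unfolding box_monomials_def by (intro CollectI exI[of _ a]) (auto simp: le_SucI)
  qed
  obtain a where a: "\<forall>i\<in>I. a i \<le> e i" "m = (\<Prod>i\<in>I. y i ^ a i)" using m unfolding box_monomials_def by auto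
  have "y i * m = (\<Prod>j\<in>I. y j ^ (a(i := a i + 1)) j)"
  proof -
   have "(\<Prod>j\<in>I. y j ^ (a(i := a i + 1)) j) = y i ^ (a i + 1) * (\<Prod>j\<in>I - {i}. y j ^ (a(i := a i + 1)) j)"
    using i assms(1) by (subst prod.remove) auto
   also have "(\<Prod>j\<in>I - {i}. y j ^ (a(i := a i + 1)) j) = (\<Prod>j\<in>I - {i}. y j ^ a j)"
    by (rule prod.cong) auto
   also have "y i ^ (a i + 1) * (\<Prod>j\<in>I - {i}. y j ^ a j) = y i * m"
    unfolding a(2) using i assms(1) by (subst (2) prod.remove) (auto simp: mult.assoc)
   finally show ?thesis ..
  qed
  then have ym: "y i * m \<in> ?M ?e" unfolding box_monomials_def using a(1) by (intro CollectI exI[of _ "a(i := a i + 1)"]) auto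
  have nU: "y i * m \<notin> qspan U" using n qspan_subset[OF fin] U(1) qspan_base[OF fin] by blast
  have finU: "finite U" using U(1) fin finite_subset by blast
  have "?P ?e"
  proof (intro exI[of _ "insert (y i * m) U"] conjI)
   show "insert (y i * m) U \<subseteq> ?M ?e" using ym U(1) sub by blast
   show "qindep (insert (y i * m) U)" by (rule qindep_insert[OF finU U(2) nU])
   have "y i * m \<notin> U" using nU qspan_base[OF finU] by blast
   moreover have "sum ?e I = sum e I + 1"
    using i assms(1) by (simp add: sum.remove[of I i] )
   ultimately show "card (insert (y i * m) U) = sum ?e I + 1" using U(3) finU by simp
  qed
  then have "sum ?e I \<le> sum e I" using e by blast
  moreover have "sum ?e I = sum e I + 1" using i assms(1) by (simp add: sum.remove[of I i])
  ultimately show False by simp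
 qed
 have stepR: "y i * z \<in> ?R" if i: "i \<in> I" and z: "z \<in> ?R" for i z
 proof -
  obtain c where c: "z = (\<Sum>w\<in>?M e. of_rat (c w) * w)" using z unfolding qspan_def by blast
  have "y i * z = (\<Sum>w\<in>?M e. of_rat (c w) * (y i * w))" unfolding c by (simp add: sum_distrib_left mult_ac)
  also have "... \<in> ?R" by (intro qspan_sum qspan_scale step i)
  finally show ?thesis .
 qed
 have powR: "y i ^ n * z \<in> ?R" if "i \<in> I" "z \<in> ?R" for i z n
  by (induction n) (use that stepR in \<open>auto simp: mult.assoc\<close>)
 have monR: "(\<Prod>i\<in>J. y i ^ a i) * z \<in> ?R" if "finite J" "J \<subseteq> I" "z \<in> ?R" for J a z
  using that by (induction J rule: finite_induct) (auto simp: mult.assoc intro: powR)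
 have multR: "x * z \<in> ?R" if x: "x \<in> ?R" and z: "z \<in> ?R" for x z
 proof -
  obtain c where c: "x = (\<Sum>w\<in>?M e. of_rat (c w) * w)" using x unfolding qspan_def by blast
  have "x * z = (\<Sum>w\<in>?M e. of_rat (c w) * (w * z))" unfolding c by (simp add: sum_distrib_left mult_ac)
  also have "... \<in> ?R"
   by (intro qspan_sum qspan_scale) (use monR[OF assms(1) order_refl z] in \<open>auto simp: box_monomials_def\<close>)
  finally show ?thesis .
 qed
 have oneR: "1 \<in> ?R" by (rule qspan_base[OF fin one])
 have "number_field ?R" by (rule finite_qspan_ring_number_field[OF fin refl oneR multR])
 then have "?R = k"
  by (intro gen number_fieldD qspan_in Mk) (use stepR[OF _ oneR] in auto)
 moreover have "sum e I \<le> d - 1" using bound[of e] e by auto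
 ultimately show ?thesis by (intro that[of e])
qed

text \<open>Monomials from the box form a basis. Dividing row i of their embedding matrix by
  \<open>c i\<close> makes all entries at most 1, so Hadamard applies, and the product of the
  \<open>c i\<close> is a product of exponentiated heights with total exponent at most d -
  1.\<close>

theorem disc_bound:
 assumes "finite I" and y: "\<And>i. i \<in> I \<Longrightarrow> y i \<in> int_ring k" "\<And>i. i \<in> I \<Longrightarrow> y i \<noteq> 0"
  and gen: "\<And>F. is_subfield F \<Longrightarrow> F \<subseteq> k \<Longrightarrow> y ` I \<subseteq> F \<Longrightarrow> F = k"
  and h: "\<And>i. i \<in> I \<Longrightarrow> height (y i) \<le> h" "h \<ge> 0"
 shows "cmod (field_disc k) \<le> real d ^ d * exp (2 * real (d - 1) * h)"
proof -
 have yk: "y i \<in> k" if "i \<in> I" for i using y(1)[OF that] by (simp add: int_ring_def)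
 obtain e where e: "sum e I \<le> d - 1" "qspan (box_monomials I y e) = k"
  by (rule box_monomials_span[OF assms(1) yk gen])
 let ?M = "box_monomials I y e"
 have fin: "finite ?M" by (rule finite_box_monomials[OF assms(1)])
 obtain B where B: "B \<subseteq> ?M" "qindep B" "qspan B = qspan ?M"
  by (rule qindep_extend[OF fin, of "{}"]) (auto simp: qindep_def)
 have finB: "finite B" using B(1) fin finite_subset by blast
 have Bk: "qspan B = k" using B(3) e(2) by simp
 obtain b where b: "bij_betw b {..<d} B" by (rule enum_basis[OF finB B(2) Bk])
 have bM: "b j \<in> ?M" if "j < d" for j using b B(1) that unfolding bij_betw_def by auto
 obtain s where s: "is_enum s" and min:
  "\<And>y. (\<And>j. j < d \<Longrightarrow> y j \<in> int_ring k) \<Longrightarrow> fdet d (\<lambda>i j. s i (y j)) \<noteq> 0 \<Longrightarrow>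
   cmod (field_disc k) \<le> (cmod (fdet d (\<lambda>i j. s i (y j))))\<^sup>2"
  using field_disc_minimal by metis
 have nz: "fdet d (\<lambda>i j. s i (b j)) \<noteq> 0"
  using b B Bk by (intro fdet_embeddings_nonzero[OF s]) (auto simp: bij_betw_def)
 have bO: "b j \<in> int_ring k" if "j < d" for j
  using bM[OF that] y(1) unfolding box_monomials_def int_ring_def
  by (auto intro!: prod_in power_in algebraic_int_prod algebraic_int_power)
 define c where "c i = (\<Prod>l\<in>I. max 1 (cmod (s i (y l))) ^ e l)" for i
 have c1: "c i \<ge> 1" for i unfolding c_def by (intro prod_ge_1) (auto simp: one_le_power)
 have ent: "cmod (s i (b j)) \<le> c i" if ij: "i < d" "j < d" for i j
 proof -
  interpret embedding k "s i" by (rule emb[OF enum_in[OF s ij(1)]])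
  obtain a where a: "\<forall>l\<in>I. a l \<le> e l" "b j = (\<Prod>l\<in>I. y l ^ a l)"
   using bM[OF ij(2)] unfolding box_monomials_def by auto
  have "cmod (s i (b j)) = (\<Prod>l\<in>I. cmod (s i (y l)) ^ a l)"
   unfolding a(2) by (subst prod) (auto simp: power power_in yk norm_power prod_norm[symmetric])
  also have "... \<le> c i"
   unfolding c_def
  proof (rule prod_mono, safe)
   fix l assume l: "l \<in> I"
   have "cmod (s i (y l)) ^ a l \<le> max 1 (cmod (s i (y l))) ^ a l" by (intro power_mono) auto
   also have "... \<le> max 1 (cmod (s i (y l))) ^ e l" using a(1) l by (intro power_increasing) auto
   finally show "cmod (s i (y l)) ^ a l \<le> max 1 (cmod (s i (y l))) ^ e l" .
  qed auto
  finally show ?thesis .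
 qed
 have "fdet d (\<lambda>i j. s i (b j)) = fdet d (\<lambda>i j. of_real (c i) * (s i (b j) / of_real (c i)))"
  by (rule fdet_cong) (use c1 in \<open>auto simp: field_simps\<close>, metis c1 not_one_le_zero)
 also have "... = (\<Prod>i<d. of_real (c i)) * fdet d (\<lambda>i j. s i (b j) / of_real (c i))" by (rule fdet_scale_rows)
 finally have fd: "fdet d (\<lambda>i j. s i (b j)) = of_real (\<Prod>i<d. c i) * fdet d (\<lambda>i j. s i (b j) / of_real (c i))"
  by simp
 have cpos: "c i > 0" for i using c1[of i] by linarith
 have had: "(cmod (fdet d (\<lambda>i j. s i (b j) / of_real (c i))))\<^sup>2 \<le> real d ^ d"
  by (rule fdet_hadamard) (simp add: norm_divide divide_le_eq abs_of_pos[OF cpos] cpos ent)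
 have cprod: "(\<Prod>i<d. c i) \<le> exp (real (d - 1) * h)"
 proof -
  have "(\<Prod>i<d. c i) = (\<Prod>l\<in>I. (\<Prod>i<d. max 1 (cmod (s i (y l)))) ^ e l)"
   unfolding c_def by (subst prod.swap) (simp add: prod_power_distrib)
  also have "... = (\<Prod>l\<in>I. exp (height (y l)) ^ e l)"
   using exp_height yk y(2) enum_prod[OF s, of "\<lambda>\<sigma>. max 1 (cmod (\<sigma> (y l)))" for l] by simp
  also have "... \<le> (\<Prod>l\<in>I. exp h ^ e l)" using h by (intro prod_mono) (auto intro!: power_mono)
  also have "... = exp h ^ sum e I" by (simp add: power_sum)
  also have "... \<le> exp h ^ (d - 1)" using e(1) h(2) by (intro power_increasing) auto
  finally show ?thesis by (simp add: exp_of_nat_mult)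
 qed
 have "cmod (field_disc k) \<le> (cmod (fdet d (\<lambda>i j. s i (b j))))\<^sup>2" by (rule min[OF bO nz])
 also have "... = (\<Prod>i<d. c i)\<^sup>2 * (cmod (fdet d (\<lambda>i j. s i (b j) / of_real (c i))))\<^sup>2"
  unfolding fd norm_mult by (simp add: power_mult_distrib flip: of_real_prod)
 also have "... \<le> (exp (real (d - 1) * h))\<^sup>2 * real d ^ d"
  using had cprod cpos by (intro mult_mono power_mono) (auto intro!: prod_pos less_imp_le)
 also have "(exp (real (d - 1) * h))\<^sup>2 = exp (2 * real (d - 1) * h)"
  by (simp add: power2_eq_square flip: exp_add)
 finally show ?thesis by (simp add: mult.commute)
qed

subsection \<open>Units\<close>

lemma unit_grp_iff: "u \<in> unit_grp k \<longleftrightarrow> u \<in> int_ring k \<and> u \<noteq> 0 \<and> inverse u \<in> int_ring k"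
proof
 assume "u \<in> unit_grp k"
 then obtain y where y: "u \<in> int_ring k" "y \<in> int_ring k" "u * y = 1" unfolding unit_grp_def by auto
 then have "y = inverse u" using inverse_unique by metis
 then show "u \<in> int_ring k \<and> u \<noteq> 0 \<and> inverse u \<in> int_ring k" using y by auto
qed (auto simp: unit_grp_def intro!: bexI[of _ "inverse u"])

lemma unit_in_k: "u \<in> unit_grp k \<Longrightarrow> u \<in> k" "u \<in> unit_grp k \<Longrightarrow> u \<noteq> 0"
 by (auto simp: unit_grp_iff int_ring_def)

lemma unit_one: "1 \<in> unit_grp k" using of_int_int_ring[of 1] by (simp add: unit_grp_iff)

lemma unit_mult: "u \<in> unit_grp k \<Longrightarrow> v \<in> unit_grp k \<Longrightarrow> u * v \<in> unit_grp k"
 by (auto simp: unit_grp_iff int_ring_closed)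

lemma unit_inverse: "u \<in> unit_grp k \<Longrightarrow> inverse u \<in> unit_grp k"
 by (auto simp: unit_grp_iff)

lemma unit_power: "u \<in> unit_grp k \<Longrightarrow> u ^ n \<in> unit_grp k"
 by (induction n) (auto intro: unit_one unit_mult)

lemma unit_powi: "u \<in> unit_grp k \<Longrightarrow> u powi n \<in> unit_grp k"
 by (cases "n \<ge> 0") (auto simp: power_int_def intro: unit_power unit_inverse)

lemma unit_prod: "(\<And>i. i \<in> I \<Longrightarrow> f i \<in> unit_grp k) \<Longrightarrow> prod f I \<in> unit_grp k"
 by (induction I rule: infinite_finite_induct) (auto intro: unit_one unit_mult)

lemma unit_divide: "u \<in> unit_grp k \<Longrightarrow> v \<in> unit_grp k \<Longrightarrow> u / v \<in> unit_grp k"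
 by (simp add: divide_inverse unit_mult unit_inverse)

lemma unit_norm:
 assumes "u \<in> unit_grp k"
 shows "(\<Prod>\<sigma>\<in>E. cmod (\<sigma> u)) = 1"
proof -
 have u: "u \<in> k" "algebraic_int u" "inverse u \<in> k" "algebraic_int (inverse u)" "u \<noteq> 0"
  using assms by (auto simp: unit_grp_iff int_ring_def)
 obtain a where a: "(\<Prod>\<sigma>\<in>E. \<sigma> u) = of_int a" using norm_in_Ints[OF u(1,2)] by (auto elim: Ints_cases)
 obtain b where b: "(\<Prod>\<sigma>\<in>E. \<sigma> (inverse u)) = of_int b" using norm_in_Ints[OF u(3,4)] by (auto elim: Ints_cases)
 have "of_int (a * b) = (\<Prod>\<sigma>\<in>E. \<sigma> u * \<sigma> (inverse u))" using a b by (simp add: prod.distrib)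
 also have "... = 1"
 proof (rule prod.neutral, rule ballI)
  fix \<sigma> assume "\<sigma> \<in> E"
  then interpret embedding k \<sigma> by (rule emb)
  show "\<sigma> u * \<sigma> (inverse u) = 1" using mult[OF u(1,3)] u(5) by simp
 qed
 finally have "a * b = 1" using of_int_eq_iff by (metis of_int_1)
 then have "\<bar>a * b\<bar> = 1" by simp
 then have "\<bar>a\<bar> = 1" by (rule abs_zmult_eq_1)
 then have "cmod (\<Prod>\<sigma>\<in>E. \<sigma> u) = 1" using a by (metis norm_of_int of_int_1 of_int_abs)
 then show ?thesis by (simp add: prod_norm)
qed

section \<open>Logarithms of the absolute values of units\<close>

definition lg :: "('a \<Rightarrow> complex) \<Rightarrow> 'a \<Rightarrow> real" where "lg \<sigma> u = ln (cmod (\<sigma> u))"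

lemma emb_unit_pos: "\<sigma> \<in> E \<Longrightarrow> u \<in> unit_grp k \<Longrightarrow> cmod (\<sigma> u) > 0"
 using embedding.eq_0_iff[OF emb] unit_in_k by auto

lemma lg_mult: "\<sigma> \<in> E \<Longrightarrow> u \<in> unit_grp k \<Longrightarrow> v \<in> unit_grp k \<Longrightarrow> lg \<sigma> (u * v) = lg \<sigma> u + lg \<sigma> v"
 unfolding lg_def using emb_unit_pos by (simp add: embedding.mult[OF emb] unit_in_k norm_mult ln_mult)

lemma lg_inverse: "\<sigma> \<in> E \<Longrightarrow> u \<in> unit_grp k \<Longrightarrow> lg \<sigma> (inverse u) = - lg \<sigma> u"
 unfolding lg_def using emb_unit_pos by (simp add: embedding.inverse[OF emb] unit_in_k norm_inverse ln_inverse)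

lemma lg_one: "\<sigma> \<in> E \<Longrightarrow> lg \<sigma> 1 = 0"
 unfolding lg_def by (simp add: embedding.one[OF emb])

lemma lg_power: "\<sigma> \<in> E \<Longrightarrow> u \<in> unit_grp k \<Longrightarrow> lg \<sigma> (u ^ n) = real n * lg \<sigma> u"
 by (induction n) (auto simp: lg_one lg_mult unit_power algebra_simps)

lemma lg_powi: "\<sigma> \<in> E \<Longrightarrow> u \<in> unit_grp k \<Longrightarrow> lg \<sigma> (u powi n) = of_int n * lg \<sigma> u"
 by (cases "n \<ge> 0") (auto simp: power_int_def lg_power lg_inverse unit_inverse)

lemma lg_sum_zero: "u \<in> unit_grp k \<Longrightarrow> (\<Sum>\<sigma>\<in>E. lg \<sigma> u) = 0"
 using unit_norm[of u] emb_unit_pos ln_prod[OF finite_E, of "\<lambda>\<sigma>. cmod (\<sigma> u)"] unfolding lg_def by force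

lemma height_eq:
 assumes "u \<in> unit_grp k"
 shows "height u = (\<Sum>\<sigma>\<in>E. \<bar>lg \<sigma> u\<bar>) / 2"
proof -
 have "height u = (\<Sum>\<sigma>\<in>E. (lg \<sigma> u + \<bar>lg \<sigma> u\<bar>) / 2)"
  unfolding height_def lg_def by (intro sum.cong) (auto simp: max_def)
 then show ?thesis using lg_sum_zero[OF assms] by (simp add: sum.distrib flip: sum_divide_distrib)
qed

end

section \<open>Integration over finite products of the real line\<close>

text \<open>Points are functions on a finite index set, because the dimension is the unit rank, a
  number computed in the proof, and because splitting the index set gives the slices needed for
  Minkowski's theorem.\<close>

abbreviation PB :: "nat set \<Rightarrow> (nat \<Rightarrow> real) measure" where
 "PB I \<equiv> PiM I (\<lambda>_. lborel)"

interpretation PB: product_sigma_finite "\<lambda>_::nat. lborel :: real measure" ..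

lemma measurable_PB_coord [measurable]: "i \<in> I \<Longrightarrow> (\<lambda>x. x i) \<in> borel_measurable (PB I)"
 using measurable_component_singleton[of i I "\<lambda>_. lborel :: real measure"] by (simp add: measurable_lborel1)

lemma measurable_PBI:
 assumes "\<And>i. i \<in> I \<Longrightarrow> (\<lambda>x. f x i) \<in> borel_measurable M"
 shows "(\<lambda>x. \<lambda>i\<in>I. f x i) \<in> measurable M (PB I)"
 by (rule measurable_restrict) (use assms in simp)

lemma nn_integral_PB_affine:
 assumes "finite I" "s \<noteq> 0" "f \<in> borel_measurable (PB I)"
 shows "(\<integral>\<^sup>+x. f x \<partial>PB I) = ennreal (\<bar>s\<bar> ^ card I) * (\<integral>\<^sup>+x. f (\<lambda>i\<in>I. c i + s * x i) \<partial>PB I)"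
 using assms(1,3)
proof (induction I arbitrary: f rule: finite_induct)
 case empty
 then show ?case by (simp add: PiM_empty nn_integral_count_space_finite)
next
 case (insert i I)
 note f = insert.prems
 have upd: "(\<lambda>z. (fst z)(i := g (snd z))) \<in> measurable (PB I \<Otimes>\<^sub>M lborel) (PB (insert i I))"
  if [measurable]: "g \<in> borel_measurable borel" for g :: "real \<Rightarrow> real"
  by (rule measurable_fun_upd[of _ I]) auto
 define F where "F x = (\<integral>\<^sup>+y. f (x(i := c i + s * y)) \<partial>lborel)" for x
 have m: "(\<lambda>z. f ((fst z)(i := c i + s * snd z))) \<in> borel_measurable (PB I \<Otimes>\<^sub>M lborel)"
  using measurable_compose[OF upd[of "\<lambda>y. c i + s * y"] f] by (simp del: fun_upd_apply)
 have F: "F \<in> borel_measurable (PB I)"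
  unfolding F_def using lborel.borel_measurable_nn_integral_fst[OF m] by simp
 have sec: "(\<lambda>y. f (x(i := y))) \<in> borel_measurable borel" if "x \<in> space (PB I)" for x
 proof -
  have "(\<lambda>y. x(i := y)) \<in> measurable lborel (PB (insert i I))"
   by (rule measurable_fun_upd[of _ I]) (use that in auto)
  from measurable_compose[OF this f] show ?thesis by (simp del: fun_upd_apply)
 qed
 have resc: "(\<lambda>x. \<lambda>j\<in>insert i I. c j + s * x j) \<in> measurable (PB (insert i I)) (PB (insert i I))"
  by (rule measurable_PBI) measurable
 have "(\<integral>\<^sup>+x. f x \<partial>PB (insert i I)) = (\<integral>\<^sup>+x. \<integral>\<^sup>+y. f (x(i := y)) \<partial>lborel \<partial>PB I)"
  by (rule PB.product_nn_integral_insert[OF insert.hyps f])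
 also have "... = (\<integral>\<^sup>+x. ennreal \<bar>s\<bar> * F x \<partial>PB I)"
  unfolding F_def by (intro nn_integral_cong nn_integral_real_affine sec assms(2))
 also have "... = ennreal \<bar>s\<bar> * (ennreal (\<bar>s\<bar> ^ card I) * (\<integral>\<^sup>+x. F (\<lambda>j\<in>I. c j + s * x j) \<partial>PB I))"
  unfolding nn_integral_cmult[OF F] insert.IH[OF F] ..
 also have "(\<integral>\<^sup>+x. F (\<lambda>j\<in>I. c j + s * x j) \<partial>PB I)
   = (\<integral>\<^sup>+x. \<integral>\<^sup>+y. f (\<lambda>j\<in>insert i I. c j + s * (x(i := y)) j) \<partial>lborel \<partial>PB I)"
  unfolding F_def using insert.hyps
  by (intro nn_integral_cong arg_cong[where f = f] ext) auto
 also have "... = (\<integral>\<^sup>+x. f (\<lambda>j\<in>insert i I. c j + s * x j) \<partial>PB (insert i I))"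
  by (rule PB.product_nn_integral_insert[OF insert.hyps, symmetric]) (rule measurable_compose[OF resc f])
 finally have *: "(\<integral>\<^sup>+x. f x \<partial>PB (insert i I)) = ennreal \<bar>s\<bar> * (ennreal (\<bar>s\<bar> ^ card I) *
   (\<integral>\<^sup>+x. f (\<lambda>j\<in>insert i I. c j + s * x j) \<partial>PB (insert i I)))" .
 have "ennreal (\<bar>s\<bar> ^ card (insert i I)) = ennreal \<bar>s\<bar> * ennreal (\<bar>s\<bar> ^ card I)"
  using insert.hyps by (simp add: ennreal_mult')
 then show ?case by (simp only: * mult.assoc)
qed

section \<open>Linear change of variables\<close>

definition lin :: "nat \<Rightarrow> (nat \<Rightarrow> nat \<Rightarrow> real) \<Rightarrow> (nat \<Rightarrow> real) \<Rightarrow> nat \<Rightarrow> real" where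
 "lin n A x = (\<lambda>i\<in>{..<n}. \<Sum>j<n. A i j * x j)"

lemma measurable_lin: "lin n A \<in> measurable (PB {..<n}) (PB {..<n})"
 unfolding lin_def[abs_def] by (rule measurable_PBI) measurable

definition lin_subst :: "nat \<Rightarrow> (nat \<Rightarrow> nat \<Rightarrow> real) \<Rightarrow> bool" where
 "lin_subst n A \<longleftrightarrow> (\<forall>f\<in>borel_measurable (PB {..<n}).
  (\<integral>\<^sup>+x. f x \<partial>PB {..<n}) = ennreal \<bar>fdet n A\<bar> * (\<integral>\<^sup>+x. f (lin n A x) \<partial>PB {..<n}))"

text \<open>For fixed remaining coordinates the new coordinate is an affine function of the old one
  with slope \<open>a c\<close>, so Fubini reduces the claim to the real line.\<close>

lemma nn_integral_replace_coord:
 assumes c: "c < n" and a: "a c \<noteq> 0" and g: "g \<in> borel_measurable (PB {..<n})"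
 shows "(\<integral>\<^sup>+x. g x \<partial>PB {..<n}) = ennreal \<bar>a c\<bar> * (\<integral>\<^sup>+x. g (x(c := \<Sum>j<n. a j * x j)) \<partial>PB {..<n})"
proof -
 let ?J = "{..<n} - {c}"
 have I: "{..<n} = insert c ?J" and fin: "finite ?J" "c \<notin> ?J" using c by auto
 define b where "b x = (\<Sum>j\<in>?J. a j * x j)" for x :: "nat \<Rightarrow> real"
 have [measurable]: "(\<lambda>x. \<Sum>j<n. a j * x j) \<in> borel_measurable (PB {..<n})" by measurable
 have upd: "(\<lambda>x. x(c := \<Sum>j<n. a j * x j)) \<in> measurable (PB {..<n}) (PB {..<n})"
  by (rule measurable_fun_upd[of _ "{..<n}"]) (use c in auto)
 have sec: "(\<lambda>y. g (x(c := y))) \<in> borel_measurable borel" if "x \<in> space (PB ?J)" for x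
 proof -
  have "(\<lambda>y. x(c := y)) \<in> measurable lborel (PB {..<n})"
   by (rule measurable_fun_upd[of _ ?J]) (use that c in auto)
  from measurable_compose[OF this g] show ?thesis by (simp del: fun_upd_apply)
 qed
 have sum: "(\<Sum>j<n. a j * (x(c := y)) j) = b x + a c * y" for x y
  unfolding b_def by (subst I, subst sum.insert) (auto intro!: sum.cong simp: fin)
 have sec2: "(\<lambda>y. g (x(c := b x + a c * y))) \<in> borel_measurable lborel" if "x \<in> space (PB ?J)" for x
  using measurable_compose[OF _ sec[OF that], of "\<lambda>y. b x + a c * y" lborel] by simp
 have "(\<integral>\<^sup>+x. g x \<partial>PB {..<n}) = (\<integral>\<^sup>+x. \<integral>\<^sup>+y. g (x(c := y)) \<partial>lborel \<partial>PB ?J)"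
  using PB.product_nn_integral_insert[OF fin, of g] g I by simp
 also have "... = (\<integral>\<^sup>+x. ennreal \<bar>a c\<bar> * (\<integral>\<^sup>+y. g (x(c := b x + a c * y)) \<partial>lborel) \<partial>PB ?J)"
  by (intro nn_integral_cong nn_integral_real_affine sec a)
 also have "... = (\<integral>\<^sup>+x. \<integral>\<^sup>+y. ennreal \<bar>a c\<bar> * g (x(c := b x + a c * y)) \<partial>lborel \<partial>PB ?J)"
  by (intro nn_integral_cong nn_integral_cmult[symmetric] sec2)
 also have "... = (\<integral>\<^sup>+x. \<integral>\<^sup>+y. (\<lambda>x. ennreal \<bar>a c\<bar> * g (x(c := \<Sum>j<n. a j * x j))) (x(c := y)) \<partial>lborel \<partial>PB ?J)"
  by (simp only: sum fun_upd_upd)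
 also have "... = (\<integral>\<^sup>+x. ennreal \<bar>a c\<bar> * g (x(c := \<Sum>j<n. a j * x j)) \<partial>PB {..<n})"
  using PB.product_nn_integral_insert[OF fin, of "\<lambda>x. ennreal \<bar>a c\<bar> * g (x(c := \<Sum>j<n. a j * x j))"]
   measurable_compose[OF upd g] I by simp
 finally show ?thesis by (simp add: nn_integral_cmult measurable_compose[OF upd g])
qed

text \<open>The matrix is the product of A with the identity matrix whose row c is replaced by
  \<open>a\<close>. Every nonsingular matrix is reached by factors of this kind.\<close>

lemma lin_subst_compose:
 assumes A: "lin_subst n A" and c: "c < n" and a: "a c \<noteq> 0"
 shows "lin_subst n (\<lambda>i l. A i c * a l + (if l = c then 0 else A i l))" (is "lin_subst n ?B")
proof -
 define C where "C i j = (if i = c then a j else if i = j then 1 else 0 :: real)" for i j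
 have "fdet n ?B = fdet n (\<lambda>i j. \<Sum>l<n. A i l * C l j)"
 proof (rule fdet_cong)
  fix i j assume ij: "i < n" "j < n"
  have "(\<Sum>l<n. A i l * C l j) = (\<Sum>l<n. (if l = c then A i c * a j else 0) + (if l = j then (if j = c then 0 else A i j) else 0))"
   by (intro sum.cong) (auto simp: C_def)
  then show "?B i j = (\<Sum>l<n. A i l * C l j)" using c ij by (simp add: sum.distrib)
 qed
 also have "... = fdet n A * fdet n C" by (rule fdet_mult)
 also have "fdet n C = fdet n (\<lambda>i j. C j i)" by (rule fdet_transpose[symmetric])
 also have "... = fdet n (\<lambda>i j. if j = c then \<Sum>l<n. (if i = l then 1 else 0) * a l else (if i = j then 1 else 0))"
  by (rule fdet_cong) (auto simp: C_def if_distrib[of "\<lambda>x. x * _"] cong: if_cong)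
 also have "... = a c" by (simp only: fdet_replace_column[OF c] fdet_id mult_1_right)
 finally have det: "fdet n ?B = fdet n A * a c" .
 have lin: "lin n A (x(c := \<Sum>j<n. a j * x j)) = lin n ?B x" for x
 proof (rule ext)
  fix i
  have "(\<Sum>j<n. A i j * (x(c := \<Sum>j<n. a j * x j)) j)
    = (\<Sum>j<n. (if j = c then A i c * (\<Sum>j<n. a j * x j) else 0) + (if j = c then 0 else A i j) * x j)"
   by (intro sum.cong) auto
  also have "... = A i c * (\<Sum>j<n. a j * x j) + (\<Sum>j<n. (if j = c then 0 else A i j) * x j)"
   using c by (simp add: sum.distrib)
  also have "... = (\<Sum>j<n. ?B i j * x j)"
   unfolding sum_distrib_left sum.distrib[symmetric] by (rule sum.cong) (auto simp: algebra_simps)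
  finally show "lin n A (x(c := \<Sum>j<n. a j * x j)) i = lin n ?B x i" by (simp add: lin_def)
 qed
 show ?thesis
  unfolding lin_subst_def
 proof
  fix f :: "(nat \<Rightarrow> real) \<Rightarrow> ennreal" assume f: "f \<in> borel_measurable (PB {..<n})"
  have "(\<integral>\<^sup>+x. f x \<partial>PB {..<n}) = ennreal \<bar>fdet n A\<bar> * (\<integral>\<^sup>+x. f (lin n A x) \<partial>PB {..<n})"
   using A f unfolding lin_subst_def by blast
  also have "(\<integral>\<^sup>+x. f (lin n A x) \<partial>PB {..<n}) = ennreal \<bar>a c\<bar> * (\<integral>\<^sup>+x. f (lin n ?B x) \<partial>PB {..<n})"
   unfolding lin[symmetric]
   by (rule nn_integral_replace_coord[where a = a, OF c a]) (rule measurable_compose[OF measurable_lin f])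
  finally show "(\<integral>\<^sup>+x. f x \<partial>PB {..<n}) = ennreal \<bar>fdet n ?B\<bar> * (\<integral>\<^sup>+x. f (lin n ?B x) \<partial>PB {..<n})"
   unfolding det by (simp add: abs_mult ennreal_mult mult.assoc)
 qed
qed

text \<open>Elimination row by row: once the first m rows are those of the identity, a factor
  carrying row m is split off, leaving a matrix with m + 1 such rows. The induction counts the
  remaining rows.\<close>

lemma lin_subst_nonsingular:
 assumes "fdet n A \<noteq> 0"
 shows "lin_subst n A"
proof -
 have "lin_subst n A" if "fdet n A \<noteq> 0" "m \<le> n" "\<forall>i<m. \<forall>j<n. A i j = (if i = j then 1 else 0)" for m A
  using that
 proof (induction "n - m" arbitrary: m A)
  case 0
  have "lin n A x = x" if x: "x \<in> space (PB {..<n})" for x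
  proof (rule ext)
   fix i
   show "lin n A x i = x i"
   proof (cases "i < n")
    case True
    have "(\<Sum>j<n. A i j * x j) = (\<Sum>j<n. if j = i then x i else 0)"
     using 0 True by (intro sum.cong) auto
    then show ?thesis using True by (simp add: lin_def)
   qed (use x in \<open>auto simp: lin_def space_PiM PiE_iff extensional_def\<close>)
  qed
  moreover have "fdet n A = 1" using 0 fdet_cong[of n A "\<lambda>i j. if i = j then 1 else 0"] by (simp add: fdet_id)
  ultimately show ?case unfolding lin_subst_def by (auto intro!: nn_integral_cong)
 next
  case (Suc q)
  then have m: "m < n" by simp
  have pivot: "lin_subst n A" if nz: "fdet n A \<noteq> 0" and rows: "\<forall>i<m. \<forall>j<n. A i j = (if i = j then 1 else 0)"
   and p: "A m m \<noteq> 0" for A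
  proof -
   define A' where "A' i j = (if j = m then A i m / A m m else A i j - A i m / A m m * A m j)" for i j
   have eq: "A' i m * A m l + (if l = m then 0 else A' i l) = A i l" for i l
    using p by (auto simp: A'_def)
   have A': "lin_subst n A'"
   proof (rule Suc.hyps(1)[of "Suc m"])
    show "\<forall>i<Suc m. \<forall>j<n. A' i j = (if i = j then 1 else 0)"
     using rows p m by (auto simp: A'_def less_Suc_eq)
    show "fdet n A' \<noteq> 0"
    proof
     assume "fdet n A' = 0"
     then obtain x where x: "(\<exists>j<n. x j \<noteq> 0) \<and> (\<forall>i<n. (\<Sum>j<n. A' j i * x j) = 0)"
      using fdet_eq_0_iff[of n "\<lambda>i j. A' j i"] fdet_transpose[of n A'] by auto
     have "(\<Sum>j<n. A j i * x j) = 0" if "i < n" for i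
     proof -
      have "(\<Sum>j<n. A j i * x j) = (\<Sum>j<n. A' j m * x j) * A m i + (if i = m then 0 else (\<Sum>j<n. A' j i * x j))"
      proof -
       have "A j i * x j = A' j m * x j * A m i + (if i = m then 0 else A' j i * x j)" for j
        by (subst eq[of j i, symmetric]) (simp add: algebra_simps)
       then show ?thesis by (simp add: sum_distrib_right sum.distrib)
      qed
      then show ?thesis using x m that by simp
     qed
     then have "fdet n (\<lambda>i j. A j i) = 0" unfolding fdet_eq_0_iff using x by blast
     then show False using nz fdet_transpose[of n A] by simp
    qed
   qed (use Suc.hyps(2) m in auto)
   have "lin_subst n (\<lambda>i l. A' i m * A m l + (if l = m then 0 else A' i l))"
    by (rule lin_subst_compose[where a = "A m", OF A' m p])
   then show ?thesis by (simp add: eq)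
  qed
  show ?case
  proof (cases "A m m = 0")
   case False
   then show ?thesis using pivot Suc.prems by blast
  next
   case True
   \<comment> \<open>Otherwise row m would be a combination of the unit rows above it, and the
     matrix singular.\<close>
   have "\<exists>j<n. m < j \<and> A m j \<noteq> 0"
   proof (rule ccontr)
    assume neg: "\<not> ?thesis"
    define x where "x j = (if j = m then 1 else if j < m then - A m j else 0)" for j
    have "(\<Sum>j<n. A j i * x j) = 0" if i: "i < n" for i
    proof -
     have "(\<Sum>j<n. A j i * x j) = (\<Sum>j<n. (if j = m then A m i else 0) + (if j = i then (if i < m then - A m i else 0) else 0))"
      using Suc.prems(3) i by (intro sum.cong) (auto simp: x_def)
     also have "... = A m i + (if i < m then - A m i else 0)" using m i by (simp add: sum.distrib)
     also have "... = 0" using neg True i by (metis add.right_inverse add.right_neutral linorder_neqE_nat)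
     finally show ?thesis .
    qed
    then have "fdet n (\<lambda>i j. A j i) = 0"
     unfolding fdet_eq_0_iff using m by (intro exI[of _ x]) (auto simp: x_def intro!: exI[of _ m])
    then show False using Suc.prems(1) fdet_transpose[of n A] by simp
   qed
   then obtain j where j: "j < n" "m < j" "A m j \<noteq> 0" by blast
   \<comment> \<open>Column j is subtracted from column m, which makes the pivot nonzero. Adding it
     back is a factor of the form required by \<open>lin_subst_compose\<close>.\<close>
   define A' where "A' i l = (if l = m then A i m - A i j else A i l)" for i l
   have eq: "A' i j * (if l = j \<or> l = m then 1 else 0) + (if l = j then 0 else A' i l) = A i l" for i l
    using j(2) by (auto simp: A'_def)
   have "lin_subst n A'"
   proof (rule pivot)
    show "A' m m \<noteq> 0" using True j by (simp add: A'_def)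
    show "\<forall>i<m. \<forall>l<n. A' i l = (if i = l then 1 else 0)" using Suc.prems(3) j m by (auto simp: A'_def)
    show "fdet n A' \<noteq> 0"
    proof
     assume "fdet n A' = 0"
     then obtain x where x: "(\<exists>j<n. x j \<noteq> 0) \<and> (\<forall>i<n. (\<Sum>l<n. A' l i * x l) = 0)"
      using fdet_eq_0_iff[of n "\<lambda>i j. A' j i"] fdet_transpose[of n A'] by auto
     have "(\<Sum>l<n. A l i * x l) = 0" if "i < n" for i
     proof -
      have "(\<Sum>l<n. A l i * x l) = (if i = j \<or> i = m then 1 else 0) * (\<Sum>l<n. A' l j * x l)
        + (if i = j then 0 else (\<Sum>l<n. A' l i * x l))"
      proof -
       have "A l i * x l = (if i = j \<or> i = m then 1 else 0) * (A' l j * x l) + (if i = j then 0 else A' l i * x l)" for l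
        by (subst eq[of l i, symmetric]) (simp add: algebra_simps)
       then show ?thesis by (simp add: sum_distrib_left sum.distrib)
      qed
      then show ?thesis using x j that by simp
     qed
     then have "fdet n (\<lambda>i j. A j i) = 0" unfolding fdet_eq_0_iff using x by blast
     then show False using Suc.prems(1) fdet_transpose[of n A] by simp
    qed
   qed
   then have "lin_subst n (\<lambda>i l. A' i j * (if l = j \<or> l = m then 1 else 0) + (if l = j then 0 else A' i l))"
    by (rule lin_subst_compose[OF _ j(1)]) simp
   then show ?thesis by (simp only: eq)
  qed
 qed
 from this[of A 0] assms show ?thesis by simp
qed

text \<open>The integer translates of the half-open unit cube tile space: exactly one of them
  contains a given point. Fubini and translation then fold the integral onto the cube.\<close>

lemma nn_integral_periodize:
 assumes "finite I" and g[measurable]: "g \<in> borel_measurable (PB I)"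
 shows "(\<integral>\<^sup>+x. g x \<partial>PB I) = (\<integral>\<^sup>+t. indicator {t. \<forall>i\<in>I. 0 \<le> t i \<and> t i < 1} t *
  (\<integral>\<^sup>+m. g (\<lambda>i\<in>I. t i + of_int (m i)) \<partial>count_space (I \<rightarrow>\<^sub>E (UNIV::int set))) \<partial>PB I)"
proof -
 let ?C = "{t. \<forall>i\<in>I. 0 \<le> t i \<and> t i < (1::real)}" and ?M = "I \<rightarrow>\<^sub>E (UNIV::int set)"
 have cM: "countable ?M" by (rule countable_PiE[OF assms(1)]) auto
 have C: "Measurable.pred (PB I) (\<lambda>t. t \<in> ?C)"
  using assms(1) by (auto intro!: pred_intros_finite(3) simp: Ball_def[symmetric])
 have [measurable]: "(\<lambda>t. indicator ?C t :: ennreal) \<in> borel_measurable (PB I)"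
 proof -
  have "?C \<inter> space (PB I) = {t \<in> space (PB I). t \<in> ?C}" by auto
  also have "... \<in> sets (PB I)" using C unfolding pred_def .
  finally show ?thesis by (simp only: borel_measurable_indicator_iff)
 qed
 have sh: "(\<lambda>t. \<lambda>i\<in>I. t i + c i) \<in> measurable (PB I) (PB I)" for c :: "nat \<Rightarrow> real"
  by (rule measurable_PBI) measurable
 have one: "(\<integral>\<^sup>+m. indicator ?C (\<lambda>i\<in>I. x i - of_int (m i)) \<partial>count_space ?M) = 1" for x :: "nat \<Rightarrow> real"
 proof -
  have "(\<integral>\<^sup>+m. indicator ?C (\<lambda>i\<in>I. x i - of_int (m i)) \<partial>count_space ?M)
    = (\<integral>\<^sup>+m. indicator {\<lambda>i\<in>I. \<lfloor>x i\<rfloor>} m \<partial>count_space ?M)"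
  proof (rule nn_integral_cong)
   fix m assume "m \<in> space (count_space ?M)"
   then have m: "m \<in> ?M" by simp
   have "(\<lambda>i\<in>I. x i - of_int (m i)) \<in> ?C \<longleftrightarrow> (\<forall>i\<in>I. m i = \<lfloor>x i\<rfloor>)"
    by (auto simp: floor_eq_iff) (smt (verit) floor_eq_iff)+
   also have "... \<longleftrightarrow> m = (\<lambda>i\<in>I. \<lfloor>x i\<rfloor>)" using m by (auto intro!: PiE_ext[of m I "\<lambda>_. UNIV"])
   finally show "indicator ?C (\<lambda>i\<in>I. x i - of_int (m i)) = (indicator {\<lambda>i\<in>I. \<lfloor>x i\<rfloor>} m :: ennreal)"
    by (simp add: indicator_def)
  qed
  also have "... = emeasure (count_space ?M) {\<lambda>i\<in>I. \<lfloor>x i\<rfloor>}" by (rule nn_integral_indicator) auto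
  also have "... = 1" by (subst emeasure_count_space_finite) auto
  finally show ?thesis .
 qed
 have m1: "(\<lambda>x. indicator ?C (\<lambda>i\<in>I. x i - of_int (m i)) :: ennreal) \<in> borel_measurable (PB I)" for m :: "nat \<Rightarrow> int"
  using measurable_compose[OF sh[of "\<lambda>i. - of_int (m i)"], of "indicator ?C :: _ \<Rightarrow> ennreal" borel] by simp
 have m2: "(\<lambda>t. g (\<lambda>i\<in>I. t i + of_int (m i))) \<in> borel_measurable (PB I)" for m :: "nat \<Rightarrow> int"
  by (rule measurable_compose[OF sh g])
 have "(\<integral>\<^sup>+x. g x \<partial>PB I) = (\<integral>\<^sup>+x. \<integral>\<^sup>+m. g x * indicator ?C (\<lambda>i\<in>I. x i - of_int (m i)) \<partial>count_space ?M \<partial>PB I)"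
  by (subst nn_integral_cmult) (auto simp: one)
 also have "... = (\<integral>\<^sup>+m. \<integral>\<^sup>+x. g x * indicator ?C (\<lambda>i\<in>I. x i - of_int (m i)) \<partial>PB I \<partial>count_space ?M)"
  by (rule nn_integral_count_space_nn_integral[OF cM]) (use m1 in auto)
 also have "... = (\<integral>\<^sup>+m. \<integral>\<^sup>+t. indicator ?C t * g (\<lambda>i\<in>I. t i + of_int (m i)) \<partial>PB I \<partial>count_space ?M)"
 proof (rule nn_integral_cong)
  fix m :: "nat \<Rightarrow> int"
  let ?f = "\<lambda>x. g x * indicator ?C (\<lambda>i\<in>I. x i - of_int (m i))"
  have "(\<integral>\<^sup>+x. ?f x \<partial>PB I) = (\<integral>\<^sup>+x. ?f (\<lambda>i\<in>I. of_int (m i) + 1 * x i) \<partial>PB I)"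
   using nn_integral_PB_affine[OF assms(1), of 1 ?f "\<lambda>i. of_int (m i)"] m1 by simp
  also have "... = (\<integral>\<^sup>+t. indicator ?C t * g (\<lambda>i\<in>I. t i + of_int (m i)) \<partial>PB I)"
  proof (rule nn_integral_cong)
   fix t
   have "(\<lambda>i\<in>I. (\<lambda>i\<in>I. of_int (m i) + 1 * t i) i - of_int (m i)) \<in> ?C \<longleftrightarrow> t \<in> ?C" by auto
   moreover have "(\<lambda>i\<in>I. of_int (m i) + 1 * t i) = (\<lambda>i\<in>I. t i + of_int (m i))" by auto
   ultimately show "?f (\<lambda>i\<in>I. of_int (m i) + 1 * t i) = indicator ?C t * g (\<lambda>i\<in>I. t i + of_int (m i))"
    by (simp add: indicator_def)
  qed
  finally show "(\<integral>\<^sup>+x. ?f x \<partial>PB I) = (\<integral>\<^sup>+t. indicator ?C t * g (\<lambda>i\<in>I. t i + of_int (m i)) \<partial>PB I)" .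
 qed
 also have "... = (\<integral>\<^sup>+t. \<integral>\<^sup>+m. indicator ?C t * g (\<lambda>i\<in>I. t i + of_int (m i)) \<partial>count_space ?M \<partial>PB I)"
  by (rule nn_integral_count_space_nn_integral[OF cM, symmetric]) (use m2 in auto)
 finally show ?thesis by (subst (asm) nn_integral_cmult) auto
qed

subsection \<open>The volume of the unit ball of the height\<close>

text \<open>The volume of the set where the positive parts add up to at most a and the negative
  parts to at most b: there are n choose j orthants with j positive coordinates, and each
  contributes a simplex of volume a^j / j! times one of volume b^(n-j) / (n-j)!.\<close>

definition ball_vol :: "nat \<Rightarrow> real \<Rightarrow> real \<Rightarrow> real" where
 "ball_vol n a b = (\<Sum>j\<le>n. real (n choose j) / (fact j * fact (n - j)) * a ^ j * b ^ (n - j))"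

text \<open>Pascal's rule separates the two possible signs of the new coordinate; each sum is an
  integral computed in \<open>ball_vol_FTC\<close>.\<close>

lemma ball_vol_Suc:
 "ball_vol (Suc n) a b = (\<Sum>j\<le>n. real (n choose j) / (fact (Suc j) * fact (n - j)) * a ^ Suc j * b ^ (n - j))
  + (\<Sum>j\<le>n. real (n choose j) / (fact j * fact (Suc (n - j))) * a ^ j * b ^ Suc (n - j))"
proof -
 let ?t = "\<lambda>c j. real c / (fact j * fact (Suc n - j)) * a ^ j * b ^ (Suc n - j)"
 have "ball_vol (Suc n) a b = ?t 1 0 + (\<Sum>j\<le>n. ?t (Suc n choose Suc j) (Suc j))"
  unfolding ball_vol_def by (subst sum.atMost_Suc_shift) simp
 also have "(\<Sum>j\<le>n. ?t (Suc n choose Suc j) (Suc j)) = (\<Sum>j\<le>n. ?t (n choose j) (Suc j)) + (\<Sum>j\<le>n. ?t (n choose Suc j) (Suc j))"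
  unfolding sum.distrib[symmetric] by (rule sum.cong) (auto simp: add_divide_distrib ring_distribs)
 also have "?t 1 0 + ((\<Sum>j\<le>n. ?t (n choose j) (Suc j)) + (\<Sum>j\<le>n. ?t (n choose Suc j) (Suc j)))
   = (\<Sum>j\<le>n. ?t (n choose j) (Suc j)) + (\<Sum>j\<le>Suc n. ?t (n choose j) j)"
  using sum.atMost_Suc_shift[of "\<lambda>j. ?t (n choose j) j" n] by simp
 also have "(\<Sum>j\<le>Suc n. ?t (n choose j) j) = (\<Sum>j\<le>n. ?t (n choose j) j)" by simp
 also have "... = (\<Sum>j\<le>n. real (n choose j) / (fact j * fact (Suc (n - j))) * a ^ j * b ^ Suc (n - j))"
  by (rule sum.cong) (auto simp: Suc_diff_le)
 finally show ?thesis by simp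
qed

lemma ball_vol_nonneg: "0 \<le> a \<Longrightarrow> 0 \<le> b \<Longrightarrow> 0 \<le> ball_vol n a b"
 unfolding ball_vol_def by (intro sum_nonneg) auto

lemma ball_vol_commute: "ball_vol n a b = ball_vol n b a"
 unfolding ball_vol_def
 by (rule sum.reindex_bij_witness[of _ "\<lambda>j. n - j" "\<lambda>j. n - j"]) (auto simp: binomial_symmetric[symmetric] mult_ac)

lemma ball_vol_FTC:
 assumes "0 \<le> a" "0 \<le> b"
 shows "(\<integral>\<^sup>+y. ennreal (ball_vol n (a - y) b) * indicator {0..a} y \<partial>lborel)
  = ennreal (\<Sum>j\<le>n. real (n choose j) / (fact (Suc j) * fact (n - j)) * a ^ Suc j * b ^ (n - j))"
proof -
 define F where "F y = - (\<Sum>j\<le>n. real (n choose j) / (fact (Suc j) * fact (n - j)) * (a - y) ^ Suc j * b ^ (n - j))" for y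
 have D: "DERIV F y :> ball_vol n (a - y) b" for y
 proof -
  have "DERIV F y :> - (\<Sum>j\<le>n. real (n choose j) / (fact (Suc j) * fact (n - j)) * (- (real (Suc j) * (a - y) ^ j)) * b ^ (n - j))"
  proof -
   have "DERIV (\<lambda>y. (a - y) ^ Suc j) y :> - (real (Suc j) * (a - y) ^ j)" for j
   proof -
    have "DERIV (\<lambda>y. a - y) y :> - 1" by (auto intro!: derivative_eq_intros)
    from DERIV_power_Suc[OF this, of j] show ?thesis by simp
   qed
   then show ?thesis unfolding F_def by (intro DERIV_minus DERIV_sum DERIV_cmult_right DERIV_cmult)
  qed
  also have "- (\<Sum>j\<le>n. real (n choose j) / (fact (Suc j) * fact (n - j)) * (- (real (Suc j) * (a - y) ^ j)) * b ^ (n - j))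
    = ball_vol n (a - y) b"
   unfolding ball_vol_def sum_negf[symmetric]
   by (rule sum.cong) (auto simp: divide_simps simp del: of_nat_Suc)
  finally show ?thesis .
 qed
 have "(\<integral>\<^sup>+y. ennreal (ball_vol n (a - y) b) * indicator {0..a} y \<partial>lborel) = ennreal (F a - F 0)"
 proof (rule nn_integral_FTC_Icc)
  show "(\<lambda>y. ball_vol n (a - y) b) \<in> borel_measurable borel" unfolding ball_vol_def by measurable
 qed (use D assms ball_vol_nonneg in auto)
 then show ?thesis by (simp add: F_def)
qed

text \<open>Integrate over the last coordinate y: a positive y uses up part of the budget a, a
  negative one part of the budget b.\<close>

lemma emeasure_ball:
 assumes "0 \<le> a" "0 \<le> b"
 shows "(\<integral>\<^sup>+x. indicator {x. (\<Sum>i<n. max 0 (x i)) \<le> a \<and> (\<Sum>i<n. max 0 (- x i)) \<le> b} x \<partial>PB {..<n}) = ennreal (ball_vol n a b)"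
 using assms
proof (induction n arbitrary: a b)
 case 0
 then show ?case by (simp add: PiM_empty nn_integral_count_space_finite ball_vol_def)
next
 case (Suc n)
 let ?K = "\<lambda>n a b. {x. (\<Sum>i<n. max 0 (x i)) \<le> a \<and> (\<Sum>i<n. max 0 (- x i)) \<le> b} :: (nat \<Rightarrow> real) set"
 let ?f = "indicator (?K (Suc n) a b) :: _ \<Rightarrow> ennreal"
 have f: "?f \<in> borel_measurable (PB (insert n {..<n}))"
 proof -
  have "Measurable.pred (PB (insert n {..<n})) (\<lambda>x. (\<Sum>i\<in>insert n {..<n}. max 0 (x i)) \<le> a \<and> (\<Sum>i\<in>insert n {..<n}. max 0 (- x i)) \<le> b)"
   by measurable
  then have "{x \<in> space (PB (insert n {..<n})). x \<in> ?K (Suc n) a b} \<in> sets (PB (insert n {..<n}))"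
   by (simp only: pred_def lessThan_Suc[symmetric] mem_Collect_eq)
  then show ?thesis by (simp only: borel_measurable_indicator_iff Int_def conj_commute)
 qed
 have fub: "(\<integral>\<^sup>+x. ?f x \<partial>PB {..<Suc n}) = (\<integral>\<^sup>+y. \<integral>\<^sup>+x. ?f (x(n := y)) \<partial>PB {..<n} \<partial>lborel)"
  using PB.product_nn_integral_insert_rev[of "{..<n}" n ?f] f by (simp add: lessThan_Suc del: fun_upd_apply)
 have inner: "(\<integral>\<^sup>+x. ?f (x(n := y)) \<partial>PB {..<n})
  = (if 0 \<le> a - max 0 y \<and> 0 \<le> b - max 0 (- y) then ennreal (ball_vol n (a - max 0 y) (b - max 0 (- y))) else 0)" for y
 proof -
  have eq: "x(n := y) \<in> ?K (Suc n) a b \<longleftrightarrow> x \<in> ?K n (a - max 0 y) (b - max 0 (- y))" for x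
  proof -
   have "(\<Sum>i<n. max 0 ((x(n := y)) i)) = (\<Sum>i<n. max 0 (x i))" "(\<Sum>i<n. max 0 (- (x(n := y)) i)) = (\<Sum>i<n. max 0 (- x i))"
    by (auto intro!: sum.cong)
   then show ?thesis by auto
  qed
  then have "(\<integral>\<^sup>+x. ?f (x(n := y)) \<partial>PB {..<n}) = (\<integral>\<^sup>+x. indicator (?K n (a - max 0 y) (b - max 0 (- y))) x \<partial>PB {..<n})"
   by (intro nn_integral_cong) (simp add: indicator_def del: fun_upd_apply)
  also have "... = (if 0 \<le> a - max 0 y \<and> 0 \<le> b - max 0 (- y) then ennreal (ball_vol n (a - max 0 y) (b - max 0 (- y))) else 0)"
  proof (cases "0 \<le> a - max 0 y \<and> 0 \<le> b - max 0 (- y)")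
   case True
   then show ?thesis using Suc.IH by simp
  next
   case False
   have "(\<Sum>i<n. max 0 (x i)) \<ge> 0" "(\<Sum>i<n. max 0 (- x i)) \<ge> 0" for x :: "nat \<Rightarrow> real" by (auto intro!: sum_nonneg)
   then have "?K n (a - max 0 y) (b - max 0 (- y)) = {}" using False by (auto, (smt (verit))+)
   then show ?thesis by (simp only: False if_False) simp
  qed
  finally show ?thesis .
 qed
 have bm [measurable]: "(\<lambda>y. ball_vol n (a - y) b) \<in> borel_measurable borel" unfolding ball_vol_def by measurable
 have bm' [measurable]: "(\<lambda>y. ball_vol n a (b + y)) \<in> borel_measurable borel" unfolding ball_vol_def by measurable
 have m1: "(\<lambda>y. ennreal (ball_vol n (a - y) b) * indicator {0..a} y) \<in> borel_measurable borel" by measurable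
 have m2: "(\<lambda>y. ennreal (ball_vol n a (b + y)) * indicator {-b..0} y) \<in> borel_measurable borel" by measurable
 \<comment> \<open>At y = 0 both indicators on the right are one, so the integrands agree only off
   this null point.\<close>
 have "AE y in lborel. y \<noteq> (0::real)" by (rule AE_lborel_singleton)
 then have "(\<integral>\<^sup>+y. \<integral>\<^sup>+x. ?f (x(n := y)) \<partial>PB {..<n} \<partial>lborel)
   = (\<integral>\<^sup>+y. ennreal (ball_vol n (a - y) b) * indicator {0..a} y + ennreal (ball_vol n a (b + y)) * indicator {-b..0} y \<partial>lborel)"
  unfolding inner
 proof (intro nn_integral_cong_AE, eventually_elim)
  fix y :: real assume y: "y \<noteq> 0"
  show "(if 0 \<le> a - max 0 y \<and> 0 \<le> b - max 0 (- y) then ennreal (ball_vol n (a - max 0 y) (b - max 0 (- y))) else 0)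
    = ennreal (ball_vol n (a - y) b) * indicator {0..a} y + ennreal (ball_vol n a (b + y)) * indicator {-b..0} y"
   using y Suc.prems by (cases "y > 0") (auto simp: indicator_def max_def)
 qed
 also have "... = (\<integral>\<^sup>+y. ennreal (ball_vol n (a - y) b) * indicator {0..a} y \<partial>lborel)
   + (\<integral>\<^sup>+y. ennreal (ball_vol n a (b + y)) * indicator {-b..0} y \<partial>lborel)"
  by (rule nn_integral_add) (use m1 m2 in simp_all)
 also have "(\<integral>\<^sup>+y. ennreal (ball_vol n a (b + y)) * indicator {-b..0} y \<partial>lborel)
   = (\<integral>\<^sup>+y. ennreal (ball_vol n (b - y) a) * indicator {0..b} y \<partial>lborel)"
  using nn_integral_real_affine[OF m2, of "-1" 0]
  by (simp add: ball_vol_commute[of n a] indicator_def del: mult_if_delta) (intro nn_integral_cong, auto)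
 also have "(\<integral>\<^sup>+y. ennreal (ball_vol n (a - y) b) * indicator {0..a} y \<partial>lborel) + ...
  = ennreal (ball_vol (Suc n) a b)"
 proof -
  have "(\<Sum>j\<le>n. real (n choose j) / (fact (Suc j) * fact (n - j)) * b ^ Suc j * a ^ (n - j))
   = (\<Sum>j\<le>n. real (n choose j) / (fact j * fact (Suc (n - j))) * a ^ j * b ^ Suc (n - j))"
   by (rule sum.reindex_bij_witness[of _ "\<lambda>j. n - j" "\<lambda>j. n - j"])
    (auto simp: binomial_symmetric[symmetric] mult_ac simp del: fact_Suc power_Suc)
  then show ?thesis
   unfolding ball_vol_FTC[OF Suc.prems] ball_vol_FTC[OF Suc.prems(2,1)] ball_vol_Suc
   using Suc.prems by (subst ennreal_plus[symmetric]) (auto intro!: sum_nonneg simp del: fact_Suc power_Suc)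
 qed
 finally show ?case by (rule trans[OF fub])
qed

lemma ball_vol_diag: "ball_vol n t t = fact (2 * n) / fact n ^ 3 * t ^ n"
proof -
 have "ball_vol n t t = (\<Sum>j\<le>n. (real (n choose j))\<^sup>2 * (t ^ n / fact n))"
  unfolding ball_vol_def
 proof (rule sum.cong[OF refl])
  fix j assume "j \<in> {..n}"
  then have j: "j \<le> n" by simp
  have "fact n = real (n choose j) * (fact j * fact (n - j))" using j by (simp add: binomial_fact)
  then have "real (n choose j) / (fact j * fact (n - j)) = (real (n choose j))\<^sup>2 / fact n"
   by (simp add: power2_eq_square divide_simps)
  moreover have "t ^ j * t ^ (n - j) = t ^ n" using j by (simp flip: power_add)
  ultimately show "real (n choose j) / (fact j * fact (n - j)) * t ^ j * t ^ (n - j) = (real (n choose j))\<^sup>2 * (t ^ n / fact n)"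
   by (simp add: mult.assoc)
 qed
 also have "... = real (\<Sum>j\<le>n. (n choose j)\<^sup>2) * (t ^ n / fact n)"
  by (simp add: sum_distrib_right sum_divide_distrib)
 also have "(\<Sum>j\<le>n. (n choose j)\<^sup>2) = (2 * n choose n)" by (rule choose_square_sum)
 also have "real (2 * n choose n) = fact (2 * n) / (fact n * fact n)" by (simp add: binomial_fact mult_2)
 finally show ?thesis by (simp add: power3_eq_cube)
qed

subsection \<open>Minkowski's theorem with two lower bounds\<close>

text \<open>Cut K = {N <= T/2} into slices with fixed coordinates from p on, and shrink each slice
  by the factor s = T / A about one of its points; this costs s^p in volume. The shrunken set
  contains no two points differing by a nonzero integer vector: the bound T puts both points in one
  slice, and there the difference has norm at most T / s = A. Hence its volume is at most 1.\<close>

lemma minkowski_two_valued: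
 fixes N :: "(nat \<Rightarrow> real) \<Rightarrow> real"
 assumes pr: "p \<le> r" and meas: "N \<in> borel_measurable (PB {..<r})"
  and sub: "\<And>x y. N (\<lambda>i. x i + y i) \<le> N x + N y" and hom: "\<And>c x. N (\<lambda>i. c * x i) = \<bar>c\<bar> * N x"
  and ext: "\<And>x y. (\<And>i. i < r \<Longrightarrow> x i = y i) \<Longrightarrow> N x = N y"
  and AT: "0 < A" "A \<le> T"
  and lowA: "\<And>m::nat \<Rightarrow> int. \<exists>i<r. m i \<noteq> (0::int) \<Longrightarrow> A < N (\<lambda>i. of_int (m i))"
  and lowT: "\<And>m::nat \<Rightarrow> int. \<exists>i<r. p \<le> i \<and> m i \<noteq> (0::int) \<Longrightarrow> T < N (\<lambda>i. of_int (m i))"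
 shows "(\<integral>\<^sup>+x. indicator {x. N x \<le> T / 2} x \<partial>PB {..<r}) \<le> ennreal ((T / A) ^ p)"
proof -
 define I where "I = {..<p}"
 define J where "J = {p..<r}"
 define s where "s = T / A"
 have s: "s \<ge> 1" "s > 0" using AT by (auto simp: s_def)
 have IJ: "J \<inter> I = {}" "J \<union> I = {..<r}" "finite I" "finite J" using pr by (auto simp: I_def J_def)
 let ?K = "{x. N x \<le> T / 2}"
 let ?MI = "I \<rightarrow>\<^sub>E (UNIV::int set)" and ?MJ = "J \<rightarrow>\<^sub>E (UNIV::int set)"
 let ?C = "\<lambda>I. {t. \<forall>i\<in>I. 0 \<le> t i \<and> t i < (1::real)}"
 have cI: "countable ?MI" "countable ?MJ" using IJ by (auto intro!: countable_PiE)
 have cube: "(\<integral>\<^sup>+t. indicator (?C L) t \<partial>PB L) \<le> 1" if "finite L" for L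
 proof -
  have "(\<integral>\<^sup>+t. indicator (?C L) t \<partial>PB L) = (\<integral>\<^sup>+t. indicator (PiE L (\<lambda>_. {0..<1})) t \<partial>PB L)"
   by (rule nn_integral_cong) (auto simp: indicator_def space_PiM PiE_iff)
  also have "... = emeasure (PB L) (PiE L (\<lambda>_. {0..<1}))"
   using that by (intro nn_integral_indicator sets_PiM_I_finite) auto
  also have "... = 1" using that by (subst PB.emeasure_PiM) auto
  finally show ?thesis by simp
 qed
 have Nneg: "N (\<lambda>i. x i - y i) \<le> N x + N y" for x y
  using sub[of x "\<lambda>i. - y i"] hom[of "-1" y] by simp
 have fK: "(indicator ?K :: _ \<Rightarrow> ennreal) \<in> borel_measurable (PB (J \<union> I))"
 proof -
  have "{x \<in> space (PB {..<r}). N x \<le> T / 2} \<in> sets (PB {..<r})" using meas by measurable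
  then show ?thesis by (simp add: borel_measurable_indicator_iff IJ(2) Int_def conj_commute)
 qed
 define F where "F y x = (indicator ?K (merge J I (y, x)) :: ennreal)" for x y
 define h where "h y = (\<integral>\<^sup>+x. F y x \<partial>PB I)" for y
 have mm: "merge J I \<in> measurable (PB J \<Otimes>\<^sub>M PB I) (PB (J \<union> I))" by (rule measurable_merge)
 have Fm: "(\<lambda>z. F (fst z) (snd z)) \<in> borel_measurable (PB J \<Otimes>\<^sub>M PB I)"
  unfolding F_def using measurable_compose[OF mm fK] by simp
 interpret I: sigma_finite_measure "PB I" by (rule PB.sigma_finite) fact
 have hm: "h \<in> borel_measurable (PB J)" unfolding h_def using I.borel_measurable_nn_integral_fst[OF Fm] by simp
 have Fsec: "F y \<in> borel_measurable (PB I)" if "y \<in> space (PB J)" for y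
  using measurable_compose[OF measurable_Pair1'[OF that] Fm] by simp
 have mrg: "N (merge J I (y, x)) = N (\<lambda>i. if p \<le> i then y i else x i)" for x y
  by (rule ext) (auto simp: merge_def I_def J_def)
 have key: "(\<integral>\<^sup>+m. h (\<lambda>i\<in>J. y i + of_int (m i)) \<partial>count_space ?MJ) \<le> ennreal (s ^ p)" for y
 proof -
  let ?y = "\<lambda>m::nat \<Rightarrow> int. \<lambda>i\<in>J. y i + of_int (m i)"
  have ysp: "?y m \<in> space (PB J)" for m by (simp add: space_PiM)
  \<comment> \<open>A centre for the homothety in the slice at y + m. For an empty slice the value
    is arbitrary, but then \<open>D m\<close> vanishes everywhere.\<close>
  define c where "c m = (SOME x. N (\<lambda>i. if p \<le> i then y i + of_int (m i) else x i) \<le> T / 2)" for m :: "nat \<Rightarrow> int"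
  \<comment> \<open>The indicator of the shrunken slice: a point x belongs to it if stretching x
    from the centre by s gives a point of the slice.\<close>
  define D where "D m x = F (?y m) (\<lambda>i\<in>I. (1 - s) * c m i + s * x i)" for m x
  have NF: "F (?y m) x = (if N (\<lambda>i. if p \<le> i then y i + of_int (m i) else x i) \<le> T / 2 then 1 else 0)" for m x
  proof -
   have "N (merge J I (?y m, x)) = N (\<lambda>i. if p \<le> i then y i + of_int (m i) else x i)"
    unfolding mrg by (rule ext) (auto simp: J_def)
   then show ?thesis by (simp add: F_def)
  qed
  have ND: "D m x = (if N (\<lambda>i. if p \<le> i then y i + of_int (m i) else (1 - s) * c m i + s * x i) \<le> T / 2 then 1 else 0)" for m x
  proof -
   have "N (\<lambda>i. if p \<le> i then y i + of_int (m i) else (\<lambda>i\<in>I. (1 - s) * c m i + s * x i) i)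
    = N (\<lambda>i. if p \<le> i then y i + of_int (m i) else (1 - s) * c m i + s * x i)"
    by (rule ext) (auto simp: I_def)
   then show ?thesis unfolding D_def NF by simp
  qed
  have Dm: "D m \<in> borel_measurable (PB I)" for m
  proof -
   have "(\<lambda>x. \<lambda>i\<in>I. (1 - s) * c m i + s * x i) \<in> measurable (PB I) (PB I)" by (rule measurable_PBI) measurable
   from measurable_compose[OF this Fsec[OF ysp]] show ?thesis unfolding D_def by simp
  qed
  have hD: "h (?y m) = ennreal (s ^ p) * (\<integral>\<^sup>+x. D m x \<partial>PB I)" for m
   unfolding h_def D_def using nn_integral_PB_affine[OF IJ(3) _ Fsec[OF ysp], of s m "\<lambda>i. (1 - s) * c m i"] s
   by (simp add: I_def)
  have cen: "N (\<lambda>i. if p \<le> i then y i + of_int (m i) else x i) \<le> T / 2"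
    "N (\<lambda>i. if p \<le> i then y i + of_int (m i) else (1 - s) * c m i + s * x i) \<le> T / 2" if "D m x \<noteq> 0" for m x
  proof -
   let ?a = "\<lambda>i. if p \<le> i then y i + of_int (m i) else (1 - s) * c m i + s * x i"
   show a: "N ?a \<le> T / 2" using that unfolding ND by (auto split: if_splits)
   have cm: "N (\<lambda>i. if p \<le> i then y i + of_int (m i) else c m i) \<le> T / 2"
    unfolding c_def by (rule someI[of _ "\<lambda>i. (1 - s) * c m i + s * x i"]) (use a in simp)
   \<comment> \<open>A point of the shrunken slice is the convex combination, with weights 1 - 1/s
     and 1/s, of the centre and of the stretched point, so it stays in K.\<close>
   have "(\<lambda>i. if p \<le> i then y i + of_int (m i) else x i)
     = (\<lambda>i. (1 - 1 / s) * (if p \<le> i then y i + of_int (m i) else c m i) + (1 / s) * ?a i)"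
    using s by (intro HOL.ext) (auto simp: field_simps)
   then have "N (\<lambda>i. if p \<le> i then y i + of_int (m i) else x i)
     \<le> (1 - 1 / s) * N (\<lambda>i. if p \<le> i then y i + of_int (m i) else c m i) + (1 / s) * N ?a"
    using sub[of "\<lambda>i. (1 - 1 / s) * (if p \<le> i then y i + of_int (m i) else c m i)" "\<lambda>i. (1 / s) * ?a i"] s
    unfolding hom by simp
   also have "... \<le> (1 - 1 / s) * (T / 2) + (1 / s) * (T / 2)"
    using cm a s by (intro add_mono mult_left_mono) auto
   also have "... = T / 2" by (simp only: distrib_right[symmetric]) simp
   finally show "N (\<lambda>i. if p \<le> i then y i + of_int (m i) else x i) \<le> T / 2" .
  qed
  have uniq: "m1 = m2 \<and> k1 = k2"
   if "m1 \<in> ?MJ" "m2 \<in> ?MJ" "k1 \<in> ?MI" "k2 \<in> ?MI"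
    "D m1 (\<lambda>i\<in>I. t i + of_int (k1 i)) \<noteq> 0" "D m2 (\<lambda>i\<in>I. t i + of_int (k2 i)) \<noteq> 0" for m1 m2 k1 k2 t
  proof -
   let ?x = "\<lambda>k::nat \<Rightarrow> int. \<lambda>i\<in>I. t i + of_int (k i)"
   let ?z = "\<lambda>(m::nat \<Rightarrow> int) x i. if p \<le> i then y i + of_int (m i) else x i :: real"
   define n where "n i = (if p \<le> i then m1 i - m2 i else k1 i - k2 i)" for i
   have "N (\<lambda>i. n i) = N (\<lambda>i. ?z m1 (?x k1) i - ?z m2 (?x k2) i)"
    by (rule ext) (auto simp: n_def I_def)
   also have "... \<le> T / 2 + T / 2" using Nneg[of "?z m1 (?x k1)" "?z m2 (?x k2)"] cen(1)[OF that(5)] cen(1)[OF that(6)] by simp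
   finally have "\<not> (\<exists>i<r. p \<le> i \<and> n i \<noteq> 0)" using lowT[of n] by auto
   then have "\<forall>i\<in>J. m1 i = m2 i" by (auto simp: n_def J_def)
   then have m: "m1 = m2" using that(1,2) by (intro PiE_ext[of m1 J "\<lambda>_. UNIV"]) auto
   \<comment> \<open>Within a single slice the centre cancels, and the integer difference is 1/s
     times a difference of two points of K.\<close>
   let ?a = "\<lambda>k i. if p \<le> i then y i + of_int (m2 i) else (1 - s) * c m2 i + s * ?x k i"
   have "N (\<lambda>i. n i) = N (\<lambda>i. (1 / s) * (?a k1 i - ?a k2 i))"
    by (rule ext) (use m s in \<open>auto simp: n_def I_def field_simps\<close>)
   also have "... = (1 / s) * N (\<lambda>i. ?a k1 i - ?a k2 i)" using s unfolding hom by simp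
   also have "... \<le> (1 / s) * (T / 2 + T / 2)"
    using Nneg[of "?a k1" "?a k2"] cen(2)[OF that(5)] cen(2)[OF that(6)] s m by (intro mult_left_mono) auto
   also have "... = A" using AT by (simp add: s_def)
   finally have n0: "n i = 0" if "i < r" for i using lowA[of n] that by auto
   have "k1 i = k2 i" if "i \<in> I" for i using n0[of i] that pr by (simp add: n_def I_def)
   then show ?thesis using m that(3,4) by (auto intro!: PiE_ext[of k1 I "\<lambda>_. UNIV"])
  qed
  have le1: "(\<integral>\<^sup>+m. \<integral>\<^sup>+k. D m (\<lambda>i\<in>I. t i + of_int (k i)) \<partial>count_space ?MI \<partial>count_space ?MJ) \<le> 1" for t
  proof (cases "\<exists>m\<in>?MJ. \<exists>k\<in>?MI. D m (\<lambda>i\<in>I. t i + of_int (k i)) \<noteq> 0")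
   case True
   then obtain m0 k0 where mk: "m0 \<in> ?MJ" "k0 \<in> ?MI" "D m0 (\<lambda>i\<in>I. t i + of_int (k0 i)) \<noteq> 0" by blast
   have "(\<integral>\<^sup>+m. \<integral>\<^sup>+k. D m (\<lambda>i\<in>I. t i + of_int (k i)) \<partial>count_space ?MI \<partial>count_space ?MJ)
     \<le> (\<integral>\<^sup>+m. \<integral>\<^sup>+k. indicator {m0} m * indicator {k0} k \<partial>count_space ?MI \<partial>count_space ?MJ)"
   proof (intro nn_integral_mono)
    fix m k assume "m \<in> space (count_space ?MJ)" "k \<in> space (count_space ?MI)"
    then have "D m (\<lambda>i\<in>I. t i + of_int (k i)) \<noteq> 0 \<Longrightarrow> m = m0 \<and> k = k0" using uniq[of m m0 k k0 t] mk by auto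
    moreover have "D m x \<le> 1" for x unfolding ND by simp
    ultimately show "D m (\<lambda>i\<in>I. t i + of_int (k i)) \<le> indicator {m0} m * indicator {k0} k"
     by (cases "D m (\<lambda>i\<in>I. t i + of_int (k i)) = 0") auto
   qed
   also have "... = 1" using mk
    by (simp add: nn_integral_cmult nn_integral_multc emeasure_count_space_finite)
   finally show ?thesis .
  next
   case False
   have "(\<integral>\<^sup>+m. \<integral>\<^sup>+k. D m (\<lambda>i\<in>I. t i + of_int (k i)) \<partial>count_space ?MI \<partial>count_space ?MJ)
     = (\<integral>\<^sup>+m. \<integral>\<^sup>+k. 0 \<partial>count_space ?MI \<partial>count_space ?MJ)"
    by (intro nn_integral_cong) (use False in auto)
   then show ?thesis by simp
  qed
  have shm: "(\<lambda>t. D m (\<lambda>i\<in>I. t i + of_int (k i))) \<in> borel_measurable (PB I)" for m and k :: "nat \<Rightarrow> int"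
   by (rule measurable_compose[OF _ Dm]) (rule measurable_PBI, measurable)
  have Cm: "(indicator (?C I) :: _ \<Rightarrow> ennreal) \<in> borel_measurable (PB I)"
  proof -
   have "?C I \<inter> space (PB I) = PiE I (\<lambda>_. {0..<1})" by (auto simp: space_PiM PiE_iff)
   then show ?thesis using IJ(3) by (simp add: borel_measurable_indicator_iff sets_PiM_I_finite)
  qed
  have inm: "(\<lambda>t. \<integral>\<^sup>+k. D m (\<lambda>i\<in>I. t i + of_int (k i)) \<partial>count_space ?MI) \<in> borel_measurable (PB I)" for m
  proof -
   interpret c: sigma_finite_measure "count_space ?MI" by (rule sigma_finite_measure_count_space_countable[OF cI(1)])
   have "(\<lambda>z. D m (\<lambda>i\<in>I. snd z i + of_int (fst z i))) \<in> borel_measurable (count_space ?MI \<Otimes>\<^sub>M PB I)"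
    by (rule measurable_pair_measure_countable1[OF cI(1)]) (use shm in simp)
   then have "(\<lambda>z. D m (\<lambda>i\<in>I. fst z i + of_int (snd z i))) \<in> borel_measurable (PB I \<Otimes>\<^sub>M count_space ?MI)"
    by (subst measurable_pair_swap_iff) (simp add: case_prod_beta)
   from c.borel_measurable_nn_integral_fst[OF this] show ?thesis by simp
  qed
  have eq: "(\<integral>\<^sup>+m. h (?y m) \<partial>count_space ?MJ) = ennreal (s ^ p) * (\<integral>\<^sup>+m. \<integral>\<^sup>+x. D m x \<partial>PB I \<partial>count_space ?MJ)"
   unfolding hD by (rule nn_integral_cmult) simp
  have "(\<integral>\<^sup>+m. \<integral>\<^sup>+x. D m x \<partial>PB I \<partial>count_space ?MJ) = (\<integral>\<^sup>+m. \<integral>\<^sup>+t. indicator (?C I) t *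
    (\<integral>\<^sup>+k. D m (\<lambda>i\<in>I. t i + of_int (k i)) \<partial>count_space ?MI) \<partial>PB I \<partial>count_space ?MJ)"
   by (intro nn_integral_cong nn_integral_periodize[OF IJ(3) Dm])
  also have "... = (\<integral>\<^sup>+t. \<integral>\<^sup>+m. indicator (?C I) t *
    (\<integral>\<^sup>+k. D m (\<lambda>i\<in>I. t i + of_int (k i)) \<partial>count_space ?MI) \<partial>count_space ?MJ \<partial>PB I)"
   by (rule nn_integral_count_space_nn_integral[OF cI(2), symmetric]) (use Cm inm in auto)
  also have "... \<le> (\<integral>\<^sup>+t. indicator (?C I) t \<partial>PB I)"
  proof (rule nn_integral_mono)
   fix t
   have "(\<integral>\<^sup>+m. indicator (?C I) t * (\<integral>\<^sup>+k. D m (\<lambda>i\<in>I. t i + of_int (k i)) \<partial>count_space ?MI) \<partial>count_space ?MJ)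
    = indicator (?C I) t * (\<integral>\<^sup>+m. \<integral>\<^sup>+k. D m (\<lambda>i\<in>I. t i + of_int (k i)) \<partial>count_space ?MI \<partial>count_space ?MJ)"
    by (rule nn_integral_cmult) simp
   also have "... \<le> indicator (?C I) t * 1" by (rule mult_left_mono[OF le1]) simp
   finally show "(\<integral>\<^sup>+m. indicator (?C I) t * (\<integral>\<^sup>+k. D m (\<lambda>i\<in>I. t i + of_int (k i)) \<partial>count_space ?MI) \<partial>count_space ?MJ)
     \<le> indicator (?C I) t" by simp
  qed
  also have "... \<le> 1" by (rule cube[OF IJ(3)])
  finally have "ennreal (s ^ p) * (\<integral>\<^sup>+m. \<integral>\<^sup>+x. D m x \<partial>PB I \<partial>count_space ?MJ) \<le> ennreal (s ^ p) * 1"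
   by (rule mult_left_mono) simp
  then show ?thesis by (simp only: eq mult_1_right)
 qed
 have "(\<integral>\<^sup>+x. indicator ?K x \<partial>PB {..<r}) = (\<integral>\<^sup>+y. h y \<partial>PB J)"
  using PB.product_nn_integral_fold[OF IJ(1,4,3) fK] unfolding IJ(2) h_def F_def .
 also have "... = (\<integral>\<^sup>+y. indicator (?C J) y * (\<integral>\<^sup>+m. h (\<lambda>i\<in>J. y i + of_int (m i)) \<partial>count_space ?MJ) \<partial>PB J)"
  by (rule nn_integral_periodize[OF IJ(4) hm])
 also have "... \<le> (\<integral>\<^sup>+y. indicator (?C J) y * ennreal (s ^ p) \<partial>PB J)"
  by (intro nn_integral_mono mult_left_mono key) auto
 also have "... = (\<integral>\<^sup>+y. indicator (?C J) y \<partial>PB J) * ennreal (s ^ p)"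
 proof (rule nn_integral_multc)
  have "?C J \<inter> space (PB J) = PiE J (\<lambda>_. {0..<1})" by (auto simp: space_PiM PiE_iff)
  then show "(indicator (?C J) :: _ \<Rightarrow> ennreal) \<in> borel_measurable (PB J)"
   using IJ(4) by (simp add: borel_measurable_indicator_iff sets_PiM_I_finite)
 qed
 also have "... \<le> 1 * ennreal (s ^ p)" by (rule mult_right_mono[OF cube[OF IJ(4)]]) simp
 finally show ?thesis by (simp add: s_def)
qed

text \<open>The coordinate at the omitted place is minus the sum of the others, so this is half the
  l1 norm of the full logarithmic vector, that is, the height.\<close>

definition half_l1 :: "nat \<Rightarrow> (nat \<Rightarrow> real) \<Rightarrow> real" where
 "half_l1 r x = ((\<Sum>i<r. \<bar>x i\<bar>) + \<bar>\<Sum>i<r. x i\<bar>) / 2"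

lemma half_l1_eq: "half_l1 r x = max (\<Sum>i<r. max 0 (x i)) (\<Sum>i<r. max 0 (- x i))"
proof -
 have "(\<Sum>i<r. \<bar>x i\<bar>) = (\<Sum>i<r. max 0 (x i)) + (\<Sum>i<r. max 0 (- x i))"
  unfolding sum.distrib[symmetric] by (rule sum.cong) auto
 moreover have "(\<Sum>i<r. x i) = (\<Sum>i<r. max 0 (x i)) - (\<Sum>i<r. max 0 (- x i))"
  unfolding sum_subtractf[symmetric] by (rule sum.cong) auto
 ultimately show ?thesis unfolding half_l1_def by (auto simp: max_def)
qed

text \<open>The linear substitution compares the ball of radius T/2 for \<open>half_l1\<close>, of
  volume \<open>ball_vol\<close> r (T/2) (T/2), with its preimage in lattice coordinates, to which
  Minkowski's theorem applies.\<close>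

theorem lattice_det_lower:
 fixes \<Lambda> :: "nat \<Rightarrow> nat \<Rightarrow> real" and r :: nat
 defines "N \<equiv> \<lambda>x. half_l1 r (\<lambda>i. \<Sum>j<r. \<Lambda> i j * x j)"
 assumes pr: "p \<le> r" and det: "fdet r \<Lambda> \<noteq> 0" and AT: "0 < A" "A \<le> T"
  and lowA: "\<And>m::nat \<Rightarrow> int. \<exists>i<r. m i \<noteq> (0::int) \<Longrightarrow> A \<le> N (\<lambda>i. of_int (m i))"
  and lowT: "\<And>m::nat \<Rightarrow> int. \<exists>i<r. p \<le> i \<and> m i \<noteq> (0::int) \<Longrightarrow> T \<le> N (\<lambda>i. of_int (m i))"
 shows "fact (2 * r) / fact r ^ 3 * (A / 2) ^ p * (T / 2) ^ (r - p) \<le> \<bar>fdet r \<Lambda>\<bar>"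
proof -
 let ?c = "fact (2 * r) / fact r ^ 3 :: real"
 have meas: "N \<in> borel_measurable (PB {..<r})" unfolding N_def half_l1_def by measurable
 have sub: "N (\<lambda>i. x i + y i) \<le> N x + N y" for x y
 proof -
  define X where "X i = (\<Sum>j<r. \<Lambda> i j * x j)" for i
  define Y where "Y i = (\<Sum>j<r. \<Lambda> i j * y j)" for i
  have "(\<Sum>j<r. \<Lambda> i j * (x j + y j)) = X i + Y i" for i
   unfolding X_def Y_def by (simp add: ring_distribs sum.distrib)
  then have "N (\<lambda>i. x i + y i) = half_l1 r (\<lambda>i. X i + Y i)" "N x = half_l1 r X" "N y = half_l1 r Y"
   unfolding N_def X_def[symmetric] Y_def[symmetric] by simp_all
  moreover have "(\<Sum>i<r. \<bar>X i + Y i\<bar>) \<le> (\<Sum>i<r. \<bar>X i\<bar>) + (\<Sum>i<r. \<bar>Y i\<bar>)"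
   unfolding sum.distrib[symmetric] by (rule sum_mono) simp
  ultimately show ?thesis unfolding half_l1_def sum.distrib by simp
 qed
 have hom: "N (\<lambda>i. c * x i) = \<bar>c\<bar> * N x" for c x
 proof -
  have "(\<Sum>j<r. \<Lambda> i j * (c * x j)) = c * (\<Sum>j<r. \<Lambda> i j * x j)" for i by (simp add: sum_distrib_left mult_ac)
  then show ?thesis unfolding N_def half_l1_def by (simp add: abs_mult sum_distrib_left[symmetric] distrib_left)
 qed
 have ext: "N x = N y" if "\<And>i. i < r \<Longrightarrow> x i = y i" for x y using that unfolding N_def by simp
 \<comment> \<open>Minkowski's theorem requires strict lower bounds; A and T are scaled by \<theta>
   < 1, and \<theta> tends to 1 at the end.\<close>
 have bound: "?c * (\<theta> * T / 2) ^ r * (A / T) ^ p \<le> \<bar>fdet r \<Lambda>\<bar>" if \<theta>: "0 < \<theta>" "\<theta> < 1" for \<theta>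
 proof -
  let ?t = "\<theta> * T / 2"
  have mk: "(\<integral>\<^sup>+x. indicator {x. N x \<le> ?t} x \<partial>PB {..<r}) \<le> ennreal ((\<theta> * T / (\<theta> * A)) ^ p)"
  proof (rule minkowski_two_valued[OF pr meas sub hom ext])
   show "0 < \<theta> * A" "\<theta> * A \<le> \<theta> * T" using \<theta> AT by auto
   show "\<theta> * A < N (\<lambda>i. of_int (m i))" if "\<exists>i<r. m i \<noteq> (0::int)" for m :: "nat \<Rightarrow> int"
    using lowA[OF that] mult_strict_right_mono[OF \<theta>(2) AT(1)] by linarith
   show "\<theta> * T < N (\<lambda>i. of_int (m i))" if "\<exists>i<r. p \<le> i \<and> m i \<noteq> (0::int)" for m :: "nat \<Rightarrow> int"
    using lowT[OF that] mult_strict_right_mono[OF \<theta>(2), of T] AT by linarith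
  qed
  let ?K = "{x. (\<Sum>i<r. max 0 (x i)) \<le> ?t \<and> (\<Sum>i<r. max 0 (- x i)) \<le> ?t} :: (nat \<Rightarrow> real) set"
  have K: "(indicator ?K :: _ \<Rightarrow> ennreal) \<in> borel_measurable (PB {..<r})"
  proof -
   have "{x \<in> space (PB {..<r}). (\<Sum>i<r. max 0 (x i)) \<le> ?t \<and> (\<Sum>i<r. max 0 (- x i)) \<le> ?t} \<in> sets (PB {..<r})"
    by measurable
   then show ?thesis by (simp add: borel_measurable_indicator_iff Int_def conj_commute)
  qed
  have LK: "lin r \<Lambda> x \<in> ?K \<longleftrightarrow> N x \<le> ?t" for x
  proof -
   have "N x = half_l1 r (lin r \<Lambda> x)" unfolding N_def half_l1_def lin_def by simp
   then show ?thesis unfolding half_l1_eq by (simp only: mem_Collect_eq max.bounded_iff)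
  qed
  have "ennreal (ball_vol r ?t ?t) = (\<integral>\<^sup>+x. indicator ?K x \<partial>PB {..<r})"
   using \<theta> AT by (intro emeasure_ball[symmetric]) auto
  also have "... = ennreal \<bar>fdet r \<Lambda>\<bar> * (\<integral>\<^sup>+x. indicator ?K (lin r \<Lambda> x) \<partial>PB {..<r})"
   using lin_subst_nonsingular[OF det] K unfolding lin_subst_def by blast
  also have "(\<integral>\<^sup>+x. indicator ?K (lin r \<Lambda> x) \<partial>PB {..<r}) = (\<integral>\<^sup>+x. indicator {x. N x \<le> ?t} x \<partial>PB {..<r})"
   using LK by (intro nn_integral_cong) (simp add: indicator_def)
  also have "ennreal \<bar>fdet r \<Lambda>\<bar> * ... \<le> ennreal \<bar>fdet r \<Lambda>\<bar> * ennreal ((\<theta> * T / (\<theta> * A)) ^ p)"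
   by (rule mult_left_mono[OF mk]) simp
  also have "... = ennreal (\<bar>fdet r \<Lambda>\<bar> * (T / A) ^ p)" using \<theta> AT by (simp add: ennreal_mult'')
  finally have "ball_vol r ?t ?t \<le> \<bar>fdet r \<Lambda>\<bar> * (T / A) ^ p" using AT by (subst (asm) ennreal_le_iff) auto
  then have "?c * ?t ^ r * (A / T) ^ p \<le> \<bar>fdet r \<Lambda>\<bar> * (T / A) ^ p * (A / T) ^ p"
   unfolding ball_vol_diag using AT by (intro mult_right_mono) auto
  also have "... = \<bar>fdet r \<Lambda>\<bar>" using AT by (simp add: mult.assoc flip: power_mult_distrib)
  finally show ?thesis .
 qed
 have "((\<lambda>\<theta>. ?c * (\<theta> * T / 2) ^ r * (A / T) ^ p) \<longlongrightarrow> ?c * (1 * T / 2) ^ r * (A / T) ^ p) (at_left 1)"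
  using AT by (intro tendsto_intros) auto
 moreover have "\<forall>\<^sub>F \<theta> in at_left 1. ?c * (\<theta> * T / 2) ^ r * (A / T) ^ p \<le> \<bar>fdet r \<Lambda>\<bar>"
 proof -
  have "\<forall>\<^sub>F \<theta> in at_left (1::real). \<theta> \<in> {0<..<1}" by (rule eventually_at_left_real) simp
  then show ?thesis by (rule eventually_mono) (use bound in auto)
 qed
 ultimately have "?c * (1 * T / 2) ^ r * (A / T) ^ p \<le> \<bar>fdet r \<Lambda>\<bar>"
  by (rule tendsto_upperbound) simp
 moreover have "(1 * T / 2) ^ r * (A / T) ^ p = (A / 2) ^ p * (T / 2) ^ (r - p)"
 proof -
  have "(T / 2) ^ r = (T / 2) ^ p * (T / 2) ^ (r - p)" using pr by (simp flip: power_add)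
  moreover have "(T / 2) ^ p * (A / T) ^ p = (A / 2) ^ p" using AT by (simp flip: power_mult_distrib)
  ultimately show ?thesis by (simp add: mult_ac)
 qed
 ultimately show ?thesis by (simp add: mult.assoc)
qed

section \<open>An energy inequality for points of the plane\<close>

lemma ln_cmod_one_minus_sums:
 assumes "cmod z < 1"
 shows "(\<lambda>n. Re (- (z ^ Suc n) / of_nat (Suc n))) sums ln (cmod (1 - z))"
proof -
 have "(\<lambda>n. (-1) ^ Suc n / of_nat n * (- z) ^ n) sums Ln (1 + - z)"
  by (rule Ln_series) (use assms in simp)
 then have "(\<lambda>n. (-1) ^ Suc (Suc n) / of_nat (Suc n) * (- z) ^ Suc n) sums Ln (1 - z)"
  using sums_Suc_iff[of "\<lambda>n. (-1) ^ Suc n / of_nat n * (- z) ^ n" "Ln (1 - z)"] by simp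
 moreover have "(-1) ^ Suc (Suc n) / of_nat (Suc n) * (- z) ^ Suc n = - (z ^ Suc n) / of_nat (Suc n)" for n
 proof -
  have "(- z) ^ Suc n = (-1) ^ Suc n * z ^ Suc n" by (metis mult_minus1 power_mult_distrib)
  moreover have "(-1) ^ Suc (Suc n) * ((-1) ^ Suc n * w) = - (w::complex)" for w
  proof -
   have "(-1) ^ Suc (Suc n) * (-1) ^ Suc n = ((-1) ^ (Suc (Suc n) + Suc n) :: complex)" by (simp only: power_add)
   also have "... = -1" by simp
   finally show ?thesis by (simp only: mult.assoc[symmetric]) simp
  qed
  ultimately show ?thesis by (simp only: times_divide_eq_left)
 qed
 ultimately have "(\<lambda>n. - (z ^ Suc n) / of_nat (Suc n)) sums Ln (1 - z)" by (simp only:)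
 then have "(\<lambda>n. Re (- (z ^ Suc n) / of_nat (Suc n))) sums Re (Ln (1 - z))" by (rule sums_Re)
 moreover have "1 - z \<noteq> 0" using assms by auto
 ultimately show ?thesis by simp
qed

text \<open>Expanding the logarithm, the double sum becomes minus the sum over n of r^n / n times
  the squared modulus of the n-th weighted power sum of the points.\<close>

lemma energy_disc_nonpos:
 fixes z :: "'i \<Rightarrow> complex" and w :: "'i \<Rightarrow> real" and r :: real
 assumes I: "finite I" and z: "\<And>i. i \<in> I \<Longrightarrow> cmod (z i) \<le> 1" and r: "0 \<le> r" "r < 1"
 shows "(\<Sum>i\<in>I. \<Sum>j\<in>I. w i * w j * ln (cmod (1 - r * z i * cnj (z j)))) \<le> 0"
proof -
 have lt: "cmod (r * z i * cnj (z j)) < 1" if "i \<in> I" "j \<in> I" for i j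
 proof -
  have "cmod (z i) * cmod (z j) \<le> 1" using z that by (intro mult_le_one) auto
  then have "r * (cmod (z i) * cmod (z j)) \<le> r * 1" using r by (intro mult_left_mono) auto
  then show ?thesis using r by (simp add: norm_mult mult.assoc)
 qed
 let ?t = "\<lambda>n i j. w i * w j * Re (- ((r * z i * cnj (z j)) ^ Suc n) / of_nat (Suc n))"
 have s: "(\<lambda>n. \<Sum>i\<in>I. \<Sum>j\<in>I. ?t n i j) sums (\<Sum>i\<in>I. \<Sum>j\<in>I. w i * w j * ln (cmod (1 - r * z i * cnj (z j))))"
  by (intro sums_sum sums_mult ln_cmod_one_minus_sums lt)
 have "(\<Sum>i\<in>I. \<Sum>j\<in>I. ?t n i j) \<le> 0" for n
 proof -
  define S where "S = (\<Sum>i\<in>I. of_real (w i) * z i ^ Suc n)"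
  have "(\<Sum>i\<in>I. \<Sum>j\<in>I. ?t n i j) = Re (\<Sum>i\<in>I. \<Sum>j\<in>I. of_real (- (r ^ Suc n) / real (Suc n)) *
    ((of_real (w i) * z i ^ Suc n) * cnj (of_real (w j) * z j ^ Suc n)))"
   unfolding Re_sum
  proof (intro sum.cong refl)
   fix i j
   have "of_real (w i * w j) * (- ((r * z i * cnj (z j)) ^ Suc n) / of_nat (Suc n))
    = of_real (- (r ^ Suc n) / real (Suc n)) * ((of_real (w i) * z i ^ Suc n) * cnj (of_real (w j) * z j ^ Suc n))"
    by (simp add: power_mult_distrib mult_ac del: of_nat_Suc power_Suc)
   from this[symmetric] show "?t n i j = Re (of_real (- (r ^ Suc n) / real (Suc n)) * ((of_real (w i) * z i ^ Suc n) * cnj (of_real (w j) * z j ^ Suc n)))"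
    by (simp only: times_complex.sel[of "of_real (w i * w j)"] Re_complex_of_real Im_complex_of_real mult_zero_left diff_zero)
  qed
  also have "(\<Sum>i\<in>I. \<Sum>j\<in>I. of_real (- (r ^ Suc n) / real (Suc n)) *
    ((of_real (w i) * z i ^ Suc n) * cnj (of_real (w j) * z j ^ Suc n))) = of_real (- (r ^ Suc n) / real (Suc n)) * (S * cnj S)"
   unfolding S_def cnj_sum sum_product by (simp only: sum_distrib_left)
  also have "Re ... = - (r ^ Suc n) / real (Suc n) * (cmod S)\<^sup>2"
   unfolding complex_norm_square[symmetric] by (simp only: of_real_mult[symmetric] Re_complex_of_real)
  also have "... \<le> 0" using r by (intro mult_nonpos_nonneg divide_nonpos_pos) auto
  finally show ?thesis .
 qed
 then show ?thesis using sums_le[OF _ s sums_zero] by simp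
qed

text \<open>The constant 2 / (1 + r) is optimal: equality holds at z = -1.\<close>

lemma cmod_one_minus_le:
 fixes r :: real and z :: complex
 assumes "cmod z \<le> 1" "0 \<le> r" "r \<le> 1"
 shows "cmod (1 - z) \<le> 2 / (1 + r) * cmod (1 - r * z)"
proof -
 obtain a b where z: "z = Complex a b" by (cases z)
 have ab: "a\<^sup>2 + b\<^sup>2 \<le> 1" using assms(1) by (simp add: z cmod_def real_sqrt_le_1_iff)
 \<comment> \<open>This product is the difference of the two squared sides after clearing 1 + r; the
   identity is verified below.\<close>
 have "(1 - r) * (2 * a * (1 - r) + (3 + r) - (a\<^sup>2 + b\<^sup>2) * (1 + 3 * r)) \<ge> 0"
 proof (intro mult_nonneg_nonneg)
  have "a\<^sup>2 \<le> 1" using ab by (smt (verit) zero_le_power2)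
  then have a: "-1 \<le> a" using abs_square_le_1[of a] by simp
  have "2 * a * (1 - r) \<ge> -2 * (1 - r)" using a assms(3) mult_right_mono[of "-2" "2 * a" "1 - r"] by simp
  moreover have "(a\<^sup>2 + b\<^sup>2) * (1 + 3 * r) \<le> 1 * (1 + 3 * r)" using ab assms(2) by (intro mult_right_mono) auto
  ultimately show "2 * a * (1 - r) + (3 + r) - (a\<^sup>2 + b\<^sup>2) * (1 + 3 * r) \<ge> 0" by (simp add: algebra_simps)
 qed (use assms in auto)
 moreover have "4 * ((1 - r * a)\<^sup>2 + (r * b)\<^sup>2) - (1 + r)\<^sup>2 * ((1 - a)\<^sup>2 + b\<^sup>2)
  = (1 - r) * (2 * a * (1 - r) + (3 + r) - (a\<^sup>2 + b\<^sup>2) * (1 + 3 * r))" by (simp add: power2_eq_square algebra_simps)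
 ultimately have "(1 + r)\<^sup>2 * ((1 - a)\<^sup>2 + b\<^sup>2) \<le> 4 * ((1 - r * a)\<^sup>2 + (r * b)\<^sup>2)" by simp
 moreover have "(cmod (1 - z))\<^sup>2 = (1 - a)\<^sup>2 + b\<^sup>2" "(cmod (1 - r * z))\<^sup>2 = (1 - r * a)\<^sup>2 + (r * b)\<^sup>2"
  by (simp_all add: z cmod_power2)
 ultimately have "((1 + r) * cmod (1 - z))\<^sup>2 \<le> (2 * cmod (1 - r * z))\<^sup>2" by (simp add: power_mult_distrib)
 then have "(1 + r) * cmod (1 - z) \<le> 2 * cmod (1 - r * z)" by (rule power2_le_imp_le) simp
 then show ?thesis using assms(2) by (simp add: field_simps)
qed

definition reflect :: "complex \<Rightarrow> complex" where
 "reflect x = (if cmod x \<le> 1 then x else 1 / cnj x)"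

lemma cmod_reflect: "cmod (reflect x) \<le> 1"
 unfolding reflect_def by (auto simp: norm_divide divide_le_eq_1)

text \<open>The difference of the squares is (1 - |x|^2) (1 - |y|^2).\<close>

lemma cmod_diff_le_cmod_one_minus:
 assumes "cmod x \<le> 1" "cmod y \<le> 1"
 shows "cmod (x - y) \<le> cmod (1 - x * cnj y)"
proof -
 obtain a b where x: "x = Complex a b" by (cases x)
 obtain c e where y: "y = Complex c e" by (cases y)
 have "(cmod x)\<^sup>2 \<le> 1" "(cmod y)\<^sup>2 \<le> 1" using assms by (simp_all add: power_le_one)
 then have "0 \<le> (1 - (a\<^sup>2 + b\<^sup>2)) * (1 - (c\<^sup>2 + e\<^sup>2))" by (simp add: x y cmod_power2)
 then have "(cmod (x - y))\<^sup>2 \<le> (cmod (1 - x * cnj y))\<^sup>2"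
  unfolding x y cmod_power2 by (simp add: power2_eq_square algebra_simps)
 then show ?thesis by (rule power2_le_imp_le) simp
qed

text \<open>Moving a point from outside the unit disc to its mirror image costs a factor equal to
  its modulus. If exactly one of the points lies outside, this is an equality.\<close>

lemma cmod_diff_le_reflect:
 "cmod (x - y) \<le> max 1 (cmod x) * max 1 (cmod y) * cmod (1 - reflect x * cnj (reflect y))"
proof -
 consider "cmod x \<le> 1" "cmod y \<le> 1" | "cmod x > 1" "cmod y \<le> 1" | "cmod x \<le> 1" "cmod y > 1" | "cmod x > 1" "cmod y > 1"
  by linarith
 then show ?thesis
 proof cases
  case 1
  then show ?thesis using cmod_diff_le_cmod_one_minus[of x y] by (simp add: reflect_def max_def)
 next
  case 2
  then have "x \<noteq> 0" by auto
  have "cmod x * cmod (1 - 1 / cnj x * cnj y) = cmod (cnj x * (1 - 1 / cnj x * cnj y))" by (simp only: norm_mult complex_mod_cnj)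
  also have "cnj x * (1 - 1 / cnj x * cnj y) = cnj (x - y)" using \<open>x \<noteq> 0\<close> by (simp add: algebra_simps)
  finally show ?thesis using 2 by (simp add: reflect_def max_def del: complex_cnj_diff)
 next
  case 3
  then have "y \<noteq> 0" by auto
  have "cmod y * cmod (1 - x * cnj (1 / cnj y)) = cmod (y * (1 - x * cnj (1 / cnj y)))" by (simp only: norm_mult)
  also have "y * (1 - x * cnj (1 / cnj y)) = y - x" using \<open>y \<noteq> 0\<close> by (simp add: algebra_simps)
  finally show ?thesis using 3 by (simp add: reflect_def max_def norm_minus_commute)
 next
  case 4
  then have nz: "x \<noteq> 0" "y \<noteq> 0" by auto
  have "x - y = x * y * (1 / y - 1 / x)" using nz by (simp add: algebra_simps)
  then have "cmod (x - y) = cmod x * cmod y * cmod (1 / y - 1 / x)" by (simp only: norm_mult)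
  also have "cmod (1 / y - 1 / x) \<le> cmod (1 - 1 / y * cnj (1 / x))"
   by (rule cmod_diff_le_cmod_one_minus) (use 4 in \<open>auto simp: norm_divide divide_le_eq_1\<close>)
  also have "1 - 1 / y * cnj (1 / x) = 1 - reflect x * cnj (reflect y)" using 4 by (simp add: reflect_def)
  finally show ?thesis using 4 by (simp add: max_def mult_left_mono)
 qed
qed

text \<open>Reflect all points into the unit disc, which costs the Mahler term, and replace 1 - z by
  1 - r z, which costs the factor 1 + \<tau> = 2 / (1 + r) per pair. The completed double sum is
  nonpositive by \<open>energy_disc_nonpos\<close>, and the diagonal terms removed from it
  contribute at most Q ln (1 / (1 - r)).\<close>

theorem energy_bound:
 fixes z :: "'i \<Rightarrow> complex" and w :: "'i \<Rightarrow> real"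
 assumes I: "finite I" and inj: "inj_on z I" and w: "\<And>i. i \<in> I \<Longrightarrow> w i \<ge> 0" and Q0: "Q > 0"
 defines "W \<equiv> \<Sum>i\<in>I. w i" 
 assumes Q: "Q = (\<Sum>i\<in>I. (w i)\<^sup>2)"
 shows "(\<Sum>i\<in>I. \<Sum>j\<in>I - {i}. w i * w j * ln (cmod (z i - z j)))
  \<le> 2 * W * (\<Sum>i\<in>I. w i * ln (max 1 (cmod (z i)))) + Q * (1 + ln ((W\<^sup>2 + Q) / (2 * Q)))"
proof -
 \<comment> \<open>With this choice the total cost of the factors 1 + \<tau>, at most W^2 \<tau>,
   equals Q and matches the scale of the diagonal term; r is the solution of 2 / (1 + r) = 1 +
   \<tau>.\<close>
 define \<tau> where "\<tau> = Q / W\<^sup>2"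
 define r where "r = (1 - \<tau>) / (1 + \<tau>)"
 have QW: "Q \<le> W\<^sup>2"
 proof -
  have "Q = (\<Sum>i\<in>I. w i * w i)" unfolding Q by (simp add: power2_eq_square)
  also have "... \<le> (\<Sum>i\<in>I. w i * W)"
   unfolding W_def using I w by (intro sum_mono mult_left_mono member_le_sum) auto
  also have "... = W\<^sup>2" by (simp add: W_def sum_distrib_right power2_eq_square)
  finally show ?thesis .
 qed
 have W2: "W\<^sup>2 > 0" using QW Q0 by linarith
 have \<tau>: "0 < \<tau>" "\<tau> \<le> 1" using QW Q0 W2 by (auto simp: \<tau>_def)
 have r: "0 \<le> r" "r < 1" using \<tau> by (auto simp: r_def)
 have r1: "2 / (1 + r) = 1 + \<tau>" "1 / (1 - r) = (W\<^sup>2 + Q) / (2 * Q)"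
 proof -
  have "1 + r = 2 / (1 + \<tau>)" "1 - r = 2 * \<tau> / (1 + \<tau>)" using \<tau> by (auto simp: r_def field_simps)
  moreover have "(1 + \<tau>) / (2 * \<tau>) = (W\<^sup>2 + Q) / (2 * Q)" using Q0 W2 by (simp add: \<tau>_def divide_simps) algebra
  ultimately show "2 / (1 + r) = 1 + \<tau>" "1 / (1 - r) = (W\<^sup>2 + Q) / (2 * Q)" by simp_all
 qed
 define l where "l i = ln (max 1 (cmod (z i)))" for i
 define e where "e i j = ln (cmod (1 - r * reflect (z i) * cnj (reflect (z j))))" for i j
 have nz: "cmod (1 - r * reflect (z i) * cnj (reflect (z j))) > 0" for i j
 proof -
  have "cmod (reflect (z i)) * cmod (reflect (z j)) \<le> 1" using cmod_reflect by (intro mult_le_one) auto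
  then have "cmod (r * reflect (z i) * cnj (reflect (z j))) \<le> r"
   using mult_left_mono[of "cmod (reflect (z i)) * cmod (reflect (z j))" 1 r] r by (simp add: norm_mult mult.assoc)
  then have "r * reflect (z i) * cnj (reflect (z j)) \<noteq> 1" using r by auto
  then show ?thesis by simp
 qed
 have pair: "w i * w j * ln (cmod (z i - z j)) \<le> w i * w j * (l i + l j) + w i * w j * \<tau> + w i * w j * e i j"
  if "i \<in> I" "j \<in> I" "i \<noteq> j" for i j
 proof -
  have "z i \<noteq> z j" using inj that by (auto dest: inj_onD)
  then have pos: "cmod (z i - z j) > 0" by simp
  have "cmod (z i - z j) \<le> max 1 (cmod (z i)) * max 1 (cmod (z j)) * cmod (1 - reflect (z i) * cnj (reflect (z j)))"
   by (rule cmod_diff_le_reflect)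
  also have "... \<le> max 1 (cmod (z i)) * max 1 (cmod (z j)) * (2 / (1 + r) * cmod (1 - r * (reflect (z i) * cnj (reflect (z j)))))"
   using r cmod_reflect by (intro mult_left_mono cmod_one_minus_le) (auto simp: norm_mult intro!: mult_le_one)
  also have "... = max 1 (cmod (z i)) * max 1 (cmod (z j)) * ((1 + \<tau>) * cmod (1 - r * reflect (z i) * cnj (reflect (z j))))"
   by (simp only: r1 mult.assoc)
  finally have "ln (cmod (z i - z j)) \<le> ln (max 1 (cmod (z i)) * max 1 (cmod (z j)) * ((1 + \<tau>) * cmod (1 - r * reflect (z i) * cnj (reflect (z j)))))"
   using pos by (meson ln_mono)
  also have "... = l i + l j + (ln (1 + \<tau>) + e i j)"
   unfolding l_def e_def
  proof -
   have "max 1 (cmod x) > 0" for x by (simp add: less_max_iff_disj)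
   then show "ln (max 1 (cmod (z i)) * max 1 (cmod (z j)) * ((1 + \<tau>) * cmod (1 - r * reflect (z i) * cnj (reflect (z j)))))
    = ln (max 1 (cmod (z i))) + ln (max 1 (cmod (z j))) + (ln (1 + \<tau>) + ln (cmod (1 - r * reflect (z i) * cnj (reflect (z j)))))"
    using \<tau> nz[of i j] by (simp only: ln_mult_pos mult_pos_pos add_pos_pos zero_less_one)
  qed
  also have "... \<le> l i + l j + (\<tau> + e i j)" using ln_add_one_self_le_self[of \<tau>] \<tau> by simp
  finally have "w i * w j * ln (cmod (z i - z j)) \<le> w i * w j * (l i + l j + (\<tau> + e i j))"
   using w that by (intro mult_left_mono) auto
  then show ?thesis by (simp add: algebra_simps)
 qed
 have l0: "l i \<ge> 0" for i unfolding l_def by simp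
 have "(\<Sum>i\<in>I. \<Sum>j\<in>I - {i}. w i * w j * ln (cmod (z i - z j)))
  \<le> (\<Sum>i\<in>I. \<Sum>j\<in>I - {i}. w i * w j * (l i + l j) + w i * w j * \<tau> + w i * w j * e i j)"
  using pair by (intro sum_mono) auto
 also have "... = (\<Sum>i\<in>I. (\<Sum>j\<in>I. w i * w j * (l i + l j) + w i * w j * \<tau> + w i * w j * e i j)
   - (w i * w i * (l i + l i) + w i * w i * \<tau> + w i * w i * e i i))"
  using I by (intro sum.cong refl) (simp add: sum_diff1)
 also have "... = (\<Sum>i\<in>I. \<Sum>j\<in>I. w i * w j * (l i + l j)) + (\<Sum>i\<in>I. \<Sum>j\<in>I. w i * w j * \<tau>) + (\<Sum>i\<in>I. \<Sum>j\<in>I. w i * w j * e i j)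
   - (\<Sum>i\<in>I. w i * w i * (l i + l i)) - (\<Sum>i\<in>I. w i * w i * \<tau>) - (\<Sum>i\<in>I. w i * w i * e i i)"
  by (simp add: sum.distrib sum_subtractf)
 also have "(\<Sum>i\<in>I. \<Sum>j\<in>I. w i * w j * (l i + l j)) = 2 * W * (\<Sum>i\<in>I. w i * l i)"
 proof -
  have "(\<Sum>i\<in>I. \<Sum>j\<in>I. w i * w j * (l i + l j)) = (\<Sum>i\<in>I. \<Sum>j\<in>I. (w i * l i) * w j) + (\<Sum>i\<in>I. \<Sum>j\<in>I. w i * (w j * l j))"
   unfolding sum.distrib[symmetric] by (intro sum.cong) (auto simp: algebra_simps)
  then show ?thesis unfolding sum_product[symmetric] by (simp add: W_def)
 qed
 also have "(\<Sum>i\<in>I. \<Sum>j\<in>I. w i * w j * \<tau>) = W\<^sup>2 * \<tau>"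
  unfolding W_def power2_eq_square sum_product by (simp only: sum_distrib_right)
 also have "W\<^sup>2 * \<tau> = Q" using W2 by (simp add: \<tau>_def)
 also have "(\<Sum>i\<in>I. w i * w i * \<tau>) = Q * \<tau>" unfolding Q by (simp add: sum_distrib_right power2_eq_square)
 finally have main: "(\<Sum>i\<in>I. \<Sum>j\<in>I - {i}. w i * w j * ln (cmod (z i - z j)))
  \<le> 2 * W * (\<Sum>i\<in>I. w i * l i) + Q + (\<Sum>i\<in>I. \<Sum>j\<in>I. w i * w j * e i j)
   - (\<Sum>i\<in>I. w i * w i * (l i + l i)) - Q * \<tau> - (\<Sum>i\<in>I. w i * w i * e i i)" .
 have "(\<Sum>i\<in>I. \<Sum>j\<in>I. w i * w j * e i j) \<le> 0"
  unfolding e_def by (rule energy_disc_nonpos[where z = "\<lambda>i. reflect (z i)", OF I cmod_reflect r])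
 moreover have "(\<Sum>i\<in>I. w i * w i * (l i + l i)) \<ge> 0" using l0 by (intro sum_nonneg) auto
 moreover have "Q * \<tau> \<ge> 0" using Q0 \<tau> by simp
 moreover have "- (\<Sum>i\<in>I. w i * w i * e i i) \<le> Q * ln ((W\<^sup>2 + Q) / (2 * Q))"
 proof -
  have "- e i i \<le> ln ((W\<^sup>2 + Q) / (2 * Q))" for i
  proof -
   have "1 - r \<le> 1 - r * (cmod (reflect (z i)))\<^sup>2"
    using r cmod_reflect[of "z i"] mult_left_mono[of "(cmod (reflect (z i)))\<^sup>2" 1 r] by (simp add: power_le_one)
   also have "... = Re (1 - r * reflect (z i) * cnj (reflect (z i)))"
    by (simp add: mult.assoc complex_norm_square[symmetric] flip: of_real_mult of_real_power)
   also have "... \<le> cmod (1 - r * reflect (z i) * cnj (reflect (z i)))" by (rule complex_Re_le_cmod)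
   finally have "ln (1 - r) \<le> e i i" unfolding e_def using r nz[of i i] by (subst ln_le_cancel_iff) auto
   moreover have "ln (1 / (1 - r)) = - ln (1 - r)" using r by (simp add: ln_div)
   ultimately show ?thesis unfolding r1(2)[symmetric] by simp
  qed
  then have "(\<Sum>i\<in>I. w i * w i * - e i i) \<le> (\<Sum>i\<in>I. w i * w i * ln ((W\<^sup>2 + Q) / (2 * Q)))"
   by (intro sum_mono mult_left_mono) auto
  then show ?thesis by (simp add: sum_negf Q sum_distrib_right power2_eq_square)
 qed
 ultimately show ?thesis using main unfolding l_def by (simp add: distrib_left)
qed

section \<open>Galois orbits of algebraic integers\<close>

lemma prime_dvd_power_add:
 fixes u v :: "'a::comm_ring_1"
 assumes "prime p"
 shows "of_nat p dvd (u + v) ^ p - u ^ p - v ^ p"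
proof -
 have p: "p > 1" using assms by (rule prime_gt_1_nat)
 have split: "{..p} = insert 0 (insert p {0<..<p})" using p by auto
 have "(u + v) ^ p = (\<Sum>k\<le>p. of_nat (p choose k) * u ^ k * v ^ (p - k))" by (rule binomial_ring)
 also have "... = v ^ p + (u ^ p + (\<Sum>k\<in>{0<..<p}. of_nat (p choose k) * u ^ k * v ^ (p - k)))"
  unfolding split using p by simp
 finally have "(u + v) ^ p - u ^ p - v ^ p = (\<Sum>k\<in>{0<..<p}. of_nat (p choose k) * u ^ k * v ^ (p - k))" by simp
 also have "of_nat p dvd ..."
 proof (rule dvd_sum)
  fix k assume "k \<in> {0<..<p}"
  then have "p dvd (p choose k)" using assms by (intro dvd_choose_prime) auto
  then obtain c where "p choose k = p * c" by auto
  then show "of_nat p dvd of_nat (p choose k) * u ^ k * v ^ (p - k)" by (simp add: mult.assoc)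
 qed
 finally show ?thesis .
qed

lemma prime_dvd_power_diff:
 assumes "prime p"
 shows "int p dvd a ^ p - a"
proof -
 have p: "p > 0" using assms by (rule prime_gt_0_nat)
 have nat: "int p dvd int m ^ p - int m" for m
 proof (induction m)
  case 0
  then show ?case using p by (simp add: zero_power)
 next
  case (Suc m)
  have "int (Suc m) ^ p - int (Suc m) = ((int m + 1) ^ p - int m ^ p - 1 ^ p) + (int m ^ p - int m)" by (simp add: add.commute)
  then show ?case using prime_dvd_power_add[OF assms, of "int m" 1] Suc by (simp only: dvd_add of_nat_id of_nat_eq_id id_apply)
 qed
 show ?thesis
 proof (cases "a \<ge> 0")
  case True
  then show ?thesis using nat[of "nat a"] by simp
 next
  case False
  have "int p dvd - (a ^ p) - (- a) ^ p" using prime_dvd_power_add[OF assms, of a "- a"] by (simp add: zero_power p)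
  moreover have "int p dvd (- a) ^ p - (- a)" using nat[of "nat (- a)"] False by simp
  ultimately have "int p dvd (- (a ^ p) - (- a) ^ p) + ((- a) ^ p - (- a))" by (rule dvd_add)
  then have "int p dvd - (a ^ p - a)" by simp
  then show ?thesis by (simp only: dvd_minus_iff)
 qed
qed

text \<open>Modulo p the p-th power is additive and, by Fermat, fixes the integer coefficients. The
  induction peels off the constant coefficient.\<close>

lemma pcompose_power_cong:
 fixes g :: "int poly"
 assumes "prime p"
 shows "of_nat p dvd pcompose g ([:0, 1:] ^ p) - g ^ p"
proof (induction g)
 case 0
 then show ?case using prime_gt_0_nat[OF assms] by (simp add: zero_power)
next
 case (pCons a g)
 let ?q = "[:0, 1:] ^ p :: int poly"
 have "pCons a g = [:a:] + [:0, 1:] * g" by simp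
 then have d1: "of_nat p dvd (pCons a g) ^ p - [:a:] ^ p - ([:0, 1:] * g) ^ p"
  using prime_dvd_power_add[OF assms, of "[:a:]" "[:0, 1:] * g"] by simp
 have d2: "of_nat p dvd [:a:] ^ p - [:a:]"
 proof -
  obtain c where "a ^ p - a = int p * c" using prime_dvd_power_diff[OF assms, of a] by auto
  then have "[:a:] ^ p - [:a:] = of_nat p * [:c:]" by (simp add: poly_const_pow of_nat_poly)
  then show ?thesis by (rule dvdI)
 qed
 have d3: "of_nat p dvd ?q * (pcompose g ?q - g ^ p)" using pCons.IH by (rule dvd_mult)
 have "([:0, 1:] * g) ^ p = ?q * g ^ p" by (rule power_mult_distrib)
 then have eq: "?q * (pcompose g ?q - g ^ p) - ((pCons a g) ^ p - [:a:] ^ p - ([:0, 1:] * g) ^ p) - ([:a:] ^ p - [:a:])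
   = pcompose (pCons a g) ?q - (pCons a g) ^ p"
  by (simp only: pcompose_pCons) (simp add: algebra_simps)
 show ?case using dvd_diff[OF dvd_diff[OF d3 d1] d2] unfolding eq .
qed

text \<open>The logarithmic Mahler measure of the monic polynomial whose simple roots are the
  elements of S.\<close>

definition log_mahler :: "complex set \<Rightarrow> real" where
 "log_mahler S = (\<Sum>x\<in>S. ln (max 1 (cmod x)))"

text \<open>L plays a Galois number field inside the complex numbers and G its automorphisms. The
  members of G are functions on all complex numbers of which only the values on L matter, so
  composition and inverses are postulated pointwise on L.\<close>

locale galois_system =
 fixes L :: "complex set" and G :: "(complex \<Rightarrow> complex) set"
 assumes subfield_L: "is_subfield L"
  and maps: "\<And>g x. g \<in> G \<Longrightarrow> x \<in> L \<Longrightarrow> g x \<in> L"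
  and g_one: "\<And>g. g \<in> G \<Longrightarrow> g 1 = 1"
  and g_diff: "\<And>g x y. g \<in> G \<Longrightarrow> x \<in> L \<Longrightarrow> y \<in> L \<Longrightarrow> g (x - y) = g x - g y"
  and g_mult: "\<And>g x y. g \<in> G \<Longrightarrow> x \<in> L \<Longrightarrow> y \<in> L \<Longrightarrow> g (x * y) = g x * g y"
  and g_inj: "\<And>g x y. g \<in> G \<Longrightarrow> x \<in> L \<Longrightarrow> y \<in> L \<Longrightarrow> g x = g y \<Longrightarrow> x = y"
  and g_comp: "\<And>g h. g \<in> G \<Longrightarrow> h \<in> G \<Longrightarrow> \<exists>f\<in>G. \<forall>x\<in>L. f x = g (h x)"
  and g_right_inv: "\<And>g. g \<in> G \<Longrightarrow> \<exists>h\<in>G. \<forall>x\<in>L. g (h x) = x"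
  and fixed_rational: "\<And>x. x \<in> L \<Longrightarrow> (\<And>g. g \<in> G \<Longrightarrow> g x = x) \<Longrightarrow> x \<in> \<rat>"
begin

sublocale L: subfield L by standard (rule subfield_L)

lemma g_power: "g \<in> G \<Longrightarrow> x \<in> L \<Longrightarrow> g (x ^ n) = g x ^ n"
 by (induction n) (auto simp: g_one g_mult L.power_in)

lemma g_prod: "g \<in> G \<Longrightarrow> (\<And>i. i \<in> I \<Longrightarrow> f i \<in> L) \<Longrightarrow> g (prod f I) = (\<Prod>i\<in>I. g (f i))"
 by (induction I rule: infinite_finite_induct) (auto simp: g_one g_mult L.prod_in)

lemma g_zero: "g \<in> G \<Longrightarrow> g 0 = 0" using g_diff[of g 0 0] L.zero_in by simp

lemma g_add: "g \<in> G \<Longrightarrow> x \<in> L \<Longrightarrow> y \<in> L \<Longrightarrow> g (x + y) = g x + g y"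
 using g_diff[of g x "- y"] g_diff[of g 0 y] g_zero[of g] L.zero_in L.uminus_in by simp

lemma g_sum: "g \<in> G \<Longrightarrow> (\<And>i. i \<in> I \<Longrightarrow> f i \<in> L) \<Longrightarrow> g (sum f I) = (\<Sum>i\<in>I. g (f i))"
 by (induction I rule: infinite_finite_induct) (auto simp: g_zero g_add L.sum_in)

lemma g_of_int: "g \<in> G \<Longrightarrow> g (of_int a) = of_int a"
proof -
 assume g: "g \<in> G"
 have nat: "g (of_nat n) = of_nat n" for n
  by (induction n) (auto simp: g_zero g_one g_add g L.of_nat_in L.one_in)
 then show ?thesis
  by (cases a rule: int_cases2) (use g_diff[OF g L.zero_in L.of_nat_in] g_zero[OF g] nat in auto)
qed

lemma g_left_inv:
 assumes g: "g \<in> G"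
 obtains h where "h \<in> G" "\<And>x. x \<in> L \<Longrightarrow> h (g x) = x"
proof -
 obtain h where h: "h \<in> G" "\<forall>x\<in>L. g (h x) = x" using g_right_inv[OF g] by blast
 have "h (g x) = x" if x: "x \<in> L" for x
 proof (rule g_inj[OF g])
  show "g (h (g x)) = g x" using h(2) maps[OF g x] by blast
 qed (use x h(1) g maps in auto)
 then show ?thesis by (rule that[OF h(1)])
qed

definition orbit :: "complex set \<Rightarrow> bool" where
 "orbit S \<longleftrightarrow> finite S \<and> S \<noteq> {} \<and> S \<subseteq> L \<and> (\<forall>x\<in>S. algebraic_int x) \<and> (\<forall>g\<in>G. g ` S \<subseteq> S) \<and>
  (\<forall>x\<in>S. \<forall>y\<in>S. \<exists>g\<in>G. g x = y)"

definition free :: "complex set \<Rightarrow> bool" where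
 "free S \<longleftrightarrow> orbit S \<and> (\<forall>x\<in>S. x \<noteq> 0 \<and> (\<forall>n>0. x ^ n \<noteq> 1))"

lemma orbitD:
 assumes "orbit S"
 shows "finite S" "S \<noteq> {}" "\<And>x. x \<in> S \<Longrightarrow> x \<in> L" "\<And>x. x \<in> S \<Longrightarrow> algebraic_int x"
  "\<And>g x. g \<in> G \<Longrightarrow> x \<in> S \<Longrightarrow> g x \<in> S" "\<And>x y. x \<in> S \<Longrightarrow> y \<in> S \<Longrightarrow> \<exists>g\<in>G. g x = y"
 using assms unfolding orbit_def image_subset_iff by blast+

lemma orbit_bij:
 assumes S: "orbit S" and g: "g \<in> G"
 shows "bij_betw g S S"
proof -
 have inj: "inj_on g S" using orbitD(3)[OF S] g_inj[OF g] by (auto simp: inj_on_def)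
 moreover have "g ` S = S" by (rule endo_inj_surj[OF orbitD(1)[OF S] _ inj]) (use orbitD(5)[OF S g] in auto)
 ultimately show ?thesis by (simp add: bij_betw_def)
qed

text \<open>The product is fixed by G, hence rational, and it is a nonzero algebraic integer, hence
  a nonzero integer. Indexing by a stable set of pairs covers discriminants, resultants and, through
  the diagonal, products over one orbit.\<close>

lemma invariant_prod_ge_1:
 assumes S: "orbit S" and T: "T \<subseteq> S \<times> S" "\<And>g x y. g \<in> G \<Longrightarrow> (x, y) \<in> T \<Longrightarrow> (g x, g y) \<in> T"
  and f: "\<And>x y. (x, y) \<in> T \<Longrightarrow> f x y \<in> L \<and> algebraic_int (f x y) \<and> f x y \<noteq> 0"
  and fg: "\<And>g x y. g \<in> G \<Longrightarrow> (x, y) \<in> T \<Longrightarrow> g (f x y) = f (g x) (g y)"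
 shows "0 \<le> (\<Sum>(x, y)\<in>T. ln (cmod (f x y)))"
proof -
 let ?P = "\<Prod>(x, y)\<in>T. f x y"
 have fin: "finite T" using T(1) orbitD(1)[OF S] finite_subset by blast
 have inL: "?P \<in> L" using f by (auto intro!: L.prod_in)
 have "g ?P = ?P" if g: "g \<in> G" for g
 proof -
  have inj: "inj_on (map_prod g g) T"
  proof (rule inj_onI)
   have in_L: "fst z \<in> L" "snd z \<in> L" if "z \<in> T" for z using T(1) orbitD(3)[OF S] that by auto
   fix u v assume uv: "u \<in> T" "v \<in> T" "map_prod g g u = map_prod g g v"
   then have "g (fst u) = g (fst v)" "g (snd u) = g (snd v)" by (auto simp: map_prod_def case_prod_beta)
   then show "u = v" using g_inj[OF g] in_L uv by (simp add: prod_eq_iff)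
  qed
  have "map_prod g g ` T = T" by (rule endo_inj_surj[OF fin _ inj]) (use T(2) g in auto)
  then have bij: "bij_betw (map_prod g g) T T" using inj by (simp add: bij_betw_def)
  have "g ?P = (\<Prod>z\<in>T. g (case z of (x, y) \<Rightarrow> f x y))" using f g by (intro g_prod) auto
  also have "... = (\<Prod>z\<in>T. (case map_prod g g z of (x, y) \<Rightarrow> f x y))" using fg g by (intro prod.cong) auto
  also have "... = ?P" by (rule prod.reindex_bij_betw[OF bij])
  finally show "g ?P = ?P" .
 qed
 then have "?P \<in> \<rat>" using fixed_rational[OF inL] by blast
 moreover have "algebraic_int ?P" using f by (auto intro!: algebraic_int_prod)
 ultimately have "?P \<in> \<int>" using rational_algebraic_int_is_int by blast
 then obtain a where a: "?P = of_int a" by (auto elim: Ints_cases)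
 have "?P \<noteq> 0" using fin f by auto
 then have "a \<noteq> 0" using a by auto
 then have "cmod ?P \<ge> 1" unfolding a by (simp only: norm_of_int)
 then have "0 \<le> ln (cmod ?P)" by simp
 also have "cmod ?P = (\<Prod>z\<in>T. cmod (case z of (x, y) \<Rightarrow> f x y))" by (rule prod_norm[symmetric])
 also have "ln ... = (\<Sum>z\<in>T. ln (cmod (case z of (x, y) \<Rightarrow> f x y)))"
  by (rule ln_prod[OF fin]) (use f in auto)
 finally show ?thesis by (simp add: case_prod_beta)
qed

text \<open>The coefficients are algebraic integers fixed by G. The induction runs over subsets of
  S, for which an automorphism carries the coefficients of the product over y to those of the
  product over its images.\<close>

lemma orbit_int_poly:
 assumes S: "orbit S"
 obtains g :: "int poly" where "of_int_poly g = (\<Prod>y\<in>S. [:- y, 1:])"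
proof -
 let ?P = "\<lambda>f T. \<Prod>y\<in>T. [:- f y, 1:] :: complex poly"
 have co: "coeff (?P id T) i \<in> L \<and> algebraic_int (coeff (?P id T) i) \<and> (\<forall>g\<in>G. coeff (?P g T) i = g (coeff (?P id T) i))"
  if "finite T" "T \<subseteq> S" for T i
  using that
 proof (induction T arbitrary: i rule: finite_induct)
  case empty
  then show ?case by (auto simp: coeff_1 L.one_in L.zero_in g_one g_zero)
 next
  case (insert y T)
  have c: "coeff (?P f (insert y T)) i = (case i of 0 \<Rightarrow> 0 | Suc j \<Rightarrow> coeff (?P f T) j) - f y * coeff (?P f T) i" for f
   using insert.hyps by (cases i) (simp_all add: coeff_pCons)
  have IH: "coeff (?P id T) i \<in> L" "algebraic_int (coeff (?P id T) i)" "\<And>g. g \<in> G \<Longrightarrow> coeff (?P g T) i = g (coeff (?P id T) i)" for i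
   using insert.IH[of i] insert.prems by auto
  have y: "y \<in> L" "algebraic_int y" using orbitD[OF S] insert.prems by auto
  define C where "C f = (case i of 0 \<Rightarrow> 0 | Suc j \<Rightarrow> coeff (?P f T) j)" for f
  have C: "C id \<in> L" "algebraic_int (C id)" "\<And>g. g \<in> G \<Longrightarrow> C g = g (C id)"
   unfolding C_def using IH by (auto split: nat.split simp: L.zero_in g_zero)
  define X where "X f = f y * coeff (?P f T) i" for f
  have X: "X id \<in> L" "algebraic_int (X id)" "\<And>g. g \<in> G \<Longrightarrow> X g = g (X id)"
   unfolding X_def using y IH(1)[of i] IH(2)[of i] IH(3)[of _ i] by (auto intro: L.mult_in algebraic_int_add_mult simp: g_mult)
  show ?case
   unfolding c C_def[symmetric] X_def[symmetric]
  proof (intro conjI ballI)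
   show "C id - X id \<in> L" using C(1) X(1) by (rule L.diff_in)
   show "algebraic_int (C id - X id)" using C(2) X(2) by (rule algebraic_int_diff)
   show "C g - X g = g (C id - X id)" if "g \<in> G" for g
    using C(3)[OF that] X(3)[OF that] g_diff[OF that C(1) X(1)] by simp
  qed
 qed
 have "\<exists>a. coeff (?P id S) i = of_int a" for i
 proof -
  have c: "coeff (?P id S) i \<in> L" "algebraic_int (coeff (?P id S) i)"
   using co[of S i] orbitD(1)[OF S] by auto
  have "g (coeff (?P id S) i) = coeff (?P id S) i" if g: "g \<in> G" for g
  proof -
   have "g (coeff (?P id S) i) = coeff (?P g S) i" using co[of S i] orbitD(1)[OF S] g by auto
   also have "?P g S = ?P id S"
    using prod.reindex_bij_betw[OF orbit_bij[OF S g], of "\<lambda>y. [:- y, 1:]"] by simp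
   finally show ?thesis .
  qed
  then have "coeff (?P id S) i \<in> \<rat>" using fixed_rational[OF c(1)] by blast
  then have "coeff (?P id S) i \<in> \<int>" using rational_algebraic_int_is_int c(2) by blast
  then show ?thesis by (auto elim: Ints_cases)
 qed
 then obtain a where a: "\<And>i. coeff (?P id S) i = of_int (a i)" by metis
 have "?P id S = of_int_poly (\<Sum>i\<le>degree (?P id S). monom (a i) i)"
 proof (rule poly_eqI)
  fix i
  show "coeff (?P id S) i = coeff (of_int_poly (\<Sum>i\<le>degree (?P id S). monom (a i) i)) i"
   using a[of i] coeff_eq_0[of "?P id S" i] by (cases "i \<le> degree (?P id S)") (auto simp: coeff_sum if_distrib cong: if_cong)
 qed
 then show ?thesis by (intro that[of "\<Sum>i\<le>degree (?P id S). monom (a i) i"]) simp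
qed

text \<open>If g is the polynomial of the orbit, then g(y^p) = g(y)^p + p h(y) = p h(y) for each
  root y. The product of the h(y) is a nonzero integer, so the resultant has absolute value at least
  p to the number of roots.\<close>

lemma orbit_frobenius:
 assumes S: "orbit S" and p: "prime p" and nz: "\<And>x y. x \<in> S \<Longrightarrow> y \<in> S \<Longrightarrow> x \<noteq> y ^ p"
 shows "card S * ln p \<le> (\<Sum>x\<in>S. \<Sum>y\<in>S. ln (cmod (x - y ^ p)))"
proof -
 note SD = orbitD[OF S]
 obtain g :: "int poly" where g: "of_int_poly g = (\<Prod>y\<in>S. [:- y, 1:])" by (rule orbit_int_poly[OF S])
 obtain h where h: "pcompose g ([:0, 1:] ^ p) - g ^ p = of_nat p * h" using pcompose_power_cong[OF p, of g] by auto
 have ev: "poly (of_int_poly g) y = (\<Prod>x\<in>S. y - x)" for y :: complex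
  unfolding g by (simp add: poly_prod)
 have key: "(\<Prod>x\<in>S. y ^ p - x) = of_nat p * poly (of_int_poly h) y" if y: "y \<in> S" for y
 proof -
  have "pcompose g ([:0, 1:] ^ p) = g ^ p + of_nat p * h" using h by (simp add: algebra_simps)
  then have "poly (of_int_poly (pcompose g ([:0, 1:] ^ p))) y = poly (of_int_poly (g ^ p + of_nat p * h)) y" by simp
  then have "poly (of_int_poly g) (y ^ p) = poly (of_int_poly g) y ^ p + of_nat p * poly (of_int_poly h) y"
   by (simp add: of_int_hom.map_poly_pcompose poly_pcompose hom_distribs)
  moreover have "poly (of_int_poly g) y = 0" unfolding ev using y SD(1) by (intro prod_zero) auto
  ultimately show ?thesis using prime_gt_0_nat[OF p] unfolding ev by simp
 qed
 have hz: "poly (of_int_poly h) y \<noteq> 0" if y: "y \<in> S" for y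
  using key[OF y] nz[OF _ y] SD(1) by (metis mult_zero_right prod_zero_iff right_minus_eq)
 have hL: "poly (of_int_poly h) y \<in> L" "algebraic_int (poly (of_int_poly h) y)" if y: "y \<in> S" for y
  unfolding poly_altdef using SD(3,4)[OF y]
  by (auto intro!: L.sum_in L.mult_in L.power_in L.of_int_in algebraic_int_sum algebraic_int_add_mult algebraic_int_power algebraic_int_of_int)
 have hg: "\<gamma> (poly (of_int_poly h) y) = poly (of_int_poly h) (\<gamma> y)" if "y \<in> S" "\<gamma> \<in> G" for y \<gamma>
  unfolding poly_altdef using SD(3)[OF that(1)] that(2)
  by (subst g_sum) (auto simp: g_mult g_power g_of_int L.mult_in L.power_in L.of_int_in)
 \<comment> \<open>The diagonal pairs turn the statement on pairs into one on a single product over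
   S.\<close>
 have "0 \<le> (\<Sum>(x, y)\<in>(\<lambda>x. (x, x)) ` S. ln (cmod (poly (of_int_poly h) y)))"
  by (rule invariant_prod_ge_1[OF S]) (use hz hL hg SD(5) in auto)
 also have "... = (\<Sum>y\<in>S. ln (cmod (poly (of_int_poly h) y)))"
  by (subst sum.reindex) (auto simp: inj_on_def)
 finally have h0: "0 \<le> (\<Sum>y\<in>S. ln (cmod (poly (of_int_poly h) y)))" .
 have "(\<Sum>x\<in>S. \<Sum>y\<in>S. ln (cmod (x - y ^ p))) = (\<Sum>y\<in>S. \<Sum>x\<in>S. ln (cmod (y ^ p - x)))"
  by (subst sum.swap) (simp add: norm_minus_commute)
 also have "... = (\<Sum>y\<in>S. ln (cmod (\<Prod>x\<in>S. y ^ p - x)))"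
 proof (rule sum.cong[OF refl])
  fix y assume y: "y \<in> S"
  have "ln (\<Prod>x\<in>S. cmod (y ^ p - x)) = (\<Sum>x\<in>S. ln (cmod (y ^ p - x)))"
   by (rule ln_prod[OF SD(1)]) (use nz[OF _ y] in force)
  then show "(\<Sum>x\<in>S. ln (cmod (y ^ p - x))) = ln (cmod (\<Prod>x\<in>S. y ^ p - x))" by (simp add: prod_norm)
 qed
 also have "... = (\<Sum>y\<in>S. ln p + ln (cmod (poly (of_int_poly h) y)))"
  using hz prime_gt_0_nat[OF p] by (intro sum.cong refl) (simp add: key norm_mult ln_mult)
 finally show ?thesis using h0 by (simp add: sum.distrib)
qed

text \<open>By transitivity every z in S satisfies z^a = f(z)^b for some self-map f of S. On a cycle
  of f of length N this gives z^(a^N) = z^(b^N) with distinct exponents, so z would be a root of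
  unity.\<close>

lemma orbit_power_collision:
 assumes S: "free S" and xy: "x \<in> S" "y \<in> S" "x ^ a = y ^ b" and ab: "a \<noteq> b" "a > 0" "b > 0"
 shows False
proof -
 have O: "orbit S" using S by (simp add: free_def)
 note SD = orbitD[OF O]
 have "\<exists>z'\<in>S. z ^ a = z' ^ b" if z: "z \<in> S" for z
 proof -
  obtain g where g: "g \<in> G" "g x = z" using SD(6)[OF xy(1) z] by blast
  have "z ^ a = g (x ^ a)" using g_power[OF g(1) SD(3)[OF xy(1)]] g(2) by simp
  also have "... = g y ^ b" using g_power[OF g(1) SD(3)[OF xy(2)]] xy(3) by simp
  finally have "z ^ a = g y ^ b" .
  then show ?thesis using SD(5)[OF g(1) xy(2)] by blast
 qed
 then obtain f where f: "\<And>z. z \<in> S \<Longrightarrow> f z \<in> S" "\<And>z. z \<in> S \<Longrightarrow> z ^ a = f z ^ b" by metis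
 have fS: "(f ^^ N) z \<in> S" if "z \<in> S" for N z by (induction N) (use that f in auto)
 have it: "z ^ (a ^ N) = (f ^^ N) z ^ (b ^ N)" if "z \<in> S" for N z
  using that
 proof (induction N arbitrary: z)
  case (Suc N)
  have "z ^ (a ^ Suc N) = (z ^ a) ^ (a ^ N)" by (simp add: power_mult)
  also have "... = (f z ^ (a ^ N)) ^ b" using f(2)[OF Suc.prems] by (simp flip: power_mult add: mult.commute)
  also have "... = ((f ^^ N) (f z) ^ (b ^ N)) ^ b" using Suc.IH[OF f(1)[OF Suc.prems]] by simp
  finally show ?case by (simp add: funpow_swap1 mult.commute flip: power_mult)
 qed simp
 have "\<not> inj_on (\<lambda>N. (f ^^ N) x) {..card S}"
 proof
  assume "inj_on (\<lambda>N. (f ^^ N) x) {..card S}"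
  then have "card {..card S} \<le> card S" using fS[OF xy(1)] SD(1) by (intro card_inj_on_le) auto
  then show False by simp
 qed
 then obtain M N where MN: "M < N" "(f ^^ M) x = (f ^^ N) x"
  unfolding inj_on_def by (metis linorder_neqE_nat)
 define z where "z = (f ^^ M) x"
 have z: "z \<in> S" using fS[OF xy(1)] by (simp add: z_def)
 have "(f ^^ (N - M)) z = z"
  using MN funpow_add[of "N - M" M f] by (simp add: z_def)
 then have eq: "z ^ (a ^ (N - M)) = z ^ (b ^ (N - M))" using it[OF z, of "N - M"] by simp
 have ne: "a ^ (N - M) \<noteq> b ^ (N - M)" using ab MN(1) by (simp add: power_eq_iff_eq_base)
 have z0: "z \<noteq> 0" and zn: "\<And>n. n > 0 \<Longrightarrow> z ^ n \<noteq> 1" using S z by (auto simp: free_def)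
 have "\<exists>n>0. z ^ n = 1" if "z ^ i = z ^ j" "i < j" for i j
 proof (intro exI[of _ "j - i"] conjI)
  have "z ^ j = z ^ i * z ^ (j - i)" using that(2) by (simp flip: power_add)
  then show "z ^ (j - i) = 1" using that(1) z0 by simp
 qed (use that in simp)
 then show False using eq ne zn by (metis linorder_neqE_nat)
qed

text \<open>Apply the energy inequality to the points x with weight m and x^p with weight 1. From
  below, the pairs of exponents (1, p) and (p, 1) contribute m n ln p each, n being the size of S,
  and all other pairs have nonnegative energy because they come from nonzero integers. Dividing by n
  gives the claim.\<close>

lemma free_energy:
 fixes W q :: real
 assumes S: "free S" and P: "finite P" "\<And>p. p \<in> P \<Longrightarrow> prime p" and inj: "\<And>p. p \<in> P \<Longrightarrow> inj_on (\<lambda>x. x ^ p) S"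
  and m: "m > (0::nat)"
 defines "W \<equiv> real m + card P" and "q \<equiv> (real m)\<^sup>2 + card P"
 shows "2 * real m * (\<Sum>p\<in>P. ln p) \<le> 2 * W * (m + (\<Sum>p\<in>P. real p)) * log_mahler S
  + q * (1 + ln ((card S * W\<^sup>2 + q) / (2 * q)))"
proof -
 have O: "orbit S" using S by (simp add: free_def)
 note SD = orbitD[OF O]
 define n where "n = real (card S)"
 have n: "n > 0" using SD(1,2) by (simp add: n_def card_gt_0_iff)
 define A where "A = insert 1 P"
 have P1: "1 \<notin> P" using P(2) not_prime_1 by blast
 have A: "finite A" "\<And>a. a \<in> A \<Longrightarrow> a > 0" using P prime_gt_0_nat by (auto simp: A_def)
 \<comment> \<open>Only pairs that involve the exponent 1 carry Frobenius congruences; the weight m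
   enlarges their share in the energy.\<close>
 define w where "w a = (if a = 1 then real m else 1)" for a :: nat
 have sumA: "(\<Sum>a\<in>A. w a * f a) = m * f 1 + (\<Sum>p\<in>P. f p)" for f :: "nat \<Rightarrow> real"
 proof -
  have "(\<Sum>p\<in>P. w p * f p) = (\<Sum>p\<in>P. f p)" using P1 by (intro sum.cong) (auto simp: w_def)
  then show ?thesis using P(1) P1 by (simp add: A_def w_def)
 qed
 define F where "F a b = (\<Sum>x\<in>S. \<Sum>y\<in>S. if a = b \<and> x = y then 0 else ln (cmod (x ^ a - y ^ b)))" for a b
 let ?I = "A \<times> S"
 let ?z = "\<lambda>(a, x). x ^ a :: complex" and ?w = "\<lambda>(a, x). w a :: real"
 have dis: "x ^ a \<noteq> y ^ b" if "a \<in> A" "b \<in> A" "x \<in> S" "y \<in> S" "\<not> (a = b \<and> x = y)" for a b x y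
 proof (cases "a = b")
  case True
  then have "x \<noteq> y" using that by simp
  then show ?thesis
   using that True inj by (cases "a = 1") (auto simp: A_def inj_on_def)
 next
  case False
  then show ?thesis using orbit_power_collision[OF S that(3,4), of a b] A(2) that by blast
 qed
 have zinj: "inj_on ?z ?I"
  using dis by (auto simp: inj_on_def)
 have F0: "F a b \<ge> 0" if ab: "a \<in> A" "b \<in> A" for a b
 proof -
  define T where "T = {(x, y) \<in> S \<times> S. \<not> (a = b \<and> x = y)}"
  have "0 \<le> (\<Sum>(x, y)\<in>T. ln (cmod (x ^ a - y ^ b)))"
  proof (rule invariant_prod_ge_1[OF O])
   show "T \<subseteq> S \<times> S" by (auto simp: T_def)
   show "(g x, g y) \<in> T" if "g \<in> G" "(x, y) \<in> T" for g x y
    using that SD(3,5) g_inj by (auto simp: T_def)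
   show "x ^ a - y ^ b \<in> L \<and> algebraic_int (x ^ a - y ^ b) \<and> x ^ a - y ^ b \<noteq> 0" if "(x, y) \<in> T" for x y
    using that SD(3,4) dis[OF ab, of x y] by (auto simp: T_def intro!: L.diff_in L.power_in algebraic_int_diff algebraic_int_power)
   show "g (x ^ a - y ^ b) = g x ^ a - g y ^ b" if "g \<in> G" "(x, y) \<in> T" for g x y
    using that SD(3) by (auto simp: T_def g_diff g_power L.power_in)
  qed
  also have "... = (\<Sum>(x, y)\<in>S \<times> S. if a = b \<and> x = y then 0 else ln (cmod (x ^ a - y ^ b)))"
   unfolding T_def using SD(1) by (intro sum.mono_neutral_cong_left) auto
  also have "... = F a b" unfolding F_def by (simp add: sum.cartesian_product)
  finally show ?thesis .
 qed
 have F1: "F 1 p \<ge> n * ln p" "F p 1 \<ge> n * ln p" if p: "p \<in> P" for p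
 proof -
  have p1: "p \<noteq> 1" using p P1 by auto
  have "n * ln p \<le> (\<Sum>x\<in>S. \<Sum>y\<in>S. ln (cmod (x - y ^ p)))"
   unfolding n_def by (rule orbit_frobenius[OF O P(2)[OF p]]) (use dis[of 1 p] p p1 in \<open>auto simp: A_def\<close>)
  moreover have "F 1 p = (\<Sum>x\<in>S. \<Sum>y\<in>S. ln (cmod (x - y ^ p)))" using p1 by (simp add: F_def)
  moreover have "F p 1 = F 1 p"
   unfolding F_def using p1 by (subst sum.swap) (simp add: norm_minus_commute)
  ultimately show "F 1 p \<ge> n * ln p" "F p 1 \<ge> n * ln p" by simp_all
 qed
 have "2 * m * n * (\<Sum>p\<in>P. ln p) \<le> (\<Sum>a\<in>A. w a * (\<Sum>b\<in>A. w b * F a b))"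
 proof -
  have "(\<Sum>a\<in>A. w a * (\<Sum>b\<in>A. w b * F a b)) = m * (\<Sum>b\<in>A. w b * F 1 b) + (\<Sum>p\<in>P. \<Sum>b\<in>A. w b * F p b)"
   by (rule sumA)
  also have "(\<Sum>b\<in>A. w b * F 1 b) = m * F 1 1 + (\<Sum>p\<in>P. F 1 p)" by (rule sumA)
  also have "(\<Sum>p\<in>P. \<Sum>b\<in>A. w b * F p b) = (\<Sum>p\<in>P. m * F p 1 + (\<Sum>b\<in>P. F p b))" by (simp only: sumA)
  also have "m * (m * F 1 1 + (\<Sum>p\<in>P. F 1 p)) + (\<Sum>p\<in>P. m * F p 1 + (\<Sum>b\<in>P. F p b))
   \<ge> m * (\<Sum>p\<in>P. n * ln p) + (\<Sum>p\<in>P. m * (n * ln p))"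
  proof (intro add_mono mult_left_mono sum_mono)
   have "(\<Sum>p\<in>P. n * ln p) \<le> (\<Sum>p\<in>P. F 1 p)" using F1 by (intro sum_mono) auto
   then show "(\<Sum>p\<in>P. n * ln p) \<le> m * F 1 1 + (\<Sum>p\<in>P. F 1 p)" using F0[of 1 1] by (simp add: A_def add_increasing)
   show "m * (n * ln p) \<le> m * F p 1 + (\<Sum>b\<in>P. F p b)" if "p \<in> P" for p
   proof -
    have "(\<Sum>b\<in>P. F p b) \<ge> 0" using that F0 by (intro sum_nonneg) (auto simp: A_def)
    moreover have "m * (n * ln p) \<le> m * F p 1" using F1[OF that] by (intro mult_left_mono) auto
    ultimately show ?thesis by simp
   qed
  qed auto
  also have "m * (\<Sum>p\<in>P. n * ln p) + (\<Sum>p\<in>P. m * (n * ln p)) = 2 * m * n * (\<Sum>p\<in>P. ln p)"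
   by (simp add: sum_distrib_left[symmetric])
  finally show ?thesis .
 qed
 also have "(\<Sum>a\<in>A. w a * (\<Sum>b\<in>A. w b * F a b)) = (\<Sum>i\<in>?I. \<Sum>j\<in>?I - {i}. ?w i * ?w j * ln (cmod (?z i - ?z j)))"
 proof -
  have "(\<Sum>i\<in>?I. \<Sum>j\<in>?I - {i}. ?w i * ?w j * ln (cmod (?z i - ?z j)))
   = (\<Sum>i\<in>?I. \<Sum>j\<in>?I. if i = j then 0 else ?w i * ?w j * ln (cmod (?z i - ?z j)))"
   using A(1) SD(1) by (intro sum.cong refl sum.mono_neutral_cong_left) auto
  also have "... = (\<Sum>a\<in>A. \<Sum>x\<in>S. \<Sum>b\<in>A. \<Sum>y\<in>S. w a * (w b * (if a = b \<and> x = y then 0 else ln (cmod (x ^ a - y ^ b)))))"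
  proof -
   have "(\<Sum>i\<in>?I. \<Sum>j\<in>?I. if i = j then 0 else ?w i * ?w j * ln (cmod (?z i - ?z j)))
    = (\<Sum>(a, x)\<in>?I. \<Sum>(b, y)\<in>?I. w a * (w b * (if a = b \<and> x = y then 0 else ln (cmod (x ^ a - y ^ b)))))"
    by (intro sum.cong refl) (auto intro!: sum.cong split: prod.splits)
   also have "... = (\<Sum>a\<in>A. \<Sum>x\<in>S. \<Sum>(b, y)\<in>?I. w a * (w b * (if a = b \<and> x = y then 0 else ln (cmod (x ^ a - y ^ b)))))"
    by (rule sum.cartesian_product[symmetric])
   also have "... = (\<Sum>a\<in>A. \<Sum>x\<in>S. \<Sum>b\<in>A. \<Sum>y\<in>S. w a * (w b * (if a = b \<and> x = y then 0 else ln (cmod (x ^ a - y ^ b)))))"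
    by (intro sum.cong refl sum.cartesian_product[symmetric])
   finally show ?thesis .
  qed
  also have "... = (\<Sum>a\<in>A. \<Sum>b\<in>A. \<Sum>x\<in>S. \<Sum>y\<in>S. w a * (w b * (if a = b \<and> x = y then 0 else ln (cmod (x ^ a - y ^ b)))))"
   by (intro sum.cong refl sum.swap)
  also have "... = (\<Sum>a\<in>A. w a * (\<Sum>b\<in>A. w b * F a b))" unfolding F_def by (simp only: sum_distrib_left)
  finally show ?thesis ..
 qed
 also have "... \<le> 2 * (\<Sum>i\<in>?I. ?w i) * (\<Sum>i\<in>?I. ?w i * ln (max 1 (cmod (?z i)))) + (n * q) * (1 + ln (((\<Sum>i\<in>?I. ?w i)\<^sup>2 + n * q) / (2 * (n * q))))"
 proof (rule energy_bound[OF _ zinj])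
  show "finite ?I" using A(1) SD(1) by simp
  show "?w i \<ge> 0" for i by (cases i) (auto simp: w_def)
  show "n * q > 0" using n m by (simp add: q_def add_pos_nonneg)
  have "(\<Sum>i\<in>?I. (?w i)\<^sup>2) = (\<Sum>a\<in>A. \<Sum>x\<in>S. w a * w a)"
   unfolding sum.cartesian_product by (auto intro!: sum.cong simp: power2_eq_square)
  also have "... = n * (\<Sum>a\<in>A. w a * w a)" by (simp add: n_def sum_distrib_left)
  also have "(\<Sum>a\<in>A. w a * w a) = q"
  proof -
   have "(\<Sum>p\<in>P. w p) = card P" using P1 by (subst sum.cong[of P P w "\<lambda>_. 1"]) (auto simp: w_def)
   then show ?thesis unfolding sumA q_def by (simp add: w_def power2_eq_square)
  qed
  finally show "n * q = (\<Sum>i\<in>?I. (?w i)\<^sup>2)" ..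
 qed
 also have "(\<Sum>i\<in>?I. ?w i) = n * W"
 proof -
  have "(\<Sum>i\<in>?I. ?w i) = (\<Sum>a\<in>A. \<Sum>x\<in>S. w a)" unfolding sum.cartesian_product by (auto intro!: sum.cong)
  also have "... = n * (\<Sum>a\<in>A. w a * 1)" by (simp add: n_def sum_distrib_left)
  finally show ?thesis unfolding sumA W_def by simp
 qed
 also have "(\<Sum>i\<in>?I. ?w i * ln (max 1 (cmod (?z i)))) = (m + (\<Sum>p\<in>P. real p)) * log_mahler S"
 proof -
  have "ln (max 1 (cmod (x ^ a))) = a * ln (max 1 (cmod x))" for x :: complex and a :: nat
  proof -
   have "max 1 (cmod (x ^ a)) = (max 1 (cmod x)) ^ a"
    unfolding norm_power using one_le_power[of "cmod x" a] power_le_one[of "cmod x" a]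
    by (cases "cmod x \<ge> 1") (auto simp: max_def)
   then show ?thesis by (simp add: ln_realpow)
  qed
  then have "(\<Sum>i\<in>?I. ?w i * ln (max 1 (cmod (?z i)))) = (\<Sum>a\<in>A. \<Sum>x\<in>S. w a * (a * ln (max 1 (cmod x))))"
   unfolding sum.cartesian_product by (auto intro!: sum.cong)
  also have "... = (\<Sum>a\<in>A. w a * (a * log_mahler S))" by (simp add: log_mahler_def sum_distrib_left)
  also have "... = (m + (\<Sum>p\<in>P. real p)) * log_mahler S" unfolding sumA by (simp add: distrib_right sum_distrib_right)
  finally show ?thesis .
 qed
 finally have "n * (2 * m * (\<Sum>p\<in>P. ln p)) \<le> n * (2 * W * (m + (\<Sum>p\<in>P. real p)) * log_mahler S
  + q * (1 + ln (((n * W)\<^sup>2 + n * q) / (2 * (n * q)))))" by (simp add: algebra_simps)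
 moreover have "((n * W)\<^sup>2 + n * q) / (2 * (n * q)) = (n * W\<^sup>2 + q) / (2 * q)"
 proof -
  have "(n * W)\<^sup>2 + n * q = n * (n * W\<^sup>2 + q)" by (simp add: power2_eq_square algebra_simps)
  then show ?thesis using n by simp
 qed
 ultimately show ?thesis using n unfolding n_def[symmetric] by simp
qed

text \<open>The new elements are the products over the fibres of x -> x^p. They are permuted by G
  like the p-th powers, there are fewer of them, and their Mahler measure is at most that of S. The
  p-th power of such a product is a positive power of x, so it is no root of unity.\<close>

lemma free_descent:
 assumes S: "free S" and p: "p > (0::nat)" and ninj: "\<not> inj_on (\<lambda>x. x ^ p) S"
 obtains S' where "free S'" "card S' < card S" "log_mahler S' \<le> log_mahler S"
proof -
 have O: "orbit S" using S by (simp add: free_def)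
 note SD = orbitD[OF O]
 let ?C = "(\<lambda>x. x ^ p) ` S"
 define fib where "fib c = {y \<in> S. y ^ p = c}" for c
 define \<psi> where "\<psi> c = (\<Prod>y\<in>fib c. y)" for c
 have fib: "finite (fib c)" "fib c \<subseteq> S" for c using SD(1) by (auto simp: fib_def)
 have card: "card (\<psi> ` ?C) < card S"
 proof -
  have "card (\<psi> ` ?C) \<le> card ?C" using SD(1) by (intro card_image_le) simp
  moreover have "card ?C \<noteq> card S" using eq_card_imp_inj_on[OF SD(1)] ninj by blast
  moreover have "card ?C \<le> card S" using SD(1) by (rule card_image_le)
  ultimately show ?thesis by simp
 qed
 have g\<psi>: "g (\<psi> (x ^ p)) = \<psi> (g x ^ p)" if g: "g \<in> G" and x: "x \<in> S" for g x
 proof -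
  have "g (\<psi> (x ^ p)) = (\<Prod>y\<in>fib (x ^ p). g y)" unfolding \<psi>_def using fib SD(3) by (intro g_prod[OF g]) auto
  also have "... = (\<Prod>y\<in>g ` fib (x ^ p). y)"
   using orbit_bij[OF O g] fib by (subst prod.reindex) (auto simp: bij_betw_def intro: inj_on_subset)
  also have "g ` fib (x ^ p) = fib (g x ^ p)"
  proof
   show "g ` fib (x ^ p) \<subseteq> fib (g x ^ p)"
    using SD(3,5) g x by (auto simp: fib_def simp flip: g_power)
   show "fib (g x ^ p) \<subseteq> g ` fib (x ^ p)"
   proof
    fix z assume z: "z \<in> fib (g x ^ p)"
    then obtain y where y: "y \<in> S" "z = g y" using orbit_bij[OF O g] by (auto simp: fib_def bij_betw_def)
    have "g (y ^ p) = g (x ^ p)" using z y x g SD(3) by (simp add: fib_def g_power)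
    then have "y ^ p = x ^ p" using g_inj[OF g] y x SD(3) L.power_in by blast
    then show "z \<in> g ` fib (x ^ p)" using y by (auto simp: fib_def)
   qed
  qed
  finally show ?thesis by (simp add: \<psi>_def)
 qed
 have "orbit (\<psi> ` ?C)"
  unfolding orbit_def
 proof (intro conjI ballI)
  show "finite (\<psi> ` ?C)" "\<psi> ` ?C \<noteq> {}" using SD(1,2) by auto
  show "\<psi> ` ?C \<subseteq> L" unfolding \<psi>_def using fib SD(3) by (auto intro!: L.prod_in)
  show "algebraic_int z" if "z \<in> \<psi> ` ?C" for z using that fib SD(4) by (auto simp: \<psi>_def intro!: algebraic_int_prod)
  show "g ` \<psi> ` ?C \<subseteq> \<psi> ` ?C" if "g \<in> G" for g using g\<psi>[OF that] SD(5)[OF that] by auto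
  fix z z' assume "z \<in> \<psi> ` ?C" "z' \<in> \<psi> ` ?C"
  then obtain x x' where x: "x \<in> S" "z = \<psi> (x ^ p)" "x' \<in> S" "z' = \<psi> (x' ^ p)" by auto
  obtain g where "g \<in> G" "g x = x'" using SD(6) x by blast
  then show "\<exists>g\<in>G. g z = z'" using g\<psi>[of g x] x by auto
 qed
 moreover have "z \<noteq> 0 \<and> (\<forall>n>0. z ^ n \<noteq> 1)" if z: "z \<in> \<psi> ` ?C" for z
 proof -
  obtain x where x: "x \<in> S" "z = \<psi> (x ^ p)" using z by auto
  have "z \<noteq> 0" unfolding x(2) \<psi>_def using S fib by (auto simp: free_def)
  moreover have "z ^ n \<noteq> 1" if n: "n > 0" for n
  proof
   assume "z ^ n = 1"
   have "z ^ p = (\<Prod>y\<in>fib (x ^ p). x ^ p)" unfolding x(2) \<psi>_def prod_power_distrib by (rule prod.cong) (auto simp: fib_def)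
   also have "... = x ^ (p * card (fib (x ^ p)))" by (simp add: power_mult)
   finally have "(x ^ (p * card (fib (x ^ p)))) ^ n = (z ^ p) ^ n" by simp
   also have "... = (z ^ n) ^ p" by (simp only: power_mult[symmetric] mult.commute)
   finally have "x ^ (p * card (fib (x ^ p)) * n) = (z ^ n) ^ p" by (simp only: power_mult)
   then have "x ^ (p * card (fib (x ^ p)) * n) = 1" using \<open>z ^ n = 1\<close> by simp
   moreover have "card (fib (x ^ p)) > 0" using fib x by (auto simp: card_gt_0_iff fib_def)
   ultimately show False using S x(1) p n by (auto simp: free_def)
  qed
  ultimately show ?thesis by blast
 qed
 ultimately have "free (\<psi> ` ?C)" by (simp add: free_def)
 moreover have "log_mahler (\<psi> ` ?C) \<le> log_mahler S"
 proof -
  let ?l = "\<lambda>x. ln (max 1 (cmod x))"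
  have "log_mahler (\<psi> ` ?C) \<le> (\<Sum>c\<in>?C. ?l (\<psi> c))"
   unfolding log_mahler_def using SD(1) sum_image_le[of ?C ?l \<psi>] by (simp add: comp_def)
  also have "... \<le> (\<Sum>c\<in>?C. \<Sum>y\<in>fib c. ?l y)"
  proof (rule sum_mono)
   fix c
   have "max 1 (cmod (\<psi> c)) \<le> (\<Prod>y\<in>fib c. max 1 (cmod y))"
    unfolding \<psi>_def prod_norm[symmetric] by (auto intro!: prod_mono prod_ge_1)
   then have "?l (\<psi> c) \<le> ln (\<Prod>y\<in>fib c. max 1 (cmod y))" by (intro ln_mono) auto
   also have "... = (\<Sum>y\<in>fib c. ?l y)" by (rule ln_prod[OF fib(1)]) (simp add: less_max_iff_disj)
   finally show "?l (\<psi> c) \<le> (\<Sum>y\<in>fib c. ?l y)" .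
  qed
  also have "... = log_mahler S"
   unfolding log_mahler_def fib_def using SD(1) by (rule sum.image_gen[symmetric])
  finally show ?thesis .
 qed
 ultimately show ?thesis using card by (intro that[of "\<psi> ` ?C"])
qed

text \<open>The bound uses an upper bound D for the size of S instead of the size itself, so it is
  inherited from the smaller orbits produced by \<open>free_descent\<close>.\<close>

theorem free_log_mahler_bound:
 fixes W q :: real
 assumes S: "free S" "card S \<le> D" and P: "finite P" "\<And>p. p \<in> P \<Longrightarrow> prime p" and m: "m > (0::nat)"
 defines "W \<equiv> real m + card P" and "q \<equiv> (real m)\<^sup>2 + card P"
 shows "2 * real m * (\<Sum>p\<in>P. ln p) \<le> 2 * W * (m + (\<Sum>p\<in>P. real p)) * log_mahler S
  + q * (1 + ln ((D * W\<^sup>2 + q) / (2 * q)))"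
 using S
proof (induction "card S" arbitrary: S rule: less_induct)
 case less
 have q: "q > 0" using m by (simp add: q_def add_pos_nonneg)
 show ?case
 proof (cases "\<forall>p\<in>P. inj_on (\<lambda>x. x ^ p) S")
  case True
  have "2 * real m * (\<Sum>p\<in>P. ln p) \<le> 2 * W * (m + (\<Sum>p\<in>P. real p)) * log_mahler S
   + q * (1 + ln ((card S * W\<^sup>2 + q) / (2 * q)))"
   unfolding W_def q_def by (rule free_energy[OF less.prems(1) P _ m]) (use True in auto)
  also have "ln ((card S * W\<^sup>2 + q) / (2 * q)) \<le> ln ((D * W\<^sup>2 + q) / (2 * q))"
   using less.prems(2) q
   by (intro ln_mono divide_right_mono add_right_mono mult_right_mono divide_pos_pos add_nonneg_pos) auto
  finally show ?thesis using q by (simp add: mult_left_mono)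
 next
  case False
  then obtain p where p: "p \<in> P" "\<not> inj_on (\<lambda>x. x ^ p) S" by blast
  obtain S' where S': "free S'" "card S' < card S" "log_mahler S' \<le> log_mahler S"
   by (rule free_descent[OF less.prems(1) prime_gt_0_nat[OF P(2)[OF p(1)]] p(2)])
  have "2 * real m * (\<Sum>p\<in>P. ln p) \<le> 2 * W * (m + (\<Sum>p\<in>P. real p)) * log_mahler S'
   + q * (1 + ln ((D * W\<^sup>2 + q) / (2 * q)))" using less.hyps[OF S'(2,1)] S'(2) less.prems(2) by simp
  also have "2 * W * (m + (\<Sum>p\<in>P. real p)) * log_mahler S' \<le> 2 * W * (m + (\<Sum>p\<in>P. real p)) * log_mahler S"
   using S'(3) by (intro mult_left_mono mult_nonneg_nonneg add_nonneg_nonneg sum_nonneg) (auto simp: W_def)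
  finally show ?thesis by simp
 qed
qed

end

section \<open>The Galois closure of a number field inside the complex numbers\<close>

context number_fld
begin

lemma compose_embedding:
 assumes L: "is_subfield L" and \<sigma>: "\<sigma> \<in> E" "\<And>x. x \<in> k \<Longrightarrow> \<sigma> x \<in> L" and \<tau>: "\<tau> \<in> embeddings L"
 shows "(\<lambda>x\<in>k. \<tau> (\<sigma> x)) \<in> E"
proof -
 interpret s: embedding k \<sigma> by (rule emb[OF \<sigma>(1)])
 interpret t: embedding L \<tau> using L \<tau> by unfold_locales
 show ?thesis
  unfolding embeddings_def using \<sigma>(2)
  by (auto simp: one_in add_in mult_in s.add s.mult t.add t.mult)
qed

text \<open>The compositum L of all conjugate fields is stable under its own embeddings, so these
  form its Galois group. The orbit of one conjugate of u consists of conjugates of u, which bounds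
  its size by d and its Mahler measure by the height.\<close>

theorem galois_orbit_exists:
 assumes u: "u \<in> int_ring k" "u \<noteq> 0" "\<And>n. n > 0 \<Longrightarrow> u ^ n \<noteq> 1"
 obtains L G S where "galois_system L G" "galois_system.free L G S" "card S \<le> d" "log_mahler S \<le> height u"
proof -
 have uk: "u \<in> k" "algebraic_int u" using u by (auto simp: int_ring_def)
 obtain B where B: "finite B" "qindep B" "qspan B = k" by (rule number_field_basis[OF nf])
 have Bk: "b \<in> k" if "b \<in> B" for b using qspan_base[OF B(1) that] B(3) by simp
 \<comment> \<open>L is spanned by products with one factor from each conjugate field, where the
   arguments run independently through a basis. Expanding a product of sums keeps such products
   inside the span.\<close>
 define pr where "pr c = (\<Prod>\<sigma>\<in>E. \<sigma> (c \<sigma>))" for c :: "('a \<Rightarrow> complex) \<Rightarrow> 'a"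
 define W where "W = pr ` (E \<rightarrow>\<^sub>E B)"
 have fin: "finite W" unfolding W_def using finite_E B(1) by (intro finite_imageI finite_PiE) auto
 define L where "L = qspan W"
 have prL: "pr c \<in> L" if c: "\<And>\<sigma>. \<sigma> \<in> E \<Longrightarrow> c \<sigma> \<in> k" for c
 proof -
  have "\<forall>\<sigma>\<in>E. \<exists>q. c \<sigma> = (\<Sum>b\<in>B. of_rat (q b) * b)" using c B(3) unfolding qspan_def by blast
  from bchoice[OF this] obtain q where q: "\<And>\<sigma>. \<sigma> \<in> E \<Longrightarrow> c \<sigma> = (\<Sum>b\<in>B. of_rat (q \<sigma> b) * b)" by blast
  have "pr c = (\<Prod>\<sigma>\<in>E. \<Sum>b\<in>B. of_rat (q \<sigma> b) * \<sigma> b)"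
   unfolding pr_def
  proof (rule prod.cong[OF refl])
   fix \<sigma> assume \<sigma>: "\<sigma> \<in> E"
   interpret embedding k \<sigma> by (rule emb[OF \<sigma>])
   have "\<sigma> (c \<sigma>) = \<sigma> (\<Sum>b\<in>B. of_rat (q \<sigma> b) * b)" using q[OF \<sigma>] by simp
   also have "... = (\<Sum>b\<in>B. of_rat (q \<sigma> b) * \<sigma> b)" by (subst sum) (auto simp: mult of_rat mult_in of_rat_in Bk)
   finally show "\<sigma> (c \<sigma>) = (\<Sum>b\<in>B. of_rat (q \<sigma> b) * \<sigma> b)" .
  qed
  also have "... = (\<Sum>f\<in>E \<rightarrow>\<^sub>E B. \<Prod>\<sigma>\<in>E. of_rat (q \<sigma> (f \<sigma>)) * \<sigma> (f \<sigma>))"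
   using finite_E B(1) by (intro prod_sum_PiE) auto
  also have "... = (\<Sum>f\<in>E \<rightarrow>\<^sub>E B. of_rat (\<Prod>\<sigma>\<in>E. q \<sigma> (f \<sigma>)) * pr f)"
   by (simp add: prod.distrib pr_def of_rat_prod)
  also have "... \<in> L" unfolding L_def by (intro qspan_sum qspan_scale qspan_base[OF fin]) (simp add: W_def)
  finally show ?thesis .
 qed
 have oneL: "1 \<in> L"
 proof -
  have "pr (\<lambda>_. 1) = 1" unfolding pr_def by (intro prod.neutral) (auto simp: embedding.one[OF emb])
  then show ?thesis using prL[of "\<lambda>_. 1"] one_in by simp
 qed
 have WW: "w * w' \<in> L" if w: "w \<in> W" "w' \<in> W" for w w'
 proof -
  obtain b b' where b: "b \<in> E \<rightarrow>\<^sub>E B" "w = pr b" "b' \<in> E \<rightarrow>\<^sub>E B" "w' = pr b'" using w by (auto simp: W_def)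
  have bk: "b \<sigma> \<in> k" "b' \<sigma> \<in> k" if "\<sigma> \<in> E" for \<sigma> using b that Bk by (auto simp: PiE_iff)
  have "w * w' = pr (\<lambda>\<sigma>. b \<sigma> * b' \<sigma>)"
   unfolding b pr_def prod.distrib[symmetric] using bk by (intro prod.cong) (auto simp: embedding.mult[OF emb])
  then show ?thesis using prL[of "\<lambda>\<sigma>. b \<sigma> * b' \<sigma>"] bk by (simp add: mult_in)
 qed
 have multL: "x * y \<in> L" if x: "x \<in> L" and y: "y \<in> L" for x y
 proof -
  obtain c where c: "x = (\<Sum>w\<in>W. of_rat (c w) * w)" using x unfolding L_def qspan_def by blast
  obtain e where e: "y = (\<Sum>w\<in>W. of_rat (e w) * w)" using y unfolding L_def qspan_def by blast
  have "x * y = (\<Sum>w\<in>W. of_rat (c w) * (\<Sum>w'\<in>W. of_rat (e w') * (w * w')))"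
   unfolding c e sum_product by (intro sum.cong refl) (simp add: sum_distrib_left mult_ac)
  also have "... \<in> L" using WW unfolding L_def by (intro qspan_sum qspan_scale) auto
  finally show ?thesis .
 qed
 have nfL: "number_field L" by (rule finite_qspan_ring_number_field[OF fin L_def oneL multL])
 have subL: "is_subfield L" by (rule number_fieldD[OF nfL])
 interpret L: number_fld L by standard (rule nfL)
 let ?G = "embeddings L"
 have sL: "\<sigma> x \<in> L" if \<sigma>: "\<sigma> \<in> E" and x: "x \<in> k" for \<sigma> x
 proof -
  have "pr (\<lambda>\<sigma>'. if \<sigma>' = \<sigma> then x else 1) = (\<Prod>\<sigma>'\<in>E. if \<sigma>' = \<sigma> then \<sigma> x else 1)"
   unfolding pr_def by (intro prod.cong) (auto simp: embedding.one[OF emb])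
  then have "pr (\<lambda>\<sigma>'. if \<sigma>' = \<sigma> then x else 1) = \<sigma> x" using \<sigma> finite_E by simp
  then show ?thesis using prL[of "\<lambda>\<sigma>'. if \<sigma>' = \<sigma> then x else 1"] x one_in by simp
 qed
 have comp: "(\<lambda>x\<in>k. \<tau> (\<sigma> x)) \<in> E" if "\<tau> \<in> ?G" "\<sigma> \<in> E" for \<tau> \<sigma>
  by (rule compose_embedding[OF subL that(2) sL[OF that(2)] that(1)])
 \<comment> \<open>Composition with \<tau> permutes the embeddings of k, hence the factors of the
   spanning products; this is why \<tau> maps L into itself.\<close>
 have bij: "bij_betw (\<lambda>\<sigma>. \<lambda>x\<in>k. \<tau> (\<sigma> x)) E E" if \<tau>: "\<tau> \<in> ?G" for \<tau>
 proof -
  interpret t: embedding L \<tau> by (rule L.emb[OF \<tau>])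
  have inj: "inj_on (\<lambda>\<sigma>. \<lambda>x\<in>k. \<tau> (\<sigma> x)) E"
  proof (rule inj_onI)
   fix \<sigma> \<sigma>' assume s: "\<sigma> \<in> E" "\<sigma>' \<in> E" and eq: "(\<lambda>x\<in>k. \<tau> (\<sigma> x)) = (\<lambda>x\<in>k. \<tau> (\<sigma>' x))"
   show "\<sigma> = \<sigma>'"
   proof (rule ext)
    fix x
    show "\<sigma> x = \<sigma>' x"
    proof (cases "x \<in> k")
     case True
     then have "\<tau> (\<sigma> x) = \<tau> (\<sigma>' x)" using fun_cong[OF eq, of x] by simp
     then show ?thesis using t.inj sL s True by blast
    next
     case False
     then show ?thesis using embedding.ext[OF emb] s by metis
    qed
   qed
  qed
  moreover have "(\<lambda>\<sigma>. \<lambda>x\<in>k. \<tau> (\<sigma> x)) ` E = E"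
   by (rule endo_inj_surj[OF finite_E _ inj]) (use comp[OF \<tau>] in auto)
  ultimately show ?thesis by (simp add: bij_betw_def)
 qed
 have mapsL: "\<tau> x \<in> L" if \<tau>: "\<tau> \<in> ?G" and x: "x \<in> L" for \<tau> x
 proof -
  interpret t: embedding L \<tau> by (rule L.emb[OF \<tau>])
  let ?c = "\<lambda>\<sigma>. \<lambda>x\<in>k. \<tau> (\<sigma> x)"
  have WL: "w \<in> L" if "w \<in> W" for w using qspan_base[OF fin that] by (simp add: L_def)
  have \<tau>W: "\<tau> w \<in> L" if w: "w \<in> W" for w
  proof -
   obtain b where b: "b \<in> E \<rightarrow>\<^sub>E B" "w = pr b" using w by (auto simp: W_def)
   have bk: "b \<sigma> \<in> k" if "\<sigma> \<in> E" for \<sigma> using b that Bk by (auto simp: PiE_iff)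
   define b' where "b' \<sigma> = b (inv_into E ?c \<sigma>)" for \<sigma>
   have b': "b' (?c \<sigma>) = b \<sigma>" if "\<sigma> \<in> E" for \<sigma>
    using inv_into_f_f[OF bij_betw_imp_inj_on[OF bij[OF \<tau>]] that] by (simp only: b'_def)
   have "\<tau> w = (\<Prod>\<sigma>\<in>E. \<tau> (\<sigma> (b \<sigma>)))" unfolding b pr_def using sL bk by (intro t.prod) auto
   also have "... = (\<Prod>\<sigma>\<in>E. (\<lambda>\<sigma>. \<sigma> (b' \<sigma>)) (?c \<sigma>))"
    by (intro prod.cong) (use b' bk in auto)
   also have "... = (\<Prod>\<sigma>\<in>E. \<sigma> (b' \<sigma>))" by (rule prod.reindex_bij_betw[OF bij[OF \<tau>]])
   also have "... \<in> L"
   proof -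
    have "b' \<sigma> \<in> k" if "\<sigma> \<in> E" for \<sigma>
     unfolding b'_def by (rule bk) (use that bij[OF \<tau>] in \<open>metis bij_betw_def inv_into_into\<close>)
    then show ?thesis using prL[of b'] by (simp add: pr_def)
   qed
   finally show ?thesis .
  qed
  obtain c where c: "x = (\<Sum>w\<in>W. of_rat (c w) * w)" using x unfolding L_def qspan_def by blast
  have "\<tau> x = (\<Sum>w\<in>W. of_rat (c w) * \<tau> w)"
   unfolding c by (subst t.sum) (auto simp: t.mult t.of_rat L.mult_in L.of_rat_in WL)
  also have "... \<in> L" by (intro L.sum_in L.mult_in L.of_rat_in \<tau>W)
  finally show ?thesis .
 qed
 have compG: "(\<lambda>x\<in>L. g (h x)) \<in> ?G" if "g \<in> ?G" "h \<in> ?G" for g h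
  by (rule L.compose_embedding[OF subL that(2) mapsL[OF that(2)] that(1)])
 have idG: "(\<lambda>x\<in>L. x) \<in> ?G"
  unfolding embeddings_def by (auto simp: L.one_in L.add_in L.mult_in)
 interpret g: galois_system L ?G
 proof
  show "is_subfield L" by (rule subL)
  fix g assume g: "g \<in> ?G"
  interpret t: embedding L g by (rule L.emb[OF g])
  show "g x \<in> L" if "x \<in> L" for x by (rule mapsL[OF g that])
  show "g 1 = 1" by simp
  show "g (x - y) = g x - g y" "g (x * y) = g x * g y" if "x \<in> L" "y \<in> L" for x y using that by (simp_all add: t.diff t.mult)
  show "x = y" if "x \<in> L" "y \<in> L" "g x = g y" for x y using t.inj that by blast
  show "\<exists>f\<in>?G. \<forall>x\<in>L. f x = g (h x)" if "h \<in> ?G" for h using compG[OF g that] by (intro bexI) auto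
  show "\<exists>h\<in>?G. \<forall>x\<in>L. g (h x) = x"
  proof -
   let ?f = "\<lambda>h. \<lambda>x\<in>L. g (h x)"
   have "inj_on ?f ?G"
   proof (rule inj_onI)
    fix h h' assume h: "h \<in> ?G" "h' \<in> ?G" and eq: "?f h = ?f h'"
    show "h = h'"
    proof (rule ext)
     fix x
     show "h x = h' x"
     proof (cases "x \<in> L")
      case True
      then have "g (h x) = g (h' x)" using fun_cong[OF eq, of x] by simp
      then show ?thesis using t.inj mapsL h True by blast
     next
      case False
      then show ?thesis using embedding.ext[OF L.emb] h by metis
     qed
    qed
   qed
   then have "?f ` ?G = ?G" using compG[OF g] L.finite_E by (intro endo_inj_surj) auto
   then obtain h where "h \<in> ?G" "?f h = (\<lambda>x\<in>L. x)" using idG by (metis (no_types, lifting) imageE)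
   then show ?thesis by (intro bexI[of _ h]) (metis restrict_apply')+
  qed
 next
  show "x \<in> \<rat>" if "x \<in> L" "\<And>g. g \<in> ?G \<Longrightarrow> g x = x" for x
   using L.constant_imp_rational[OF that(1), of x] that(2) by blast
 qed
 obtain \<sigma>0 where \<sigma>0: "\<sigma>0 \<in> E" using E_nonempty by blast
 define x0 where "x0 = \<sigma>0 u"
 have x0: "x0 \<in> L" unfolding x0_def by (rule sL[OF \<sigma>0 uk(1)])
 define S where "S = (\<lambda>g. g x0) ` ?G"
 have Ssub: "S \<subseteq> (\<lambda>\<sigma>. \<sigma> u) ` E"
 proof
  fix z assume "z \<in> S"
  then obtain g where g: "g \<in> ?G" "z = g x0" by (auto simp: S_def)
  then have "z = (\<lambda>x\<in>k. g (\<sigma>0 x)) u" using uk by (simp add: x0_def)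
  then show "z \<in> (\<lambda>\<sigma>. \<sigma> u) ` E" using comp[OF g(1) \<sigma>0] by blast
 qed
 have finS: "finite S" using L.finite_E by (simp add: S_def)
 have "g.orbit S"
  unfolding g.orbit_def
 proof (intro conjI ballI)
  show "finite S" by (rule finS)
  show "S \<noteq> {}" using idG by (auto simp: S_def)
  show "S \<subseteq> L" using mapsL x0 by (auto simp: S_def)
  show "algebraic_int z" if "z \<in> S" for z
   using that Ssub algebraic_int_emb uk by blast
  show "g ` S \<subseteq> S" if g: "g \<in> ?G" for g
  proof
   fix z assume "z \<in> g ` S"
   then obtain h where h: "h \<in> ?G" "z = g (h x0)" by (auto simp: S_def)
   then have "z = (\<lambda>x\<in>L. g (h x)) x0" using x0 by simp
   then show "z \<in> S" using compG[OF g h(1)] unfolding S_def by (rule image_eqI)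
  qed
  fix x y assume xy: "x \<in> S" "y \<in> S"
  obtain g1 where g1: "g1 \<in> ?G" "x = g1 x0" using xy by (auto simp: S_def)
  obtain g2 where g2: "g2 \<in> ?G" "y = g2 x0" using xy by (auto simp: S_def)
  obtain h where h: "h \<in> ?G" "\<And>x. x \<in> L \<Longrightarrow> h (g1 x) = x" using g.g_left_inv[OF g1(1)] by blast
  have "(\<lambda>z\<in>L. g2 (h z)) x = y" using g1 g2 h(2)[OF x0] mapsL[OF g1(1) x0] by simp
  then show "\<exists>g\<in>?G. g x = y" using compG[OF g2(1) h(1)] by blast
 qed
 moreover have "z \<noteq> 0 \<and> (\<forall>n>0. z ^ n \<noteq> 1)" if z: "z \<in> S" for z
 proof -
  obtain \<sigma> where \<sigma>: "\<sigma> \<in> E" "z = \<sigma> u" using Ssub z by blast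
  interpret embedding k \<sigma> by (rule emb[OF \<sigma>(1)])
  have "\<sigma> (u ^ n) \<noteq> \<sigma> 1" if "n > 0" for n using inj[OF power_in[OF uk(1)] one_in] u(3)[OF that] by blast
  then show ?thesis using \<sigma>(2) eq_0_iff[OF uk(1)] u(2) power[OF uk(1)] by simp
 qed
 ultimately have "g.free S" by (simp add: g.free_def)
 moreover have "card S \<le> d" using card_mono[OF _ Ssub] card_image_le[OF finite_E, of "\<lambda>\<sigma>. \<sigma> u"] finite_E by (simp add: d_def)
 moreover have "log_mahler S \<le> height u"
 proof -
  have "log_mahler S \<le> (\<Sum>z\<in>(\<lambda>\<sigma>. \<sigma> u) ` E. ln (max 1 (cmod z)))"
   unfolding log_mahler_def using finite_E Ssub by (intro sum_mono2) auto
  also have "... \<le> (\<Sum>\<sigma>\<in>E. ln (max 1 (cmod (\<sigma> u))))"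
   using sum_image_le[OF finite_E, of "\<lambda>z. ln (max 1 (cmod z))" "\<lambda>\<sigma>. \<sigma> u"] by (simp add: comp_def)
  also have "... = height u"
   unfolding height_def
  proof (rule sum.cong[OF refl])
   fix \<sigma> assume "\<sigma> \<in> E"
   then have "cmod (\<sigma> u) > 0" using embedding.eq_0_iff[OF emb uk(1)] u(2) by simp
   then show "ln (max 1 (cmod (\<sigma> u))) = max 0 (ln (cmod (\<sigma> u)))" by (auto simp: max_def)
  qed
  finally show ?thesis .
 qed
 ultimately show ?thesis by (intro that[OF g.galois_system_axioms])
qed

end

section \<open>Explicit prime data\<close>

definition trial :: "nat \<Rightarrow> bool" where
 "trial p \<longleftrightarrow> 1 < p \<and> p < 43 * 43 \<and> list_all (\<lambda>q. q < p \<longrightarrow> p mod q \<noteq> 0) [2, 3, 5, 7, 11, 13, 17, 19, 23, 29, 31, 37, 41]"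

lemma small_divisor:
 assumes "1 < q" "q < (43::nat)"
 shows "\<exists>c\<in>set [2, 3, 5, 7, 11, 13, 17, 19, 23, 29, 31, 37, 41]. c dvd q"
proof -
 have "list_all (\<lambda>q. list_ex (\<lambda>c. c dvd q) [2, 3, 5, 7, 11, 13, 17, 19, 23, 29, 31, 37, 41]) [2..<43]" by simp
 then have "\<forall>q\<in>set [2..<43]. list_ex (\<lambda>c. c dvd q) [2, 3, 5, 7, 11, 13, 17, 19, 23, 29, 31, 37, 41]" by (simp only: list_all_iff)
 moreover have "q \<in> set [2..<43]" using assms by (simp only: set_upt atLeastLessThan_iff) simp
 ultimately have "list_ex (\<lambda>c. c dvd q) [2, 3, 5, 7, 11, 13, 17, 19, 23, 29, 31, 37, 41]" by blast
 then show ?thesis by (simp only: list_ex_iff)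
qed

text \<open>A composite number below 43^2 has a factor below 43, and that factor is divisible by one
  of the tabulated primes.\<close>

lemma trial_prime:
 assumes "trial p"
 shows "prime (p::nat)"
proof (rule ccontr)
 have p: "1 < p" "p < 43 * 43" "\<forall>q\<in>set [2, 3, 5, 7, 11, 13, 17, 19, 23, 29, 31, 37, 41]. q < p \<longrightarrow> p mod q \<noteq> 0"
  using assms unfolding trial_def list_all_iff by blast+
 assume "\<not> prime p"
 then obtain a where a: "a dvd p" "a \<noteq> 1" "a \<noteq> p" using p(1) by (auto simp: prime_nat_iff)
 then obtain b where b: "p = a * b" by auto
 have pos: "a > 0" "b > 0" using p(1) b by (auto intro!: gr0I)
 have no: False if q: "q dvd p" "1 < q" "q < p" "q < 43" for q
 proof -
  obtain c where c: "c \<in> set [2, 3, 5, 7, 11, 13, 17, 19, 23, 29, 31, 37, 41]" "c dvd q" using small_divisor[OF q(2,4)] by blast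
  have "c < p" using dvd_imp_le[OF c(2)] q by linarith
  then have "p mod c \<noteq> 0" by (rule p(3)[rule_format, OF c(1)])
  then show False using dvd_trans[OF c(2) q(1)] by (simp only: dvd_eq_mod_eq_0)
 qed
 have ap: "a < p" using a dvd_imp_le[of a p] p(1) by auto
 have b1: "b \<noteq> 1" using a(3) b by auto
 have a1: "1 < a" using a(2) pos by linarith
 then have "1 * b < a * b" using pos by (intro mult_strict_right_mono)
 then have bp: "b < p" using b by simp
 have "\<not> a < 43" using no[OF a(1) a1 ap] by blast
 moreover have "b dvd p" using b by simp
 moreover have "1 < b" using b1 pos by linarith
 ultimately have "\<not> a < 43" "\<not> b < 43" using no[of b] bp by blast+
 then have "43 \<le> a" "43 \<le> b" by simp_all
 then have "43 * 43 \<le> a * b" by (rule mult_le_mono)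
 then show False using p(2) b by linarith
qed

text \<open>The product of the primes is recorded only through a lower bound with a short mantissa a
  and a binary exponent e, since only its logarithm enters.\<close>

definition prime_data :: "nat set \<Rightarrow> nat \<Rightarrow> nat \<Rightarrow> nat \<Rightarrow> nat \<Rightarrow> nat \<Rightarrow> bool" where
 "prime_data P X s t a e \<longleftrightarrow> finite P \<and> (\<forall>p\<in>P. prime p \<and> p \<le> X) \<and> card P = s \<and> \<Sum>P = t \<and> a * 2 ^ e \<le> \<Prod>P"

lemma prime_data_empty: "prime_data {} 4 0 0 1 0"
 by (simp add: prime_data_def)

lemma prime_data_append:
 assumes P: "prime_data P X s t a e" and xs: "xs \<noteq> []" "sorted_wrt (<) (X # xs)" "list_all trial xs"
  and prod: "a' * 2 ^ e' \<le> prod_list xs"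
 shows "prime_data (P \<union> set xs) (last xs) (s + length xs) (t + sum_list xs) (a * a') (e + e')"
proof -
 have d: "distinct xs" using xs(2) by (simp add: strict_sorted_iff)
 have gt: "X < p" if "p \<in> set xs" for p using xs(2) that by simp
 have le: "p \<le> last xs" if "p \<in> set xs" for p
 proof -
  have "sorted xs" using xs(2) by (simp add: strict_sorted_iff)
  then have "sorted (butlast xs @ [last xs])" "p \<in> set (butlast xs @ [last xs])" using xs(1) that by simp_all
  then show ?thesis by (auto simp: sorted_append simp del: append_butlast_last_id)
 qed
 have dis: "P \<inter> set xs = {}" 
 proof (rule equals0I)
  fix p assume "p \<in> P \<inter> set xs"
  then have "p \<le> X" "X < p" using P gt by (auto simp: prime_data_def)
  then show False by simp
 qed
 have l: "last xs \<in> set xs" using xs(1) by simp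
 have "a * a' * 2 ^ (e + e') = (a * 2 ^ e) * (a' * 2 ^ e')" by (simp add: power_add)
 also have "... \<le> \<Prod>P * prod_list xs" using P prod by (intro mult_le_mono) (auto simp: prime_data_def)
 also have "prod_list xs = \<Prod>(set xs)" using d by (simp add: prod.distinct_set_conv_list)
 also have "\<Prod>P * \<Prod>(set xs) = \<Prod>(P \<union> set xs)" using P dis by (intro prod.union_disjoint[symmetric]) (auto simp: prime_data_def)
 finally have "a * a' * 2 ^ (e + e') \<le> \<Prod>(P \<union> set xs)" .
 moreover have "\<Sum>(P \<union> set xs) = t + sum_list xs"
  using P dis d by (subst sum.union_disjoint) (auto simp: prime_data_def sum.distinct_set_conv_list)
 moreover have "card (P \<union> set xs) = s + length xs"
  using P dis d by (subst card_Un_disjoint) (auto simp: prime_data_def distinct_card)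
 moreover have "p \<le> last xs" if "p \<in> P" for p using P that gt[OF l] by (force simp: prime_data_def)
 ultimately show ?thesis using P xs(3) le trial_prime by (auto simp: prime_data_def list_all_iff)
qed

text \<open>After multiplying the two mantissas, n binary digits are moved to the exponent; rounding
  down keeps the mantissa short.\<close>

lemma prime_data_extend:
 assumes "\<exists>P. prime_data P X s t a e" "xs \<noteq> []" "sorted_wrt (<) (X # xs)" "list_all trial xs" "a' * 2 ^ e' \<le> prod_list xs"
  "last xs = X'" "s + length xs = s'" "t + sum_list xs = t'" "a'' * 2 ^ n \<le> a * a'" "e + e' + n = e''"
 shows "\<exists>P. prime_data P X' s' t' a'' e''"
proof -
 obtain P where "prime_data P X s t a e" using assms(1) by blast
 from prime_data_append[OF this assms(2-5)]
 have *: "prime_data (P \<union> set xs) X' s' t' (a * a') (e + e')" unfolding assms(6-8) .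
 have "a'' * 2 ^ e'' = (a'' * 2 ^ n) * 2 ^ (e + e')" unfolding assms(10)[symmetric] by (simp add: power_add mult_ac)
 also have "... \<le> (a * a') * 2 ^ (e + e')" using assms(9) by (rule mult_le_mono1)
 finally show ?thesis using * unfolding prime_data_def by (intro exI[of _ "P \<union> set xs"]) auto
qed

lemma prime_data_16: "\<exists>P. prime_data P 61 16 496 542567 55"
 by (rule prime_data_extend[where xs = "[5, 7, 11, 13, 17, 19, 23, 29, 31, 37, 41, 43, 47, 53, 59, 61]"
  and a' = 542567 and e' = 55 and n = 0], rule exI, rule prime_data_empty) (simp_all add: trial_def)

lemma prime_data_28: "\<exists>P. prime_data P 113 28 1588 990862983 122"
 by (rule prime_data_extend[where xs = "[67, 71, 73, 79, 83, 89, 97, 101, 103, 107, 109, 113]"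
  and a' = 935040 and e' = 58 and n = 9], rule prime_data_16) (simp_all add: trial_def)

lemma prime_data_52: "\<exists>P. prime_data P 251 52 6076 657267330 303"
 by (rule prime_data_extend[where xs = "[127, 131, 137, 139, 149, 151, 157, 163, 167, 173, 179, 181, 191, 193, 197, 199, 211, 223, 227, 229, 233,
  239, 241, 251]"
  and a' = 695550 and e' = 161 and n = 20], rule prime_data_28) (simp_all add: trial_def)

lemma prime_data_76: "\<exists>P. prime_data P 397 76 13882 647337263 503"
 by (rule prime_data_extend[where xs = "[257, 263, 269, 271, 277, 281, 283, 293, 307, 311, 313, 317, 331, 337, 347, 349, 353, 359, 367, 373, 379,
  383, 389, 397]"
  and a' = 1032734 and e' = 180 and n = 20], rule prime_data_52) (simp_all add: trial_def)

lemma prime_data_102: "\<exists>P. prime_data P 569 102 26364 848188030 734"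
 by (rule prime_data_extend[where xs = "[401, 409, 419, 421, 431, 433, 439, 443, 449, 457, 461, 463, 467, 479, 487, 491, 499, 503, 509, 521, 523,
  541, 547, 557, 563, 569]"
  and a' = 686960 and e' = 212 and n = 19], rule prime_data_76) (simp_all add: trial_def)

lemma prime_data_128: "\<exists>P. prime_data P 733 128 43196 690034470 977"
 by (rule prime_data_extend[where xs = "[571, 577, 587, 593, 599, 601, 607, 613, 617, 619, 631, 641, 643, 647, 653, 659, 661, 673, 677, 683, 691,
  701, 709, 719, 727, 733]"
  and a' = 853058 and e' = 223 and n = 20], rule prime_data_102) (simp_all add: trial_def)

lemma prime_data_154: "\<exists>P. prime_data P 911 154 64610 583522849 1229"
 by (rule prime_data_extend[where xs = "[739, 743, 751, 757, 761, 769, 773, 787, 797, 809, 811, 821, 823, 827, 829, 839, 853, 857, 859, 863, 877,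
  881, 883, 887, 907, 911]"
  and a' = 886721 and e' = 232 and n = 20], rule prime_data_128) (simp_all add: trial_def)

lemma prime_data_180: "\<exists>P. prime_data P 1091 180 90758 707275262 1488"
 by (rule prime_data_extend[where xs = "[919, 929, 937, 941, 947, 953, 967, 971, 977, 983, 991, 997, 1009, 1013, 1019, 1021, 1031, 1033, 1039,
  1049, 1051, 1061, 1063, 1069, 1087, 1091]"
  and a' = 635478 and e' = 240 and n = 19], rule prime_data_154) (simp_all add: trial_def)

lemma prime_data_205: "\<exists>P. prime_data P 1279 205 120343 799341864 1743"
 by (rule prime_data_extend[where xs = "[1093, 1097, 1103, 1109, 1117, 1123, 1129, 1151, 1153, 1163, 1171, 1181, 1187, 1193, 1201, 1213, 1217,
  1223, 1229, 1231, 1237, 1249, 1259, 1277, 1279]"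
  and a' = 592535 and e' = 236 and n = 19], rule prime_data_180) (simp_all add: trial_def)

lemma prime_data_230: "\<exists>P. prime_data P 1459 230 154632 566773491 2004"
 by (rule prime_data_extend[where xs = "[1283, 1289, 1291, 1297, 1301, 1303, 1307, 1319, 1321, 1327, 1361, 1367, 1373, 1381, 1399, 1409, 1423,
  1427, 1429, 1433, 1439, 1447, 1451, 1453, 1459]"
  and a' = 743493 and e' = 241 and n = 20], rule prime_data_205) (simp_all add: trial_def)

lemma prime_data_255: "\<exists>P. prime_data P 1621 255 193371 537342863 2269"
 by (rule prime_data_extend[where xs = "[1471, 1481, 1483, 1487, 1489, 1493, 1499, 1511, 1523, 1531, 1543, 1549, 1553, 1559, 1567, 1571, 1579,
  1583, 1597, 1601, 1607, 1609, 1613, 1619, 1621]"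
  and a' = 994127 and e' = 245 and n = 20], rule prime_data_230) (simp_all add: trial_def)

lemma prime_data_270: "\<exists>P. prime_data P 1747 270 218754 978870883 2429"
 by (rule prime_data_extend[where xs = "[1627, 1637, 1657, 1663, 1667, 1669, 1693, 1697, 1699, 1709, 1721, 1723, 1733, 1741, 1747]"
  and a' = 955089 and e' = 141 and n = 19], rule prime_data_255) (simp_all add: trial_def)

section \<open>Chebyshev's lower bound\<close>

text \<open>The Leibniz harmonic triangle: the reciprocal of (m + 1) (n choose m + 1) is the
  difference of the reciprocals of m (n - 1 choose m) and m (n choose m). Multiplied by M, both
  terms of the difference are integers by induction.\<close>

lemma leibniz_triangle_dvd:
 fixes M :: nat
 assumes M: "\<And>i. 1 \<le> i \<Longrightarrow> i \<le> N \<Longrightarrow> i dvd M" and "1 \<le> m" "m \<le> n" "n \<le> N"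
 shows "m * (n choose m) dvd M"
 using assms(2-4)
proof (induction m arbitrary: n rule: dec_induct)
 case base
 then show ?case using M[of n] by simp
next
 case (step m)
 obtain k where n: "n = Suc k" using step.prems by (cases n) auto
 let ?c = "k choose m"
 obtain u where u: "M = m * ?c * u" using step.IH[of k] step.prems n by (auto elim!: dvdE)
 obtain v where v: "M = m * (n choose m) * v" using step.IH[of n] step.prems n by (auto elim!: dvdE)
 have absorb: "(n - m) * (n choose m) = n * ?c" "Suc m * (n choose Suc m) = n * ?c"
  using binomial_absorb_comp[of n m] binomial_absorption[of m n] by (simp_all only: n diff_Suc_1)
 define A where "A = int (n * ?c)"
 have "int m * A * int u = int n * int M" by (subst u) (simp add: A_def)
 moreover have "int m * A * int v = int (n - m) * int M"
  unfolding A_def absorb(1)[symmetric] by (subst v) simp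
 moreover have "int n * int M - int (n - m) * int M = int m * int M"
  using step.prems step.hyps n by (simp add: of_nat_diff algebra_simps)
 ultimately have "int m * (A * (int u - int v)) = int m * int M" by (simp add: algebra_simps)
 then have "int M = int (n * ?c) * (int u - int v)" using step.hyps by (simp add: A_def)
 then have "int (n * ?c) dvd int M" by (rule dvdI)
 then have "n * ?c dvd M" by (simp only: of_nat_dvd_iff)
 then show ?case using absorb(2) by simp
qed

text \<open>Let M be the least common multiple of 1, ..., 2k, written as a product of largest prime
  powers, each at most 2k. The number k times the central binomial coefficient divides M and is at
  least 4^k / 2, while M is at most 2k to the number of primes.\<close>

lemma prime_count_lower:
 assumes k: "k \<ge> (1::nat)"
 shows "(2 * real k - 1) * ln 2 \<le> card {p. prime p \<and> p \<le> 2 * k} * ln (2 * real k)"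
proof -
 define X where "X = 2 * k"
 let ?P = "{p. prime p \<and> p \<le> X}"
 have fin: "finite ?P" by (rule finite_subset[of _ "{..X}"]) auto
 define e where "e p = Max {n. p ^ n \<le> X}" for p :: nat
 have finE: "finite {n. p ^ n \<le> X}" if "prime p" for p
 proof (rule finite_subset[of _ "{..X}"])
  show "{n. p ^ n \<le> X} \<subseteq> {..X}"
  proof
   fix n assume "n \<in> {n. p ^ n \<le> X}"
   moreover have "n < p ^ n" using prime_ge_2_nat[OF that] by (intro power_gt_expt) simp
   ultimately show "n \<in> {..X}" by simp
  qed
 qed simp
 have eX: "p ^ e p \<le> X" if "prime p" for p
 proof -
  have "e p \<in> {n. p ^ n \<le> X}" unfolding e_def
   by (rule Max_in[OF finE[OF that]]) (use k in \<open>auto simp: X_def intro!: exI[of _ 0]\<close>)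
  then show ?thesis by simp
 qed
 have eM: "n \<le> e p" if "prime p" "p ^ n \<le> X" for p n
  unfolding e_def by (rule Max_ge[OF finE[OF that(1)]]) (use that in simp)
 define M where "M = (\<Prod>p\<in>?P. p ^ e p)"
 have Mpos: "M > 0" unfolding M_def using prime_gt_0_nat by (intro prod_pos) auto
 have div: "i dvd M" if i: "1 \<le> i" "i \<le> X" for i
 proof -
  have "i = (\<Prod>p\<in>prime_factors i. p ^ multiplicity p i)"
   using i by (intro prime_factorization_nat) simp
  also have "... dvd (\<Prod>p\<in>prime_factors i. p ^ e p)"
  proof (rule prod_dvd_prod)
   fix p assume p: "p \<in> prime_factors i"
   then have pp: "prime p" by auto
   have "p ^ multiplicity p i \<le> i" using i by (intro dvd_imp_le multiplicity_dvd) simp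
   then have "multiplicity p i \<le> e p" using i by (intro eM[OF pp]) simp
   then show "p ^ multiplicity p i dvd p ^ e p" by (rule le_imp_power_dvd)
  qed
  also have "... dvd M"
   unfolding M_def
  proof (rule prod_dvd_prod_subset[OF fin])
   show "prime_factors i \<subseteq> ?P"
   proof
    fix p assume p: "p \<in> prime_factors i"
    then have "p \<le> i" using i by (intro dvd_imp_le in_prime_factors_imp_dvd) auto
    then show "p \<in> ?P" using i in_prime_factors_imp_prime[OF p] by simp
   qed
  qed
  finally show ?thesis .
 qed
 have "k * (X choose k) dvd M"
  by (rule leibniz_triangle_dvd[where N = X]) (use div k in \<open>auto simp: X_def\<close>)
 then have le: "k * (X choose k) \<le> M" using Mpos by (rule dvd_imp_le)
 have "M \<le> (\<Prod>p\<in>?P. X)" unfolding M_def by (intro prod_mono) (use eX in auto)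
 then have MX: "M \<le> X ^ card ?P" by simp
 have "4 ^ k / (2 * real k) \<le> real (X choose k)" unfolding X_def using k by (intro central_binomial_lower_bound) simp
 then have "real k * (4 ^ k / (2 * real k)) \<le> real k * real (X choose k)" by (intro mult_left_mono) auto
 also have "... \<le> real M" using le by (metis of_nat_le_iff of_nat_mult)
 also have "... \<le> real X ^ card ?P" using MX by (metis of_nat_le_iff of_nat_power)
 finally have "4 ^ k / 2 \<le> real X ^ card ?P" using k by simp
 then have "ln (4 ^ k / 2) \<le> ln (real X ^ card ?P)" by (intro ln_mono) auto
 also have "ln (real X ^ card ?P) = card ?P * ln (2 * real k)" 
  using k ln_realpow[of "real X" "card ?P"] by (simp add: X_def del: of_nat_mult)
 also have "ln (4 ^ k / 2 :: real) = (2 * real k - 1) * ln 2"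
 proof -
  have "(4::real) ^ k = 2 ^ (2 * k)" by (simp add: power_mult)
  then show ?thesis by (simp add: ln_div ln_realpow algebra_simps)
 qed
 finally show ?thesis by (simp add: X_def)
qed

lemma fact_card_le_prod:
 assumes "finite A" "\<And>a. a \<in> A \<Longrightarrow> a > (0::nat)"
 shows "fact (card A) \<le> \<Prod>A"
 using assms
proof (induction "card A" arbitrary: A)
 case (Suc n)
 let ?M = "Max A"
 have ne: "A \<noteq> {}" using Suc.hyps(2) by auto
 have M: "?M \<in> A" using Suc.prems ne by simp
 have "A \<subseteq> {1..?M}" using Suc.prems by (auto simp: Suc_le_eq)
 then have "card A \<le> ?M" using card_mono[of "{1..?M}" A] by simp
 moreover have "fact (card (A - {?M})) \<le> \<Prod>(A - {?M})"
  using Suc.prems Suc.hyps(2) M by (intro Suc.hyps(1)) auto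
 moreover have "\<Prod>A = ?M * \<Prod>(A - {?M})" using M Suc.prems by (intro prod.remove) auto
 moreover have "card A = Suc (card (A - {?M}))" by (rule card_Suc_Diff1[OF Suc.prems(1) M, symmetric])
 then have "fact (card A) = card A * (fact (card (A - {?M})) :: nat)" by (simp only: fact_Suc of_nat_id)
 ultimately show ?case by (simp only: mult_le_mono)
qed simp

text \<open>Primes above 5 avoid the multiples of 2, 3 and 5, so they have density at most 4/15
  among the integers. Rounding 4p/15 down compresses them injectively.\<close>

lemma prime_wheel_inj:
 assumes "prime p" "prime q" "p > 5" "q > 5" "4 * p div 15 = 4 * q div (15::nat)"
 shows "p = q"
proof -
 have w: "p mod 2 \<noteq> 0 \<and> p mod 3 \<noteq> 0 \<and> p mod 5 \<noteq> 0" if "prime p" "p > 5" for p :: nat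
 proof -
  have "\<not> c dvd p" if "c \<noteq> 1" "c < p" for c
   using that \<open>prime p\<close> by (auto simp: prime_nat_iff)
  from this[of 2] this[of 3] this[of 5] \<open>p > 5\<close> show ?thesis by (auto simp: dvd_eq_mod_eq_0)
 qed
 have "p mod 2 = 1" "q mod 2 = 1" "p mod 3 \<noteq> 0" "p mod 5 \<noteq> 0" "q mod 3 \<noteq> 0" "q mod 5 \<noteq> 0"
  using w[OF assms(1,3)] w[OF assms(2,4)] by auto
 moreover have False if pq: "p < q" "p mod 2 = 1" "q mod 2 = 1" "p mod 3 \<noteq> 0" "p mod 5 \<noteq> 0" "q mod 3 \<noteq> 0" "q mod 5 \<noteq> 0"
   "4 * p div 15 = 4 * q div 15" for p q :: nat
 proof -
  have "4 * q mod 15 < 15" by simp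
  then have "4 * q < 4 * p + 15"
   using div_mult_mod_eq[of "4 * p" 15] div_mult_mod_eq[of "4 * q" 15] pq(8) by linarith
  \<comment> \<open>Equal quotients force 4 (q - p) < 15, and both numbers are odd. The residues of
    p modulo 15 are then checked one by one.\<close>
  then have q: "q = p + 2" using pq(1-3) by presburger
  define b where "b = p mod 15"
  have b: "b < 15" by (simp add: b_def)
  have h1: "b mod 3 = p mod 3" "b mod 5 = p mod 5" by (simp_all add: b_def mod_mod_cancel)
  have "q = (b + 2) + 3 * (5 * (p div 15))" "q = (b + 2) + 5 * (3 * (p div 15))" by (simp_all add: q b_def)
  then have h2: "(b + 2) mod 3 = q mod 3" "(b + 2) mod 5 = q mod 5" by (metis mod_mult_self2)+
  have h3: "4 * b div 15 = (4 * b + 8) div 15"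
  proof -
   have p: "p = 15 * (p div 15) + b" by (simp add: b_def)
   have "4 * p div 15 = 4 * (p div 15) + 4 * b div 15" by (subst p) (simp add: algebra_simps)
   moreover have "4 * q div 15 = 4 * (p div 15) + (4 * b + 8) div 15" unfolding q by (subst p) (simp add: algebra_simps)
   ultimately show ?thesis using pq(8) by simp
  qed
  have "list_all (\<lambda>b. b mod 3 = 0 \<or> b mod 5 = 0 \<or> (b + 2) mod 3 = 0 \<or> (b + 2) mod 5 = 0 \<or> 4 * b div 15 \<noteq> (4 * b + 8) div 15) [2..<15]" by simp
  then have "\<forall>b\<in>set [2..<15]. b mod 3 = 0 \<or> b mod 5 = 0 \<or> (b + 2) mod 3 = 0 \<or> (b + 2) mod 5 = 0 \<or> 4 * b div 15 \<noteq> (4 * b + 8) div 15"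
   by (simp only: list_all_iff)
  moreover have "b \<noteq> 0" using pq(4) h1(1) by (intro notI) simp
  moreover have "b \<noteq> 1"
  proof
   assume "b = 1"
   then have "q mod 3 = 0" using h2(1) by simp
   then show False using pq(6) by simp
  qed
  ultimately have "\<forall>b\<in>set [2..<15]. b mod 3 = 0 \<or> b mod 5 = 0 \<or> (b + 2) mod 3 = 0 \<or> (b + 2) mod 5 = 0 \<or> 4 * b div 15 \<noteq> (4 * b + 8) div 15"
   "b \<noteq> 0" "b \<noteq> 1" by blast+
  moreover from this(2,3) have "b \<in> set [2..<15]" using b by (simp only: set_upt atLeastLessThan_iff) simp
  ultimately show False using pq(4-7) h1 h2 h3 by metis
 qed
 ultimately show ?thesis using assms(5) by (metis linorder_neqE_nat)
qed

text \<open>The s compressed primes are distinct positive integers, so their product is at least s!.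
  Hence the product of the primes is at least (15/4)^s s!, and s! >= (s/e)^s.\<close>

lemma prime_set_prod_lower:
 fixes P :: "nat set"
 assumes "finite P" "\<And>p. p \<in> P \<Longrightarrow> prime p \<and> p > (5::nat)"
 shows "card P * (ln (15 / 4) + ln (card P) - 1) \<le> (\<Sum>p\<in>P. ln p)"
proof (cases "P = {}")
 case False
 let ?s = "card P" and ?q = "\<lambda>p::nat. 4 * p div 15"
 have s: "?s > 0" using assms(1) False by (simp add: card_gt_0_iff)
 have inj: "inj_on ?q P" using assms(2) prime_wheel_inj by (intro inj_onI) blast
 have "fact (card (?q ` P)) \<le> \<Prod>(?q ` P)"
  by (rule fact_card_le_prod) (use assms in \<open>force\<close>)+
 then have f: "fact ?s \<le> (\<Prod>p\<in>P. ?q p)" using inj by (simp add: card_image prod.reindex)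
 have "(15 / 4) ^ ?s * fact ?s \<le> (15 / 4) ^ ?s * real (\<Prod>p\<in>P. ?q p)"
  using f by (intro mult_left_mono) (metis of_nat_fact of_nat_le_iff, simp)
 also have "... = (\<Prod>p\<in>P. 15 / 4 * real (?q p))" by (simp only: of_nat_prod prod.distrib prod_constant)
 also have "... \<le> (\<Prod>p\<in>P. real p)"
 proof (rule prod_mono, intro conjI)
  fix p :: nat
  have "15 * (4 * p div 15) \<le> 4 * p" by simp
  then have "15 * real (4 * p div 15) \<le> 4 * real p" by (metis of_nat_le_iff of_nat_mult of_nat_numeral)
  then show "15 / 4 * real (?q p) \<le> real p" by simp
 qed simp
 finally have "ln ((15 / 4) ^ ?s * fact ?s) \<le> ln (\<Prod>p\<in>P. real p)" by (intro ln_mono) auto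
 also have "ln (\<Prod>p\<in>P. real p) = (\<Sum>p\<in>P. ln p)" using assms by (intro ln_prod) force+
 also have "ln ((15 / 4) ^ ?s * fact ?s) = ?s * ln (15 / 4) + ln (fact ?s)" by (simp add: ln_mult ln_realpow)
 finally have 1: "?s * ln (15 / 4) + ln (fact ?s) \<le> (\<Sum>p\<in>P. ln p)" .
 \<comment> \<open>A single term of the exponential series at s.\<close>
 have "real ?s ^ ?s / fact ?s \<le> exp (real ?s)"
 proof -
  have "(\<lambda>n. real ?s ^ n /\<^sub>R fact n) sums exp (real ?s)" by (rule exp_converges)
  then have sm: "summable (\<lambda>n. real ?s ^ n /\<^sub>R fact n)" "exp (real ?s) = (\<Sum>n. real ?s ^ n /\<^sub>R fact n)"
   by (auto simp: sums_iff)
  have "(\<Sum>n\<in>{?s}. real ?s ^ n /\<^sub>R fact n) \<le> exp (real ?s)"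
   unfolding sm(2) by (intro sum_le_suminf sm(1)) auto
  then show ?thesis by (simp add: divide_inverse_commute)
 qed
 then have "ln (real ?s ^ ?s / fact ?s) \<le> ln (exp (real ?s))" using s by (intro ln_mono) auto
 then have "?s * ln ?s - ln (fact ?s) \<le> ?s" using s by (simp add: ln_div ln_realpow)
 then show ?thesis using 1 by (simp add: algebra_simps)
qed simp

section \<open>Choosing the primes\<close>

lemma ln2_bounds: "6931 / 10000 \<le> ln (2::real)" "ln (2::real) \<le> 6932 / 10000"
 using ln_approx_bounds[of 2 4] by (simp_all add: eval_nat_numeral)

text \<open>Comparing powers with powers of 2 reduces every numerical logarithm to the bounds for ln
  2 and rational arithmetic.\<close>

lemma ln_le_of_power:
 assumes "0 < x" "i > 0" "x ^ i \<le> 2 ^ j"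
 shows "ln x \<le> j / i * (6932 / 10000)"
proof -
 have "i * ln x = ln (x ^ i)" using assms by (simp add: ln_realpow)
 also have "... \<le> ln (2 ^ j)" using assms by (intro ln_mono) auto
 also have "... = j * ln 2" by (simp add: ln_realpow)
 also have "... \<le> j * (6932 / 10000)" using ln2_bounds by (intro mult_left_mono) auto
 finally show ?thesis using assms(2) by (simp add: field_simps)
qed

lemma ln_ge_of_power:
 assumes "0 < x" "i > 0" "2 ^ j \<le> x ^ i"
 shows "j / i * (6931 / 10000) \<le> ln (x::real)"
proof -
 have "j * (6931 / 10000) \<le> j * ln 2" using ln2_bounds by (intro mult_left_mono) auto
 also have "... = ln (2 ^ j)" by (simp add: ln_realpow)
 also have "... \<le> ln (x ^ i)" using assms by (intro ln_mono) auto
 also have "... = i * ln x" using assms by (simp add: ln_realpow)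
 finally show ?thesis using assms(2) by (simp add: field_simps)
qed

lemma ln_tangent:
 assumes "0 < L" "0 < (c::real)"
 shows "ln L \<le> ln c - 1 + L / c"
 using ln_le_minus_one[of "L / c"] assms by (simp add: ln_div)

text \<open>For L = ln D: some multiplicity m and prime set P make the inequality of
  \<open>free_log_mahler_bound\<close> force the target height. The target has been put in place of
  the Mahler measure, and D enters only through L.\<close>

definition favourable :: "real \<Rightarrow> bool" where
 "favourable L \<longleftrightarrow> (\<exists>m P. m > 0 \<and> finite P \<and> (\<forall>p\<in>P. prime p) \<and>
  (ln L / L) ^ 3 / 4 * (2 * (real m + card P) * (m + (\<Sum>p\<in>P. real p)))
   + ((real m)\<^sup>2 + card P) * (1 + L + ln (((real m + card P)\<^sup>2 + ((real m)\<^sup>2 + card P)) / (2 * ((real m)\<^sup>2 + card P))))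
  \<le> 2 * real m * (\<Sum>p\<in>P. ln p))"

lemma (in galois_system) favourable_imp_log_mahler:
 assumes S: "free S" "card S \<le> D" and D: "D \<ge> 1" and fav: "favourable (ln D)"
 shows "(ln (ln D) / ln D) ^ 3 / 4 \<le> log_mahler S"
proof -
 obtain m P where mP: "m > 0" "finite P" "\<forall>p\<in>P. prime (p::nat)" and
  fav': "(ln (ln D) / ln D) ^ 3 / 4 * (2 * (real m + card P) * (m + (\<Sum>p\<in>P. real p)))
   + ((real m)\<^sup>2 + card P) * (1 + ln D + ln (((real m + card P)\<^sup>2 + ((real m)\<^sup>2 + card P)) / (2 * ((real m)\<^sup>2 + card P))))
  \<le> 2 * real m * (\<Sum>p\<in>P. ln p)"
  using fav unfolding favourable_def by blast
 define W where "W = real m + card P"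
 define q where "q = (real m)\<^sup>2 + card P"
 define K where "K = 2 * W * (m + (\<Sum>p\<in>P. real p))"
 define Th where "Th = 2 * real m * (\<Sum>p\<in>P. ln p)"
 have W: "W > 0" and q: "q > 0" using mP(1) by (auto simp: W_def q_def add_pos_nonneg)
 have K: "K > 0" unfolding K_def using W mP(1) by (intro mult_pos_pos add_pos_nonneg sum_nonneg) auto
 have "Th \<le> K * log_mahler S + q * (1 + ln ((D * W\<^sup>2 + q) / (2 * q)))"
  unfolding Th_def K_def W_def q_def by (rule free_log_mahler_bound[OF S mP(2) _ mP(1)]) (use mP(3) in auto)
 \<comment> \<open>Pulling D out of the logarithm makes the remaining condition depend on D only
   through ln D.\<close>
 also have "ln ((D * W\<^sup>2 + q) / (2 * q)) \<le> ln D + ln ((W\<^sup>2 + q) / (2 * q))"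
 proof -
  have "real D * W\<^sup>2 + q \<le> real D * (W\<^sup>2 + q)" using D q mult_right_mono[of 1 "real D" q] by (simp add: distrib_left)
  then have "(D * W\<^sup>2 + q) / (2 * q) \<le> real D * ((W\<^sup>2 + q) / (2 * q))" using q by (simp add: divide_right_mono)
  then have "ln ((D * W\<^sup>2 + q) / (2 * q)) \<le> ln (real D * ((W\<^sup>2 + q) / (2 * q)))"
   using q by (intro ln_mono) (auto intro!: divide_pos_pos add_nonneg_pos)
  also have "... = ln D + ln ((W\<^sup>2 + q) / (2 * q))" using D q W by (intro ln_mult_pos) (auto intro!: divide_pos_pos add_nonneg_pos)
  finally show ?thesis .
 qed
 finally have "Th \<le> K * log_mahler S + q * (1 + (ln D + ln ((W\<^sup>2 + q) / (2 * q))))" using q by (simp add: mult_left_mono)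
 moreover have "(ln (ln D) / ln D) ^ 3 / 4 * K + q * (1 + ln D + ln ((W\<^sup>2 + q) / (2 * q))) \<le> Th"
  using fav' unfolding K_def W_def q_def Th_def .
 ultimately have "(ln (ln D) / ln D) ^ 3 / 4 * K \<le> K * log_mahler S" unfolding add.assoc by linarith
 then have "(ln (ln D) / ln D) ^ 3 / 4 * K \<le> log_mahler S * K" by (simp only: mult.commute)
 then show ?thesis using K by (simp only: mult_le_cancel_right_pos)
qed

lemma cube_convex:
 assumes "0 \<le> x" "0 \<le> y" "0 \<le> \<theta>" "\<theta> \<le> (1::real)"
 shows "(\<theta> * x + (1 - \<theta>) * y) ^ 3 \<le> \<theta> * x ^ 3 + (1 - \<theta>) * y ^ 3"
proof -
 have "\<theta> * x ^ 3 + (1 - \<theta>) * y ^ 3 - (\<theta> * x + (1 - \<theta>) * y) ^ 3 = \<theta> * (1 - \<theta>) * (x - y)\<^sup>2 * ((1 + \<theta>) * x + (2 - \<theta>) * y)"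
  by (simp add: power2_eq_square power3_eq_cube algebra_simps)
 moreover have "... \<ge> 0" using assms by (intro mult_nonneg_nonneg add_nonneg_nonneg) auto
 ultimately show ?thesis by simp
qed

text \<open>The left side is a convex function of L and the right side is affine, so the two
  endpoints of an interval suffice.\<close>

lemma convex_endpoints:
 fixes \<alpha> \<beta> K a b L G Q :: real
 assumes "0 < a" "a \<le> L" "L \<le> b" "0 \<le> \<alpha>" "0 \<le> \<beta>" "0 \<le> K"
  and A: "K * (\<alpha> / a + \<beta>) ^ 3 \<le> G - Q * a" and B: "K * (\<alpha> / b + \<beta>) ^ 3 \<le> G - Q * b"
 shows "K * (\<alpha> / L + \<beta>) ^ 3 \<le> G - Q * L"
proof (cases "a = b")
 case False
 then have ab: "a < b" using assms by simp
 define \<theta> where "\<theta> = (b - L) / (b - a)"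
 have \<theta>: "0 \<le> \<theta>" "\<theta> \<le> 1" using assms ab by (auto simp: \<theta>_def)
 have L: "L = \<theta> * a + (1 - \<theta>) * b"
 proof -
  have "\<theta> * (b - a) = b - L" using ab by (simp add: \<theta>_def)
  then show ?thesis by (simp add: algebra_simps)
 qed
 have pos: "0 < L" "0 < b" using assms by auto
 have "(L - a) * (b - L) \<ge> 0" using assms by simp
 \<comment> \<open>The convex function 1 / L lies below its chord between a and b.\<close>
 then have "1 / L \<le> (a + b - L) / (a * b)" 
 proof -
  have "a * b \<le> (a + b - L) * L" using \<open>(L - a) * (b - L) \<ge> 0\<close> by (simp add: algebra_simps)
  then show ?thesis using pos assms(1) by (simp add: pos_le_divide_eq pos_divide_le_eq)
 qed
 also have "(a + b - L) / (a * b) = \<theta> / a + (1 - \<theta>) / b"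
  unfolding L using pos assms(1) by (simp add: divide_simps algebra_simps)
 finally have "\<alpha> / L + \<beta> \<le> \<alpha> * (\<theta> / a + (1 - \<theta>) / b) + \<beta>" using mult_left_mono[OF _ assms(4)] by fastforce
 also have "... = \<theta> * (\<alpha> / a + \<beta>) + (1 - \<theta>) * (\<alpha> / b + \<beta>)" by (simp add: algebra_simps)
 finally have "(\<alpha> / L + \<beta>) ^ 3 \<le> (\<theta> * (\<alpha> / a + \<beta>) + (1 - \<theta>) * (\<alpha> / b + \<beta>)) ^ 3"
  using assms pos by (intro power_mono) auto
 also have "... \<le> \<theta> * (\<alpha> / a + \<beta>) ^ 3 + (1 - \<theta>) * (\<alpha> / b + \<beta>) ^ 3"
  using assms pos \<theta> by (intro cube_convex) auto
 finally have "K * (\<alpha> / L + \<beta>) ^ 3 \<le> K * (\<theta> * (\<alpha> / a + \<beta>) ^ 3 + (1 - \<theta>) * (\<alpha> / b + \<beta>) ^ 3)"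
  using assms(6) by (intro mult_left_mono)
 also have "... = \<theta> * (K * (\<alpha> / a + \<beta>) ^ 3) + (1 - \<theta>) * (K * (\<alpha> / b + \<beta>) ^ 3)" by (simp add: algebra_simps)
 also have "... \<le> \<theta> * (G - Q * a) + (1 - \<theta>) * (G - Q * b)" using A B \<theta> by (intro add_mono mult_left_mono) auto
 also have "... = G - Q * L" unfolding L by (simp add: algebra_simps)
 finally show ?thesis .
qed (use assms in simp)

text \<open>One row settles an interval [A, B] with one prime set. The tangent to ln at c gives ln L
  / L <= \<alpha> / L + 1 / c, where \<alpha> bounds ln c - 1 through c^i <= 2^l; 2^k is a lower
  bound for the product of the primes, and j/4 bounds the binary logarithm of the remaining
  quotient.\<close>

lemma favourable_row:
 fixes \<alpha> c A B L :: real and m s t a e k j X i l :: nat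
 assumes data: "\<exists>P. prime_data P X s t a e" and m: "m > 0" and k: "2 ^ k \<le> a * 2 ^ e"
  and j: "(((real m + s)\<^sup>2 + ((real m)\<^sup>2 + s)) / (2 * ((real m)\<^sup>2 + s))) ^ 4 \<le> 2 ^ j"
  and c: "0 < c" "i > 0" "c ^ i \<le> 2 ^ l" and \<alpha>: "l / i * (6932 / 10000) - 1 \<le> \<alpha>" "0 \<le> \<alpha>"
  and L: "1 \<le> A" "A \<le> L" "L \<le> B"
  and A: "(real m + s) * (real m + t) / 2 * (\<alpha> / A + 1 / c) ^ 3
   \<le> (2 * real m * (k * (6931 / 10000)) - ((real m)\<^sup>2 + s) * (1 + j / 4 * (6932 / 10000))) - ((real m)\<^sup>2 + s) * A"
  and B: "(real m + s) * (real m + t) / 2 * (\<alpha> / B + 1 / c) ^ 3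
   \<le> (2 * real m * (k * (6931 / 10000)) - ((real m)\<^sup>2 + s) * (1 + j / 4 * (6932 / 10000))) - ((real m)\<^sup>2 + s) * B"
 shows "favourable L"
proof -
 obtain P where P: "finite P" "\<And>p. p \<in> P \<Longrightarrow> prime p" "card P = s" "\<Sum>P = t" "a * 2 ^ e \<le> \<Prod>P"
  using data unfolding prime_data_def by blast
 define q where "q = (real m)\<^sup>2 + s"
 define W where "W = real m + s"
 have q: "q > 0" using m by (simp add: q_def add_pos_nonneg)
 have L1: "1 \<le> L" using L by simp
 have "0 \<le> ln L / L" using L1 by simp
 moreover have "ln L / L \<le> \<alpha> / L + 1 / c"
 proof -
  have "ln L \<le> ln c - 1 + L / c" using L1 c by (intro ln_tangent) auto
  also have "ln c \<le> l / i * (6932 / 10000)" by (rule ln_le_of_power[OF c])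
  finally have "ln L \<le> \<alpha> + L / c" using \<alpha> by simp
  then have "ln L / L \<le> (\<alpha> + L / c) / L" using L1 by (intro divide_right_mono) auto
  then show ?thesis using L1 by (simp add: add_divide_distrib)
 qed
 ultimately have "(ln L / L) ^ 3 \<le> (\<alpha> / L + 1 / c) ^ 3" by (intro power_mono)
 then have "W * (real m + t) / 2 * (ln L / L) ^ 3 \<le> W * (real m + t) / 2 * (\<alpha> / L + 1 / c) ^ 3"
  by (intro mult_left_mono) (auto simp: W_def)
 also have "... \<le> (2 * real m * (k * (6931 / 10000)) - q * (1 + j / 4 * (6932 / 10000))) - q * L"
  by (rule convex_endpoints[of A L B]) (use L \<alpha> c A B in \<open>auto simp: W_def q_def\<close>)
 finally have 1: "W * (real m + t) / 2 * (ln L / L) ^ 3 \<le> (2 * real m * (k * (6931 / 10000)) - q * (1 + j / 4 * (6932 / 10000))) - q * L" .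
 have "k * (6931 / 10000) \<le> k * ln 2" using ln2_bounds by (intro mult_left_mono) auto
 also have "... = ln (2 ^ k)" by (simp add: ln_realpow)
 also have "... \<le> ln (real (\<Prod>P))"
 proof (rule ln_mono)
  have "2 ^ k \<le> \<Prod>P" using k P(5) by (rule order_trans)
  then show "(2::real) ^ k \<le> real (\<Prod>P)" by (metis of_nat_le_iff of_nat_numeral of_nat_power)
 qed simp
 also have "... = (\<Sum>p\<in>P. ln p)"
 proof -
  have "ln (\<Prod>p\<in>P. real p) = (\<Sum>p\<in>P. ln p)" using P(1,2) prime_gt_0_nat by (intro ln_prod) auto
  then show ?thesis by simp
 qed
 finally have 2: "2 * real m * (k * (6931 / 10000)) \<le> 2 * real m * (\<Sum>p\<in>P. ln p)" by (intro mult_left_mono) auto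
 have "ln ((W\<^sup>2 + q) / (2 * q)) \<le> j / (4::nat) * (6932 / 10000)"
 proof (rule ln_le_of_power)
  show "(W\<^sup>2 + q) / (2 * q) > 0" using q by (intro divide_pos_pos add_nonneg_pos) auto
  show "((W\<^sup>2 + q) / (2 * q)) ^ 4 \<le> 2 ^ j" using j by (simp only: W_def q_def)
 qed simp
 then have 3: "q * (1 + L + ln ((W\<^sup>2 + q) / (2 * q))) \<le> q * (1 + L + j / 4 * (6932 / 10000))" using q by (intro mult_left_mono) auto
 have t: "(\<Sum>p\<in>P. real p) = t" unfolding P(4)[symmetric] by simp
 have "(ln L / L) ^ 3 / 4 * (2 * W * (m + (\<Sum>p\<in>P. real p))) + q * (1 + L + ln ((W\<^sup>2 + q) / (2 * q))) \<le> 2 * real m * (\<Sum>p\<in>P. ln p)"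
 proof -
  have "(ln L / L) ^ 3 / 4 * (2 * W * (m + (\<Sum>p\<in>P. real p))) = W * (real m + t) / 2 * (ln L / L) ^ 3" unfolding t by simp
  moreover have "q * (1 + L + j / 4 * (6932 / 10000)) = q * (1 + j / 4 * (6932 / 10000)) + q * L" by (simp only: ring_distribs add_ac)
  ultimately show ?thesis using 1 2 3 by linarith
 qed
 then show ?thesis unfolding favourable_def using m P(1-3) unfolding W_def q_def by blast
qed

text \<open>The rows reach up to 183/2, which exceeds exp (9/2), where
  \<open>favourable_large\<close> takes over. Consecutive intervals may share a prime set and differ
  only in the tangent point c.\<close>

lemma favourable_rows:
 assumes "1 \<le> L" "L \<le> 183 / 2"
 shows "favourable L"
proof -
 consider "L \<le> 4" | "4 \<le> L" "L \<le> (13 / 2)" | "(13 / 2) \<le> L" "L \<le> (51 / 5)" | "(51 / 5) \<le> L" "L \<le> (229 / 10)" | "(229 / 10) \<le> L" "L \<le> (132 / 5)" | "(132 / 5) \<le> L" "L \<le> (763 / 10)" | "(763 / 10) \<le> L" "L \<le> (183 / 2)"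
  using assms by linarith
 then show ?thesis
 proof cases
  case 1
  show ?thesis
   by (rule favourable_row[OF prime_data_16, where m = 7 and k = 74 and j = 9 and c = "(68 / 25)" and i = 9 and l = 13
     and \<alpha> = "(129 / 100000)" and A = "1" and B = "4"]) (use 1 assms in \<open>simp_all add: power2_eq_square power3_eq_cube power_divide\<close>)
 next
  case 2
  show ?thesis
   by (rule favourable_row[OF prime_data_28, where m = 11 and k = 151 and j = 10 and c = "4" and i = 4 and l = 8
     and \<alpha> = "(483 / 1250)" and A = "4" and B = "(13 / 2)"]) (use 2 assms in \<open>simp_all add: power2_eq_square power3_eq_cube power_divide\<close>)
 next
  case 3
  show ?thesis
   by (rule favourable_row[OF prime_data_28, where m = 11 and k = 151 and j = 10 and c = "(9513 / 1000)" and i = 4 and l = 13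
     and \<alpha> = "(12529 / 10000)" and A = "(13 / 2)" and B = "(51 / 5)"]) (use 3 assms in \<open>simp_all add: power2_eq_square power3_eq_cube power_divide\<close>)
 next
  case 4
  show ?thesis
   by (rule favourable_row[OF prime_data_76, where m = 18 and k = 532 and j = 15 and c = "(9513 / 1000)" and i = 4 and l = 13
     and \<alpha> = "(12529 / 10000)" and A = "(51 / 5)" and B = "(229 / 10)"]) (use 4 assms in \<open>simp_all add: power2_eq_square power3_eq_cube power_divide\<close>)
 next
  case 5
  show ?thesis
   by (rule favourable_row[OF prime_data_76, where m = 18 and k = 532 and j = 15 and c = "(22627 / 1000)" and i = 4 and l = 18
     and \<alpha> = "(10597 / 5000)" and A = "(229 / 10)" and B = "(132 / 5)"]) (use 5 assms in \<open>simp_all add: power2_eq_square power3_eq_cube power_divide\<close>)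
 next
  case 6
  show ?thesis
   by (rule favourable_row[OF prime_data_255, where m = 25 and k = 2298 and j = 22 and c = "(6727 / 250)" and i = 4 and l = 19
     and \<alpha> = "(22927 / 10000)" and A = "(132 / 5)" and B = "(763 / 10)"]) (use 6 assms in \<open>simp_all add: power2_eq_square power3_eq_cube power_divide\<close>)
 next
  case 7
  show ?thesis
   by (rule favourable_row[OF prime_data_270, where m = 17 and k = 2458 and j = 25 and c = "(90509 / 1000)" and i = 4 and l = 26
     and \<alpha> = "(17529 / 5000)" and A = "(763 / 10)" and B = "(183 / 2)"]) (use 7 assms in \<open>simp_all add: power2_eq_square power3_eq_cube power_divide\<close>)
 qed
qed

text \<open>By Chebyshev's bound the j-th prime above 5 is at most c (j + 4) + 3 with c = 2 ln L /
  ln 2. The hypothesis on s keeps the search range below L^2, so that the logarithm in Chebyshev's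
  bound is at most 2 ln L.\<close>

lemma first_primes:
 fixes L :: real
 assumes L: "L \<ge> exp 1" and s: "2 * ln L / ln 2 * (real s + 3) + 3 \<le> L\<^sup>2"
 obtains P where "finite P" "card P = s" "\<forall>p\<in>P. prime p \<and> p > (5::nat)"
  "(\<Sum>p\<in>P. real p) \<le> 2 * ln L / ln 2 * ((real s)\<^sup>2 / 2 + 7 / 2 * real s) + 3 * real s"
proof -
 let ?S = "{p. prime p \<and> p > (5::nat)}"
 define c where "c = 2 * ln L / ln 2"
 have t: "ln L \<ge> 1" using L ln_mono[of "exp 1" L] by simp
 then have c0: "c > 0" by (simp add: c_def)
 have inf: "infinite ?S"
 proof
  assume "finite ?S"
  then have "finite (?S \<union> {..5})" by simp
  moreover have "{p::nat. prime p} \<subseteq> ?S \<union> {..5}" by auto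
  ultimately show False using primes_infinite finite_subset by blast
 qed
 let ?e = "enumerate ?S"
 have eS: "?e j \<in> ?S" for j by (rule enumerate_in_set[OF inf])
 have inj: "inj_on ?e {..<s}" using strict_mono_enumerate[OF inf] by (simp add: strict_mono_imp_inj_on inj_on_subset[OF _ subset_UNIV])
 have bound: "real (?e j) \<le> c * (real j + 4) + 3" if j: "j < s" for j
 proof -
  \<comment> \<open>With k the least integer such that 2k - 1 >= Y, Chebyshev's bound yields at
    least j + 4 primes up to 2k.\<close>
  define Y where "Y = c * (real j + 4)"
  define h where "h = (Y + 1) / 2"
  define k where "k = nat \<lceil>h\<rceil>"
  have Y0: "0 \<le> Y" using c0 by (simp add: Y_def)
  have h: "2 * h = Y + 1" by (simp add: h_def)
  have kb: "real k \<ge> h" "real k \<le> h + 1"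
  proof -
   have "0 \<le> h" using Y0 by (simp add: h_def)
   then have "real k = of_int \<lceil>h\<rceil>" unfolding k_def by (simp add: of_nat_nat)
   then show "real k \<ge> h" "real k \<le> h + 1" by linarith+
  qed
  have "0 < real k" using kb(1) Y0 h by linarith
  then have k1: "k \<ge> 1" by simp
  have "2 * real k \<le> Y + 3" using kb(2) h by linarith
  then have k3: "2 * real k \<le> c * (real j + 4) + 3" by (simp only: Y_def)
  also have "... \<le> c * (real s + 3) + 3" using j c0 by (intro add_right_mono mult_left_mono) auto
  also have "... \<le> L\<^sup>2" using s by (simp add: c_def)
  finally have "ln (2 * real k) \<le> ln (L\<^sup>2)" using k1 by (intro ln_mono) auto
  also have "... = 2 * ln L" using L exp_gt_zero[of 1] by (subst ln_realpow) linarith+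
  finally have lnk: "ln (2 * real k) \<le> 2 * ln L" .
  have "Y \<le> 2 * real k - 1" using kb(1) h by linarith
  then have "(c * (real j + 4)) * ln 2 \<le> (2 * real k - 1) * ln 2" unfolding Y_def by (intro mult_right_mono) auto
  also have "... \<le> card {p. prime p \<and> p \<le> 2 * k} * ln (2 * real k)" by (rule prime_count_lower[OF k1])
  also have "... \<le> card {p. prime p \<and> p \<le> 2 * k} * (2 * ln L)" using lnk by (intro mult_left_mono) auto
  finally have "(real j + 4) * (2 * ln L) \<le> card {p. prime p \<and> p \<le> 2 * k} * (2 * ln L)"
   by (simp add: c_def mult_ac)
  \<comment> \<open>Below the j-th prime after 5, counted from 0, there are the primes 2, 3, 5 and j
    further ones; one prime more forces it into the range.\<close>
  then have cd: "j + 4 \<le> card {p. prime p \<and> p \<le> 2 * k}" using t by simp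
  have "?e j \<le> 2 * k"
  proof (rule ccontr)
   assume neg: "\<not> ?e j \<le> 2 * k"
   have "{p. prime p \<and> p \<le> 2 * k} \<subseteq> {2, 3, 5} \<union> ?e ` {..<j}"
   proof
    fix p assume p: "p \<in> {p. prime p \<and> p \<le> 2 * k}"
    show "p \<in> {2, 3, 5} \<union> ?e ` {..<j}"
    proof (cases "p > 5")
     case True
     then obtain i where i: "?e i = p" using enumerate_Ex[of ?S p] p inf by auto
     have "i < j"
     proof (rule ccontr)
      assume "\<not> i < j"
      then have "?e j \<le> ?e i" using strict_mono_enumerate[OF inf] by (simp add: strict_mono_less_eq)
      then show False using neg i p by simp
     qed
     then show ?thesis using i by auto
    next
     case False
     have "prime p" using p by simp
     moreover have "p \<noteq> 0" "p \<noteq> 1" "p \<noteq> 4" using \<open>prime p\<close> by (auto simp: prime_nat_iff dest!: spec[of _ 2])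
     ultimately have "p = 2 \<or> p = 3 \<or> p = 5" using False by linarith
     then show ?thesis by auto
    qed
   qed
   then have "card {p. prime p \<and> p \<le> 2 * k} \<le> card ({2, 3, 5} \<union> ?e ` {..<j})" by (intro card_mono) auto
   also have "... \<le> card {2, 3, 5::nat} + card (?e ` {..<j})" by (rule card_Un_le)
   also have "... \<le> 3 + j" using card_image_le[of "{..<j}" ?e] by simp
   finally show False using cd by simp
  qed
  then have "real (?e j) \<le> 2 * real k" by (metis of_nat_le_iff of_nat_mult of_nat_numeral)
  then show ?thesis using k3 by linarith
 qed
 have "(\<Sum>p\<in>?e ` {..<s}. real p) = (\<Sum>j<s. real (?e j))" using inj by (simp add: sum.reindex)
 also have "... \<le> (\<Sum>j<s. c * (real j + 4) + 3)" using bound by (intro sum_mono) auto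
 also have "... = c * ((\<Sum>j<s. real j) + 4 * real s) + 3 * real s" by (simp add: sum.distrib sum_distrib_left[symmetric])
 also have "(\<Sum>j<s. real j) = (real s)\<^sup>2 / 2 - real s / 2"
  by (induction s) (auto simp: power2_eq_square field_simps)
 also have "c * ((real s)\<^sup>2 / 2 - real s / 2 + 4 * real s) + 3 * real s = 2 * ln L / ln 2 * ((real s)\<^sup>2 / 2 + 7 / 2 * real s) + 3 * real s"
  by (simp add: c_def)
 finally have "(\<Sum>p\<in>?e ` {..<s}. real p) \<le> 2 * ln L / ln 2 * ((real s)\<^sup>2 / 2 + 7 / 2 * real s) + 3 * real s" .
 then show ?thesis using eS inj by (intro that[of "?e ` {..<s}"]) (auto simp: card_image)
qed

section \<open>Large degrees: an asymptotic choice of the primes with explicit constants\<close>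

lemma exp_1_lower: "2716 / 1000 \<le> exp (1::real)"
proof -
 have sm: "summable (\<lambda>n. (1::real) ^ n /\<^sub>R fact n)" "exp (1::real) = (\<Sum>n. 1 ^ n /\<^sub>R fact n)"
  using exp_converges[of "1::real"] by (auto simp: sums_iff)
 have "(\<Sum>n<6. (1::real) ^ n /\<^sub>R fact n) \<le> exp 1" unfolding sm(2) by (intro sum_le_suminf sm(1)) auto
 then show ?thesis by (simp add: lessThan_nat_numeral fact_numeral)
qed

text \<open>Put t = ln L and y = L / t, and use about 3 y^2 / 2 primes and the multiplicity 2 y. The
  height term is then at most about 2.65 t y^3 and the diagonal term about 5.71 t y^3, against a
  gain of about 12 y^3 ln y, where ln y = t - ln t. The gain wins from t = 9/2 on.\<close>

lemma favourable_large:
 assumes L0: "L > 0" and "4.5 \<le> ln L"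
 shows "favourable L"
proof -
 define t where "t = ln L"
 define y where "y = L / t"
 have t45: "t \<ge> 9 / 2" using assms by (simp add: t_def)
 have L: "L = exp t" using L0 by (simp add: t_def)
 have e45: "8955 / 100 \<le> exp (9 / 2 :: real)"
 proof (rule power2_le_imp_le)
  have "(8955 / 100)\<^sup>2 \<le> (2716 / 1000 :: real) ^ 9" by (simp add: power2_eq_square power_divide)
  also have "... \<le> exp 1 ^ 9" using exp_1_lower by (intro power_mono) auto
  also have "... = (exp (9 / 2))\<^sup>2" by (simp flip: exp_of_nat_mult)
  finally show "(8955 / 100)\<^sup>2 \<le> (exp (9 / 2 :: real))\<^sup>2" .
 qed simp
 \<comment> \<open>The value at t = 9/2 is 89.55 / 4.5; to the right of it exp t grows faster than
   t.\<close>
 have y: "y \<ge> 199 / 10"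
 proof -
  have "exp t = exp (9 / 2) * exp (t - 9 / 2)" by (simp flip: exp_add)
  also have "... \<ge> exp (9 / 2) * (1 + (t - 9 / 2))" using exp_ge_add_one_self[of "t - 9 / 2"] by (intro mult_left_mono) auto
  also have "exp (9 / 2) * (1 + (t - 9 / 2)) \<ge> 8955 / 100 * (1 + (t - 9 / 2))" using e45 t45 by (intro mult_right_mono) auto
  also have "8955 / 100 * (1 + (t - 9 / 2)) \<ge> 199 / 10 * t" using t45 by simp
  finally show ?thesis unfolding y_def L using t45 by (simp add: pos_le_divide_eq)
 qed
 have Ly: "L = t * y" using t45 by (simp add: y_def)
 define l where "l = ln y"
 have lt: "l = t - ln t" unfolding l_def y_def using L0 t45 by (simp add: ln_div t_def)
 \<comment> \<open>The tangent to ln at 9/2 turns l = t - ln t into a linear lower bound in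
   t.\<close>
 have l1: "7 / 9 * t - 506 / 1000 \<le> l"
 proof -
  have "ln t \<le> ln (9 / 2) - 1 + t / (9 / 2)" using t45 by (intro ln_tangent) auto
  also have "ln (9 / 2 :: real) \<le> 63 / 29 * (6932 / 10000)"
   using ln_le_of_power[of "9 / 2" 29 63] by (simp add: power_divide)
  finally show ?thesis unfolding lt by simp
 qed
 have l2: "l \<le> 2004 / 1000 + y / (199 / 10)"
 proof -
  have "l \<le> ln (199 / 10) - 1 + y / (199 / 10)" unfolding l_def using y by (intro ln_tangent) auto
  also have "ln (199 / 10 :: real) \<le> 13 / 3 * (6932 / 10000)"
   using ln_le_of_power[of "199 / 10" 3 13] by (simp add: power_divide)
  finally show ?thesis by simp
 qed
 define s where "s = nat \<lceil>3 / 2 * y\<^sup>2\<rceil>"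
 define m where "m = nat \<lceil>2 * y\<rceil>"
 have y2: "y\<^sup>2 \<ge> 39601 / 100" using power_mono[OF y, of 2] by (simp add: power2_eq_square)
 have s: "3 / 2 * y\<^sup>2 \<le> s" "s \<le> 3 / 2 * y\<^sup>2 + 1"
 proof -
  have "0 \<le> 3 / 2 * y\<^sup>2" by simp
  then have "real s = of_int \<lceil>3 / 2 * y\<^sup>2\<rceil>" unfolding s_def by (simp add: of_nat_nat)
  then show "3 / 2 * y\<^sup>2 \<le> s" "s \<le> 3 / 2 * y\<^sup>2 + 1" by linarith+
 qed
 have m: "2 * y \<le> m" "m \<le> 2 * y + 1"
 proof -
  have "0 \<le> 2 * y" using y by simp
  then have "real m = of_int \<lceil>2 * y\<rceil>" unfolding m_def by (simp add: of_nat_nat)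
  then show "2 * y \<le> m" "m \<le> 2 * y + 1" by linarith+
 qed
 \<comment> \<open>Since y is at least 19.9, rounding s and m up to integers changes their leading
   coefficients only in the indicated digits.\<close>
 have s2: "s \<le> 15026 / 10000 * y\<^sup>2" using s(2) y2 by simp
 have m2: "m \<le> 20503 / 10000 * y" using m(2) y by simp
 have yy: "y \<le> 10 / 199 * y\<^sup>2" using y mult_right_mono[OF y, of y] by (simp add: power2_eq_square)
 have y4: "y\<^sup>2 \<le> 100 / 39601 * y ^ 4" using mult_right_mono[OF y2, of "y\<^sup>2"] by (simp flip: power_add)
 have ln2: "2 / ln 2 \<le> 28856 / (10000::real)" using ln2_bounds(1) by (simp add: divide_le_eq)
 have c: "2 * ln L / ln 2 \<le> 28856 / 10000 * t" using mult_right_mono[OF ln2, of t] t45 by (simp add: t_def)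
 obtain P where P: "finite P" "card P = s" "\<forall>p\<in>P. prime p \<and> p > 5"
  "(\<Sum>p\<in>P. real p) \<le> 2 * ln L / ln 2 * ((real s)\<^sup>2 / 2 + 7 / 2 * real s) + 3 * real s"
 proof (rule first_primes[of L s])
  show "L \<ge> exp 1" unfolding L using t45 by simp
  have "2 * ln L / ln 2 * (real s + 3) \<le> 28856 / 10000 * t * (real s + 3)" using c by (intro mult_right_mono) auto
  also have "... \<le> 28856 / 10000 * t * (15102 / 10000 * y\<^sup>2)" using s2 y2 t45 by (intro mult_left_mono) auto
  finally have "2 * ln L / ln 2 * (real s + 3) + 3 \<le> (28856 / 10000 * (15102 / 10000)) * (t * y\<^sup>2) + 3" by (simp add: mult_ac)
  also have "... \<le> 436 / 100 * (t * y\<^sup>2) + 3" using t45 by (intro add_right_mono mult_right_mono) auto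
  also have "... \<le> t * (t * y\<^sup>2)"
  proof -
   have "t * y\<^sup>2 \<ge> 9 / 2 * (39601 / 100)" using t45 y2 by (intro mult_mono) auto
   moreover have "(9 / 2) * (t * y\<^sup>2) \<le> t * (t * y\<^sup>2)" using t45 by (intro mult_right_mono) auto
   ultimately show ?thesis by simp
  qed
  also have "... = L\<^sup>2" by (simp add: Ly power2_eq_square)
  finally show "2 * ln L / ln 2 * (real s + 3) + 3 \<le> L\<^sup>2" by simp
 qed
 define W where "W = real m + s"
 define q where "q = (real m)\<^sup>2 + s"
 define Z where "Z = real m + (\<Sum>p\<in>P. real p)"
 have W: "W \<le> 16057 / 10000 * y\<^sup>2" unfolding W_def using s2 m2 yy by simp
 have W0: "W \<ge> 0" by (simp add: W_def)
 have mm: "4 * y\<^sup>2 \<le> (real m)\<^sup>2" "(real m)\<^sup>2 \<le> 42038 / 10000 * y\<^sup>2"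
 proof -
  show "4 * y\<^sup>2 \<le> (real m)\<^sup>2" using power_mono[OF m(1), of 2] y by (simp add: power_mult_distrib)
  have "(real m)\<^sup>2 \<le> (20503 / 10000 * y)\<^sup>2" using m2 by (intro power_mono) auto
  also have "... \<le> 42038 / 10000 * y\<^sup>2" by (simp add: power2_eq_square)
  finally show "(real m)\<^sup>2 \<le> 42038 / 10000 * y\<^sup>2" .
 qed
 have q: "11 / 2 * y\<^sup>2 \<le> q" "q \<le> 57064 / 10000 * y\<^sup>2" unfolding q_def using mm s s2 by simp_all
 have q0: "q > 0" using q(1) y2 by simp
 have Z: "Z \<le> 32986 / 10000 * (t * y ^ 4)"
 proof -
  have sq: "(a * y\<^sup>2)\<^sup>2 = a\<^sup>2 * y ^ 4" for a by (simp add: power_mult_distrib flip: power_mult)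
  have ss: "(real s)\<^sup>2 \<le> 225781 / 100000 * y ^ 4"
  proof -
   have "(real s)\<^sup>2 \<le> (15026 / 10000 * y\<^sup>2)\<^sup>2" using s2 by (intro power_mono) auto
   also have "... = (15026 / 10000)\<^sup>2 * y ^ 4" by (rule sq)
   also have "... \<le> 225781 / 100000 * y ^ 4" by (intro mult_right_mono) (auto simp: power2_eq_square)
   finally show ?thesis .
  qed
  have "(real s)\<^sup>2 / 2 + 7 / 2 * real s \<le> 11422 / 10000 * y ^ 4" using ss s2 y4 by simp
  then have "28856 / 10000 * t * ((real s)\<^sup>2 / 2 + 7 / 2 * real s) \<le> 28856 / 10000 * t * (11422 / 10000 * y ^ 4)"
   using t45 by (intro mult_left_mono) auto
  moreover have "2 * ln L / ln 2 * ((real s)\<^sup>2 / 2 + 7 / 2 * real s) \<le> 28856 / 10000 * t * ((real s)\<^sup>2 / 2 + 7 / 2 * real s)"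
   using c by (intro mult_right_mono) auto
  moreover have "3 * real s + m \<le> 26 / 10000 * (t * y ^ 4)"
  proof -
   have "3 * real s + m \<le> 4611 / 1000 * y\<^sup>2" using s2 m2 yy by simp
   also have "... \<le> 11644 / 1000000 * y ^ 4"
   proof -
    have "0 \<le> y ^ 4" by simp
    then show ?thesis using y4 by linarith
   qed
   also have "... \<le> 26 / 10000 * (9 / 2 * y ^ 4)" by simp
   also have "... \<le> 26 / 10000 * (t * y ^ 4)" using t45 by (intro mult_left_mono mult_right_mono) auto
   finally show ?thesis .
  qed
  ultimately show ?thesis unfolding Z_def using P(4) by simp
 qed
 have Z0: "Z \<ge> 0" unfolding Z_def by (intro add_nonneg_nonneg sum_nonneg) auto
 have y0: "y > 0" using y by simp
 have part1: "(ln L / L) ^ 3 / 4 * (2 * W * Z) \<le> 26483 / 10000 * (t * y ^ 3)"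
 proof -
  have "ln L / L = t / L" by (simp only: t_def)
  also have "... = 1 / y" by (subst Ly) (use t45 in simp)
  finally have "ln L / L = 1 / y" .
  have "W * Z \<le> (16057 / 10000 * y\<^sup>2) * (32986 / 10000 * (t * y ^ 4))" using W Z W0 Z0 by (intro mult_mono) auto
  also have "... = 16057 / 10000 * (32986 / 10000) * (t * (y ^ 3 * y ^ 3))" by (simp add: power_add[symmetric] mult_ac)
  also have "... \<le> 52966 / 10000 * (t * (y ^ 3 * y ^ 3))" using t45 y0 by (intro mult_right_mono) auto
  finally have WZ: "W * Z \<le> 52966 / 10000 * (t * (y ^ 3 * y ^ 3))" .
  have gen: "52966 / 10000 * (t * (z * z)) / (2 * z) = 26483 / 10000 * (t * z)" if "z > 0" for z using that by simp
  have "(ln L / L) ^ 3 / 4 * (2 * W * Z) = (W * Z) / (2 * y ^ 3)" unfolding \<open>ln L / L = 1 / y\<close> by (simp add: power_divide)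
  also have "... \<le> 52966 / 10000 * (t * (y ^ 3 * y ^ 3)) / (2 * y ^ 3)" using WZ y0 by (intro divide_right_mono) auto
  also have "... = 26483 / 10000 * (t * y ^ 3)" using y0 by (intro gen) simp
  finally show ?thesis .
 qed
 have part2: "q * (1 + L + ln ((W\<^sup>2 + q) / (2 * q))) \<le> 57064 / 10000 * y\<^sup>2 * (t * y + 2 * l - 386 / 1000)"
 proof -
  have "W\<^sup>2 \<le> (16057 / 10000 * y\<^sup>2)\<^sup>2" using W W0 by (intro power_mono) auto
  also have "... = (16057 / 10000)\<^sup>2 * (y\<^sup>2 * y\<^sup>2)" by (simp add: power2_eq_square)
  also have "... \<le> 25783 / 10000 * (y\<^sup>2 * y\<^sup>2)" by (intro mult_right_mono) (auto simp: power2_eq_square)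
  finally have "W\<^sup>2 \<le> 25783 / 10000 * (y\<^sup>2 * y\<^sup>2)" .
  moreover have "y\<^sup>2 * (11 / 2 * y\<^sup>2) \<le> y\<^sup>2 * q" using q by (intro mult_left_mono) auto
  moreover have "39601 / 100 * q \<le> y\<^sup>2 * q" using y2 q0 by (intro mult_right_mono) auto
  moreover have "y\<^sup>2 * (11 / 2 * y\<^sup>2) = 11 / 2 * (y\<^sup>2 * y\<^sup>2)" "y\<^sup>2 / 4 * (2 * q) = (y\<^sup>2 * q) / 2" by simp_all
  moreover have "0 \<le> y\<^sup>2 * q" using q0 by simp
  ultimately have "W\<^sup>2 + q \<le> y\<^sup>2 / 4 * (2 * q)" by linarith
  moreover have "0 < 2 * q" using q0 by simp
  ultimately have "(W\<^sup>2 + q) / (2 * q) \<le> y\<^sup>2 / 4" using pos_divide_le_eq by blast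
  then have "ln ((W\<^sup>2 + q) / (2 * q)) \<le> ln (y\<^sup>2 / 4)" using q0 by (intro ln_mono) (auto intro!: divide_pos_pos add_nonneg_pos)
  also have "... = 2 * l - 2 * ln 2"
  proof -
   have "y\<^sup>2 / 4 = (y / 2)\<^sup>2" by (simp add: power_divide)
   then show ?thesis using y0 by (simp add: ln_realpow ln_div l_def)
  qed
  finally have "1 + L + ln ((W\<^sup>2 + q) / (2 * q)) \<le> t * y + 2 * l - 386 / 1000" using ln2_bounds(1) by (simp add: Ly)
  then have "q * (1 + L + ln ((W\<^sup>2 + q) / (2 * q))) \<le> q * (t * y + 2 * l - 386 / 1000)" using q0 by (intro mult_left_mono) auto
  also have "... \<le> 57064 / 10000 * y\<^sup>2 * (t * y + 2 * l - 386 / 1000)"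
  proof (rule mult_right_mono[OF q(2)])
   have "t * y \<ge> 0" using t45 y0 by simp
   moreover have "l \<ge> 1" using l1 t45 by simp
   ultimately show "0 \<le> t * y + 2 * l - 386 / 1000" by simp
  qed
  finally show ?thesis .
 qed
 have part3: "6 * y ^ 3 * (2 * l + 709 / 1000) \<le> 2 * real m * (\<Sum>p\<in>P. ln p)"
 proof -
  have s0: "s > 0" using s(1) y2 by (cases s) auto
  have "37 / 15 * (6931 / 10000) \<le> ln (15 / 4 * (3 / 2) :: real)"
   using ln_ge_of_power[of "15 / 4 * (3 / 2)" 15 37] by (simp add: power_divide)
  also have "ln (15 / 4 * (3 / 2) :: real) + 2 * l = ln (15 / 4 * (3 / 2 * y\<^sup>2))"
  proof -
   have "ln (15 / 4 * (3 / 2) * y\<^sup>2) = ln (15 / 4 * (3 / 2) :: real) + ln (y\<^sup>2)" using y0 by (intro ln_mult_pos) auto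
   moreover have "ln (y\<^sup>2) = 2 * l" using y0 by (simp add: ln_realpow l_def)
   ultimately show ?thesis by (simp only: mult.assoc)
  qed
  then have "ln (15 / 4 * (3 / 2) :: real) = ln (15 / 4 * (3 / 2 * y\<^sup>2)) - 2 * l" by simp
  also have "ln (15 / 4 * (3 / 2 * y\<^sup>2)) \<le> ln (15 / 4 * real s)" using s(1) y0 by (intro ln_mono) auto
  also have "ln (15 / 4 * real s) = ln (15 / 4) + ln s" using s0 by (intro ln_mult_pos) auto
  finally have "2 * l + 709 / 1000 \<le> ln (15 / 4) + ln s - 1" by simp
  moreover have "0 \<le> 2 * l + 709 / 1000" using l1 t45 by simp
  ultimately have "3 / 2 * y\<^sup>2 * (2 * l + 709 / 1000) \<le> s * (ln (15 / 4) + ln s - 1)" using s(1) by (intro mult_mono) auto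
  also have "... \<le> (\<Sum>p\<in>P. ln p)" using prime_set_prod_lower[OF P(1)] P(2,3) by simp
  finally have *: "3 / 2 * y\<^sup>2 * (2 * l + 709 / 1000) \<le> (\<Sum>p\<in>P. ln p)" .
  have "6 * y ^ 3 * (2 * l + 709 / 1000) = (2 * (2 * y)) * (3 / 2 * y\<^sup>2 * (2 * l + 709 / 1000))"
   by (simp add: power3_eq_cube power2_eq_square)
  also have "... \<le> (2 * real m) * (\<Sum>p\<in>P. ln p)"
   using m(1) y0 * \<open>0 \<le> 2 * l + 709 / 1000\<close> by (intro mult_mono) auto
  finally show ?thesis .
 qed
 \<comment> \<open>The coefficients of t y^3 in the first two parts add up to 8.3547, while 12 times
   the slope 7/9 of the lower bound for l exceeds 9.3. The lower-order terms are absorbed by 1.7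
   y^3.\<close>
 have final: "26483 / 10000 * (t * y ^ 3) + 57064 / 10000 * y\<^sup>2 * (t * y + 2 * l - 386 / 1000) \<le> 6 * y ^ 3 * (2 * l + 709 / 1000)"
 proof -
  have "57064 / 10000 * (2 * l - 386 / 1000) \<le> 57064 / 10000 * (3622 / 1000 + 20 / 199 * y)" using l2 by simp
  also have "... \<le> 17 / 10 * y" using y by simp
  finally have a: "57064 / 10000 * (2 * l - 386 / 1000) \<le> 17 / 10 * y" .
  have "83547 / 10000 * t + 17 / 10 \<le> 6 * (2 * l + 709 / 1000)" using l1 t45 by simp
  then have "y * (83547 / 10000 * t + 17 / 10) \<le> y * (6 * (2 * l + 709 / 1000))" using y0 by (intro mult_left_mono) auto
  then have "26483 / 10000 * (t * y) + 57064 / 10000 * (t * y + 2 * l - 386 / 1000) \<le> 6 * y * (2 * l + 709 / 1000)"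
  proof -
   have "y * (83547 / 10000 * t + 17 / 10) = 83547 / 10000 * (t * y) + 17 / 10 * y" by (simp add: algebra_simps)
   moreover have "y * (6 * (2 * l + 709 / 1000)) = 6 * y * (2 * l + 709 / 1000)" by simp
   moreover have "57064 / 10000 * (t * y + 2 * l - 386 / 1000) = 57064 / 10000 * (t * y) + 57064 / 10000 * (2 * l - 386 / 1000)"
    by (simp only: distrib_left[symmetric] add_diff_eq)
   ultimately show ?thesis using a \<open>y * (83547 / 10000 * t + 17 / 10) \<le> y * (6 * (2 * l + 709 / 1000))\<close> by linarith
  qed
  then have "y\<^sup>2 * (26483 / 10000 * (t * y) + 57064 / 10000 * (t * y + 2 * l - 386 / 1000)) \<le> y\<^sup>2 * (6 * y * (2 * l + 709 / 1000))"
   by (intro mult_left_mono) auto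
  moreover have "y\<^sup>2 * (a * (t * y) + b * X) = a * (t * y ^ 3) + b * y\<^sup>2 * X" "y\<^sup>2 * (6 * y * X) = 6 * y ^ 3 * X" for a b X
   by (simp_all add: power2_eq_square power3_eq_cube algebra_simps)
  ultimately show ?thesis by (simp only:)
 qed
 have "(ln L / L) ^ 3 / 4 * (2 * W * Z) + q * (1 + L + ln ((W\<^sup>2 + q) / (2 * q))) \<le> 2 * real m * (\<Sum>p\<in>P. ln p)"
  using part1 part2 part3 final by linarith
 moreover have "m > 0" using m(1) y0 by (cases m) auto
 ultimately show ?thesis unfolding favourable_def W_def q_def Z_def using P(1-3) by (intro exI[of _ m] exI[of _ P]) auto
qed

lemma favourable_ge_1: "1 \<le> L \<Longrightarrow> favourable L"
proof (cases "L \<le> 183 / 2")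
 case False
 have "exp (9 / 2 :: real) \<le> 183 / 2"
 proof (rule power2_le_imp_le)
  have "(exp (9 / 2 :: real))\<^sup>2 = exp 1 ^ 9" by (simp flip: exp_of_nat_mult)
  also have "... \<le> (272 / 100) ^ 9" using e_less_272 by (intro power_mono) auto
  also have "... \<le> (183 / 2)\<^sup>2" by (simp add: power2_eq_square power_divide)
  finally show "(exp (9 / 2 :: real))\<^sup>2 \<le> (183 / 2)\<^sup>2" .
 qed simp
 then have "ln (exp (9 / 2)) \<le> ln L" using False by (intro ln_mono) auto
 then show ?thesis using False by (intro favourable_large) auto
qed (use favourable_rows in simp)

context number_fld
begin

theorem height_lower:
 assumes u: "u \<in> int_ring k" "u \<noteq> 0" "\<And>n. n > 0 \<Longrightarrow> u ^ n \<noteq> 1" and d: "d \<ge> 3"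
 shows "(ln (ln d) / ln d) ^ 3 / 4 \<le> height u"
proof -
 obtain L G S where S: "galois_system L G" "galois_system.free L G S" "card S \<le> d" "log_mahler S \<le> height u"
  by (rule galois_orbit_exists[OF u])
 have "ln (exp 1) \<le> ln (real d)" using d e_less_272 by (intro ln_mono) auto
 then have "favourable (ln d)" by (intro favourable_ge_1) simp
 then have "(ln (ln d) / ln d) ^ 3 / 4 \<le> log_mahler S"
  using d by (intro galois_system.favourable_imp_log_mahler[OF S(1,2,3)]) auto
 then show ?thesis using S(4) by simp
qed

end

section \<open>Units with prescribed signs of logarithms\<close>

context number_fld
begin

section \<open>Complex conjugation of embeddings and the archimedean places\<close>

definition conj_emb :: "('a \<Rightarrow> complex) \<Rightarrow> 'a \<Rightarrow> complex" where "conj_emb \<sigma> = (\<lambda>x\<in>k. cnj (\<sigma> x))"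

lemma conj_emb_in: "\<sigma> \<in> E \<Longrightarrow> conj_emb \<sigma> \<in> E"
 unfolding embeddings_def conj_emb_def by (auto simp: one_in add_in mult_in)

lemma conj_emb_apply: "x \<in> k \<Longrightarrow> conj_emb \<sigma> x = cnj (\<sigma> x)" by (simp add: conj_emb_def)

lemma conj_emb_conj_emb: "\<sigma> \<in> E \<Longrightarrow> conj_emb (conj_emb \<sigma>) = \<sigma>"
 by (rule ext) (auto simp: conj_emb_def embeddings_def extensional_def restrict_def)

lemma arch_places_eq: "arch_places k = (\<lambda>\<sigma>. {\<sigma>, conj_emb \<sigma>}) ` E"
 by (auto simp: arch_places_def conj_emb_def)

lemma arch_place:
 assumes "v \<in> arch_places k"
 shows "v \<subseteq> E" "v \<noteq> {}" "finite v" "\<And>\<sigma>. \<sigma> \<in> v \<Longrightarrow> v = {\<sigma>, conj_emb \<sigma>}"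
 using assms unfolding arch_places_eq by (auto simp: conj_emb_in conj_emb_conj_emb)

lemma finite_arch_places: "finite (arch_places k)"
 by (simp add: arch_places_eq finite_E)

lemma arch_places_partition: "\<Union> (arch_places k) = E"
 by (auto simp: arch_places_eq conj_emb_in)

lemma arch_places_disjoint:
 assumes "v \<in> arch_places k" "w \<in> arch_places k" "v \<noteq> w"
 shows "v \<inter> w = {}"
 using arch_place(4)[OF assms(1)] arch_place(4)[OF assms(2)] assms(3) by (metis Int_iff equals0I)

lemma sum_arch_places: "(\<Sum>v\<in>arch_places k. \<Sum>\<sigma>\<in>v. f \<sigma>) = (\<Sum>\<sigma>\<in>E. f \<sigma>)"
 using arch_place(3) arch_places_disjoint
 by (subst arch_places_partition[symmetric], subst sum.Union_disjoint) auto

lemma cmod_arch_place: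
 assumes "v \<in> arch_places k" "\<sigma> \<in> v" "\<tau> \<in> v" "x \<in> k"
 shows "cmod (\<sigma> x) = cmod (\<tau> x)"
 using arch_place(4)[OF assms(1,2)] assms(3,4) by (auto simp: conj_emb_apply)

definition place_log :: "('a \<Rightarrow> complex) set \<Rightarrow> 'a \<Rightarrow> real" where
 "place_log v u = (\<Sum>\<sigma>\<in>v. lg \<sigma> u)"

lemma place_log_eq:
 assumes v: "v \<in> arch_places k" and u: "u \<in> k"
 shows "real (card v) * ln (place_abs v u) = place_log v u"
proof -
 have "(SOME \<sigma>. \<sigma> \<in> v) \<in> v" using arch_place(2)[OF v] by (simp add: some_in_eq)
 then have "lg \<sigma> u = ln (place_abs v u)" if "\<sigma> \<in> v" for \<sigma>
  using cmod_arch_place[OF v that _ u] by (simp add: lg_def place_abs_def)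
 then show ?thesis by (simp add: place_log_def)
qed

lemma abs_place_log:
 assumes v: "v \<in> arch_places k" and u: "u \<in> k"
 shows "\<bar>place_log v u\<bar> = (\<Sum>\<sigma>\<in>v. \<bar>lg \<sigma> u\<bar>)"
proof -
 obtain \<sigma> where s: "\<sigma> \<in> v" using arch_place(2)[OF v] by blast
 have "lg \<tau> u = lg \<sigma> u" if "\<tau> \<in> v" for \<tau>
  using cmod_arch_place[OF v that s u] by (simp add: lg_def)
 then show ?thesis by (simp add: place_log_def abs_mult)
qed

lemma int_basis_indep:
 assumes "int_basis \<omega>" "(\<Sum>i<d. of_int (e i) * \<omega> i) = 0" "i < d"
 shows "e i = 0"
proof -
 have inj: "inj_on \<omega> {..<d}" and ind: "qindep (\<omega> ` {..<d})" using assms(1) by (auto simp: int_basis_def)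
 let ?c = "\<lambda>b. rat_of_int (e (the_inv_into {..<d} \<omega> b))"
 have c: "?c (\<omega> j) = of_int (e j)" if "j < d" for j using the_inv_into_f_f[OF inj] that by simp
 have "(\<Sum>b\<in>\<omega> ` {..<d}. of_rat (?c b) * b) = (\<Sum>j<d. of_rat (?c (\<omega> j)) * \<omega> j)"
  using inj by (simp add: sum.reindex)
 also have "... = (\<Sum>j<d. of_int (e j) * \<omega> j)" by (rule sum.cong) (auto simp: c simp del: of_int_eq_iff)
 finally have "?c (\<omega> i) = 0" using assms(2,3) by (intro qindepD[OF ind]) auto
 then show ?thesis using c[OF assms(3)] by simp
qed

text \<open>The functionals \<open>Re - Im\<close> of the embeddings outside \<open>v\<close> are real coordinates that control the
 absolute values at the places outside \<open>v\<close>; there are exactly as many of them as embeddings.\<close>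

lemma small_integer_exists:
 assumes v: "v \<subseteq> E" "v \<noteq> {}" "\<And>\<sigma>. \<sigma> \<in> v \<Longrightarrow> conj_emb \<sigma> \<in> v"
 obtains C :: real where "C > 0"
  "\<forall>t::nat. t \<ge> 1 \<longrightarrow> (\<exists>\<alpha>\<in>int_ring k. \<alpha> \<noteq> 0 \<and> (\<forall>\<sigma>\<in>E - v. cmod (\<sigma> \<alpha>) \<le> C / real t) \<and> (\<Prod>\<sigma>\<in>E. cmod (\<sigma> \<alpha>)) \<le> C)"
proof -
 obtain \<omega> where w: "int_basis \<omega>" using int_basis_exists by blast
 have wi: "\<omega> i \<in> int_ring k" if "i < d" for i using w that by (auto simp: int_basis_def)
 then have wk: "\<omega> i \<in> k" if "i < d" for i using that by (auto simp: int_ring_def)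
 define x where "x a = (\<Sum>i<d. of_int (a i) * \<omega> i)" for a :: "nat \<Rightarrow> int"
 have xi: "x a \<in> int_ring k" for a unfolding x_def using wi by (intro int_ring_sum int_ring_closed of_int_int_ring) auto
 then have xk: "x a \<in> k" for a by (auto simp: int_ring_def)
 define C0 where "C0 = 1 + (\<Sum>\<sigma>\<in>E. \<Sum>i<d. cmod (\<sigma> (\<omega> i)))"
 have C0: "C0 \<ge> 1" unfolding C0_def by (simp add: sum_nonneg)
 have bound: "cmod (\<sigma> (x a)) < real M * C0" if s: "\<sigma> \<in> E" and a: "\<forall>i<d. \<bar>a i\<bar> \<le> int M" and M: "M \<ge> 1" for \<sigma> a M
 proof -
  interpret embedding k \<sigma> by (rule emb[OF s])
  have "\<sigma> (x a) = (\<Sum>i<d. of_int (a i) * \<sigma> (\<omega> i))" unfolding x_def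
   using wk by (subst sum) (auto simp: mult of_int of_int_in intro: mult_in)
  then have "cmod (\<sigma> (x a)) \<le> (\<Sum>i<d. cmod (of_int (a i) * \<sigma> (\<omega> i)))" by (simp add: norm_sum)
  also have "... \<le> (\<Sum>i<d. real M * cmod (\<sigma> (\<omega> i)))"
  proof (rule sum_mono)
   fix i assume "i \<in> {..<d}"
   then have "real_of_int \<bar>a i\<bar> \<le> real M" using a by (metis lessThan_iff of_int_le_iff of_int_of_nat_eq)
   then show "cmod (of_int (a i) * \<sigma> (\<omega> i)) \<le> real M * cmod (\<sigma> (\<omega> i))"
    by (simp add: norm_mult mult_right_mono)
  qed
  also have "... = real M * (\<Sum>i<d. cmod (\<sigma> (\<omega> i)))" by (simp add: sum_distrib_left)
  also have "... < real M * C0"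
  proof -
   have "(\<Sum>i<d. cmod (\<sigma> (\<omega> i))) \<le> (\<Sum>\<sigma>\<in>E. \<Sum>i<d. cmod (\<sigma> (\<omega> i)))"
    by (rule member_le_sum[OF s, where f = "\<lambda>\<sigma>. \<Sum>i<d. cmod (\<sigma> (\<omega> i))"]) (auto simp: finite_E sum_nonneg)
   then show ?thesis using M by (simp add: C0_def)
  qed
  finally show ?thesis .
 qed
 define ka where "ka \<sigma> y = Re (\<sigma> y) - Im (\<sigma> y)" for \<sigma> :: "'a \<Rightarrow> complex" and y
 have ka_diff: "ka \<sigma> (y - z) = ka \<sigma> y - ka \<sigma> z" if "\<sigma> \<in> E" "y \<in> k" "z \<in> k" for \<sigma> y z
  using embedding.diff[OF emb[OF that(1)] that(2,3)] by (simp add: ka_def)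
 have ka_le: "\<bar>ka \<sigma> y\<bar> \<le> 2 * cmod (\<sigma> y)" for \<sigma> y
  using abs_Re_le_cmod[of "\<sigma> y"] abs_Im_le_cmod[of "\<sigma> y"] unfolding ka_def by linarith
 have le_ka: "cmod (\<sigma> y) \<le> \<bar>ka \<sigma> y\<bar> + \<bar>ka (conj_emb \<sigma>) y\<bar>" if "y \<in> k" for \<sigma> y
  using cmod_le[of "\<sigma> y"] that unfolding ka_def by (simp add: conj_emb_apply)
 have dpos: "d > 0" using E_nonempty finite_E by (simp add: d_def card_gt_0_iff)
 define C where "C = (8 * C0) ^ d"
 define e where "e = card v"
 define c where "c = card (E - v)"
 have fv: "finite v" using v(1) finite_E finite_subset by blast
 have e1: "e \<ge> 1" using v(2) fv by (simp add: e_def Suc_le_eq card_gt_0_iff)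
 have ce: "c + e = d" using v(1) finite_E fv card_mono[OF finite_E v(1)]
  by (simp add: c_def e_def d_def card_Diff_subset)
 have C8: "8 * C0 \<le> C" using self_le_power[of "8 * C0" d] C0 dpos by (simp add: C_def)
 have "\<exists>\<alpha>\<in>int_ring k. \<alpha> \<noteq> 0 \<and> (\<forall>\<sigma>\<in>E - v. cmod (\<sigma> \<alpha>) \<le> C / real t) \<and> (\<Prod>\<sigma>\<in>E. cmod (\<sigma> \<alpha>)) \<le> C"
  if t: "t \<ge> 1" for t :: nat
 proof -
  \<comment> \<open>The exponents are balanced: with c real coordinates, each cut into q intervals,
    there are q^c = M^d boxes for (M + 1)^d coefficient vectors.\<close>
  define q where "q = t ^ d"
  define M where "M = t ^ c"
  have q1: "q \<ge> 1" and M1: "M \<ge> 1" using t by (auto simp: q_def M_def)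
  have pos: "real M * C0 > 0" "real q > 0" using M1 q1 C0 by auto
  define A where "A = PiE {..<d} (\<lambda>_. {0..int M})"
  define W where "W = real M * C0"
  have W: "W > 0" using pos(1) by (simp add: W_def)
  define z where "z a \<sigma> = (ka \<sigma> (x a) + 2 * W) * (real q / (4 * W))" for a \<sigma>
  define f where "f a = (\<lambda>\<sigma>\<in>E - v. nat \<lfloor>z a \<sigma>\<rfloor>)" for a
  have zr: "0 \<le> z a \<sigma>" "z a \<sigma> < real q" if "a \<in> A" "\<sigma> \<in> E" for a \<sigma>
  proof -
   have "\<forall>i<d. \<bar>a i\<bar> \<le> int M" using that(1) by (auto simp: A_def PiE_iff)
   from bound[OF that(2) this M1] have k: "\<bar>ka \<sigma> (x a)\<bar> < 2 * W" using ka_le[of \<sigma> "x a"] unfolding W_def by linarith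
   then have "0 \<le> ka \<sigma> (x a) + 2 * W" by simp
   then show "0 \<le> z a \<sigma>" using W unfolding z_def by (intro mult_nonneg_nonneg) auto
   have "ka \<sigma> (x a) + 2 * W < 4 * W" using k by simp
   then have "(ka \<sigma> (x a) + 2 * W) * (real q / (4 * W)) < (4 * W) * (real q / (4 * W))"
    using W pos(2) by (intro mult_strict_right_mono) auto
   then show "z a \<sigma> < real q" using W unfolding z_def by simp
  qed
  have fA: "f ` A \<subseteq> PiE (E - v) (\<lambda>_. {..<q})"
  proof
   fix y assume "y \<in> f ` A"
   then obtain a where a: "a \<in> A" "y = f a" by blast
   have "nat \<lfloor>z a \<sigma>\<rfloor> < q" if "\<sigma> \<in> E - v" for \<sigma>
    using zr[OF a(1), of \<sigma>] that by (simp add: nat_less_iff floor_less_iff)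
   then show "y \<in> PiE (E - v) (\<lambda>_. {..<q})" unfolding a(2) f_def by (intro restrict_PiE_iff[THEN iffD2]) auto
  qed
  have "card (f ` A) \<le> card (PiE (E - v) (\<lambda>_. {..<q}))"
   using finite_E by (intro card_mono[OF _ fA] finite_PiE) auto
  also have "... = q ^ c" using finite_E by (simp add: card_PiE c_def)
  also have "... = M ^ d" by (simp add: q_def M_def mult.commute flip: power_mult)
  also have "... < (M + 1) ^ d" using dpos by (intro power_strict_mono) auto
  also have "... = card A" by (simp add: A_def card_PiE nat_add_distrib)
  finally have "\<not> inj_on f A" by (rule pigeonhole)
  then obtain a b where ab: "a \<in> A" "b \<in> A" "a \<noteq> b" "f a = f b" unfolding inj_on_def by blast
  define \<alpha> where "\<alpha> = x (\<lambda>i. a i - b i)"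
  have al: "\<alpha> = x a - x b" by (simp add: \<alpha>_def x_def ring_distribs sum_subtractf)
  have "\<alpha> \<in> int_ring k" by (simp add: \<alpha>_def xi)
  moreover have "\<alpha> \<noteq> 0"
  proof
   assume "\<alpha> = 0"
   then have "(\<Sum>i<d. of_int (a i - b i) * \<omega> i) = 0" by (simp add: \<alpha>_def x_def)
   then have "a i - b i = 0" if "i < d" for i by (rule int_basis_indep[OF w _ that])
   then have "a = b" using ab(1,2) unfolding A_def by (intro PiE_ext) auto
   then show False using ab(3) by simp
  qed
  moreover have small: "cmod (\<sigma> \<alpha>) \<le> 8 * C0 / real t ^ e" if s: "\<sigma> \<in> E - v" for \<sigma>
  proof -
   have k: "\<bar>ka \<tau> \<alpha>\<bar> \<le> 4 * W / real q" if "\<tau> \<in> E - v" for \<tau>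
   proof -
    have "f a \<tau> = f b \<tau>" using ab(4) by simp
    then have "nat \<lfloor>z a \<tau>\<rfloor> = nat \<lfloor>z b \<tau>\<rfloor>" using that by (simp add: f_def)
    then have "\<lfloor>z a \<tau>\<rfloor> = \<lfloor>z b \<tau>\<rfloor>" using zr(1)[OF ab(1)] zr(1)[OF ab(2)] that by (simp add: eq_nat_nat_iff)
    then have "\<bar>z a \<tau> - z b \<tau>\<bar> \<le> 1" by linarith
    moreover have "z a \<tau> - z b \<tau> = ka \<tau> \<alpha> * (real q / (4 * W))"
    proof -
     have "ka \<tau> \<alpha> = ka \<tau> (x a) - ka \<tau> (x b)" unfolding al using that xk by (intro ka_diff) auto
     then show ?thesis unfolding z_def by (simp add: left_diff_distrib distrib_right del: times_divide_eq_right)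
    qed
    ultimately have "\<bar>ka \<tau> \<alpha>\<bar> * (real q / (4 * W)) \<le> 1" using W by (simp add: abs_mult)
    then show ?thesis using pos(2) W by (simp add: field_simps)
   qed
   have "conj_emb \<sigma> \<in> E - v" using s v(3)[of "conj_emb \<sigma>"] conj_emb_in[of \<sigma>] conj_emb_conj_emb[of \<sigma>] by auto
   from le_ka[of \<alpha> \<sigma>] k[OF s] k[OF this] have "cmod (\<sigma> \<alpha>) \<le> 2 * (4 * W / real q)"
    using xk[of "\<lambda>i. a i - b i"] unfolding \<alpha>_def[symmetric] by linarith
   also have "... = 8 * C0 / real t ^ e"
   proof -
    have "real q = real M * real t ^ e" using ce by (simp add: q_def M_def flip: power_add)
    then show ?thesis using M1 by (simp add: W_def)
   qed
   finally show ?thesis .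
  qed
  moreover have "8 * C0 / real t ^ e \<le> C / real t"
  proof (rule frac_le)
   show "real t \<le> real t ^ e" using t e1 by (simp add: self_le_power)
  qed (use C8 C0 t in auto)
  moreover have "(\<Prod>\<sigma>\<in>E. cmod (\<sigma> \<alpha>)) \<le> C"
  proof -
   have "(\<Prod>\<sigma>\<in>E. cmod (\<sigma> \<alpha>)) = (\<Prod>\<sigma>\<in>E - v. cmod (\<sigma> \<alpha>)) * (\<Prod>\<sigma>\<in>v. cmod (\<sigma> \<alpha>))"
    by (rule prod.subset_diff[OF v(1) finite_E])
   also have "... \<le> (8 * C0 / real t ^ e) ^ c * (real M * (8 * C0)) ^ e"
   proof (rule mult_mono)
    have "(\<Prod>\<sigma>\<in>E - v. cmod (\<sigma> \<alpha>)) \<le> (\<Prod>\<sigma>\<in>E - v. 8 * C0 / real t ^ e)"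
     using small by (intro prod_mono) auto
    then show "(\<Prod>\<sigma>\<in>E - v. cmod (\<sigma> \<alpha>)) \<le> (8 * C0 / real t ^ e) ^ c" by (simp add: c_def)
    have "(\<Prod>\<sigma>\<in>v. cmod (\<sigma> \<alpha>)) \<le> (\<Prod>\<sigma>\<in>v. real M * (8 * C0))"
    proof (intro prod_mono conjI)
     fix \<sigma> assume s: "\<sigma> \<in> v"
     have "\<bar>a i - b i\<bar> \<le> int M" if "i < d" for i
     proof -
      have "a i \<in> {0..int M}" "b i \<in> {0..int M}" using ab(1,2) that by (auto simp: A_def PiE_iff)
      then show ?thesis by auto
     qed
     then have "cmod (\<sigma> \<alpha>) < real M * C0" unfolding \<alpha>_def using s v(1) M1 by (intro bound) auto
     also have "... \<le> real M * (8 * C0)" using C0 by (intro mult_left_mono) auto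
     finally show "cmod (\<sigma> \<alpha>) \<le> real M * (8 * C0)" by simp
    qed simp
    then show "(\<Prod>\<sigma>\<in>v. cmod (\<sigma> \<alpha>)) \<le> (real M * (8 * C0)) ^ e" by (simp add: e_def)
   qed (use C0 in \<open>auto intro!: prod_nonneg\<close>)
   also have "... = C"
   proof -
    have "(real t ^ e) ^ c = real M ^ e" by (simp add: M_def mult.commute flip: power_mult)
    then have "(8 * C0 / real t ^ e) ^ c * (real M * (8 * C0)) ^ e = (8 * C0) ^ c * (8 * C0) ^ e"
     using M1 by (simp add: power_divide power_mult_distrib)
    then show ?thesis by (simp only: C_def ce[symmetric] power_add)
   qed
   finally show ?thesis .
  qed
  ultimately show ?thesis by (meson order_trans)
 qed
 then show ?thesis using C0 C8 by (intro that[of C]) auto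
qed

text \<open>The quotient is the product of the other conjugates, seen through one embedding.\<close>

lemma norm_divide_int_ring:
 assumes a: "\<alpha> \<in> int_ring k" "\<alpha> \<noteq> 0" and N: "(\<Prod>\<sigma>\<in>E. \<sigma> \<alpha>) = of_int N"
 shows "of_int N / \<alpha> \<in> int_ring k"
proof -
 obtain \<tau> where t: "\<tau> \<in> E" using E_nonempty by blast
 interpret embedding k \<tau> by (rule emb[OF t])
 have ak: "\<alpha> \<in> k" "algebraic_int \<alpha>" using a(1) by (auto simp: int_ring_def)
 have qk: "of_int N / \<alpha> \<in> k" by (intro divide_in of_int_in ak)
 have "\<tau> (of_int N / \<alpha>) = of_int N / \<tau> \<alpha>" using ak of_int_in by (simp add: divide of_int)
 also have "... = (\<Prod>\<sigma>\<in>E - {\<tau>}. \<sigma> \<alpha>)"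
  using N[symmetric] prod.remove[OF finite_E t, of "\<lambda>\<sigma>. \<sigma> \<alpha>"] eq_0_iff[OF ak(1)] a(2) by simp
 finally have "algebraic_int (\<tau> (of_int N / \<alpha>))"
  using ak by (auto intro!: algebraic_int_prod algebraic_int_emb)
 then show ?thesis using qk algebraic_int_iff[OF qk] by (simp add: int_ring_def)
qed

text \<open>Dirichlet's argument: choose integers of bounded norm that decrease strictly at all
  embeddings outside v. Two of them have the same norm N and are congruent modulo N. As N divided by
  either one is integral, their quotient and its inverse are integral.\<close>

lemma unit_small_outside:
 assumes v: "v \<subseteq> E" "v \<noteq> {}" "\<And>\<sigma>. \<sigma> \<in> v \<Longrightarrow> conj_emb \<sigma> \<in> v"
 obtains u where "u \<in> unit_grp k" "\<forall>\<sigma>\<in>E - v. cmod (\<sigma> u) < 1"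
proof -
 obtain C :: real where C: "C > 0"
  "\<forall>t::nat. t \<ge> 1 \<longrightarrow> (\<exists>\<alpha>\<in>int_ring k. \<alpha> \<noteq> 0 \<and> (\<forall>\<sigma>\<in>E - v. cmod (\<sigma> \<alpha>) \<le> C / real t) \<and> (\<Prod>\<sigma>\<in>E. cmod (\<sigma> \<alpha>)) \<le> C)"
  by (rule small_integer_exists[OF v])
 let ?P = "\<lambda>\<alpha>. \<alpha> \<in> int_ring k \<and> \<alpha> \<noteq> 0 \<and> (\<Prod>\<sigma>\<in>E. cmod (\<sigma> \<alpha>)) \<le> C"
 have step: "\<exists>\<alpha>. ?P \<alpha> \<and> (\<forall>\<sigma>\<in>E - v. cmod (\<sigma> \<alpha>) < \<delta>)" if "\<delta> > 0" for \<delta>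
 proof -
  obtain t :: nat where t: "C / \<delta> < real t" using reals_Archimedean2 by blast
  moreover have "C / \<delta> > 0" using C(1) that by simp
  ultimately have t1: "t \<ge> 1" by (cases t) auto
  have "C / real t < \<delta>" using t t1 that by (simp add: field_simps)
  then show ?thesis using C(2) t1 by (meson le_less_trans)
 qed
 have nz: "\<sigma> \<alpha> \<noteq> 0" if "?P \<alpha>" "\<sigma> \<in> E" for \<sigma> \<alpha>
  using embedding.eq_0_iff[OF emb[OF that(2)]] that(1) by (auto simp: int_ring_def)
 have "\<exists>f. \<forall>n. ?P (f n) \<and> (\<forall>\<sigma>\<in>E - v. cmod (\<sigma> (f (Suc n))) < cmod (\<sigma> (f n)))"
 proof (rule dependent_nat_choice)
  show "\<exists>\<alpha>. ?P \<alpha>" using step[of 1] by auto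
  fix \<alpha> and n :: nat assume P: "?P \<alpha>"
  \<comment> \<open>The inserted 1 keeps the minimum meaningful when v contains all
    embeddings.\<close>
  define \<delta> where "\<delta> = Min (insert 1 ((\<lambda>\<sigma>. cmod (\<sigma> \<alpha>)) ` (E - v)))"
  have "\<delta> > 0" unfolding \<delta>_def using finite_E nz[OF P] by (subst Min_gr_iff) auto
  from step[OF this] obtain \<beta> where b: "?P \<beta>" "\<forall>\<sigma>\<in>E - v. cmod (\<sigma> \<beta>) < \<delta>" by blast
  moreover have "\<delta> \<le> cmod (\<sigma> \<alpha>)" if "\<sigma> \<in> E - v" for \<sigma> unfolding \<delta>_def using finite_E that by (intro Min_le) auto
  ultimately show "\<exists>\<beta>. ?P \<beta> \<and> (\<forall>\<sigma>\<in>E - v. cmod (\<sigma> \<beta>) < cmod (\<sigma> \<alpha>))" by (meson less_le_trans)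
 qed
 then obtain f where f: "\<forall>n. ?P (f n) \<and> (\<forall>\<sigma>\<in>E - v. cmod (\<sigma> (f (Suc n))) < cmod (\<sigma> (f n)))" by (rule exE)
 then have fP: "?P (f n)" for n by blast
 have dec: "cmod (\<sigma> (f n)) < cmod (\<sigma> (f m))" if "m < n" "\<sigma> \<in> E - v" for m n \<sigma>
  using that(1)
 proof (induction n)
  case (Suc n)
  have "cmod (\<sigma> (f (Suc n))) < cmod (\<sigma> (f n))" using f that(2) by blast
  then show ?case using Suc by (cases "m = n") auto
 qed simp
 have "\<forall>n. \<exists>N. (\<Prod>\<sigma>\<in>E. \<sigma> (f n)) = of_int N"
  using norm_in_Ints fP by (fastforce simp: int_ring_def elim: Ints_cases)
 then obtain N where N: "\<And>n. (\<Prod>\<sigma>\<in>E. \<sigma> (f n)) = of_int (N n)" by metis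
 obtain \<omega> where w: "int_basis \<omega>" using int_basis_exists by blast
 have "\<forall>n. \<exists>e::nat \<Rightarrow> int. f n = (\<Sum>i<d. of_int (e i) * \<omega> i)" using w fP by (auto simp: int_basis_def)
 then obtain e :: "nat \<Rightarrow> nat \<Rightarrow> int" where e: "\<And>n. f n = (\<Sum>i<d. of_int (e n i) * \<omega> i)" by metis
 define K where "K = \<lfloor>C\<rfloor>"
 have NK: "\<bar>N n\<bar> \<le> K" for n
 proof -
  have "cmod (of_int (N n)) \<le> C" using fP[of n] unfolding N[symmetric] by (simp add: prod_norm)
  then have "real_of_int \<bar>N n\<bar> \<le> C" by simp
  then show ?thesis unfolding K_def by linarith
 qed
 have N0: "N n \<noteq> 0" for n
 proof
  assume "N n = 0"
  then have "(\<Prod>\<sigma>\<in>E. \<sigma> (f n)) = 0" using N by simp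
  then show False using nz[OF fP] finite_E by auto
 qed
 \<comment> \<open>The pigeonhole runs over the norm together with the coordinates modulo it; both
   take finitely many values because the norms are bounded and nonzero.\<close>
 define g where "g n = (N n, \<lambda>i\<in>{..<d}. e n i mod N n)" for n
 have "range g \<subseteq> {-K..K} \<times> PiE {..<d} (\<lambda>_. {-K..K})"
 proof -
  have "\<bar>x mod N n\<bar> \<le> K" for x n using abs_mod_less[OF N0[of n], of x] NK[of n] by linarith
  then have r: "x mod N n \<in> {-K..K}" "N n \<in> {-K..K}" for x n using NK[of n] by (force simp: abs_le_iff minus_le_iff)+
  show ?thesis
  proof
   fix y assume "y \<in> range g"
   then obtain n where "y = g n" by blast
   then show "y \<in> {-K..K} \<times> PiE {..<d} (\<lambda>_. {-K..K})" unfolding g_def using r(2)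
    by (simp only: mem_Times_iff fst_conv snd_conv restrict_PiE_iff) (use r(1) in blast)
  qed
 qed
 then have "finite (range g)" by (rule finite_subset) (intro finite_cartesian_product finite_PiE; simp)
 then have "\<not> inj g" using finite_imageD by blast
 then obtain m n where mn: "m < n" "g m = g n" unfolding inj_def by (metis linorder_neqE_nat)
 have NN: "N n = N m" using mn(2) by (simp add: g_def)
 have "N m dvd e m i - e n i" if "i < d" for i
 proof -
  have "snd (g m) i = snd (g n) i" using mn(2) by simp
  then have "e m i mod N m = e n i mod N m" using that NN by (simp add: g_def)
  then show ?thesis by (simp add: mod_eq_dvd_iff)
 qed
 then have q: "e m i - e n i = N m * ((e m i - e n i) div N m)" if "i < d" for i using that by simp
 define \<beta> where "\<beta> = (\<Sum>i<d. of_int ((e m i - e n i) div N m) * \<omega> i)"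
 have b: "\<beta> \<in> int_ring k" unfolding \<beta>_def using w
  by (intro int_ring_sum int_ring_closed of_int_int_ring) (auto simp: int_basis_def)
 have diff: "f m - f n = of_int (N m) * \<beta>"
 proof -
  have "f m - f n = (\<Sum>i<d. of_int (e m i - e n i) * \<omega> i)" by (simp add: e ring_distribs sum_subtractf)
  also have "... = (\<Sum>i<d. of_int (N m) * (of_int ((e m i - e n i) div N m) * \<omega> i))"
   by (rule sum.cong) (use q in \<open>auto simp flip: mult.assoc of_int_mult\<close>)
  finally show ?thesis by (simp add: \<beta>_def sum_distrib_left)
 qed
 have one: "1 \<in> int_ring k" using of_int_int_ring[of 1] by simp
 have "1 - (of_int (N m) / f m) * \<beta> \<in> int_ring k"
  using fP[of m] N[of m] by (intro int_ring_closed norm_divide_int_ring one b) auto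
 moreover have "1 - (of_int (N m) / f m) * \<beta> = f n / f m"
  using diff fP[of m] by (simp add: field_simps)
 moreover have "1 + (of_int (N m) / f n) * \<beta> \<in> int_ring k"
  using fP[of n] N[of n] NN by (intro int_ring_closed norm_divide_int_ring one b) auto
 moreover have "1 + (of_int (N m) / f n) * \<beta> = f m / f n"
  using diff fP[of n] by (simp add: field_simps)
 ultimately have "f n / f m \<in> unit_grp k" using fP[of n] fP[of m] by (simp add: unit_grp_iff)
 moreover have "cmod (\<sigma> (f n / f m)) < 1" if s: "\<sigma> \<in> E - v" for \<sigma>
 proof -
  have "\<sigma> (f n / f m) = \<sigma> (f n) / \<sigma> (f m)"
   using fP[of n] fP[of m] s by (intro embedding.divide[OF emb]) (auto simp: int_ring_def)
  then show ?thesis using dec[OF mn(1) s] nz[OF fP, of \<sigma> m] s by (simp add: norm_divide)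
 qed
 ultimately show ?thesis by (intro that[of "f n / f m"]) auto
qed

lemma unit_place_log_negative:
 assumes v: "v \<in> arch_places k"
 obtains u where "u \<in> unit_grp k" "\<forall>w\<in>arch_places k. w \<noteq> v \<longrightarrow> place_log w u < 0"
proof -
 have "conj_emb \<sigma> \<in> v" if "\<sigma> \<in> v" for \<sigma> using arch_place(4)[OF v that] by blast
 from unit_small_outside[OF arch_place(1,2)[OF v] this]
 obtain u where u: "u \<in> unit_grp k" "\<forall>\<sigma>\<in>E - v. cmod (\<sigma> u) < 1" by blast
 have "place_log w u < 0" if w: "w \<in> arch_places k" "w \<noteq> v" for w
 proof -
  have sub: "w \<subseteq> E - v" using arch_places_disjoint[OF w(1) v w(2)] arch_place(1)[OF w(1)] by blast
  show ?thesis unfolding place_log_def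
  proof (rule sum_strict_mono[where g = "\<lambda>_. 0", simplified])
   show "lg \<sigma> u < 0" if "\<sigma> \<in> w" for \<sigma>
    using u(2) emb_unit_pos[OF _ u(1), of \<sigma>] that sub unfolding lg_def by auto
  qed (use arch_place[OF w(1)] in auto)
 qed
 then show ?thesis using u(1) by (intro that[of u]) auto
qed

lemma sum_place_log: "u \<in> unit_grp k \<Longrightarrow> (\<Sum>v\<in>arch_places k. place_log v u) = 0"
 unfolding place_log_def sum_arch_places by (rule lg_sum_zero)

lemma height_place_log: "u \<in> unit_grp k \<Longrightarrow> height u = (\<Sum>v\<in>arch_places k. \<bar>place_log v u\<bar>) / 2"
 using abs_place_log unit_in_k sum_arch_places[of "\<lambda>\<sigma>. \<bar>lg \<sigma> u\<bar>"] by (simp add: height_eq)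

end

text \<open>The sign conditions make every column strictly diagonally dominant. A null vector of the
  transpose contradicts this at its entry of largest modulus.\<close>

lemma fdet_diagonally_dominant:
 fixes A :: "nat \<Rightarrow> nat \<Rightarrow> real"
 assumes neg: "\<And>i j. i < n \<Longrightarrow> j < n \<Longrightarrow> i \<noteq> j \<Longrightarrow> A i j < 0"
  and pos: "\<And>j. j < n \<Longrightarrow> (\<Sum>i<n. A i j) > 0"
 shows "fdet n A \<noteq> 0"
proof
 assume "fdet n A = 0"
 then have "fdet n (\<lambda>i j. A j i) = 0" by (rule trans[OF fdet_transpose])
 then obtain x where x: "\<exists>j<n. x j \<noteq> 0" "\<forall>i<n. (\<Sum>j<n. A j i * x j) = 0" unfolding fdet_eq_0_iff by blast
 have ne: "(\<lambda>i. \<bar>x i\<bar>) ` {..<n} \<noteq> {}" using x(1) by auto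
 have "Max ((\<lambda>i. \<bar>x i\<bar>) ` {..<n}) \<in> (\<lambda>i. \<bar>x i\<bar>) ` {..<n}" by (rule Max_in[OF _ ne]) simp
 then obtain i where i0: "i < n" "Max ((\<lambda>i. \<bar>x i\<bar>) ` {..<n}) = \<bar>x i\<bar>" by auto
 then have i: "i < n" "\<forall>j<n. \<bar>x j\<bar> \<le> \<bar>x i\<bar>" unfolding i0(2)[symmetric] by (auto intro!: Max_ge)
 have xi: "\<bar>x i\<bar> > 0" using x(1) i(2) by force
 have "A i i * x i = - (\<Sum>j\<in>{..<n} - {i}. A j i * x j)"
  using x(2)[rule_format, OF i(1)] i(1) sum.remove[of "{..<n}" i "\<lambda>j. A j i * x j"] by simp
 then have "\<bar>A i i\<bar> * \<bar>x i\<bar> = \<bar>\<Sum>j\<in>{..<n} - {i}. A j i * x j\<bar>" by (metis abs_minus_cancel abs_mult)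
 also have "... \<le> (\<Sum>j\<in>{..<n} - {i}. \<bar>A j i * x j\<bar>)" by (rule sum_abs)
 also have "... \<le> (\<Sum>j\<in>{..<n} - {i}. - A j i * \<bar>x i\<bar>)"
 proof (rule sum_mono)
  fix j assume j: "j \<in> {..<n} - {i}"
  have "A j i < 0" using j i(1) by (intro neg) auto
  then have "\<bar>A j i * x j\<bar> = - A j i * \<bar>x j\<bar>" by (simp add: abs_mult)
  also have "... \<le> - A j i * \<bar>x i\<bar>" using i(2) j \<open>A j i < 0\<close> by (intro mult_left_mono) auto
  finally show "\<bar>A j i * x j\<bar> \<le> - A j i * \<bar>x i\<bar>" .
 qed
 also have "... = - (\<Sum>j\<in>{..<n} - {i}. A j i) * \<bar>x i\<bar>" by (simp add: sum_distrib_right sum_negf)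
 also have "... < A i i * \<bar>x i\<bar>"
  using pos[OF i(1)] xi i(1) by (intro mult_strict_right_mono) (auto simp: sum.remove[of "{..<n}" i])
 also have "... \<le> \<bar>A i i\<bar> * \<bar>x i\<bar>" by (intro mult_right_mono) auto
 finally show False by simp
qed

section \<open>Lattice bases adapted to the short vectors\<close>

lemma fdet_permute_columns_nonzero:
 fixes A :: "nat \<Rightarrow> nat \<Rightarrow> 'a::field"
 assumes "fdet n A \<noteq> 0" "bij_betw \<pi> {..<n} {..<n}"
 shows "fdet n (\<lambda>i j. A i (\<pi> j)) \<noteq> 0"
proof
 assume "fdet n (\<lambda>i j. A i (\<pi> j)) = 0"
 then obtain x where x: "\<exists>j<n. x j \<noteq> 0" "\<forall>i<n. (\<Sum>j<n. A i (\<pi> j) * x j) = 0" unfolding fdet_eq_0_iff by blast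
 define y where "y j = x (inv_into {..<n} \<pi> j)" for j
 have yp: "y (\<pi> j) = x j" if "j < n" for j using assms(2) that by (simp add: y_def bij_betw_inv_into_left)
 have "(\<Sum>j<n. A i j * y j) = 0" if "i < n" for i
 proof -
  have "(\<Sum>j<n. A i j * y j) = (\<Sum>j<n. A i (\<pi> j) * y (\<pi> j))"
   by (rule sum.reindex_bij_betw[OF assms(2), symmetric])
  also have "... = (\<Sum>j<n. A i (\<pi> j) * x j)" using yp by (intro sum.cong) auto
  finally show ?thesis using x(2) that by simp
 qed
 moreover have "\<exists>j<n. y j \<noteq> 0" using x(1) yp bij_betwE[OF assms(2)] by (metis lessThan_iff)
 ultimately have "fdet n A = 0" unfolding fdet_eq_0_iff by blast
 then show False using assms(1) by simp
qed

lemma half_l1_sum_le: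
 "half_l1 r (\<lambda>i. \<Sum>j<n. c j * w j i) \<le> (\<Sum>j<n. \<bar>c j\<bar> * half_l1 r (w j))"
proof -
 have "(\<Sum>i<r. \<bar>\<Sum>j<n. c j * w j i\<bar>) \<le> (\<Sum>i<r. \<Sum>j<n. \<bar>c j\<bar> * \<bar>w j i\<bar>)"
  by (intro sum_mono order_trans[OF sum_abs]) (simp add: abs_mult)
 also have "... = (\<Sum>j<n. \<bar>c j\<bar> * (\<Sum>i<r. \<bar>w j i\<bar>))" by (subst sum.swap) (simp add: sum_distrib_left)
 finally have a: "(\<Sum>i<r. \<bar>\<Sum>j<n. c j * w j i\<bar>) \<le> (\<Sum>j<n. \<bar>c j\<bar> * (\<Sum>i<r. \<bar>w j i\<bar>))" .
 have "(\<Sum>i<r. \<Sum>j<n. c j * w j i) = (\<Sum>j<n. c j * (\<Sum>i<r. w j i))" by (subst sum.swap) (simp add: sum_distrib_left)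
 then have "\<bar>\<Sum>i<r. \<Sum>j<n. c j * w j i\<bar> \<le> (\<Sum>j<n. \<bar>c j\<bar> * \<bar>\<Sum>i<r. w j i\<bar>)"
  using sum_abs[of "\<lambda>j. c j * (\<Sum>i<r. w j i)" "{..<n}"] by (simp add: abs_mult)
 with a have "half_l1 r (\<lambda>i. \<Sum>j<n. c j * w j i)
   \<le> ((\<Sum>j<n. \<bar>c j\<bar> * (\<Sum>i<r. \<bar>w j i\<bar>)) + (\<Sum>j<n. \<bar>c j\<bar> * \<bar>\<Sum>i<r. w j i\<bar>)) / 2"
  by (simp add: half_l1_def)
 also have "... = (\<Sum>j<n. \<bar>c j\<bar> * half_l1 r (w j))"
  unfolding half_l1_def sum.distrib[symmetric] sum_divide_distrib
  by (rule sum.cong) (auto simp: distrib_left)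
 finally show ?thesis .
qed

lemma half_l1_nonneg: "half_l1 r x \<ge> 0"
 unfolding half_l1_def by (simp add: sum_nonneg)

lemma half_l1_cong: "(\<And>i. i < r \<Longrightarrow> x i = y i) \<Longrightarrow> half_l1 r x = half_l1 r y"
 unfolding half_l1_def by simp

text \<open>By Dirichlet's simultaneous approximation some m <= K^r brings m c within 1/K of an
  integer vector. The remainder is a lattice vector shorter than A, hence zero, so m c is
  integral.\<close>

lemma bounded_denominators:
 fixes \<Lambda> :: "(nat \<Rightarrow> real) set"
 assumes diff: "\<And>x y. x \<in> \<Lambda> \<Longrightarrow> y \<in> \<Lambda> \<Longrightarrow> (\<lambda>i. x i - y i) \<in> \<Lambda>"
  and disc: "0 < A" "\<And>x. x \<in> \<Lambda> \<Longrightarrow> half_l1 r x < A \<Longrightarrow> \<forall>i<r. x i = 0"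
  and w: "\<And>j. j < r \<Longrightarrow> w j \<in> \<Lambda>"
  and indep: "\<And>c. \<forall>i<r. (\<Sum>j<r. c j * w j i) = 0 \<Longrightarrow> \<forall>j<r. c j = 0"
 obtains Q :: nat where "Q > 0" "\<forall>c. (\<lambda>i. \<Sum>j<r. c j * w j i) \<in> \<Lambda> \<longrightarrow> (\<forall>i<r. of_nat Q * c i \<in> \<int>)"
proof -
 define H where "H = (\<Sum>j<r. half_l1 r (w j))"
 obtain K :: nat where K0: "H / A < real K" using reals_Archimedean2 by blast
 moreover have "H / A \<ge> 0" unfolding H_def using disc(1) by (simp add: sum_nonneg half_l1_nonneg)
 ultimately have K1: "K > 0" by (cases K) auto
 have K: "H / real K < A" using K0 K1 disc(1) by (simp add: field_simps)
 have comb: "(\<lambda>i. of_int m * x i - (\<Sum>j<n. of_int (z j) * w j i)) \<in> \<Lambda>"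
  if x: "x \<in> \<Lambda>" and "n \<le> r" for x m n and z :: "nat \<Rightarrow> int"
  using that(2)
 proof (induction n)
  case 0
  have "(\<lambda>i. x i - of_int (1 - m) * x i) \<in> \<Lambda>" by (rule group_int_combination[OF diff x x])
  then show ?case by (simp add: algebra_simps)
 next
  case (Suc n)
  have IH: "(\<lambda>i. of_int m * x i - (\<Sum>j<n. of_int (z j) * w j i)) \<in> \<Lambda>" using Suc by simp
  have wn: "w n \<in> \<Lambda>" using Suc.prems by (intro w) simp
  have "(\<lambda>i. of_int m * x i - (\<Sum>j<n. of_int (z j) * w j i) - of_int (z n) * w n i) \<in> \<Lambda>"
   by (rule group_int_combination[OF diff IH wn])
  then show ?case by (simp add: diff_diff_eq)
 qed
 have den: "\<exists>m. 0 < m \<and> m \<le> K ^ r \<and> (\<forall>i<r. of_nat m * c i \<in> \<int>)"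
  if c: "(\<lambda>i. \<Sum>j<r. c j * w j i) \<in> \<Lambda>" for c
 proof -
  define f where "f n = (\<lambda>i\<in>{..<r}. nat \<lfloor>real K * frac (real n * c i)\<rfloor>)" for n :: nat
  have fA: "f ` {..K ^ r} \<subseteq> PiE {..<r} (\<lambda>_. {..<K})"
  proof
   fix y assume "y \<in> f ` {..K ^ r}"
   then obtain n where "y = f n" by blast
   moreover have "nat \<lfloor>real K * frac (real n * c i)\<rfloor> < K" for i
   proof -
    have "real K * frac (real n * c i) < real K * 1" using K1 frac_lt_1 by (intro mult_strict_left_mono) auto
    then show ?thesis using K1 by (simp add: nat_less_iff floor_less_iff)
   qed
   ultimately show "y \<in> PiE {..<r} (\<lambda>_. {..<K})" unfolding f_def by (simp only: restrict_PiE_iff) blast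
  qed
  have "card (f ` {..K ^ r}) \<le> card (PiE {..<r} (\<lambda>_. {..<K}))"
   by (intro card_mono[OF _ fA] finite_PiE) auto
  also have "... < card {..K ^ r}" by (simp add: card_PiE)
  finally have "\<not> inj_on f {..K ^ r}" by (rule pigeonhole)
  then obtain n1 n2 where n: "n1 < n2" "n2 \<le> K ^ r" "f n1 = f n2"
   unfolding inj_on_def by (metis atMost_iff linorder_neqE_nat)
  define m where "m = n2 - n1"
  define z where "z i = \<lfloor>real n2 * c i\<rfloor> - \<lfloor>real n1 * c i\<rfloor>" for i
  define \<delta> where "\<delta> i = real m * c i - of_int (z i)" for i
  have dl: "\<bar>\<delta> i\<bar> \<le> 1 / real K" if "i < r" for i
  proof -
   have "f n1 i = f n2 i" using n(3) by simp
   then have "nat \<lfloor>real K * frac (real n1 * c i)\<rfloor> = nat \<lfloor>real K * frac (real n2 * c i)\<rfloor>" using that by (simp add: f_def)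
   then have "\<lfloor>real K * frac (real n1 * c i)\<rfloor> = \<lfloor>real K * frac (real n2 * c i)\<rfloor>"
    by (subst (asm) eq_nat_nat_iff) auto
   then have "\<bar>real K * frac (real n2 * c i) - real K * frac (real n1 * c i)\<bar> \<le> 1" by linarith
   moreover have "real K * frac (real n2 * c i) - real K * frac (real n1 * c i) = real K * \<delta> i"
    using n(1) by (simp add: \<delta>_def z_def m_def frac_def of_nat_diff algebra_simps)
   ultimately have "real K * \<bar>\<delta> i\<bar> \<le> 1" by (simp add: abs_mult)
   then show ?thesis using K1 by (simp add: field_simps)
  qed
  define y where "y i = of_int (int m) * (\<Sum>j<r. c j * w j i) - (\<Sum>j<r. of_int (z j) * w j i)" for i
  have y: "y \<in> \<Lambda>" unfolding y_def by (rule comb[OF c]) simp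
  have yd: "y = (\<lambda>i. \<Sum>j<r. \<delta> j * w j i)"
   by (rule ext) (simp add: y_def \<delta>_def sum_distrib_left left_diff_distrib sum_subtractf mult.assoc)
  have "half_l1 r y \<le> (\<Sum>j<r. \<bar>\<delta> j\<bar> * half_l1 r (w j))" unfolding yd by (rule half_l1_sum_le)
  also have "... \<le> (\<Sum>j<r. 1 / real K * half_l1 r (w j))"
   using dl by (intro sum_mono mult_right_mono half_l1_nonneg) auto
  also have "... = H / real K" by (simp add: H_def sum_divide_distrib)
  finally have "\<forall>i<r. y i = 0" using K by (intro disc(2)[OF y]) simp
  then have "\<forall>j<r. \<delta> j = 0" unfolding yd by (rule indep)
  then have "\<forall>j<r. real m * c j = of_int (z j)" by (simp add: \<delta>_def)
  then show ?thesis using n by (intro exI[of _ m]) (auto simp: m_def)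
 qed
 show ?thesis
 \<comment> \<open>The denominator m depends on the vector but never exceeds K^r, so it divides this
   factorial.\<close>
 proof (rule that[of "fact (K ^ r)"], simp, intro allI impI)
  fix c i assume c: "(\<lambda>i. \<Sum>j<r. c j * w j i) \<in> \<Lambda>" and i: "i < r"
  from den[OF c] obtain m where m: "0 < m" "m \<le> K ^ r" "\<forall>i<r. of_nat m * c i \<in> \<int>" by blast
  have "m dvd fact (K ^ r)" using m by (intro dvd_fact) auto
  then obtain l where "fact (K ^ r) = m * l" by (rule dvdE)
  then have "of_nat (fact (K ^ r)) * c i = of_nat l * (of_nat m * c i)" by simp
  then show "of_nat (fact (K ^ r)) * c i \<in> \<int>" using m(3) i by (simp only: Ints_mult Ints_of_nat)
 qed
qed

text \<open>A maximal independent set of short vectors is completed to a full independent family, and the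
 lattice basis is taken triangular with respect to that family.\<close>

lemma adapted_lattice_basis:
 fixes \<Lambda> :: "(nat \<Rightarrow> real) set"
 assumes diff: "\<And>x y. x \<in> \<Lambda> \<Longrightarrow> y \<in> \<Lambda> \<Longrightarrow> (\<lambda>i. x i - y i) \<in> \<Lambda>"
  and supp: "\<And>x i. x \<in> \<Lambda> \<Longrightarrow> r \<le> i \<Longrightarrow> x i = 0"
  and disc: "0 < A" "\<And>x. x \<in> \<Lambda> \<Longrightarrow> half_l1 r x < A \<Longrightarrow> \<forall>i<r. x i = 0"
  and full: "\<forall>j<r. b j \<in> \<Lambda>" "fdet r (\<lambda>i j. b j i) \<noteq> 0"
 obtains p w \<eta> where "p \<le> r" "\<forall>j<r. w j \<in> \<Lambda>" "fdet r (\<lambda>i j. w j i) \<noteq> 0" "\<forall>j<p. half_l1 r (w j) < T"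
  "\<forall>j<r. \<eta> j \<in> \<Lambda>" "fdet r (\<lambda>i j. \<eta> j i) \<noteq> 0"
  "\<forall>x\<in>\<Lambda>. \<exists>m::nat \<Rightarrow> int. (\<forall>i<r. x i = (\<Sum>j<r. of_int (m j) * \<eta> j i)) \<and> (half_l1 r x < T \<longrightarrow> (\<forall>j\<ge>p. m j = 0))"
proof -
 let ?P = "\<lambda>p. p \<le> r \<and> (\<exists>w. (\<forall>j<r. w j \<in> \<Lambda>) \<and> fdet r (\<lambda>i j. w j i) \<noteq> 0 \<and> (\<forall>j<p. half_l1 r (w j) < T))"
 define p where "p = Greatest ?P"
 have "?P p" unfolding p_def by (rule GreatestI_nat[of ?P 0 r]) (use full in auto)
 then obtain w where pr: "p \<le> r" and w: "\<And>j. j < r \<Longrightarrow> w j \<in> \<Lambda>" "fdet r (\<lambda>i j. w j i) \<noteq> 0" "\<forall>j<p. half_l1 r (w j) < T"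
  by blast
 have pmax: "q \<le> p" if "?P q" for q unfolding p_def by (rule Greatest_le_nat[of ?P q r]) (use that in auto)
 obtain W where W: "\<And>i j. i < r \<Longrightarrow> j < r \<Longrightarrow> (\<Sum>l<r. w l i * W l j) = (if i = j then 1 else 0)"
  "\<And>i j. i < r \<Longrightarrow> j < r \<Longrightarrow> (\<Sum>l<r. W i l * w j l) = (if i = j then 1 else 0)"
  using fdet_inverse[OF w(2)] by blast
 define co where "co x j = (\<Sum>l<r. W j l * x l)" for x :: "nat \<Rightarrow> real" and j
 have co: "(\<Sum>j<r. co x j * w j i) = x i" if "i < r" for x i
 proof -
  have "(\<Sum>j<r. co x j * w j i) = (\<Sum>j<r. \<Sum>l<r. x l * (w j i * W j l))"
   by (simp add: co_def sum_distrib_left sum_distrib_right mult_ac)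
  also have "... = (\<Sum>l<r. x l * (\<Sum>j<r. w j i * W j l))" by (subst sum.swap) (simp add: sum_distrib_left)
  also have "... = (\<Sum>l<r. if i = l then x l else 0)" using W(1) that by (intro sum.cong) auto
  finally show ?thesis using that by simp
 qed
 have co_unique: "co x j = c j" if "\<forall>i<r. x i = (\<Sum>l<r. c l * w l i)" "j < r" for x c j
 proof -
  have "co x j = (\<Sum>l<r. \<Sum>m<r. c m * (W j l * w m l))"
   unfolding co_def using that(1) by (intro sum.cong) (auto simp: sum_distrib_left mult_ac)
  also have "... = (\<Sum>m<r. c m * (\<Sum>l<r. W j l * w m l))" by (subst sum.swap) (simp add: sum_distrib_left)
  also have "... = (\<Sum>m<r. if j = m then c m else 0)" using W(2) that(2) by (intro sum.cong) auto
  finally show ?thesis using that(2) by simp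
 qed
 have indep: "\<forall>j<r. c j = 0" if "\<forall>i<r. (\<Sum>j<r. c j * w j i) = 0" for c
  using co_unique[of "\<lambda>_. 0" c] that by (simp add: co_def)
 have small: "co x j = 0" if x: "x \<in> \<Lambda>" "half_l1 r x < T" and j: "p \<le> j" "j < r" for x j
 proof (rule ccontr)
  assume nz: "co x j \<noteq> 0"
  define w1 where "w1 = w(j := x)"
  have "fdet r (\<lambda>i l. w1 l i) = fdet r (\<lambda>i l. if l = j then \<Sum>m<r. w m i * co x m else w l i)"
   by (rule fdet_cong) (auto simp: w1_def co mult.commute)
  also have "... = co x j * fdet r (\<lambda>i l. w l i)" by (rule fdet_replace_column[OF j(2)])
  finally have f1: "fdet r (\<lambda>i l. w1 l i) \<noteq> 0" using nz w(2) by simp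
  \<comment> \<open>A short vector with a nonzero coordinate j >= p could replace w j. Swapping the
    positions p and j would then give p + 1 leading short vectors, against the maximality of
    p.\<close>
  define \<pi> where "\<pi> l = (if l = p then j else if l = j then p else l)" for l
  have "bij_betw \<pi> {..<r} {..<r}" using j
   by (intro bij_betw_byWitness[where f' = \<pi>]) (auto simp: \<pi>_def)
  then have "fdet r (\<lambda>i l. w1 (\<pi> l) i) \<noteq> 0" by (rule fdet_permute_columns_nonzero[OF f1])
  moreover have "w1 (\<pi> l) \<in> \<Lambda>" if "l < r" for l using that j w(1) x(1) by (auto simp: w1_def \<pi>_def)
  moreover have "half_l1 r (w1 (\<pi> l)) < T" if "l < Suc p" for l
   using that j w(3) x(2) by (auto simp: w1_def \<pi>_def)
  ultimately have "?P (Suc p)" using j by (intro conjI exI[of _ "\<lambda>l. w1 (\<pi> l)"]) auto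
  then show False using pmax by fastforce
 qed
 define \<Gamma> where "\<Gamma> = {c. (\<lambda>i. \<Sum>j<r. c j * w j i) \<in> \<Lambda>}"
 obtain Q :: nat where Q: "Q > 0" "\<forall>c. (\<lambda>i. \<Sum>j<r. c j * w j i) \<in> \<Lambda> \<longrightarrow> (\<forall>i<r. of_nat Q * c i \<in> \<int>)"
 proof (rule bounded_denominators[of \<Lambda> A r w])
  show "(\<lambda>i. x i - y i) \<in> \<Lambda>" if "x \<in> \<Lambda>" "y \<in> \<Lambda>" for x y by (rule diff[OF that])
  show "0 < A" by (rule disc(1))
  show "\<forall>i<r. x i = 0" if "x \<in> \<Lambda>" "half_l1 r x < A" for x by (rule disc(2)[OF that])
  show "w j \<in> \<Lambda>" if "j < r" for j by (rule w(1)[OF that])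
  show "\<forall>j<r. c j = 0" if "\<forall>i<r. (\<Sum>j<r. c j * w j i) = 0" for c by (rule indep[OF that])
 qed
 have unit: "(\<lambda>j. if j = i then 1 else 0) \<in> \<Gamma>" if "i < r" for i
  using w(1)[OF that] that by (simp add: \<Gamma>_def if_distrib[of "\<lambda>x. x * _"] cong: if_cong)
 show thesis
 proof (rule triangular_lattice_basis[of Q \<Gamma> r])
  show "Q > 0" by (rule Q(1))
  show "(\<lambda>i. x i - y i) \<in> \<Gamma>" if "x \<in> \<Gamma>" "y \<in> \<Gamma>" for x y
   using diff[of "\<lambda>i. \<Sum>j<r. x j * w j i" "\<lambda>i. \<Sum>j<r. y j * w j i"] that
   by (simp add: \<Gamma>_def left_diff_distrib sum_subtractf)
  show "of_nat Q * x i \<in> \<int>" if "x \<in> \<Gamma>" "i < r" for x i using Q(2) that by (simp add: \<Gamma>_def)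
  show "\<exists>x\<in>\<Gamma>. x i > 0 \<and> (\<forall>j. i < j \<and> j < r \<longrightarrow> x j = 0)" if "i < r" for i
   by (rule bexI[OF _ unit[OF that]]) auto
  fix t assume t: "\<And>i. i < r \<Longrightarrow> t i \<in> \<Gamma>" and "\<And>i. i < r \<Longrightarrow> t i i > 0" "\<And>i j. i < j \<Longrightarrow> j < r \<Longrightarrow> t i j = 0"
   and rep: "\<And>x m. x \<in> \<Gamma> \<Longrightarrow> m \<le> r \<Longrightarrow> (\<And>j. m \<le> j \<Longrightarrow> j < r \<Longrightarrow> x j = 0) \<Longrightarrow>
   \<exists>e::nat \<Rightarrow> int. (\<forall>i\<ge>m. e i = 0) \<and> (\<forall>l<r. x l = (\<Sum>i<r. e i * t i l))"
  have ft: "fdet r t \<noteq> 0"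
  proof -
   have "\<forall>i. \<exists>e::nat \<Rightarrow> int. i < r \<longrightarrow> (\<forall>l<r. (if l = i then 1 else 0) = (\<Sum>j<r. e j * t j l))"
   proof
    fix i
    show "\<exists>e::nat \<Rightarrow> int. i < r \<longrightarrow> (\<forall>l<r. (if l = i then 1 else 0) = (\<Sum>j<r. e j * t j l))"
    proof (cases "i < r")
     case True
     have "\<exists>e::nat \<Rightarrow> int. (\<forall>i\<ge>r. e i = 0) \<and> (\<forall>l<r. (if l = i then 1 else 0) = (\<Sum>j<r. e j * t j l))"
      by (rule rep[OF unit[OF True] order_refl]) simp
     then show ?thesis by blast
    qed simp
   qed
   then obtain e :: "nat \<Rightarrow> nat \<Rightarrow> int" where
    e: "\<forall>i<r. \<forall>l<r. (if l = i then 1 else 0) = (\<Sum>j<r. e i j * t j l)" by metis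
   have "fdet r (\<lambda>i l. real_of_int (e i l)) * fdet r t = fdet r (\<lambda>i l. \<Sum>j<r. e i j * t j l)"
    by (rule fdet_mult[symmetric])
   also have "... = fdet r (\<lambda>i l. if i = l then 1 else 0)"
   proof (rule fdet_cong)
    fix i l assume "i < r" "l < r"
    then have "(if l = i then 1 else 0) = (\<Sum>j<r. e i j * t j l)" using e by blast
    then show "(\<Sum>j<r. e i j * t j l) = (if i = l then 1 else 0)" by (cases "i = l") auto
   qed
   also have "... = 1" by (rule fdet_id)
   finally show ?thesis by auto
  qed
  define \<eta> where "\<eta> j = (\<lambda>i. \<Sum>l<r. t j l * w l i)" for j
  have "\<forall>j<r. \<eta> j \<in> \<Lambda>" using t by (auto simp: \<eta>_def \<Gamma>_def)
  moreover have "fdet r (\<lambda>i j. \<eta> j i) \<noteq> 0"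
  proof -
   have "fdet r (\<lambda>i j. \<eta> j i) = fdet r (\<lambda>i j. \<Sum>l<r. w l i * t j l)"
    by (rule fdet_cong) (simp add: \<eta>_def mult.commute)
   also have "... = fdet r (\<lambda>i l. w l i) * fdet r (\<lambda>l j. t j l)" by (rule fdet_mult)
   also have "fdet r (\<lambda>l j. t j l) = fdet r t" by (rule fdet_transpose)
   finally show ?thesis using ft w(2) by simp
  qed
  moreover have "\<exists>m::nat \<Rightarrow> int. (\<forall>i<r. x i = (\<Sum>j<r. of_int (m j) * \<eta> j i)) \<and> (half_l1 r x < T \<longrightarrow> (\<forall>j\<ge>p. m j = 0))"
   if x: "x \<in> \<Lambda>" for x
  proof -
   have "(\<lambda>i. \<Sum>j<r. co x j * w j i) = x"
   proof
    fix i show "(\<Sum>j<r. co x j * w j i) = x i"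
     using co[of i x] supp[OF x] supp[OF w(1)] by (cases "i < r") auto
   qed
   then have c: "co x \<in> \<Gamma>" using x by (simp add: \<Gamma>_def)
   define q where "q = (if half_l1 r x < T then p else r)"
   have "\<exists>e::nat \<Rightarrow> int. (\<forall>i\<ge>q. e i = 0) \<and> (\<forall>l<r. co x l = (\<Sum>i<r. e i * t i l))"
    by (rule rep[OF c]) (use pr small[OF x] in \<open>auto simp: q_def split: if_splits\<close>)
   then obtain e :: "nat \<Rightarrow> int" where e: "\<forall>i\<ge>q. e i = 0" "\<forall>l<r. co x l = (\<Sum>i<r. e i * t i l)" by blast
   have "x i = (\<Sum>j<r. of_int (e j) * \<eta> j i)" if i: "i < r" for i
   proof -
    have "x i = (\<Sum>l<r. co x l * w l i)" using co[OF i] by simp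
    also have "... = (\<Sum>l<r. \<Sum>j<r. e j * (t j l * w l i))"
     using e(2) by (intro sum.cong) (auto simp: sum_distrib_right sum_distrib_left mult_ac)
    also have "... = (\<Sum>j<r. of_int (e j) * \<eta> j i)" by (subst sum.swap) (simp add: \<eta>_def sum_distrib_left)
    finally show ?thesis .
   qed
   then show ?thesis using e(1) by (intro exI[of _ e]) (auto simp: q_def)
  qed
  ultimately show thesis using pr w by (intro that[of p w \<eta>]) auto
 qed
qed

section \<open>Fundamental units and the regulator\<close>

locale place_enum = number_fld +
 fixes vs :: "('a \<Rightarrow> complex) set list"
 assumes vs: "distinct vs" "set vs = arch_places k" and d3: "d \<ge> 3"
begin

text \<open>The Dirichlet rank; \<open>unit_rank_eq\<close> identifies it with the rank of the unit
  group.\<close>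

definition "r = length vs - 1"

lemma length_vs: "length vs = Suc r"
proof -
 have "vs \<noteq> []" using E_nonempty arch_places_eq vs(2) by auto
 then show ?thesis by (simp add: r_def)
qed

lemma vs_in: "i \<le> r \<Longrightarrow> vs ! i \<in> arch_places k"
 using vs(2) length_vs nth_mem[of i vs] by auto

lemma sum_places: "(\<Sum>v\<in>arch_places k. f v) = (\<Sum>i<r. f (vs ! i)) + f (vs ! r)"
 using sum.reindex_bij_betw[OF bij_betw_nth[OF vs(1) refl vs(2)[symmetric]], of f] length_vs by simp

text \<open>The value 0 from r on makes the vector determined by its first r entries, as the support
  condition of \<open>adapted_lattice_basis\<close> demands.\<close>

definition logv :: "'a \<Rightarrow> nat \<Rightarrow> real" where
 "logv u i = (if i < r then place_log (vs ! i) u else 0)"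

lemma logv_mult: "u \<in> unit_grp k \<Longrightarrow> v \<in> unit_grp k \<Longrightarrow> logv (u * v) i = logv u i + logv v i"
proof -
 assume "u \<in> unit_grp k" "v \<in> unit_grp k"
 then have "lg \<sigma> (u * v) = lg \<sigma> u + lg \<sigma> v" if "i < r" "\<sigma> \<in> vs ! i" for \<sigma>
  using arch_place(1)[OF vs_in[of i]] that by (intro lg_mult) auto
 then show ?thesis by (simp add: logv_def place_log_def sum.distrib)
qed

lemma logv_inverse: "u \<in> unit_grp k \<Longrightarrow> logv (inverse u) i = - logv u i"
 using arch_place(1)[OF vs_in[of i]]
 by (auto simp: logv_def place_log_def simp flip: sum_negf intro!: sum.cong lg_inverse)

lemma logv_divide: "u \<in> unit_grp k \<Longrightarrow> v \<in> unit_grp k \<Longrightarrow> logv (u / v) i = logv u i - logv v i"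
 by (simp add: divide_inverse logv_mult logv_inverse unit_inverse)

lemma logv_one: "logv 1 i = 0"
 using logv_mult[OF unit_one unit_one, of i] by simp

lemma logv_powi: "u \<in> unit_grp k \<Longrightarrow> logv (u powi n) i = of_int n * logv u i"
 using arch_place(1)[OF vs_in[of i]]
 by (auto simp: logv_def place_log_def sum_distrib_left intro!: sum.cong lg_powi)

lemma logv_prod:
 "(\<And>l. l \<in> I \<Longrightarrow> f l \<in> unit_grp k) \<Longrightarrow> logv (prod f I) i = (\<Sum>l\<in>I. logv (f l) i)"
 by (induction I rule: infinite_finite_induct) (auto simp: logv_one logv_mult unit_prod)

lemma logv_prod_powi:
 "(\<And>l. l < n \<Longrightarrow> u l \<in> unit_grp k) \<Longrightarrow> logv (\<Prod>l<n. u l powi e l) i = (\<Sum>l<n. of_int (e l) * logv (u l) i)"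
 by (subst logv_prod) (auto simp: logv_powi unit_powi)

lemma unit_prod_powi: "(\<And>l. l < n \<Longrightarrow> u l \<in> unit_grp k) \<Longrightarrow> (\<Prod>l<n. u l powi e l) \<in> unit_grp k"
 by (intro unit_prod unit_powi) auto

lemma height_logv:
 assumes "u \<in> unit_grp k"
 shows "height u = half_l1 r (logv u)"
proof -
 have "place_log (vs ! r) u = - (\<Sum>i<r. place_log (vs ! i) u)" using sum_place_log[OF assms] by (simp add: sum_places)
 then show ?thesis by (simp add: height_place_log[OF assms] sum_places half_l1_def logv_def)
qed

definition "hmin = (ln (ln (real d)) / ln (real d)) ^ 3 / 4"

lemma hmin_pos: "hmin > 0"
proof -
 have "exp 1 < real d" using d3 e_less_272 by linarith
 then have "ln (real d) > 1" using ln_less_cancel_iff[of "exp 1" "real d"] d3 by simp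
 then show ?thesis by (simp add: hmin_def)
qed

text \<open>A unit with vanishing logarithms has height 0, and the lower bound for heights leaves
  only roots of unity. This takes the place of Kronecker's theorem.\<close>

lemma logv_eq_0_iff:
 assumes u: "u \<in> unit_grp k"
 shows "(\<forall>i<r. logv u i = 0) \<longleftrightarrow> (\<exists>n>0. u ^ n = 1)"
proof
 assume "\<forall>i<r. logv u i = 0"
 then have "height u = 0" by (simp add: height_logv[OF u] half_l1_def)
 then have "\<not> hmin \<le> height u" using hmin_pos by simp
 then show "\<exists>n>0. u ^ n = 1"
  using height_lower[of u] u d3 unfolding hmin_def unit_grp_iff by blast
next
 assume "\<exists>n>0. u ^ n = 1"
 then obtain n :: nat where n: "n > 0" "u ^ n = 1" by blast
 have "real n * logv u i = 0" for i using logv_powi[OF u, of "int n" i] n(2) by (simp add: logv_one)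
 then show "\<forall>i<r. logv u i = 0" using n(1) by simp
qed

text \<open>It translates the condition in \<open>fundamental_units\<close>, equality modulo
  torsion, into a linear equation between logarithmic vectors.\<close>

lemma torsion_quotient_iff:
 assumes u: "u \<in> unit_grp k" and us: "\<And>l. l < n \<Longrightarrow> us l \<in> unit_grp k"
 shows "(\<exists>m>0. (u / (\<Prod>l<n. us l powi e l)) ^ m = 1) \<longleftrightarrow> (\<forall>i<r. logv u i = (\<Sum>l<n. of_int (e l) * logv (us l) i))"
proof -
 have P: "(\<Prod>l<n. us l powi e l) \<in> unit_grp k" by (rule unit_prod_powi[OF us])
 show ?thesis
  unfolding logv_eq_0_iff[OF unit_divide[OF u P], symmetric] by (simp add: logv_divide[OF u P] logv_prod_powi us)
qed

text \<open>For each of the first r places take a unit with negative logarithms at all other places.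
  The logarithm at the omitted place is also negative, so the column sums over the first r places
  are positive.\<close>

lemma full_log_rank:
 obtains u where "\<forall>j<r. u j \<in> unit_grp k" "fdet r (\<lambda>i j. logv (u j) i) \<noteq> 0"
proof -
 have "\<forall>j. \<exists>u. j < r \<longrightarrow> u \<in> unit_grp k \<and> (\<forall>w\<in>arch_places k. w \<noteq> vs ! j \<longrightarrow> place_log w u < 0)"
 proof
  fix j
  show "\<exists>u. j < r \<longrightarrow> u \<in> unit_grp k \<and> (\<forall>w\<in>arch_places k. w \<noteq> vs ! j \<longrightarrow> place_log w u < 0)"
  proof (cases "j < r")
   case True
   then obtain u where "u \<in> unit_grp k" "\<forall>w\<in>arch_places k. w \<noteq> vs ! j \<longrightarrow> place_log w u < 0"
    by (rule unit_place_log_negative[OF vs_in[OF less_imp_le]])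
   then show ?thesis by blast
  qed simp
 qed
 then obtain u where u: "\<forall>j<r. u j \<in> unit_grp k \<and> (\<forall>w\<in>arch_places k. w \<noteq> vs ! j \<longrightarrow> place_log w (u j) < 0)" by metis
 have neg: "place_log (vs ! i) (u j) < 0" if "i \<le> r" "j < r" "i \<noteq> j" for i j
  using u that vs_in[of i] vs(1) length_vs by (auto simp: nth_eq_iff_index_eq)
 have "fdet r (\<lambda>i j. logv (u j) i) \<noteq> 0"
 proof (rule fdet_diagonally_dominant)
  show "logv (u j) i < 0" if "i < r" "j < r" "i \<noteq> j" for i j using neg[of i j] that by (simp add: logv_def)
  show "(\<Sum>i<r. logv (u j) i) > 0" if "j < r" for j
   using sum_place_log[of "u j"] u neg[of r j] that by (simp add: sum_places logv_def)
 qed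
 then show ?thesis using u by (intro that[of u]) auto
qed

lemma adapted_units:
 obtains p x g where "p \<le> r" "\<forall>j<r. x j \<in> unit_grp k" "fdet r (\<lambda>i j. logv (x j) i) \<noteq> 0"
  "\<forall>j<p. height (x j) < T" "\<forall>j<r. g j \<in> unit_grp k" "fdet r (\<lambda>i j. logv (g j) i) \<noteq> 0"
  "\<forall>u\<in>unit_grp k. \<exists>m::nat \<Rightarrow> int. (\<forall>i<r. logv u i = (\<Sum>j<r. of_int (m j) * logv (g j) i)) \<and>
   (height u < T \<longrightarrow> (\<forall>j\<ge>p. m j = 0))"
proof -
 obtain b where b: "\<forall>j<r. b j \<in> unit_grp k" "fdet r (\<lambda>i j. logv (b j) i) \<noteq> 0" by (rule full_log_rank)
 show ?thesis
 proof (rule adapted_lattice_basis[of "logv ` unit_grp k" r hmin "\<lambda>j. logv (b j)" T])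
  show "(\<lambda>i. x i - y i) \<in> logv ` unit_grp k" if xy: "x \<in> logv ` unit_grp k" "y \<in> logv ` unit_grp k" for x y
  proof -
   obtain u v where "u \<in> unit_grp k" "v \<in> unit_grp k" "x = logv u" "y = logv v" using xy by blast
   then show ?thesis using logv_divide[of u v] by (intro image_eqI[of _ _ "u / v"]) (auto intro: unit_divide)
  qed
  show "x i = 0" if "x \<in> logv ` unit_grp k" "r \<le> i" for x i using that by (auto simp: logv_def)
  show "0 < hmin" by (rule hmin_pos)
  show "\<forall>i<r. x i = 0" if x: "x \<in> logv ` unit_grp k" "half_l1 r x < hmin" for x
  proof -
   obtain u where u: "u \<in> unit_grp k" "x = logv u" using x(1) by blast
   then have "\<not> hmin \<le> height u" using x(2) height_logv by simp
   then have "\<exists>n>0. u ^ n = 1" using height_lower[of u] u d3 unfolding hmin_def unit_grp_iff by blast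
   then show ?thesis using logv_eq_0_iff[OF u(1)] u(2) by blast
  qed
  show "\<forall>j<r. logv (b j) \<in> logv ` unit_grp k" using b(1) by blast
  show "fdet r (\<lambda>i j. logv (b j) i) \<noteq> 0" by (rule b(2))
  fix p w \<eta> assume p: "p \<le> r" and w: "\<forall>j<r. w j \<in> logv ` unit_grp k" "fdet r (\<lambda>i j. w j i) \<noteq> 0" "\<forall>j<p. half_l1 r (w j) < T"
   and e: "\<forall>j<r. \<eta> j \<in> logv ` unit_grp k" "fdet r (\<lambda>i j. \<eta> j i) \<noteq> 0"
   and rep: "\<forall>x\<in>logv ` unit_grp k. \<exists>m::nat \<Rightarrow> int. (\<forall>i<r. x i = (\<Sum>j<r. of_int (m j) * \<eta> j i)) \<and>
    (half_l1 r x < T \<longrightarrow> (\<forall>j\<ge>p. m j = 0))"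
  have "\<forall>j. \<exists>u. j < r \<longrightarrow> u \<in> unit_grp k \<and> w j = logv u" using w(1) by blast
  then obtain x where x: "\<forall>j<r. x j \<in> unit_grp k \<and> w j = logv (x j)" by metis
  have "\<forall>j. \<exists>u. j < r \<longrightarrow> u \<in> unit_grp k \<and> \<eta> j = logv u" using e(1) by blast
  then obtain g where g: "\<forall>j<r. g j \<in> unit_grp k \<and> \<eta> j = logv (g j)" by metis
  show ?thesis
  proof (rule that[of p x g])
   show "p \<le> r" "\<forall>j<r. x j \<in> unit_grp k" "\<forall>j<r. g j \<in> unit_grp k" using p x g by auto
   have "fdet r (\<lambda>i j. logv (x j) i) = fdet r (\<lambda>i j. w j i)" by (rule fdet_cong) (use x in auto)
   then show "fdet r (\<lambda>i j. logv (x j) i) \<noteq> 0" using w(2) by simp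
   have "fdet r (\<lambda>i j. logv (g j) i) = fdet r (\<lambda>i j. \<eta> j i)" by (rule fdet_cong) (use g in auto)
   then show "fdet r (\<lambda>i j. logv (g j) i) \<noteq> 0" using e(2) by simp
   show "\<forall>j<p. height (x j) < T" using w(3) x p height_logv by (metis order_less_le_trans)
   show "\<forall>u\<in>unit_grp k. \<exists>m::nat \<Rightarrow> int. (\<forall>i<r. logv u i = (\<Sum>j<r. of_int (m j) * logv (g j) i)) \<and>
     (height u < T \<longrightarrow> (\<forall>j\<ge>p. m j = 0))"
   proof
    fix u assume u: "u \<in> unit_grp k"
    from rep u obtain m :: "nat \<Rightarrow> int" where
     m: "\<forall>i<r. logv u i = (\<Sum>j<r. of_int (m j) * \<eta> j i)" "half_l1 r (logv u) < T \<longrightarrow> (\<forall>j\<ge>p. m j = 0)" by blast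
    have "logv u i = (\<Sum>j<r. of_int (m j) * logv (g j) i)" if "i < r" for i
    proof -
     have "(\<Sum>j<r. of_int (m j) * \<eta> j i) = (\<Sum>j<r. of_int (m j) * logv (g j) i)"
      by (rule sum.cong) (use g in auto)
     then show ?thesis using m(1) that by simp
    qed
    then show "\<exists>m::nat \<Rightarrow> int. (\<forall>i<r. logv u i = (\<Sum>j<r. of_int (m j) * logv (g j) i)) \<and>
     (height u < T \<longrightarrow> (\<forall>j\<ge>p. m j = 0))" using m(2) height_logv[OF u] by (intro exI[of _ m]) simp
   qed
  qed
 qed
qed

lemma fdet_logv_indep:
 assumes "fdet r (\<lambda>i j. logv (x j) i) \<noteq> 0" "\<forall>i<r. (\<Sum>j<r. c j * logv (x j) i) = 0" "j < r"
 shows "c j = 0"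
proof (rule ccontr)
 assume "c j \<noteq> 0"
 then have "fdet r (\<lambda>i j. logv (x j) i) = 0" unfolding fdet_eq_0_iff
  using assms(2,3) by (intro exI[of _ c]) (auto simp: mult.commute)
 then show False using assms(1) by simp
qed

lemma fdet_logv_unique:
 fixes m m' :: "nat \<Rightarrow> int"
 assumes "fdet r (\<lambda>i j. logv (x j) i) \<noteq> 0" "\<forall>i<r. (\<Sum>j<r. m j * logv (x j) i) = (\<Sum>j<r. m' j * logv (x j) i)" "j < r"
 shows "m j = m' j"
 using fdet_logv_indep[OF assms(1), of "\<lambda>j. real_of_int (m j) - m' j" j] assms(2,3)
 by (simp add: left_diff_distrib sum_subtractf)

text \<open>The integer coordinates of more than r units in a lattice basis are dependent over the
  rationals. Clearing denominators gives a product that is a root of unity, and multiplying the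
  exponents by its order gives 1.\<close>

lemma units_dependence:
 assumes n: "r < n" and u: "\<And>l. l < n \<Longrightarrow> u l \<in> unit_grp k"
 obtains e :: "nat \<Rightarrow> int" where "\<exists>l<n. e l \<noteq> 0" "(\<Prod>l<n. u l powi e l) = 1"
proof -
 \<comment> \<open>With the threshold 0 this is just a basis of the lattice of logarithmic
   vectors.\<close>
 obtain g where g: "\<forall>u\<in>unit_grp k. \<exists>m::nat \<Rightarrow> int. \<forall>i<r. logv u i = (\<Sum>j<r. of_int (m j) * logv (g j) i)"
  by (rule adapted_units[of 0]) blast
 have "\<forall>l. \<exists>m::nat \<Rightarrow> int. l < n \<longrightarrow> (\<forall>i<r. logv (u l) i = (\<Sum>j<r. of_int (m j) * logv (g j) i))"
  using g u by blast
 then obtain m :: "nat \<Rightarrow> nat \<Rightarrow> int" where m: "\<forall>l<n. \<forall>i<r. logv (u l) i = (\<Sum>j<r. of_int (m l j) * logv (g j) i)" by metis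
 obtain x :: "nat \<Rightarrow> rat" where x: "\<exists>l<n. x l \<noteq> 0" "\<forall>j<r. (\<Sum>l<n. of_int (m l j) * x l) = 0"
  using linear_dependence[OF n, of "\<lambda>j l. rat_of_int (m l j)"] by blast
 obtain N :: nat and e :: "nat \<Rightarrow> int" where N: "N > 0" "\<And>l. l \<in> {..<n} \<Longrightarrow> of_nat N * x l = of_int (e l)"
  using common_denominator[of "{..<n}" x] by blast
 have e0: "\<exists>l<n. e l \<noteq> 0"
 proof -
  obtain l where l: "l < n" "x l \<noteq> 0" using x(1) by blast
  then have "rat_of_int (e l) \<noteq> 0" using N(1) N(2)[of l] by (metis lessThan_iff mult_eq_0_iff of_nat_eq_0_iff less_not_refl)
  then show ?thesis using l by auto
 qed
 have z: "(\<Sum>l<n. e l * m l j) = 0" if "j < r" for j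
 proof -
  have "rat_of_int (\<Sum>l<n. e l * m l j) = (\<Sum>l<n. of_nat N * (of_int (m l j) * x l))"
   unfolding of_int_sum of_int_mult by (rule sum.cong) (use N(2) in \<open>auto simp: mult_ac simp flip: N(2)\<close>)
  also have "... = 0" using x(2) that by (simp flip: sum_distrib_left)
  finally show ?thesis by (rule of_int_eq_0_iff[THEN iffD1])
 qed
 let ?P = "\<Prod>l<n. u l powi e l"
 have P: "?P \<in> unit_grp k" by (rule unit_prod_powi[OF u])
 have "logv ?P i = 0" if i: "i < r" for i
 proof -
  have "logv ?P i = (\<Sum>l<n. of_int (e l) * logv (u l) i)" by (rule logv_prod_powi[OF u])
  also have "... = (\<Sum>l<n. \<Sum>j<r. of_int (e l * m l j) * logv (g j) i)"
   using m i by (intro sum.cong) (auto simp: sum_distrib_left mult.assoc)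
  also have "... = (\<Sum>j<r. of_int (\<Sum>l<n. e l * m l j) * logv (g j) i)"
   by (subst sum.swap) (simp add: sum_distrib_right)
  also have "... = 0" using z by simp
  finally show ?thesis .
 qed
 then obtain q :: nat where q: "q > 0" "?P ^ q = 1" using logv_eq_0_iff[OF P] by blast
 show ?thesis
 proof (rule that[of "\<lambda>l. e l * int q"])
  show "\<exists>l<n. e l * int q \<noteq> 0" using e0 q(1) by auto
  show "(\<Prod>l<n. u l powi (e l * int q)) = 1" using q(2) by (simp add: power_int_mult flip: prod_power_distrib)
 qed
qed

section \<open>Unit ranks of the field and of its subfields\<close>

lemma mult_indep_card_le:
 assumes S: "finite S" "S \<subseteq> unit_grp k" "mult_indep S"
 shows "card S \<le> r"
proof (rule ccontr)
 assume "\<not> card S \<le> r"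
 then have n: "r < card S" by simp
 obtain h where h: "bij_betw h {..<card S} S" using ex_bij_betw_nat_finite[OF S(1)] by (auto simp: atLeast0LessThan)
 have hu: "h l \<in> unit_grp k" if "l < card S" for l using h S(2) that by (auto simp: bij_betw_def)
 obtain e :: "nat \<Rightarrow> int" where e: "\<exists>l<card S. e l \<noteq> 0" "(\<Prod>l<card S. h l powi e l) = 1"
  by (rule units_dependence[OF n hu])
 define f where "f x = e (inv_into {..<card S} h x)" for x
 have fh: "f (h l) = e l" if "l < card S" for l using h that by (simp add: f_def bij_betw_inv_into_left)
 have "(\<Prod>x\<in>S. x powi f x) = (\<Prod>l<card S. h l powi f (h l))"
  by (rule prod.reindex_bij_betw[OF h, symmetric])
 also have "... = 1" using e(2) fh by simp
 finally have "\<forall>x\<in>S. f x = 0" using S(3) unfolding mult_indep_def by blast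
 then show False using e(1) fh h by (metis bij_betwE lessThan_iff)
qed

lemma mult_indep_units:
 assumes x: "\<forall>j<r. x j \<in> unit_grp k" "fdet r (\<lambda>i j. logv (x j) i) \<noteq> 0" and p: "p \<le> r"
 shows "card (x ` {..<p}) = p" "mult_indep (x ` {..<p})"
proof -
 have inj: "inj_on x {..<p}"
 proof
  fix a b assume ab: "a \<in> {..<p}" "b \<in> {..<p}" "x a = x b"
  show "a = b"
  proof (rule ccontr)
   assume ne: "a \<noteq> b"
   have ab': "a < r" "b < r" using ab p by auto
   have "(if a = a then 1 else 0 :: int) = (if a = b then 1 else 0)"
    by (rule fdet_logv_unique[OF x(2) _ ab'(1), of "\<lambda>j. if j = a then 1 else 0" "\<lambda>j. if j = b then 1 else 0"])
     (use ab' ab(3) in \<open>simp add: if_distrib[of "\<lambda>x. x * _"] if_distrib[of real_of_int] cong: if_cong\<close>)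
   then show False using ne by simp
  qed
 qed
 then show "card (x ` {..<p}) = p" by (simp add: card_image)
 show "mult_indep (x ` {..<p})" unfolding mult_indep_def
 proof (intro allI impI)
  fix e :: "'a \<Rightarrow> int" assume "(\<Prod>y\<in>x ` {..<p}. y powi e y) = 1"
  then have one: "(\<Prod>j<p. x j powi e (x j)) = 1" using inj by (simp add: prod.reindex)
  define c where "c j = (if j < p then real_of_int (e (x j)) else 0)" for j
  have "(\<Sum>j<r. c j * logv (x j) i) = 0" for i
  proof -
   have "(\<Sum>j<r. c j * logv (x j) i) = (\<Sum>j<p. c j * logv (x j) i)"
    using p by (intro sum.mono_neutral_right) (auto simp: c_def)
   also have "... = (\<Sum>j<p. of_int (e (x j)) * logv (x j) i)" by (simp add: c_def)
   also have "... = logv (\<Prod>j<p. x j powi e (x j)) i" using x(1) p by (intro logv_prod_powi[symmetric]) auto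
   finally show ?thesis using one by (simp add: logv_one)
  qed
  then have "c j = 0" if "j < r" for j using fdet_logv_indep[OF x(2) _ that] by blast
  then have "e (x j) = 0" if "j < p" for j using that p by (metis c_def less_le_trans of_int_eq_0_iff)
  then show "\<forall>y\<in>x ` {..<p}. e y = 0" by blast
 qed
qed

text \<open>The bound r makes the set of cardinalities finite, and the empty set makes it nonempty,
  so \<open>Max\<close> in \<open>unit_rank\<close> is a true maximum.\<close>

lemma unit_rank_subfield:
 assumes "k' \<subseteq> k"
 shows "unit_rank k' \<le> r" "finite S \<Longrightarrow> S \<subseteq> unit_grp k' \<Longrightarrow> mult_indep S \<Longrightarrow> card S \<le> unit_rank k'"
proof -
 let ?R = "{card S | S. finite S \<and> S \<subseteq> unit_grp k' \<and> mult_indep S}"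
 have "unit_grp k' \<subseteq> unit_grp k" using assms by (auto simp: unit_grp_def int_ring_def)
 then have sub: "?R \<subseteq> {..r}" using mult_indep_card_le by blast
 have fin: "finite ?R" by (rule finite_subset[OF sub]) simp
 have "card ({} :: 'a set) \<in> ?R" unfolding mult_indep_def by blast
 then have "Max ?R \<in> ?R" by (intro Max_in[OF fin]) blast
 then show "unit_rank k' \<le> r" using sub unfolding unit_rank_def by blast
 show "card S \<le> unit_rank k'" if "finite S" "S \<subseteq> unit_grp k'" "mult_indep S"
  unfolding unit_rank_def using that by (intro Max_ge[OF fin]) blast
qed

lemma unit_rank_eq: "unit_rank k = r"
proof -
 obtain u where u: "\<forall>j<r. u j \<in> unit_grp k" "fdet r (\<lambda>i j. logv (u j) i) \<noteq> 0" by (rule full_log_rank)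
 have "card (u ` {..<r}) \<le> unit_rank k"
  using u mult_indep_units[OF u order_refl] by (intro unit_rank_subfield) auto
 then show ?thesis using mult_indep_units(1)[OF u order_refl] unit_rank_subfield(1)[of k] by simp
qed

text \<open>A witness that the maximum over proper subfields is not empty: the rational field has a
  single embedding, whereas k has at least three.\<close>

lemma rat_proper_subfield: "is_subfield (range of_rat :: 'a set)" "range of_rat \<subset> k"
proof -
 show "is_subfield (range of_rat :: 'a set)" unfolding is_subfield_def
 proof (intro conjI ballI)
  show "(0::'a) \<in> range of_rat" "(1::'a) \<in> range of_rat" by (metis of_rat_0 rangeI, metis of_rat_1 rangeI)
  fix x :: 'a assume "x \<in> range of_rat"
  then obtain a where a: "x = of_rat a" by blast
  show "inverse x \<in> range of_rat" unfolding a of_rat_inverse[symmetric] by (rule rangeI)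
  fix y :: 'a assume "y \<in> range of_rat"
  then obtain b where b: "y = of_rat b" by blast
  show "x - y \<in> range of_rat" unfolding a b of_rat_diff[symmetric] by (rule rangeI)
  show "x * y \<in> range of_rat" unfolding a b of_rat_mult[symmetric] by (rule rangeI)
 qed
 have "range of_rat \<noteq> k"
 proof
  assume k: "range of_rat = k"
  have "\<sigma> = \<tau>" if "\<sigma> \<in> E" "\<tau> \<in> E" for \<sigma> \<tau>
  proof (rule extensionalityI[of _ k])
   show "\<sigma> \<in> extensional k" "\<tau> \<in> extensional k" using that by (auto simp: embeddings_def)
   fix x assume "x \<in> k"
   then obtain q where "x = of_rat q" using k by blast
   then show "\<sigma> x = \<tau> x" using embedding.of_rat[OF emb[OF that(1)]] embedding.of_rat[OF emb[OF that(2)]] by simp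
  qed
  then have "card E \<le> 1" by (simp add: card_le_Suc0_iff_eq[OF finite_E])
  then show False using d3 by (simp add: d_def)
 qed
 then show "range of_rat \<subset> k" using of_rat_in by blast
qed

lemma max_subfield_rank_props:
 shows "max_subfield_rank k \<le> r" "is_subfield k' \<Longrightarrow> k' \<subset> k \<Longrightarrow> unit_rank k' \<le> max_subfield_rank k"
proof -
 let ?R = "{unit_rank k' | k'. is_subfield k' \<and> k' \<subset> k}"
 have sub: "?R \<subseteq> {..r}" using unit_rank_subfield(1) by blast
 have fin: "finite ?R" by (rule finite_subset[OF sub]) simp
 have "unit_rank (range of_rat :: 'a set) \<in> ?R" using rat_proper_subfield by blast
 then have "Max ?R \<in> ?R" by (intro Max_in[OF fin]) blast
 then show "max_subfield_rank k \<le> r" using sub unfolding max_subfield_rank_def by blast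
 show "unit_rank k' \<le> max_subfield_rank k" if "is_subfield k'" "k' \<subset> k"
  unfolding max_subfield_rank_def using that by (intro Max_ge[OF fin]) blast
qed

section \<open>Lattice bases compared with fundamental units\<close>

lemma fundamental_unitsI:
 assumes g: "\<forall>j<r. g j \<in> unit_grp k" "fdet r (\<lambda>i j. logv (g j) i) \<noteq> 0"
  and rep: "\<forall>u\<in>unit_grp k. \<exists>m::nat \<Rightarrow> int. \<forall>i<r. logv u i = (\<Sum>j<r. of_int (m j) * logv (g j) i)"
 shows "fundamental_units k (map g [0..<r])"
proof -
 have tq: "(\<exists>n>0. (u / (\<Prod>i<r. (map g [0..<r] ! i) powi (es ! i))) ^ n = 1) \<longleftrightarrow>
   (\<forall>i<r. logv u i = (\<Sum>j<r. of_int (es ! j) * logv (g j) i))" if "u \<in> unit_grp k" for u es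
 proof -
  have "(\<Prod>i<r. (map g [0..<r] ! i) powi (es ! i)) = (\<Prod>i<r. g i powi (es ! i))" by (rule prod.cong) auto
  then show ?thesis using torsion_quotient_iff[OF that, of r g "\<lambda>i. es ! i"] g(1) by simp
 qed
 show ?thesis unfolding fundamental_units_def length_map length_upt diff_zero
 proof (intro conjI ballI)
  show "set (map g [0..<r]) \<subseteq> unit_grp k" using g(1) by auto
  fix u assume u: "u \<in> unit_grp k"
  from rep u obtain m :: "nat \<Rightarrow> int" where m: "\<forall>i<r. logv u i = (\<Sum>j<r. of_int (m j) * logv (g j) i)" by blast
  show "\<exists>!es::int list. length es = r \<and> (\<exists>n>0. (u / (\<Prod>i<r. (map g [0..<r] ! i) powi (es ! i))) ^ n = 1)"
   unfolding tq[OF u]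
  proof (rule ex1I[of _ "map m [0..<r]"])
   show "length (map m [0..<r]) = r \<and> (\<forall>i<r. logv u i = (\<Sum>j<r. of_int (map m [0..<r] ! j) * logv (g j) i))"
    using m by simp
   fix es :: "int list"
   assume es: "length es = r \<and> (\<forall>i<r. logv u i = (\<Sum>j<r. of_int (es ! j) * logv (g j) i))"
   have "es ! j = m j" if "j < r" for j
    by (rule fdet_logv_unique[OF g(2) _ that]) (use es m in simp)
   then show "es = map m [0..<r]" using es by (intro nth_equalityI) auto
  qed
 qed
qed

text \<open>Uniqueness of exponents excludes more than r units, and representing the basis g
  excludes fewer. The logarithmic matrix of \<open>us\<close> is that of g times an integral matrix
  of nonzero determinant, which gives the inequality in the direction of a lower bound.\<close>

lemma fundamental_units_compare:
 assumes g: "\<forall>j<r. g j \<in> unit_grp k" "fdet r (\<lambda>i j. logv (g j) i) \<noteq> 0"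
  and rep: "\<forall>u\<in>unit_grp k. \<exists>m::nat \<Rightarrow> int. \<forall>i<r. logv u i = (\<Sum>j<r. of_int (m j) * logv (g j) i)"
  and us: "fundamental_units k us"
 shows "length us = r" "\<bar>fdet r (\<lambda>i j. logv (g j) i)\<bar> \<le> \<bar>fdet r (\<lambda>i j. logv (us ! j) i)\<bar>"
proof -
 let ?n = "length us"
 have uu: "us ! l \<in> unit_grp k" if "l < ?n" for l using us that unfolding fundamental_units_def by (meson nth_mem subsetD)
 have ex1: "\<exists>!es::int list. length es = ?n \<and> (\<forall>i<r. logv u i = (\<Sum>l<?n. of_int (es ! l) * logv (us ! l) i))"
  if u: "u \<in> unit_grp k" for u
 proof -
  have "\<exists>!es::int list. length es = ?n \<and> (\<exists>n>0. (u / (\<Prod>i<?n. (us ! i) powi (es ! i))) ^ n = 1)"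
   using us u unfolding fundamental_units_def by blast
  then show ?thesis using torsion_quotient_iff[OF u uu, of ?n] by simp
 qed
 have "\<not> r < ?n"
 proof
  assume "r < ?n"
  then obtain e :: "nat \<Rightarrow> int" where e: "\<exists>l<?n. e l \<noteq> 0" "(\<Prod>l<?n. (us ! l) powi e l) = 1"
   using units_dependence[of ?n "\<lambda>l. us ! l"] uu by blast
  have "(\<Sum>l<?n. of_int (e l) * logv (us ! l) i) = 0" for i
   using logv_prod_powi[of ?n "\<lambda>l. us ! l" e i] uu e(2) by (simp add: logv_one)
  then have "length (map e [0..<?n]) = ?n \<and> (\<forall>i<r. logv 1 i = (\<Sum>l<?n. of_int (map e [0..<?n] ! l) * logv (us ! l) i))"
   by (simp add: logv_one)
  moreover have "length (replicate ?n (0::int)) = ?n \<and>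
    (\<forall>i<r. logv 1 i = (\<Sum>l<?n. of_int (replicate ?n (0::int) ! l) * logv (us ! l) i))" by (simp add: logv_one)
  ultimately have eq: "map e [0..<?n] = replicate ?n 0" using ex1[OF unit_one] by blast
  have "e l = 0" if "l < ?n" for l using arg_cong[OF eq, of "\<lambda>es. es ! l"] that by simp
  then show False using e(1) by blast
 qed
 have "\<forall>j. \<exists>es::int list. j < r \<longrightarrow> (\<forall>i<r. logv (g j) i = (\<Sum>l<?n. of_int (es ! l) * logv (us ! l) i))"
  using ex1 g(1) by blast
 then obtain A where A: "\<forall>j<r. \<forall>i<r. logv (g j) i = (\<Sum>l<?n. of_int (A j ! l :: int) * logv (us ! l) i)" by metis
 have "\<not> ?n < r"
 proof
  assume lt: "?n < r"
  obtain x where x: "\<exists>j<r. x j \<noteq> 0" "\<forall>l<?n. (\<Sum>j<r. real_of_int (A j ! l) * x j) = 0"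
   using linear_dependence[OF lt, of "\<lambda>l j. real_of_int (A j ! l)"] by blast
  have "(\<Sum>j<r. x j * logv (g j) i) = 0" if i: "i < r" for i
  proof -
   have "(\<Sum>j<r. x j * logv (g j) i) = (\<Sum>j<r. \<Sum>l<?n. (real_of_int (A j ! l) * x j) * logv (us ! l) i)"
    using A i by (intro sum.cong) (auto simp: sum_distrib_left mult_ac)
   also have "... = (\<Sum>l<?n. (\<Sum>j<r. real_of_int (A j ! l) * x j) * logv (us ! l) i)"
    by (subst sum.swap) (simp add: sum_distrib_right)
   also have "... = 0" using x(2) by simp
   finally show ?thesis .
  qed
  then have "\<forall>j<r. x j = 0" using fdet_logv_indep[OF g(2)] by blast
  then show False using x(1) by blast
 qed
 with \<open>\<not> r < ?n\<close> show n: "?n = r" by simp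
 have "\<forall>l. \<exists>m::nat \<Rightarrow> int. l < r \<longrightarrow> (\<forall>i<r. logv (us ! l) i = (\<Sum>j<r. of_int (m j) * logv (g j) i))"
  using rep uu unfolding n by blast
 then obtain B where B: "\<forall>l<r. \<forall>i<r. logv (us ! l) i = (\<Sum>j<r. of_int (B l j :: int) * logv (g j) i)" by metis
 have "fdet r (\<lambda>i l. logv (us ! l) i) = fdet r (\<lambda>i l. \<Sum>j<r. logv (g j) i * real_of_int (B l j))"
  by (rule fdet_cong) (use B in \<open>simp add: mult.commute\<close>)
 also have "... = fdet r (\<lambda>i j. logv (g j) i) * fdet r (\<lambda>j l. real_of_int (B l j))" by (rule fdet_mult)
 also have "fdet r (\<lambda>j l. real_of_int (B l j)) = real_of_int (fdet r (\<lambda>j l. B l j))"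
  by (rule fdet_of_hom) (rule of_int_hom.comm_ring_hom_axioms)
 finally have f1: "fdet r (\<lambda>i l. logv (us ! l) i) = fdet r (\<lambda>i j. logv (g j) i) * real_of_int (fdet r (\<lambda>j l. B l j))" .
 have "fdet r (\<lambda>i j. logv (g j) i) = fdet r (\<lambda>i j. \<Sum>l<r. logv (us ! l) i * real_of_int (A j ! l))"
  by (rule fdet_cong) (use A n in \<open>simp add: mult.commute\<close>)
 also have "... = fdet r (\<lambda>i l. logv (us ! l) i) * fdet r (\<lambda>l j. real_of_int (A j ! l))" by (rule fdet_mult)
 finally have "fdet r (\<lambda>i l. logv (us ! l) i) \<noteq> 0" using g(2) by auto
 then have "fdet r (\<lambda>j l. B l j) \<noteq> 0" using f1 by auto
 then have "1 \<le> \<bar>real_of_int (fdet r (\<lambda>j l. B l j))\<bar>" by linarith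
 then have "\<bar>fdet r (\<lambda>i j. logv (g j) i)\<bar> * 1 \<le> \<bar>fdet r (\<lambda>i j. logv (g j) i)\<bar> * \<bar>real_of_int (fdet r (\<lambda>j l. B l j))\<bar>"
  by (intro mult_left_mono) auto
 then show "\<bar>fdet r (\<lambda>i j. logv (g j) i)\<bar> \<le> \<bar>fdet r (\<lambda>i j. logv (us ! j) i)\<bar>"
  unfolding f1 abs_mult by simp
qed

text \<open>The lattice theorem is applied to a basis adapted to the threshold T: a combination
  involving a basis vector from p on has height at least T. The hypothesis \<open>vs_some\<close>
  ties the enumeration of places to the one picked inside \<open>regulator\<close>.\<close>

theorem regulator_lower:
 assumes T: "hmin \<le> T" and vs_some: "vs = (SOME vs. distinct vs \<and> set vs = arch_places k)"
 obtains p x where "p \<le> r" "\<forall>j<r. x j \<in> unit_grp k" "fdet r (\<lambda>i j. logv (x j) i) \<noteq> 0"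
  "\<forall>j<p. height (x j) < T" "fact (2 * r) / fact r ^ 3 * (hmin / 2) ^ p * (T / 2) ^ (r - p) \<le> regulator k"
proof -
 obtain p x g where p: "p \<le> r" and x: "\<forall>j<r. x j \<in> unit_grp k" "fdet r (\<lambda>i j. logv (x j) i) \<noteq> 0" "\<forall>j<p. height (x j) < T"
  and g: "\<forall>j<r. g j \<in> unit_grp k" "fdet r (\<lambda>i j. logv (g j) i) \<noteq> 0"
  and rep: "\<forall>u\<in>unit_grp k. \<exists>m::nat \<Rightarrow> int. (\<forall>i<r. logv u i = (\<Sum>j<r. of_int (m j) * logv (g j) i)) \<and>
   (height u < T \<longrightarrow> (\<forall>j\<ge>p. m j = 0))"
  by (rule adapted_units)
 have rep': "\<forall>u\<in>unit_grp k. \<exists>m::nat \<Rightarrow> int. \<forall>i<r. logv u i = (\<Sum>j<r. of_int (m j) * logv (g j) i)"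
  using rep by blast
 define us where "us = (SOME us. fundamental_units k us)"
 have us: "fundamental_units k us" unfolding us_def by (rule someI, rule fundamental_unitsI[OF g rep'])
 note cmp = fundamental_units_compare[OF g rep' us]
 have uu: "us ! l \<in> k" if "l < r" for l
  using us that cmp(1) unit_in_k(1) unfolding fundamental_units_def by (metis nth_mem subsetD)
 have "regulator k = \<bar>fdet (length us) (\<lambda>i j. real (card (vs ! i)) * ln (place_abs (vs ! i) (us ! j)))\<bar>"
  unfolding regulator_def Let_def fdet_def us_def vs_some ..
 also have "fdet (length us) (\<lambda>i j. real (card (vs ! i)) * ln (place_abs (vs ! i) (us ! j))) = fdet r (\<lambda>i j. logv (us ! j) i)"
  unfolding cmp(1) by (rule fdet_cong) (use uu vs_in in \<open>simp add: place_log_eq logv_def\<close>)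
 finally have reg: "\<bar>fdet r (\<lambda>i j. logv (g j) i)\<bar> \<le> regulator k" using cmp(2) by simp
 define U where "U m = (\<Prod>j<r. g j powi m j)" for m :: "nat \<Rightarrow> int"
 have U: "U m \<in> unit_grp k" for m unfolding U_def using g(1) by (intro unit_prod_powi) auto
 have Ul: "logv (U m) i = (\<Sum>j<r. of_int (m j) * logv (g j) i)" for m i
  unfolding U_def using g(1) by (intro logv_prod_powi) auto
 have N: "half_l1 r (\<lambda>i. \<Sum>j<r. logv (g j) i * of_int (m j)) = height (U m)" for m
  unfolding height_logv[OF U] by (rule half_l1_cong) (simp add: Ul mult.commute)
 have "fact (2 * r) / fact r ^ 3 * (hmin / 2) ^ p * (T / 2) ^ (r - p) \<le> \<bar>fdet r (\<lambda>i j. logv (g j) i)\<bar>"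
 proof (rule lattice_det_lower[OF p g(2) hmin_pos T])
  fix m :: "nat \<Rightarrow> int" assume m: "\<exists>i<r. m i \<noteq> 0"
  have "\<not> (\<exists>n>0. U m ^ n = 1)"
  proof
   assume "\<exists>n>0. U m ^ n = 1"
   then have "\<forall>i<r. (\<Sum>j<r. real_of_int (m j) * logv (g j) i) = 0" unfolding logv_eq_0_iff[OF U, symmetric] Ul .
   then have "real_of_int (m j) = 0" if "j < r" for j by (rule fdet_logv_indep[OF g(2) _ that])
   then show False using m by auto
  qed
  then show "hmin \<le> half_l1 r (\<lambda>i. \<Sum>j<r. logv (g j) i * of_int (m j))"
   unfolding N hmin_def using U[of m] d3 height_lower[of "U m"] unfolding unit_grp_iff by blast
 next
  fix m :: "nat \<Rightarrow> int" assume m: "\<exists>i<r. p \<le> i \<and> m i \<noteq> 0"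
  show "T \<le> half_l1 r (\<lambda>i. \<Sum>j<r. logv (g j) i * of_int (m j))"
  proof (rule ccontr)
   assume "\<not> ?thesis"
   then have "height (U m) < T" by (simp add: N)
   then obtain m' :: "nat \<Rightarrow> int" where
    m': "\<forall>i<r. logv (U m) i = (\<Sum>j<r. of_int (m' j) * logv (g j) i)" "\<forall>j\<ge>p. m' j = 0" using rep U by blast
   have "m j = m' j" if "j < r" for j by (rule fdet_logv_unique[OF g(2) _ that]) (use m'(1) Ul in simp)
   then show False using m m'(2) by auto
  qed
 qed
 then show ?thesis using p x reg by (intro that[of p x]) auto
qed

text \<open>If the p short units generated k, \<open>disc_bound\<close> would contradict the size of
  the discriminant. So they lie in a proper subfield, whose unit rank is at least p by
  independence.\<close>

lemma small_units_subfield: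
 assumes x: "\<forall>j<r. x j \<in> unit_grp k" "fdet r (\<lambda>i j. logv (x j) i) \<noteq> 0" and p: "p \<le> r"
  and h: "\<forall>j<p. height (x j) < T" "T \<ge> 0" and disc: "real d ^ d * exp (2 * real (d - 1) * T) < cmod (field_disc k)"
 shows "p \<le> max_subfield_rank k"
proof -
 have "\<exists>F. is_subfield F \<and> F \<subseteq> k \<and> x ` {..<p} \<subseteq> F \<and> F \<noteq> k"
 proof (rule ccontr)
  assume no: "\<not> ?thesis"
  have "cmod (field_disc k) \<le> real d ^ d * exp (2 * real (d - 1) * T)"
  proof (rule disc_bound[of "{..<p}" x])
   show "x i \<in> int_ring k" "x i \<noteq> 0" if "i \<in> {..<p}" for i using x(1) p that by (auto simp: unit_grp_iff)
   show "F = k" if "is_subfield F" "F \<subseteq> k" "x ` {..<p} \<subseteq> F" for F using no that by blast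
   show "height (x i) \<le> T" if "i \<in> {..<p}" for i using h(1) that by (simp add: less_imp_le)
  qed (use h in auto)
  then show False using disc by simp
 qed
 then obtain F where F: "is_subfield F" "F \<subset> k" "x ` {..<p} \<subseteq> F" by blast
 have "x ` {..<p} \<subseteq> unit_grp F"
 proof
  fix y assume y: "y \<in> x ` {..<p}"
  then have u: "y \<in> unit_grp k" using x(1) p by auto
  have "y \<in> F" "inverse y \<in> F" using y F(1,3) by (auto simp: is_subfield_def)
  then show "y \<in> unit_grp F" using u unfolding unit_grp_iff
   by (auto simp: unit_grp_def int_ring_def intro!: bexI[of _ "inverse y"])
 qed
 then have "card (x ` {..<p}) \<le> unit_rank F"
  using F(2) mult_indep_units(2)[OF x p] by (intro unit_rank_subfield) auto
 then show ?thesis using mult_indep_units(1)[OF x p] max_subfield_rank_props(2)[OF F(1,2)] by simp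
qed

end

theorem theorem1p1:
 fixes k :: "'a::field_char_0 set" and d r \<rho> :: nat and D \<gamma> :: real
 assumes "number_field k"
  and "d = ext_degree \<rat> k"
  and "d \<ge> 3"
  and "\<not> CM_field k"
  and "r = unit_rank k"
  and "\<rho> = max_subfield_rank k"
  and "D = cmod (field_disc k)"
  and "\<gamma> = real d powr (- real d)"
  and "1 < \<gamma> * D"
 shows "fact (2 * r) / (fact r) ^ 3 * (ln (ln (real d)) / (2 * ln (real d))) ^ (3 * \<rho>)
     * (ln (\<gamma> * D) / (4 * real d)) powi (int r - int \<rho>)
    \<le> regulator k"
proof -
 interpret number_fld k by standard (rule assms(1))
 have d: "d = number_fld.d k" using assms(2) ext_degree_eq by simp
 define vs where "vs = (SOME vs. distinct vs \<and> set vs = arch_places k)"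
 have "\<exists>vs. distinct vs \<and> set vs = arch_places k" using finite_distinct_list[OF finite_arch_places] by blast
 then have "distinct vs \<and> set vs = arch_places k" unfolding vs_def by (rule someI_ex)
 then interpret place_enum k vs using assms(3)[unfolded d] by unfold_locales auto
 have r: "r = place_enum.r vs" using assms(5) unit_rank_eq by simp
 \<comment> \<open>The threshold at which the discriminant bound fails strictly: it loses against D
   because its exponent carries d - 1 instead of d.\<close>
 define B where "B = ln (\<gamma> * D) / (2 * real d)"
 have d0: "real d > 0" using assms(3) by simp
 have B0: "B > 0" unfolding B_def using assms(9) d0 by simp
 have disc: "real d ^ d * exp (2 * real (d - 1) * B) < cmod (field_disc k)"
 proof -
  have "2 * real (d - 1) * B < 2 * real d * B" using B0 assms(3) by (intro mult_strict_right_mono) auto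
  also have "... = ln (\<gamma> * D)" using d0 by (simp add: B_def)
  finally have "exp (2 * real (d - 1) * B) < exp (ln (\<gamma> * D))" by (rule exp_less_mono)
  then have "exp (2 * real (d - 1) * B) < \<gamma> * D" using assms(9) by simp
  then have "real d ^ d * exp (2 * real (d - 1) * B) < real d ^ d * (\<gamma> * D)" using d0 by (intro mult_strict_left_mono) auto
  also have "real d ^ d * \<gamma> = 1" using d0 unfolding assms(8) by (simp add: powr_minus powr_realpow)
  then have "real d ^ d * (\<gamma> * D) = D" by (simp flip: mult.assoc)
  finally show ?thesis by (simp add: assms(7))
 qed
 define a where "a = hmin / 2"
 define b where "b = B / 2"
 have a0: "a > 0" using hmin_pos by (simp add: a_def)
 have b0: "b > 0" using B0 by (simp add: b_def)
 have \<rho>r: "\<rho> \<le> r" using max_subfield_rank_props(1) assms(6) r by simp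
 let ?c = "fact (2 * r) / fact r ^ 3 :: real"
 have c0: "?c \<ge> 0" by simp
 have main: "?c * (a ^ \<rho> * b ^ (r - \<rho>)) \<le> regulator k"
 \<comment> \<open>If the discriminant threshold is below the universal height bound, the lattice
   theorem is used with \<open>hmin\<close> for all coordinates, and replacing \<open>hmin\<close>
   by B only weakens the result.\<close>
 proof (cases "hmin \<le> B")
  case True
  obtain p x where p: "p \<le> r" and x: "\<forall>j<r. x j \<in> unit_grp k" "fdet r (\<lambda>i j. logv (x j) i) \<noteq> 0" "\<forall>j<p. height (x j) < B"
   and low: "?c * a ^ p * b ^ (r - p) \<le> regulator k"
   unfolding r a_def b_def by (rule regulator_lower[OF True vs_def])
  have p\<rho>: "p \<le> \<rho>" unfolding assms(6)
   by (rule small_units_subfield[of x p B]) (use x p B0 disc in \<open>auto simp: r d\<close>)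
  have "a ^ \<rho> * b ^ (r - \<rho>) = a ^ p * (a ^ (\<rho> - p) * b ^ (r - \<rho>))" using p\<rho> by (simp flip: power_add mult.assoc)
  also have "... \<le> a ^ p * (b ^ (\<rho> - p) * b ^ (r - \<rho>))"
   \<comment> \<open>As a <= b, exchanging \<rho> - p factors b for factors a decreases the product,
     which raises the exponent of a from p to \<rho>.\<close>
   using True a0 b0 by (intro mult_left_mono mult_right_mono power_mono) (auto simp: a_def b_def)
  also have "... = a ^ p * b ^ (r - p)" using p\<rho> \<rho>r by (simp flip: power_add)
  finally have "?c * (a ^ \<rho> * b ^ (r - \<rho>)) \<le> ?c * (a ^ p * b ^ (r - p))" using c0 by (rule mult_left_mono)
  then show ?thesis using low by (simp only: mult.assoc)
 next
  case False
  obtain p x where p: "p \<le> r" and low: "?c * a ^ p * a ^ (r - p) \<le> regulator k"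
   unfolding r a_def by (rule regulator_lower[OF order_refl vs_def])
  have "a ^ \<rho> * b ^ (r - \<rho>) \<le> a ^ \<rho> * a ^ (r - \<rho>)"
   using False a0 b0 by (intro mult_left_mono power_mono) (auto simp: a_def b_def)
  also have "... = a ^ p * a ^ (r - p)" using p \<rho>r by (simp flip: power_add)
  finally have "?c * (a ^ \<rho> * b ^ (r - \<rho>)) \<le> ?c * (a ^ p * a ^ (r - p))" using c0 by (rule mult_left_mono)
  then show ?thesis using low by (simp only: mult.assoc)
 qed
 have "a = (ln (ln (real d)) / (2 * ln (real d))) ^ 3"
  by (simp add: a_def hmin_def d power_divide power_mult_distrib)
 then have "(ln (ln (real d)) / (2 * ln (real d))) ^ (3 * \<rho>) = a ^ \<rho>" by (simp only: power_mult)
 moreover have "ln (\<gamma> * D) / (4 * real d) = b" by (simp add: b_def B_def)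
 \<comment> \<open>The integer exponent is nonnegative since \<rho> <= r, so it agrees with natural
   subtraction.\<close>
 moreover have "b powi (int r - int \<rho>) = b ^ (r - \<rho>)" using \<rho>r by (simp add: power_int_def nat_diff_distrib)
 ultimately show ?thesis using main by (simp only: mult.assoc)
qed

end
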